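(* For some $p>1$ let $\Omega:=\{(x_1,x_2)\in\mathbb{R}^2: 0<x_1<1 \text{ and } |x_2|<x_1^p\}$. Then $\Omega$ is a $C^{0,\beta}$ domain for $\beta=p^{-1}<1$, and $$H^1(\Omega)\subsetneqq \big(L^2(\Omega),H^2(\Omega)\big)_{1/2},$$ so that $\{H^s(\Omega):0\le s\le 2\}$ is not an interpolation scale.
   Context: For $s\in\mathbb{R}$, $H^s(\mathbb{R}^n):=\{u\in\mathscr{S}^*(\mathbb{R}^n):\|u\|_{H^s(\mathbb{R}^n)}:=(\int_{\mathbb{R}^n}(1+|\xi|^2)^s|\hat u(\xi)|^2\,d\xi)^{1/2}<\infty\}$, where $\mathscr{S}^*(\mathbb{R}^n)$ is the space of tempered distributions and $\hat u(\xi)=(2\pi)^{-n/2}\int_{\mathbb{R}^n}e^{-i\xi\cdot x}u(x)\,dx$. For open $\Omega\subset\mathbb{R}^n$, $H^s(\Omega):=\{u\in\mathscr{D}^*(\Omega):u=U|_\Omega\text{ for some }U\in H^s(\mathbb{R}^n)\}$ with norm $\|u\|_{H^s(\Omega)}:=\inf\{\|U\|_{H^s(\mathbb{R}^n)}:U|_\Omega=u\}$; $H^0(\Omega)=L^2(\Omega)$ with equal norms. For Hilbert spaces $H_0,H_1$ contained in a common vector space and compatible (here $H_0\cap H_1$ and $H_0+H_1$ are Banach spaces with their natural norms), and $0<\theta<1$, $(H_0,H_1)_\theta$ is the real interpolation space of all $\phi\in H_0+H_1$ with finite norm $\|\phi\|:=N_{\theta,2}\left(\int_0^\infty|t^{-\theta}K(t,\phi)|^2\frac{dt}{t}\right)^{1/2}$,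 where $K(t,\phi):=\inf\{(\|\phi_0\|_{H_0}^2+t^2\|\phi_1\|_{H_1}^2)^{1/2}:\phi_j\in H_j,\ \phi_0+\phi_1=\phi\}$ and $N_{\theta,2}:=((2/\pi)\sin(\pi\theta))^{1/2}$. For a closed interval $\mathcal I\subset\mathbb{R}$, a collection of Hilbert spaces $\{H_s:s\in\mathcal I\}$ is an interpolation scale if, for all $s,t\in\mathcal I$ and $0<\eta<1$, $(H_s,H_t)_\eta=H_\theta$ for $\theta=(1-\eta)s+\eta t$. An open set $\Omega\subset\mathbb{R}^n$ is a $C^0$ open set if $\partial\Omega$ is bounded and, in a neighbourhood of every point of $\partial\Omega$, $\partial\Omega$ is (in some rotated coordinate system) the graph of a continuous function and the part of $\Omega$ in that neighbourhood is part of the hypograph of the same function. For $0<\beta\le1$ it is a $C^{0,\beta}$ open set if it is a $C^0$ open set and $\partial\Omega$ is locally the graph of a function that is Hölder continuous of index $\beta$. A domain is a connected open set. *)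

theory Defs
  imports "HOL-Analysis.Analysis" "HOL-Library.Function_Algebras"
begin

section \<open>Test functions\<close>

definition partial_deriv :: "'a::euclidean_space \<Rightarrow> ('a \<Rightarrow> complex) \<Rightarrow> 'a \<Rightarrow> complex" where
  "partial_deriv b f = (\<lambda>x. frechet_derivative f (at x) b)"

primrec partials :: "'a::euclidean_space list \<Rightarrow> ('a \<Rightarrow> complex) \<Rightarrow> 'a \<Rightarrow> complex" where
  "partials [] f = f"
| "partials (b # bs) f = partial_deriv b (partials bs f)"

text \<open>Multi-indices are lists of standard basis vectors. Every iterated partial derivative is
  required to be (Frechet) differentiable, hence continuous, so this is \<open>C\<^sup>\<infinity>\<close>.\<close>

definition smooth :: "('a::euclidean_space \<Rightarrow> complex) \<Rightarrow> bool" where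
  "smooth f \<longleftrightarrow> (\<forall>bs. set bs \<subseteq> Basis \<longrightarrow> (\<forall>x. partials bs f differentiable (at x)))"

definition schwartz :: "('a::euclidean_space \<Rightarrow> complex) set" where
  "schwartz = {f. smooth f \<and>
     (\<forall>k. \<forall>bs. set bs \<subseteq> Basis \<longrightarrow> bounded (range (\<lambda>x. norm x ^ k *\<^sub>R partials bs f x)))}"

definition schwartz_conv ::
    "(nat \<Rightarrow> 'a::euclidean_space \<Rightarrow> complex) \<Rightarrow> ('a \<Rightarrow> complex) \<Rightarrow> bool" where
  "schwartz_conv F f \<longleftrightarrow> (\<forall>k. \<forall>bs. set bs \<subseteq> Basis \<longrightarrow>
     uniform_limit UNIV (\<lambda>n x. norm x ^ k *\<^sub>R partials bs (F n) x)
       (\<lambda>x. norm x ^ k *\<^sub>R partials bs f x) sequentially)"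

text \<open>Test functions on \<open>\<Omega>\<close> are identified with their extensions by zero to the whole space.\<close>

definition test_fun :: "'a::euclidean_space set \<Rightarrow> ('a \<Rightarrow> complex) set" where
  "test_fun \<Omega> = {f. smooth f \<and> compact (closure {x. f x \<noteq> 0}) \<and> closure {x. f x \<noteq> 0} \<subseteq> \<Omega>}"

definition test_conv ::
    "'a::euclidean_space set \<Rightarrow> (nat \<Rightarrow> 'a \<Rightarrow> complex) \<Rightarrow> ('a \<Rightarrow> complex) \<Rightarrow> bool" where
  "test_conv \<Omega> F f \<longleftrightarrow>
     (\<exists>C. compact C \<and> C \<subseteq> \<Omega> \<and> (\<forall>n. \<forall>x. x \<notin> C \<longrightarrow> F n x = 0)) \<and>
     (\<forall>bs. set bs \<subseteq> Basis \<longrightarrow>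
        uniform_limit UNIV (\<lambda>n. partials bs (F n)) (partials bs f) sequentially)"


section \<open>Distributions\<close>

text \<open>Functionals on a space of test functions are total functions that vanish off that space, so
  that equality of distributions is equality in HOL and all distributions live in one vector space
  with pointwise operations.\<close>

type_synonym 'a functional = "('a \<Rightarrow> complex) \<Rightarrow> complex"

definition linear_functional_on :: "('a \<Rightarrow> complex) set \<Rightarrow> 'a functional \<Rightarrow> bool" where
  "linear_functional_on X u \<longleftrightarrow>
     (\<forall>f\<in>X. \<forall>g\<in>X. \<forall>a b. u (\<lambda>x. a * f x + b * g x) = a * u f + b * u g) \<and> (\<forall>f. f \<notin> X \<longrightarrow> u f = 0)"

definition tempered_distributions :: "'a::euclidean_space functional set" where
  "tempered_distributions = {u. linear_functional_on schwartz u \<and>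
     (\<forall>F f. (\<forall>n. F n \<in> schwartz) \<longrightarrow> f \<in> schwartz \<longrightarrow> schwartz_conv F f \<longrightarrow>
        (\<lambda>n. u (F n)) \<longlonglongrightarrow> u f)}"

definition distributions :: "'a::euclidean_space set \<Rightarrow> 'a functional set" where
  "distributions \<Omega> = {u. linear_functional_on (test_fun \<Omega>) u \<and>
     (\<forall>F f. (\<forall>n. F n \<in> test_fun \<Omega>) \<longrightarrow> f \<in> test_fun \<Omega> \<longrightarrow> test_conv \<Omega> F f \<longrightarrow>
        (\<lambda>n. u (F n)) \<longlonglongrightarrow> u f)}"

definition restrict_distr :: "'a::euclidean_space set \<Rightarrow> 'a functional \<Rightarrow> 'a functional" where
  "restrict_distr \<Omega> U = (\<lambda>f. if f \<in> test_fun \<Omega> then U f else 0)"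

definition fourier :: "('a::euclidean_space \<Rightarrow> complex) \<Rightarrow> 'a \<Rightarrow> complex" where
  "fourier f \<xi> = complex_of_real ((2 * pi) powr (- real DIM('a) / 2)) *
     (LINT x|lborel. exp (- \<i> * complex_of_real (\<xi> \<bullet> x)) * f x)"

definition fourier_distr :: "'a::euclidean_space functional \<Rightarrow> 'a functional" where
  "fourier_distr u = (\<lambda>f. if f \<in> schwartz then u (fourier f) else 0)"


section \<open>Function spaces\<close>

text \<open>A normed space of elements of an ambient vector space \<open>'v\<close>; the norm matters on the carrier
  only.\<close>

record 'v nspace =
  carrier :: "'v set"
  nrm :: "'v \<Rightarrow> real"

text \<open>The tempered distribution \<open>v\<close> is the function \<open>g\<close>, and \<open>g\<close> has finite weighted square
  integral. Such a \<open>g\<close> is unique up to null sets, so the choice made in the norms below is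
  immaterial.\<close>

definition weighted_density :: "real \<Rightarrow> 'a::euclidean_space functional \<Rightarrow> ('a \<Rightarrow> complex) \<Rightarrow> bool" where
  "weighted_density s v g \<longleftrightarrow> g \<in> borel_measurable lborel \<and>
     (\<forall>f\<in>schwartz. integrable lborel (\<lambda>\<xi>. g \<xi> * f \<xi>) \<and> v f = (LINT \<xi>|lborel. g \<xi> * f \<xi>)) \<and>
     integrable lborel (\<lambda>\<xi>. (1 + (norm \<xi>)\<^sup>2) powr s * (norm (g \<xi>))\<^sup>2)"

definition sobolev_space :: "real \<Rightarrow> 'a::euclidean_space functional nspace" where
  "sobolev_space s = \<lparr>
     carrier = {u \<in> tempered_distributions. \<exists>g. weighted_density s (fourier_distr u) g},
     nrm = (\<lambda>u. sqrt (LINT \<xi>|lborel. (1 + (norm \<xi>)\<^sup>2) powr s *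
              (norm ((SOME g. weighted_density s (fourier_distr u) g) \<xi>))\<^sup>2))\<rparr>"

definition sobolev :: "'a::euclidean_space set \<Rightarrow> real \<Rightarrow> 'a functional nspace" where
  "sobolev \<Omega> s = \<lparr>
     carrier = {u \<in> distributions \<Omega>. \<exists>U \<in> carrier (sobolev_space s). restrict_distr \<Omega> U = u},
     nrm = (\<lambda>u. Inf {nrm (sobolev_space s) U |U.
              U \<in> carrier (sobolev_space s) \<and> restrict_distr \<Omega> U = u})\<rparr>"

text \<open>\<open>L\<^sup>2(\<Omega>)\<close> as a space of distributions on \<open>\<Omega>\<close>.\<close>

definition L2_density :: "'a::euclidean_space set \<Rightarrow> 'a functional \<Rightarrow> ('a \<Rightarrow> complex) \<Rightarrow> bool" where
  "L2_density \<Omega> u g \<longleftrightarrow> g \<in> borel_measurable lborel \<and>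
     set_integrable lborel \<Omega> (\<lambda>x. (norm (g x))\<^sup>2) \<and>
     u = (\<lambda>f. if f \<in> test_fun \<Omega> then (LINT x:\<Omega>|lborel. g x * f x) else 0)"

definition L2 :: "'a::euclidean_space set \<Rightarrow> 'a functional nspace" where
  "L2 \<Omega> = \<lparr>
     carrier = {u. \<exists>g. L2_density \<Omega> u g},
     nrm = (\<lambda>u. sqrt (LINT x:\<Omega>|lborel. (norm ((SOME g. L2_density \<Omega> u g) x))\<^sup>2))\<rparr>"


section \<open>Real interpolation\<close>

definition K_functional ::
    "'v::ab_group_add nspace \<Rightarrow> 'v nspace \<Rightarrow> real \<Rightarrow> 'v \<Rightarrow> real" where
  "K_functional H\<^sub>0 H\<^sub>1 t \<phi> = Inf {sqrt ((nrm H\<^sub>0 \<phi>\<^sub>0)\<^sup>2 + t\<^sup>2 * (nrm H\<^sub>1 \<phi>\<^sub>1)\<^sup>2) |\<phi>\<^sub>0 \<phi>\<^sub>1.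
     \<phi>\<^sub>0 \<in> carrier H\<^sub>0 \<and> \<phi>\<^sub>1 \<in> carrier H\<^sub>1 \<and> \<phi>\<^sub>0 + \<phi>\<^sub>1 = \<phi>}"

definition interp ::
    "'v::ab_group_add nspace \<Rightarrow> 'v nspace \<Rightarrow> real \<Rightarrow> 'v nspace" where
  "interp H\<^sub>0 H\<^sub>1 \<theta> = \<lparr>
     carrier = {\<phi>. (\<exists>\<phi>\<^sub>0 \<in> carrier H\<^sub>0. \<exists>\<phi>\<^sub>1 \<in> carrier H\<^sub>1. \<phi>\<^sub>0 + \<phi>\<^sub>1 = \<phi>) \<and>
       set_integrable lborel {0<..} (\<lambda>t. \<bar>t powr (-\<theta>) * K_functional H\<^sub>0 H\<^sub>1 t \<phi>\<bar>\<^sup>2 / t)},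
     nrm = (\<lambda>\<phi>. sqrt (2 / pi * sin (pi * \<theta>)) *
       sqrt (LINT t:{0<..}|lborel. \<bar>t powr (-\<theta>) * K_functional H\<^sub>0 H\<^sub>1 t \<phi>\<bar>\<^sup>2 / t))\<rparr>"

text \<open>Equality of spaces is equality of the underlying vector spaces (equality of norms would be an
  exact scale).\<close>

definition interpolation_scale :: "real set \<Rightarrow> (real \<Rightarrow> 'v::ab_group_add nspace) \<Rightarrow> bool" where
  "interpolation_scale I H \<longleftrightarrow> (\<forall>s\<in>I. \<forall>t\<in>I. \<forall>\<eta>. 0 < \<eta> \<and> \<eta> < 1 \<longrightarrow>
     carrier (interp (H s) (H t) \<eta>) = carrier (H ((1 - \<eta>) * s + \<eta> * t)))"


section \<open>\<open>C\<^sup>0\<close> and Hoelder domains\<close>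

text \<open>A rotated coordinate system is given by the unit vector \<open>e\<close> of its last axis: the last
  coordinate of \<open>y\<close> is \<open>y \<bullet> e\<close>, and the remaining ones are the orthogonal projection of \<open>y\<close> to the
  hyperplane \<open>e\<^sup>\<bottom>\<close>, on which \<open>f\<close> lives. The predicate \<open>P\<close> is the regularity demanded of \<open>f\<close>
  on that hyperplane.\<close>

definition locally_hypograph ::
    "('a::euclidean_space set \<Rightarrow> ('a \<Rightarrow> real) \<Rightarrow> bool) \<Rightarrow> 'a set \<Rightarrow> bool" where
  "locally_hypograph P \<Omega> \<longleftrightarrow> (\<forall>x \<in> frontier \<Omega>. \<exists>V e f. open V \<and> x \<in> V \<and> norm e = 1 \<and>
     P {z. z \<bullet> e = 0} f \<and>
     frontier \<Omega> \<inter> V = {y \<in> V. y \<bullet> e = f (y - (y \<bullet> e) *\<^sub>R e)} \<and>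
     \<Omega> \<inter> V = {y \<in> V. y \<bullet> e < f (y - (y \<bullet> e) *\<^sub>R e)})"

definition holder_on :: "real \<Rightarrow> 'a::metric_space set \<Rightarrow> ('a \<Rightarrow> real) \<Rightarrow> bool" where
  "holder_on \<beta> S f \<longleftrightarrow> (\<exists>C. \<forall>y\<in>S. \<forall>z\<in>S. \<bar>f y - f z\<bar> \<le> C * dist y z powr \<beta>)"

definition C0_open_set :: "'a::euclidean_space set \<Rightarrow> bool" where
  "C0_open_set \<Omega> \<longleftrightarrow> open \<Omega> \<and> bounded (frontier \<Omega>) \<and> locally_hypograph continuous_on \<Omega>"

definition C0_holder_open_set :: "real \<Rightarrow> 'a::euclidean_space set \<Rightarrow> bool" where
  "C0_holder_open_set \<beta> \<Omega> \<longleftrightarrow> 0 < \<beta> \<and> \<beta> \<le> 1 \<and> C0_open_set \<Omega> \<and> locally_hypograph (holder_on \<beta>) \<Omega>"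

definition C0_holder_domain :: "real \<Rightarrow> 'a::euclidean_space set \<Rightarrow> bool" where
  "C0_holder_domain \<beta> \<Omega> \<longleftrightarrow> C0_holder_open_set \<beta> \<Omega> \<and> connected \<Omega>"

end

theory Submission
  imports Defs "HOL-Probability.Probability"
begin

text \<open>If \<open>U \<in> H\<^sup>1\<close> extends \<open>u\<close>, cutting \<open>U\<close> at the frequencies with \<open>t (1 + norm \<xi>\<^sup>2) = 1\<close> into an
  \<open>H\<^sup>2\<close> part and an \<open>L\<^sup>2\<close> part (by Plancherel) bounds the functional \<open>K(t, u)\<close>, and Tonelli gives
  the inclusion.

  The inclusion is strict because of \<open>u(x) = (\<Sum>k. b ^ k * exp (- 4 ^ k * norm x\<^sup>2 / 2))\<close> with
  \<open>b = 2 powr ((p - 1) / 8)\<close>. The \<open>n\<close>-th partial sum has \<open>H\<^sup>2\<close> norm of order \<open>(2 * b) ^ n\<close>, whereas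
  the rest is small in \<open>L\<^sup>2(\<Omega>)\<close>, since the Gaussian of width \<open>2 powr (- k)\<close> meets the cusp only in a
  set of area about \<open>2 powr (- (1 + p) * k)\<close>. Choosing \<open>n\<close> according to \<open>t\<close> gives \<open>u\<close> a finite
  interpolation norm. On the other hand, a cutoff function living in the cusp at height
  \<open>2 powr (- k)\<close> has, relative to its integral, an \<open>H\<^sup>-\<^sup>1(\<real>\<^sup>2)\<close> norm that grows more slowly than any
  exponential in \<open>k\<close>, however thin its support is; the pairing of \<open>u\<close> with it, again relative to
  its integral, grows like \<open>b ^ k\<close>. Hence \<open>u\<close> has no extension in \<open>H\<^sup>1\<close>.\<close>

section \<open>Smooth and Schwartz functions\<close>

text \<open>The base \<open>b\<close> has to lie in a window. The squared H^2 norm of the n-th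
  partial sum is of order (4 b^2)^n and the squared L^2 norm of the tail of order (b^2 2^-(p+1))^n;
  after balancing, the interpolation integral behaves like a geometric series in the square root of
  their product b^4 2^(1-p). So b < 2^((p-1)/4) is wanted there, while the pairing with the test
  functions grows only for b > 1. The window is nonempty because p > 1, and 2^((p-1)/8) is its
  geometric middle. The H^-1 norms grow so slowly because 1 / (1 + norm xi^2) only just fails to be
  integrable over the plane: an arbitrarily small power of additional decay suffices. Two obstacles
  shape the rest. The inclusion concerns \<open>L2\<close>, the scale concerns
  \<open>sobolev \<Omega> 0\<close>; the two are not identified, but the series argument is run for
  any first space whose norm is controlled by the L^2 norm. And \<open>fourier\<close> is an
  integral, while the spectral density of an element of H^1 need not be integrable, so such an
  element becomes a function only through truncations.\<close>

lemma partial_deriv_eq: "(f has_derivative D) (at x) \<Longrightarrow> partial_deriv b f x = D b"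
  unfolding partial_deriv_def by (metis frechet_derivative_at)

text \<open>Smoothness by an invariant: rather than computing iterated partial derivatives, one
  exhibits a set of differentiable functions that is stable under them. Most closure proofs below
  only choose such a set.\<close>

lemma smooth_coinduct:
  fixes S :: "('a::euclidean_space \<Rightarrow> complex) set"
  assumes "f \<in> S"
    and "\<And>f x. f \<in> S \<Longrightarrow> f differentiable (at x)"
    and "\<And>f b. f \<in> S \<Longrightarrow> b \<in> Basis \<Longrightarrow> partial_deriv b f \<in> S"
  shows "smooth f"
proof -
  have "partials bs f \<in> S" if "set bs \<subseteq> Basis" for bs
    using that by (induction bs) (auto simp: assms)
  then show ?thesis
    by (auto simp: smooth_def assms(2))
qed

lemma partials_append: "partials (as @ bs) f = partials as (partials bs f)"
  by (induction as) auto

lemma smooth_differentiable: "smooth f \<Longrightarrow> f differentiable (at x)"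
  unfolding smooth_def by (drule spec[of _ "[]"]) auto

lemma smooth_partial_deriv: "smooth f \<Longrightarrow> b \<in> Basis \<Longrightarrow> smooth (partial_deriv b f)"
  unfolding smooth_def
  using partials_append[of _ "[b]" f] by (metis Un_subset_iff empty_subsetI insert_subset list.set(1)
      list.simps(15) partials.simps set_append)

lemma smooth_partials: "smooth f \<Longrightarrow> set bs \<subseteq> Basis \<Longrightarrow> smooth (partials bs f)"
  by (induction bs) (auto intro: smooth_partial_deriv)

lemma smooth_continuous_on: "smooth f \<Longrightarrow> continuous_on S f"
  by (meson continuous_at_imp_continuous_on differentiable_imp_continuous_within smooth_differentiable)

lemma smooth_measurable: "smooth f \<Longrightarrow> f \<in> borel_measurable borel"
  using smooth_continuous_on borel_measurable_continuous_onI by blast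

section \<open>Rapid decay and closure properties of the Schwartz space\<close>

definition rapid :: "('a::euclidean_space \<Rightarrow> complex) \<Rightarrow> bool" where
  "rapid f \<longleftrightarrow> (\<forall>k. \<exists>C. \<forall>x. norm x ^ k * norm (f x) \<le> C)"

lemma rapidD: "rapid f \<Longrightarrow> \<exists>C. \<forall>x. norm x ^ k * norm (f x) \<le> C"
  by (simp add: rapid_def)

lemma rapid_iff: "rapid f \<longleftrightarrow> (\<forall>k. bounded (range (\<lambda>x. norm x ^ k *\<^sub>R f x)))"
  by (simp add: rapid_def bounded_iff)

lemma rapid_add: "rapid f \<Longrightarrow> rapid g \<Longrightarrow> rapid (\<lambda>x. f x + g x)"
  unfolding rapid_def
proof
  fix k
  assume "\<forall>k. \<exists>C. \<forall>x. norm x ^ k * norm (f x) \<le> C" "\<forall>k. \<exists>C. \<forall>x. norm x ^ k * norm (g x) \<le> C"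
  then obtain C D where C: "norm x ^ k * norm (f x) \<le> C" and D: "norm x ^ k * norm (g x) \<le> D" for x
    by meson
  have "norm x ^ k * norm (f x + g x) \<le> C + D" for x
  proof -
    have "norm x ^ k * norm (f x + g x) \<le> norm x ^ k * (norm (f x) + norm (g x))"
      by (intro mult_left_mono norm_triangle_ineq) auto
    with C[of x] D[of x] show ?thesis by (simp add: algebra_simps)
  qed
  then show "\<exists>C. \<forall>x. norm x ^ k * norm (f x + g x) \<le> C" by blast
qed

text \<open>Decay of order \<open>k\<close> of the product uses decay of \<open>f\<close> of the
  orders \<open>k\<close> and \<open>k + j\<close>; the second one absorbs the polynomial growth of
  the multiplier.\<close>

lemma rapid_mult:
  assumes "rapid f" "\<And>x. norm (m x) \<le> C * (1 + norm x ^ j)"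
  shows "rapid (\<lambda>x. m x * f x)"
  unfolding rapid_def
proof
  fix k
  obtain A B where A: "norm x ^ k * norm (f x) \<le> A" and B: "norm x ^ (k + j) * norm (f x) \<le> B" for x
    using assms(1) unfolding rapid_def by meson
  have "norm x ^ k * norm (m x * f x) \<le> \<bar>C\<bar> * (A + B)" for x
  proof -
    have "norm x ^ k * norm (m x * f x) \<le> norm x ^ k * (\<bar>C\<bar> * (1 + norm x ^ j) * norm (f x))"
      unfolding norm_mult
      by (intro mult_left_mono mult_right_mono order_trans[OF assms(2)]) auto
    also have "\<dots> = \<bar>C\<bar> * (norm x ^ k * norm (f x) + norm x ^ (k + j) * norm (f x))"
      by (simp add: algebra_simps power_add)
    also have "\<dots> \<le> \<bar>C\<bar> * (A + B)"
      by (intro mult_left_mono add_mono A B) auto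
    finally show ?thesis .
  qed
  then show "\<exists>C. \<forall>x. norm x ^ k * norm (m x * f x) \<le> C" by blast
qed

lemma rapid_cmult: "rapid f \<Longrightarrow> rapid (\<lambda>x. c * f x)"
  by (rule rapid_mult[where C = "norm c" and j = 0]) auto

lemma schwartz_coinduct:
  fixes S :: "('a::euclidean_space \<Rightarrow> complex) set"
  assumes "f \<in> S"
    and "\<And>f x. f \<in> S \<Longrightarrow> f differentiable (at x)"
    and "\<And>f b. f \<in> S \<Longrightarrow> b \<in> Basis \<Longrightarrow> partial_deriv b f \<in> S"
    and "\<And>f. f \<in> S \<Longrightarrow> rapid f"
  shows "f \<in> schwartz"
proof -
  have "partials bs f \<in> S" if "set bs \<subseteq> Basis" for bs
    using that by (induction bs) (auto simp: assms)
  then show ?thesis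
    using smooth_coinduct[of f S] assms by (auto simp: schwartz_def rapid_iff)
qed

lemma schwartz_smooth: "f \<in> schwartz \<Longrightarrow> smooth f"
  by (simp add: schwartz_def)

lemma schwartz_rapid: "f \<in> schwartz \<Longrightarrow> rapid f"
  unfolding rapid_iff
proof
  fix k assume "f \<in> schwartz"
  then have "\<forall>bs. set bs \<subseteq> Basis \<longrightarrow> bounded (range (\<lambda>x. norm x ^ k *\<^sub>R partials bs f x))"
    by (auto simp: schwartz_def)
  from this[rule_format, of "[]"] show "bounded (range (\<lambda>x. norm x ^ k *\<^sub>R f x))"
    by simp
qed

lemma schwartz_differentiable: "f \<in> schwartz \<Longrightarrow> f differentiable (at x)"
  by (simp add: schwartz_smooth smooth_differentiable)

lemma schwartz_partial_deriv: "f \<in> schwartz \<Longrightarrow> b \<in> Basis \<Longrightarrow> partial_deriv b f \<in> schwartz"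
proof -
  assume f: "f \<in> schwartz" and b: "b \<in> Basis"
  have "bounded (range (\<lambda>x. norm x ^ k *\<^sub>R partials bs (partial_deriv b f) x))"
    if "set bs \<subseteq> Basis" for k bs
  proof -
    have "set (bs @ [b]) \<subseteq> Basis" using that b by auto
    then have "bounded (range (\<lambda>x. norm x ^ k *\<^sub>R partials (bs @ [b]) f x))"
      using f unfolding schwartz_def by blast
    then show ?thesis by (simp add: partials_append)
  qed
  with f b show ?thesis by (simp add: schwartz_def smooth_partial_deriv)
qed

lemma schwartz_measurable: "f \<in> schwartz \<Longrightarrow> f \<in> borel_measurable borel"
  by (simp add: schwartz_smooth smooth_measurable)

lemma partial_deriv_lincomb:
  assumes "\<And>x. f differentiable (at x)" "\<And>x. g differentiable (at x)"
  shows "partial_deriv b (\<lambda>x. c * f x + d * g x) = (\<lambda>x. c * partial_deriv b f x + d * partial_deriv b g x)"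
proof
  fix x
  have "((\<lambda>x. c * f x + d * g x) has_derivative
      (\<lambda>v. c * frechet_derivative f (at x) v + d * frechet_derivative g (at x) v)) (at x)"
    using assms[of x] unfolding frechet_derivative_works by (auto intro!: derivative_eq_intros)
  from partial_deriv_eq[OF this]
  show "partial_deriv b (\<lambda>x. c * f x + d * g x) x = c * partial_deriv b f x + d * partial_deriv b g x"
    by (simp add: partial_deriv_def)
qed

lemma smooth_lincomb:
  fixes f g :: "'a::euclidean_space \<Rightarrow> complex"
  assumes "smooth f" "smooth g"
  shows "smooth (\<lambda>x. c * f x + d * g x)"
proof -
  define S where "S = {h. \<exists>f g. h = (\<lambda>x::'a. c * f x + d * g x) \<and> smooth f \<and> smooth g}"
  show ?thesis
  proof (rule smooth_coinduct[where S = S])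
    show "(\<lambda>x. c * f x + d * g x) \<in> S"
      using assms unfolding S_def by blast
  next
    fix h :: "'a \<Rightarrow> complex" and b x :: 'a assume "h \<in> S"
    then obtain f g where h: "h = (\<lambda>x. c * f x + d * g x)" and f: "smooth f" and g: "smooth g"
      unfolding S_def by blast
    show "h differentiable (at x)"
      unfolding h using f g by (intro differentiable_add differentiable_mult differentiable_const) (auto intro: smooth_differentiable)
    assume "b \<in> Basis"
    then show "partial_deriv b h \<in> S"
      unfolding h S_def using f g smooth_partial_deriv
      by (auto simp: partial_deriv_lincomb smooth_differentiable)
  qed
qed

lemma schwartz_lincomb:
  fixes f g :: "'a::euclidean_space \<Rightarrow> complex"
  assumes "f \<in> schwartz" "g \<in> schwartz"
  shows "(\<lambda>x. c * f x + d * g x) \<in> schwartz"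
proof -
  define S where "S = {h. \<exists>f g. h = (\<lambda>x::'a. c * f x + d * g x) \<and> f \<in> schwartz \<and> g \<in> schwartz}"
  show ?thesis
  proof (rule schwartz_coinduct[where S = S])
    show "(\<lambda>x. c * f x + d * g x) \<in> S"
      using assms unfolding S_def by blast
  next
    fix h :: "'a \<Rightarrow> complex" and b x :: 'a assume "h \<in> S"
    then obtain f g where h: "h = (\<lambda>x. c * f x + d * g x)" and f: "f \<in> schwartz" and g: "g \<in> schwartz"
      unfolding S_def by blast
    show "h differentiable (at x)"
      unfolding h using f g by (intro differentiable_add differentiable_mult differentiable_const) (auto intro: schwartz_differentiable)
    show "rapid h"
      unfolding h using f g by (intro rapid_add rapid_cmult schwartz_rapid)
    assume "b \<in> Basis"
    then show "partial_deriv b h \<in> S"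
      unfolding h S_def using f g schwartz_partial_deriv
      by (auto simp: partial_deriv_lincomb schwartz_differentiable)
  qed
qed

lemma schwartz_cmult: "f \<in> schwartz \<Longrightarrow> (\<lambda>x. c * f x) \<in> schwartz"
  using schwartz_lincomb[of f f c 0] by simp

lemma schwartz_diff: "f \<in> schwartz \<Longrightarrow> g \<in> schwartz \<Longrightarrow> (\<lambda>x. f x - g x) \<in> schwartz"
  using schwartz_lincomb[of f g 1 "-1"] by simp

lemma partial_deriv_mult:
  assumes "f differentiable (at x)" "g differentiable (at x)"
  shows "partial_deriv b (\<lambda>x. f x * g x) x = f x * partial_deriv b g x + partial_deriv b f x * g x"
proof -
  have "((\<lambda>x. f x * g x) has_derivative
      (\<lambda>v. f x * frechet_derivative g (at x) v + frechet_derivative f (at x) v * g x)) (at x)"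
    using assms unfolding frechet_derivative_works by (auto intro!: derivative_eq_intros)
  from partial_deriv_eq[OF this] show ?thesis
    by (simp add: partial_deriv_def)
qed

lemma has_derivative_coord: "((\<lambda>x. complex_of_real (x \<bullet> v)) has_derivative (\<lambda>h. complex_of_real (h \<bullet> v))) F"
  by (intro bounded_linear_imp_has_derivative bounded_linear_compose[OF bounded_linear_of_real]
      bounded_linear_inner_left)

lemma differentiable_coord: "(\<lambda>x. complex_of_real (x \<bullet> v)) differentiable F"
  using has_derivative_coord differentiable_def by blast

lemma partial_deriv_coord_mult:
  assumes "f differentiable (at x)"
  shows "partial_deriv b (\<lambda>x. complex_of_real (x \<bullet> v) * f x) x =
    complex_of_real (x \<bullet> v) * partial_deriv b f x + complex_of_real (b \<bullet> v) * f x"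
  by (simp add: partial_deriv_mult[OF differentiable_coord assms] partial_deriv_eq[OF has_derivative_coord])

lemma rapid_coord_mult: "rapid f \<Longrightarrow> rapid (\<lambda>x. complex_of_real (x \<bullet> v) * f x)"
proof (rule rapid_mult[where C = "norm v" and j = 1])
  fix x
  show "norm (complex_of_real (x \<bullet> v)) \<le> norm v * (1 + norm x ^ 1)"
    using Cauchy_Schwarz_ineq2[of x v] by (simp add: algebra_simps add_increasing)
qed

lemma schwartz_coord_mult:
  assumes "f \<in> schwartz"
  shows "(\<lambda>x. complex_of_real (x \<bullet> v) * f x) \<in> schwartz"
proof -
  \<comment> \<open>The summand \<open>g\<close> is there because the product rule leaves a term
    \<open>(b \<bullet> v) * f\<close> without the coordinate factor; without it the set would not
    be stable under partial derivatives.\<close>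
  define S where "S = {\<lambda>x. complex_of_real (x \<bullet> v) * f x + g x | f g. f \<in> schwartz \<and> g \<in> schwartz}"
  show ?thesis
  proof (rule schwartz_coinduct[where S = S])
    have z: "(\<lambda>x::'a. 0) \<in> schwartz" using schwartz_cmult[OF assms, of 0] by simp
    show "(\<lambda>x. complex_of_real (x \<bullet> v) * f x) \<in> S"
      unfolding S_def by (intro CollectI exI[of _ f] exI[of _ "\<lambda>x. 0"] conjI assms z) simp
  next
    fix h and b x :: 'a assume "h \<in> S"
    then obtain f g where h: "h = (\<lambda>x. complex_of_real (x \<bullet> v) * f x + g x)"
      and f: "f \<in> schwartz" and g: "g \<in> schwartz"
      unfolding S_def by blast
    have df: "(\<lambda>x. complex_of_real (x \<bullet> v) * f x) differentiable (at y)" for y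
      using f by (intro differentiable_mult schwartz_differentiable differentiable_coord)
    have dg: "g differentiable (at y)" for y
      using g by (rule schwartz_differentiable)
    show "h differentiable (at x)"
      unfolding h using df dg by (intro differentiable_add)
    show "rapid h"
      unfolding h using f g by (intro rapid_add rapid_coord_mult schwartz_rapid)
    assume b: "b \<in> Basis"
    have "partial_deriv b h = (\<lambda>x. complex_of_real (x \<bullet> v) * partial_deriv b f x
        + (complex_of_real (b \<bullet> v) * f x + 1 * partial_deriv b g x))"
      using partial_deriv_lincomb[of "\<lambda>x. complex_of_real (x \<bullet> v) * f x" g b 1 1] df dg
      by (simp add: h partial_deriv_coord_mult schwartz_differentiable[OF f] fun_eq_iff)
    then show "partial_deriv b h \<in> S"
      unfolding S_def
      by (intro CollectI exI conjI)
         (auto intro: schwartz_partial_deriv[OF f b]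
           schwartz_lincomb[OF f schwartz_partial_deriv[OF g b], of _ 1, simplified])
  qed
qed

text \<open>The inverse transform is written below as \<open>fourier f (- x)\<close>, so reflections
  must stay within the Schwartz space.\<close>

lemma schwartz_reflect:
  fixes f :: "'a::euclidean_space \<Rightarrow> complex"
  assumes "f \<in> schwartz"
  shows "(\<lambda>x. f (- x)) \<in> schwartz"
proof -
  define S where "S = {h. \<exists>f. h = (\<lambda>x::'a. f (- x)) \<and> f \<in> schwartz}"
  show ?thesis
  proof (rule schwartz_coinduct[where S = S])
    show "(\<lambda>x. f (- x)) \<in> S" using assms unfolding S_def by blast
  next
    fix h :: "'a \<Rightarrow> complex" and b x :: 'a assume "h \<in> S"
    then obtain f where h: "h = (\<lambda>x. f (- x))" and f: "f \<in> schwartz"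
      unfolding S_def by blast
    have d: "(h has_derivative (\<lambda>v. frechet_derivative f (at (- x)) (- v))) (at x)" for x
      unfolding h
      by (rule has_derivative_compose[of uminus uminus _ _ f])
         (use schwartz_differentiable[OF f, of "- x"] in
           \<open>auto intro!: derivative_eq_intros simp: frechet_derivative_works\<close>)
    then show "h differentiable (at x)" using differentiable_def by blast
    show "rapid h"
      using schwartz_rapid[OF f] unfolding h rapid_def by (metis norm_minus_cancel)
    assume b: "b \<in> Basis"
    have "partial_deriv b h = (\<lambda>x. (-1) * partial_deriv b f (- x))"
    proof
      fix x
      have "bounded_linear (frechet_derivative f (at (- x)))"
        using schwartz_differentiable[OF f] frechet_derivative_works has_derivative_bounded_linear by blast
      then have "linear (frechet_derivative f (at (- x)))" by (rule bounded_linear.linear)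
      then show "partial_deriv b h x = (-1) * partial_deriv b f (- x)"
        using partial_deriv_eq[OF d, of b x] by (simp add: partial_deriv_def linear_neg)
    qed
    then show "partial_deriv b h \<in> S"
      unfolding S_def using schwartz_cmult[OF schwartz_partial_deriv[OF f b], of "-1"]
      by (intro CollectI exI[of _ "\<lambda>x. - 1 * partial_deriv b f x"] conjI)
  qed
qed

section \<open>Integrals of products over the coordinates, and integrability from decay\<close>

text \<open>By \<open>lborel_eq\<close> the measure is the image of a product measure under the
  coordinate map, so this is Fubini for a product. It reduces the decay weights, the Gaussians and
  the majorant on the cusp to integrals over the line.\<close>

lemma integrable_lborel_prod_Basis:
  fixes f :: "'a::euclidean_space \<Rightarrow> real \<Rightarrow> 'b::{real_normed_field,banach,second_countable_topology}"
  assumes "\<And>b. b \<in> Basis \<Longrightarrow> integrable lborel (f b)"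
  shows "integrable lborel (\<lambda>x::'a. \<Prod>b\<in>Basis. f b (x \<bullet> b))"
    and "(LINT x|lborel. (\<Prod>b\<in>Basis. f b (x \<bullet> b))) = (\<Prod>b\<in>Basis. LINT t|lborel. f b t)"
proof -
  interpret product_sigma_finite "\<lambda>b::'a. lborel :: real measure"
    by standard
  have [measurable]: "f b \<in> borel_measurable borel" if "b \<in> Basis" for b
    using borel_measurable_integrable[OF assms[OF that]] by simp
  have m: "(\<lambda>y. \<Sum>b\<in>Basis. y b *\<^sub>R b :: 'a) \<in> measurable (\<Pi>\<^sub>M b\<in>Basis. lborel :: real measure) borel"
    by measurable
  have m2: "(\<lambda>x::'a. \<Prod>b\<in>Basis. f b (x \<bullet> b)) \<in> borel_measurable borel"
    by measurable
  have eq: "(\<Prod>b\<in>Basis. f b ((\<Sum>b\<in>Basis. y b *\<^sub>R b :: 'a) \<bullet> b)) = (\<Prod>b\<in>Basis. f b (y b))" for y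
    by (intro prod.cong) auto
  show "integrable lborel (\<lambda>x::'a. \<Prod>b\<in>Basis. f b (x \<bullet> b))"
    by (subst lborel_eq, subst integrable_distr_eq[OF m m2])
       (simp only: eq product_integrable_prod[OF finite_Basis assms])
  show "(LINT x|lborel. (\<Prod>b\<in>Basis. f b (x \<bullet> b))) = (\<Prod>b\<in>Basis. LINT t|lborel. f b t)"
    by (subst lborel_eq, subst integral_distr[OF m m2])
       (simp only: eq product_integral_prod[OF finite_Basis assms])
qed

text \<open>Carries the power integrals, which are known as gauge integrals, over to
  \<open>lborel\<close>: for nonnegative functions gauge integrability is absolute, and Borel
  measurability removes the completion.\<close>

lemma set_integrable_lborel_nonneg:
  fixes f :: "'a::euclidean_space \<Rightarrow> real"
  assumes "f integrable_on S" "\<And>x. x \<in> S \<Longrightarrow> 0 \<le> f x" "f \<in> borel_measurable borel" "S \<in> sets borel"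
  shows "set_integrable lborel S f"
proof -
  have "set_integrable lebesgue S f"
    using assms(1,2) by (rule nonnegative_absolutely_integrable_1)
  then show ?thesis
    using assms(3,4) unfolding set_integrable_def by (subst (asm) integrable_completion) auto
qed

lemma integrable_decay_real:
  assumes "s > 1 / 2"
  shows "integrable lborel (\<lambda>x::real. (1 + x\<^sup>2) powr (- s))"
proof -
  define g where "g = (\<lambda>x::real. indicator {1..} x * x powr (- 2 * s))"
  have "set_integrable lborel {1..} (\<lambda>x::real. x powr (- 2 * s))"
    using has_integral_powr_to_inf[of "- 2 * s" 1] assms
    by (intro set_integrable_lborel_nonneg) (auto simp: integrable_on_def)
  then have g: "integrable lborel g"
    by (simp add: set_integrable_def g_def)
  have g': "integrable lborel (\<lambda>x. g (- x))"
    using lborel_integrable_real_affine[OF g, of "-1" 0] by simp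
  have h: "integrable lborel (indicator {-1..1} :: real \<Rightarrow> real)"
    by (simp add: integrable_indicator_iff)
  show ?thesis
  proof (rule Bochner_Integration.integrable_bound)
    show "integrable lborel (\<lambda>x. indicator {-1..1} x + (g x + g (- x)))"
      by (intro Bochner_Integration.integrable_add g g' h)
    have "(1 + x\<^sup>2) powr (- s) \<le> indicator {-1..1} x + (g x + g (- x))" for x :: real
    proof (cases "\<bar>x\<bar> \<le> 1")
      case True
      have "(1 + x\<^sup>2) powr (- s) \<le> 1 powr (- s)"
        using assms by (intro powr_mono2') auto
      moreover have "indicator {-1..1} x = (1::real)" using True by (auto simp: indicator_def)
      ultimately show ?thesis by (simp add: g_def add_increasing2)
    next
      case False
      have "(1 + x\<^sup>2) powr (- s) \<le> (\<bar>x\<bar>\<^sup>2) powr (- s)"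
        using assms False by (intro powr_mono2') auto
      also have "\<dots> = \<bar>x\<bar> powr (- 2 * s)"
        using powr_powr[of "\<bar>x\<bar>" 2 "- s"] False by simp
      also have "\<dots> \<le> indicator {-1..1} x + (g x + g (- x))"
        using False by (auto simp: g_def indicator_def)
      finally show ?thesis .
    qed
    then show "AE x in lborel. norm ((1 + x\<^sup>2) powr (- s)) \<le> norm (indicator {-1..1} x + (g x + g (- x)))"
      by (intro AE_I2) (simp add: g_def)
  qed measurable
qed

text \<open>The exponent \<open>s\<close> is divided evenly among the coordinates. Each share
  \<open>r\<close> exceeds the one-dimensional threshold 1/2, and replacing \<open>norm x\<close> by
  a single coordinate only enlarges a factor with negative exponent, which gives a product
  majorant.\<close>

lemma integrable_decay:
  assumes "s > DIM('a) / 2"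
  shows "integrable lborel (\<lambda>x::'a::euclidean_space. (1 + (norm x)\<^sup>2) powr (- s))"
proof -
  define r where "r = s / DIM('a)"
  have r: "r > 1 / 2" using assms by (simp add: r_def field_simps)
  have int: "integrable lborel (\<lambda>x::'a. \<Prod>b\<in>Basis. (1 + (x \<bullet> b)\<^sup>2) powr (- r))"
    by (rule integrable_lborel_prod_Basis(1)) (rule integrable_decay_real[OF r])
  have le: "(1 + (norm x)\<^sup>2) powr (- s) \<le> (\<Prod>b\<in>Basis. (1 + (x \<bullet> b)\<^sup>2) powr (- r))" for x :: 'a
  proof -
    have "(1 + (norm x)\<^sup>2) powr (- r) > 0"
      by (metis add_pos_nonneg less_numeral_extra(1,3) powr_gt_zero zero_le_power2)
    then have "(1 + (norm x)\<^sup>2) powr (- s) = (\<Prod>b\<in>(Basis::'a set). (1 + (norm x)\<^sup>2) powr (- r))"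
      by (simp add: powr_powr r_def flip: powr_realpow)
    also have "\<dots> \<le> (\<Prod>b\<in>Basis. (1 + (x \<bullet> b)\<^sup>2) powr (- r))"
    proof (intro prod_mono conjI powr_mono2')
      fix b :: 'a assume "b \<in> Basis"
      then have "\<bar>x \<bullet> b\<bar> \<le> norm x" by (rule Basis_le_norm)
      then show "1 + (x \<bullet> b)\<^sup>2 \<le> 1 + (norm x)\<^sup>2"
        by (metis abs_ge_zero add_left_mono power2_abs power_mono)
    qed (use r in \<open>auto intro: add_pos_nonneg\<close>)
    finally show ?thesis .
  qed
  have m: "(\<lambda>x::'a. (1 + (norm x)\<^sup>2) powr (- s)) \<in> borel_measurable lborel"
    by measurable
  show ?thesis
    by (rule Bochner_Integration.integrable_bound[OF int m]) (simp add: le order_trans[OF _ abs_ge_self])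
qed

lemma rapid_decay:
  assumes "rapid f"
  obtains C where "C \<ge> 0" "\<And>x. norm (f x) \<le> C * (1 + (norm x)\<^sup>2) powr (- s)"
proof -
  obtain m :: nat where m: "s \<le> real m" using real_arch_simple by blast
  obtain A B where A: "norm x ^ 0 * norm (f x) \<le> A" and B: "norm x ^ (2 * m) * norm (f x) \<le> B" for x
    using assms unfolding rapid_def by meson
  have "norm (f x) \<le> 2 ^ m * (A + B) * (1 + (norm x)\<^sup>2) powr (- s)" for x
  proof -
    have "(1 + (norm x)\<^sup>2) ^ m \<le> (2 * max 1 ((norm x)\<^sup>2)) ^ m"
      by (intro power_mono) auto
    also have "\<dots> = 2 ^ m * (max 1 ((norm x)\<^sup>2)) ^ m"
      by (rule power_mult_distrib)
    also have "(max 1 ((norm x)\<^sup>2)) ^ m \<le> 1 + norm x ^ (2 * m)"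
      by (auto simp: max_def power_mult)
    finally have le: "(1 + (norm x)\<^sup>2) ^ m \<le> 2 ^ m * (1 + norm x ^ (2 * m))" by simp
    have "(1 + (norm x)\<^sup>2) powr s * norm (f x) \<le> (1 + (norm x)\<^sup>2) powr real m * norm (f x)"
      by (intro mult_right_mono powr_mono m) auto
    also have "\<dots> = (1 + (norm x)\<^sup>2) ^ m * norm (f x)"
      by (simp add: powr_realpow add_pos_nonneg)
    also have "\<dots> \<le> 2 ^ m * (1 + norm x ^ (2 * m)) * norm (f x)"
      by (intro mult_right_mono le) auto
    also have "\<dots> = 2 ^ m * (norm x ^ 0 * norm (f x) + norm x ^ (2 * m) * norm (f x))"
      by (simp add: algebra_simps)
    also have "\<dots> \<le> 2 ^ m * (A + B)"
      by (intro mult_left_mono add_mono A B) auto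
    finally have "(1 + (norm x)\<^sup>2) powr s * norm (f x) \<le> 2 ^ m * (A + B)" .
    moreover have "(1 + (norm x)\<^sup>2) powr s > 0"
      by (metis add_pos_nonneg less_numeral_extra(1,3) powr_gt_zero zero_le_power2)
    ultimately show ?thesis
      by (simp add: powr_minus field_simps)
  qed
  moreover have "0 \<le> 2 ^ m * (A + B)"
  proof -
    have "0 \<le> A" using order_trans[OF norm_ge_zero A[of 0, simplified]] .
    moreover have "0 \<le> B" using B[of 0] by (meson mult_nonneg_nonneg norm_ge_zero order_trans zero_le_power)
    ultimately show ?thesis by simp
  qed
  ultimately show ?thesis using that by blast
qed

lemma rapid_bounded: "rapid f \<Longrightarrow> \<exists>C. \<forall>x. norm (f x) \<le> C"
  using rapidD[of f 0] by simp

lemma rapid_integrable: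
  fixes f :: "'a::euclidean_space \<Rightarrow> complex"
  assumes "rapid f" "f \<in> borel_measurable borel"
  shows "integrable lborel f"
proof -
  obtain C where C: "C \<ge> 0" "\<And>x. norm (f x) \<le> C * (1 + (norm x)\<^sup>2) powr (- real DIM('a))"
    using rapid_decay[OF assms(1)] by blast
  show ?thesis
  proof (rule Bochner_Integration.integrable_bound)
    show "integrable lborel (\<lambda>x::'a. C * (1 + (norm x)\<^sup>2) powr (- real DIM('a)))"
      by (intro integrable_mult_right integrable_decay) simp
    show "AE x in lborel. norm (f x) \<le> norm (C * (1 + (norm x)\<^sup>2) powr (- real DIM('a)))"
      using C by auto
  qed (use assms in simp)
qed

lemma schwartz_integrable: "f \<in> schwartz \<Longrightarrow> integrable lborel f"
  by (simp add: rapid_integrable schwartz_measurable schwartz_rapid)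

section \<open>The Fourier transform\<close>

lemma fourier_kernel_norm [simp]: "norm (exp (- \<i> * complex_of_real t)) = 1"
  by (metis norm_exp_i_times mult_minus_left of_real_minus mult_minus_right)

lemma fourier_kernel_measurable [measurable]:
  "(\<lambda>x. exp (- \<i> * complex_of_real (\<xi> \<bullet> x))) \<in> borel_measurable borel"
  by (intro borel_measurable_continuous_onI continuous_intros)

lemma integrable_fourier_kernel:
  "integrable lborel f \<Longrightarrow> integrable lborel (\<lambda>x. exp (- \<i> * complex_of_real (\<xi> \<bullet> x)) * f x)"
  by (rule Bochner_Integration.integrable_bound[of _ f]) (auto simp: norm_mult)

lemma norm_fourier_le:
  fixes f :: "'a::euclidean_space \<Rightarrow> complex"
  shows "norm (fourier f \<xi>) \<le> (2 * pi) powr (- real DIM('a) / 2) * (LINT x|lborel. norm (f x))"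
proof -
  have "norm (LINT x|lborel. exp (- \<i> * complex_of_real (\<xi> \<bullet> x)) * f x)
      \<le> (LINT x|lborel. norm (exp (- \<i> * complex_of_real (\<xi> \<bullet> x)) * f x))"
    by (rule integral_norm_bound)
  then show ?thesis
    by (simp add: fourier_def norm_mult mult_left_mono)
qed

lemma fourier_lincomb:
  assumes "integrable lborel f" "integrable lborel g"
  shows "fourier (\<lambda>x. c * f x + d * g x) \<xi> = c * fourier f \<xi> + d * fourier g \<xi>"
proof -
  let ?e = "\<lambda>x. exp (- \<i> * complex_of_real (\<xi> \<bullet> x))"
  have "(LINT x|lborel. ?e x * (c * f x + d * g x)) = (LINT x|lborel. c * (?e x * f x) + d * (?e x * g x))"
    by (simp add: algebra_simps)
  also have "\<dots> = c * (LINT x|lborel. ?e x * f x) + d * (LINT x|lborel. ?e x * g x)"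
    by (subst Bochner_Integration.integral_add)
       (use integrable_fourier_kernel[OF assms(1), of \<xi>] integrable_fourier_kernel[OF assms(2), of \<xi>] in auto)
  finally show ?thesis
    by (simp add: fourier_def algebra_simps)
qed

lemma fourier_cmult: "fourier (\<lambda>x. c * f x) \<xi> = c * fourier f \<xi>"
proof -
  have "(LINT x|lborel. exp (- \<i> * complex_of_real (\<xi> \<bullet> x)) * (c * f x))
      = (LINT x|lborel. c * (exp (- \<i> * complex_of_real (\<xi> \<bullet> x)) * f x))"
    by (simp add: mult.left_commute)
  then show ?thesis by (simp add: fourier_def)
qed

lemma fourier_measurable [measurable]:
  fixes f :: "'a::euclidean_space \<Rightarrow> complex"
  assumes [measurable]: "f \<in> borel_measurable borel"
  shows "fourier f \<in> borel_measurable borel"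
proof -
  have "(\<lambda>\<xi>. LINT x|lborel. exp (- \<i> * complex_of_real (\<xi> \<bullet> x)) * f x) \<in> borel_measurable lborel"
    by (rule lborel.borel_measurable_lebesgue_integral) measurable
  then show ?thesis
    unfolding fourier_def[abs_def] by simp
qed

lemma integrable_prod_product:
  fixes f :: "'a::euclidean_space \<Rightarrow> complex" and g :: "'b::euclidean_space \<Rightarrow> complex"
  assumes f: "integrable lborel f" and g: "integrable lborel g"
  shows "integrable (lborel \<Otimes>\<^sub>M lborel) (\<lambda>(x, y). f x * g y)"
proof (rule lborel_pair.Fubini_integrable)
  have [measurable]: "f \<in> borel_measurable borel" "g \<in> borel_measurable borel"
    using borel_measurable_integrable[OF f] borel_measurable_integrable[OF g] by auto
  show "(\<lambda>(x, y). f x * g y) \<in> borel_measurable (lborel \<Otimes>\<^sub>M lborel)"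
    by measurable
  show "integrable lborel (\<lambda>x. LINT y|lborel. norm (case (x, y) of (x, y) \<Rightarrow> f x * g y))"
    using f g by (simp add: norm_mult)
  show "AE x in lborel. integrable lborel (\<lambda>y. case (x, y) of (x, y) \<Rightarrow> f x * g y)"
    using g by simp
qed

text \<open>The kernel is symmetric in its two arguments and has modulus 1, so this is Fubini with
  the majorant \<open>norm (g x) * norm (f y)\<close>. Inversion, Plancherel's inequality and the
  transform of a distribution given by a function all rest on it.\<close>

lemma fourier_swap:
  fixes f g :: "'a::euclidean_space \<Rightarrow> complex"
  assumes f: "integrable lborel f" and g: "integrable lborel g"
  shows "integrable lborel (\<lambda>x. fourier f x * g x)"
    and "(LINT x|lborel. fourier f x * g x) = (LINT x|lborel. f x * fourier g x)"
proof -
  let ?c = "complex_of_real ((2 * pi) powr (- real DIM('a) / 2))"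
  let ?e = "\<lambda>x y :: 'a. exp (- \<i> * complex_of_real (x \<bullet> y))"
  have mf [measurable]: "f \<in> borel_measurable borel" and mg [measurable]: "g \<in> borel_measurable borel"
    using borel_measurable_integrable[OF f] borel_measurable_integrable[OF g] by auto
  have bd: "norm (fourier f x) \<le> (2 * pi) powr (- real DIM('a) / 2) * (LINT x|lborel. norm (f x))" for x
    by (rule norm_fourier_le)
  show "integrable lborel (\<lambda>x. fourier f x * g x)"
  proof (rule Bochner_Integration.integrable_bound)
    show "integrable lborel (\<lambda>x. (2 * pi) powr (- real DIM('a) / 2) * (LINT x|lborel. norm (f x)) * norm (g x))"
      using g by simp
    show "AE x in lborel. norm (fourier f x * g x)
        \<le> norm ((2 * pi) powr (- real DIM('a) / 2) * (LINT x|lborel. norm (f x)) * norm (g x))"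
      using bd by (auto simp: norm_mult intro!: mult_right_mono order_trans[OF bd])
  qed measurable
  have int: "integrable (lborel \<Otimes>\<^sub>M lborel) (\<lambda>(x, y). ?e x y * (f y * g x))"
  proof (rule Bochner_Integration.integrable_bound)
    show "integrable (lborel \<Otimes>\<^sub>M lborel) (\<lambda>(x, y). g x * f y)"
      by (rule integrable_prod_product[OF g f])
  qed (measurable, auto simp: norm_mult)
  have "(LINT x|lborel. fourier f x * g x) = (LINT x|lborel. (LINT y|lborel. ?c * (?e x y * (f y * g x))))"
    unfolding fourier_def
    by (intro Bochner_Integration.integral_cong refl)
       (simp only: integral_mult_right_zero integral_mult_left_zero[symmetric] mult.assoc)
  also have "\<dots> = ?c * (LINT x|lborel. (LINT y|lborel. ?e x y * (f y * g x)))"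
    by simp
  also have "(LINT x|lborel. (LINT y|lborel. ?e x y * (f y * g x)))
      = (LINT y|lborel. (LINT x|lborel. ?e x y * (f y * g x)))"
    using lborel_pair.Fubini_integral[of "\<lambda>x y. ?e x y * (f y * g x)"] int by simp
  also have "?c * \<dots> = (LINT y|lborel. f y * fourier g y)"
    unfolding fourier_def integral_mult_right_zero[symmetric]
    by (intro Bochner_Integration.integral_cong refl) (simp only: inner_commute mult_ac)
  finally show "(LINT x|lborel. fourier f x * g x) = (LINT x|lborel. f x * fourier g x)" .
qed

section \<open>Derivatives and the Fourier transform\<close>

text \<open>A remainder of second order suffices for differentiability. This form fits both later
  uses: a Taylor bound for the exponential kernel, and the flatness of the cutoff functions at
  0.\<close>

lemma has_derivative_quadratic:
  assumes D: "bounded_linear D" and C: "\<And>v. norm (f (x + v) - f x - D v) \<le> C * (norm v)\<^sup>2"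
  shows "(f has_derivative D) (at x)"
  unfolding has_derivative_at
proof (intro conjI D)
  show "(\<lambda>h. norm (f (x + h) - f x - D h) / norm h) \<midarrow>0\<rightarrow> 0"
  proof (rule Lim_null_comparison)
    show "\<forall>\<^sub>F h in at 0. norm (norm (f (x + h) - f x - D h) / norm h) \<le> C * norm h"
      using C by (intro always_eventually) (auto simp: power2_eq_square divide_le_eq mult.assoc)
    show "(\<lambda>h. C * norm h) \<midarrow>0\<rightarrow> 0"
      by (rule tendsto_mult_right_zero) (simp add: tendsto_norm_zero)
  qed
qed

lemma rapid_norm_power_integrable:
  fixes f :: "'a::euclidean_space \<Rightarrow> complex"
  assumes f: "rapid f" "f \<in> borel_measurable borel"
  shows "integrable lborel (\<lambda>x. norm x ^ k * norm (f x))"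
proof -
  have "rapid (\<lambda>x. complex_of_real (norm x ^ k) * f x)"
    by (rule rapid_mult[OF f(1), where C = 1 and j = k]) (simp add: norm_power)
  then have "integrable lborel (\<lambda>x. complex_of_real (norm x ^ k) * f x)"
    using f(2) by (intro rapid_integrable) measurable
  then have "integrable lborel (\<lambda>x. norm (complex_of_real (norm x ^ k) * f x))"
    by (rule integrable_norm)
  then show ?thesis
    by (simp add: norm_mult norm_power)
qed

text \<open>Differentiation under the integral with an explicit remainder: the kernel deviates from
  its linear part by at most \<open>\<bar>v \<bullet> x\<bar>\<^sup>2 / 2\<close>, and the second
  moment of a Schwartz function is finite.\<close>

lemma fourier_has_derivative:
  fixes f :: "'a::euclidean_space \<Rightarrow> complex"
  assumes f: "f \<in> schwartz"
  shows "(fourier f has_derivative (\<lambda>v. fourier (\<lambda>x. complex_of_real (x \<bullet> v) * (- \<i> * f x)) \<xi>)) (at \<xi>)"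
proof -
  let ?D = "\<lambda>v. fourier (\<lambda>x. complex_of_real (x \<bullet> v) * (- \<i> * f x)) \<xi>"
  let ?c = "complex_of_real ((2 * pi) powr (- real DIM('a) / 2))"
  let ?e = "\<lambda>x y :: 'a. exp (- \<i> * complex_of_real (x \<bullet> y))"
  have int: "integrable lborel (\<lambda>x. complex_of_real (x \<bullet> v) * (- \<i> * f x))" for v
    using f by (intro schwartz_integrable schwartz_coord_mult schwartz_cmult)
  have "linear ?D"
  proof (rule linearI)
    fix v w
    show "?D (v + w) = ?D v + ?D w"
      using fourier_lincomb[OF int[of v] int[of w], of 1 1 \<xi>] by (simp add: inner_add_right algebra_simps)
    fix r :: real
    show "?D (r *\<^sub>R v) = r *\<^sub>R ?D v"
      using fourier_cmult[of "complex_of_real r" "\<lambda>x. complex_of_real (x \<bullet> v) * (- \<i> * f x)" \<xi>]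
      by (simp add: scaleR_conv_of_real algebra_simps)
  qed
  then have bl: "bounded_linear ?D"
    by (rule linear_conv_bounded_linear[THEN iffD1])
  let ?C = "(2 * pi) powr (- real DIM('a) / 2) * (LINT x|lborel. (norm x)\<^sup>2 * norm (f x))"
  have "norm (fourier f (\<xi> + v) - fourier f \<xi> - ?D v) \<le> ?C * (norm v)\<^sup>2" for v
  proof -
    let ?r = "\<lambda>x. ?e v x - (1 - \<i> * complex_of_real (v \<bullet> x))"
    have fi: "integrable lborel f" using f by (rule schwartz_integrable)
    have "fourier f (\<xi> + v) - fourier f \<xi> - ?D v =
      ?c * (LINT x|lborel. ?e (\<xi> + v) x * f x - ?e \<xi> x * f x - ?e \<xi> x * (complex_of_real (x \<bullet> v) * (- \<i> * f x)))"
      unfolding fourier_def using integrable_fourier_kernel[OF fi, of "\<xi> + v"]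
        integrable_fourier_kernel[OF fi, of \<xi>] integrable_fourier_kernel[OF int[of v], of \<xi>]
      by (simp only: Bochner_Integration.integral_diff Bochner_Integration.integrable_diff right_diff_distrib)
    also have "(LINT x|lborel. ?e (\<xi> + v) x * f x - ?e \<xi> x * f x - ?e \<xi> x * (complex_of_real (x \<bullet> v) * (- \<i> * f x)))
       = (LINT x|lborel. ?e \<xi> x * f x * ?r x)"
      by (intro Bochner_Integration.integral_cong refl)
         (simp add: inner_add_left exp_add exp_diff exp_minus divide_inverse algebra_simps inner_commute[of v])
    finally have eq: "norm (fourier f (\<xi> + v) - fourier f \<xi> - ?D v)
        = (2 * pi) powr (- real DIM('a) / 2) * norm (LINT x|lborel. ?e \<xi> x * f x * ?r x)"
      by (simp add: norm_mult)
    have "norm (LINT x|lborel. ?e \<xi> x * f x * ?r x) \<le> (LINT x|lborel. (norm v)\<^sup>2 * ((norm x)\<^sup>2 * norm (f x)))"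
    proof (rule Bochner_Integration.integral_norm_bound_integral)
      have [measurable]: "f \<in> borel_measurable borel" using f by (rule schwartz_measurable)
      show int2: "integrable lborel (\<lambda>x. (norm v)\<^sup>2 * ((norm x)\<^sup>2 * norm (f x)))"
        using rapid_norm_power_integrable[OF schwartz_rapid[OF f] schwartz_measurable[OF f], of 2] by simp
      show le: "norm (?e \<xi> x * f x * ?r x) \<le> (norm v)\<^sup>2 * ((norm x)\<^sup>2 * norm (f x))" for x
      proof -
        have "norm (?r x) \<le> \<bar>v \<bullet> x\<bar>\<^sup>2 / 2"
          using iexp_approx1[of "- (v \<bullet> x)" 1] by (simp add: power2_eq_square algebra_simps)
        also have "\<dots> \<le> \<bar>v \<bullet> x\<bar>\<^sup>2" by simp
        also have "\<dots> \<le> (norm v * norm x)\<^sup>2"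
          by (intro power_mono Cauchy_Schwarz_ineq2) simp
        finally have "norm (f x) * norm (?r x) \<le> norm (f x) * (norm v * norm x)\<^sup>2"
          by (intro mult_left_mono) auto
        then show ?thesis
          by (simp only: norm_mult fourier_kernel_norm mult_1_left power_mult_distrib mult_ac)
      qed
      show "integrable lborel (\<lambda>x. ?e \<xi> x * f x * ?r x)"
        by (rule Bochner_Integration.integrable_bound[OF int2])
           (measurable, use le in \<open>auto intro!: AE_I2 order_trans[OF le]\<close>)
    qed
    also have "\<dots> = (LINT x|lborel. (norm x)\<^sup>2 * norm (f x)) * (norm v)\<^sup>2" by simp
    finally show ?thesis
      unfolding eq by (simp add: mult.assoc mult_left_mono)
  qed
  with bl show ?thesis
    by (intro has_derivative_quadratic) auto
qed

lemma partial_deriv_fourier: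
  "f \<in> schwartz \<Longrightarrow> partial_deriv b (fourier f) = fourier (\<lambda>x. complex_of_real (x \<bullet> b) * (- \<i> * f x))"
  using partial_deriv_eq[OF fourier_has_derivative] by blast

lemma lborel_integral_shift:
  fixes f :: "'a::euclidean_space \<Rightarrow> 'b::{banach,second_countable_topology}"
  assumes [measurable]: "f \<in> borel_measurable borel"
  shows "(LINT x|lborel. f (c + x)) = (LINT x|lborel. f x)"
proof -
  have "(LINT x|lborel. f x) = (LINT x|distr lborel borel ((+) c). f x)"
    by (simp add: lborel_distr_plus)
  also have "\<dots> = (LINT x|lborel. f (c + x))"
    by (rule integral_distr) measurable
  finally show ?thesis ..
qed

lemma lborel_integrable_shift:
  fixes f :: "'a::euclidean_space \<Rightarrow> 'b::{banach,second_countable_topology}"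
  assumes "integrable lborel f"
  shows "integrable lborel (\<lambda>x. f (c + x))"
proof -
  have [measurable]: "f \<in> borel_measurable borel"
    using borel_measurable_integrable[OF assms] by simp
  have "integrable (distr lborel borel ((+) c)) f"
    using assms by (simp add: lborel_distr_plus)
  then show ?thesis
    by (subst (asm) integrable_distr_eq) auto
qed

lemma fourier_shift:
  fixes f :: "'a::euclidean_space \<Rightarrow> complex"
  assumes [measurable]: "f \<in> borel_measurable borel"
  shows "fourier (\<lambda>x. f (c + x)) \<xi> = exp (\<i> * complex_of_real (\<xi> \<bullet> c)) * fourier f \<xi>"
proof -
  have "(LINT x|lborel. exp (- \<i> * complex_of_real (\<xi> \<bullet> x)) * f (c + x))
    = (LINT x|lborel. exp (\<i> * complex_of_real (\<xi> \<bullet> c)) *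
        (exp (- \<i> * complex_of_real (\<xi> \<bullet> (c + x))) * f (c + x)))"
    by (intro Bochner_Integration.integral_cong refl)
       (simp add: inner_add_right exp_add exp_minus exp_diff field_simps)
  also have "\<dots> = exp (\<i> * complex_of_real (\<xi> \<bullet> c)) *
      (LINT x|lborel. exp (- \<i> * complex_of_real (\<xi> \<bullet> (c + x))) * f (c + x))"
    by simp
  also have "(LINT x|lborel. exp (- \<i> * complex_of_real (\<xi> \<bullet> (c + x))) * f (c + x))
     = (LINT x|lborel. exp (- \<i> * complex_of_real (\<xi> \<bullet> x)) * f x)"
    by (rule lborel_integral_shift[of "\<lambda>x. exp (- \<i> * complex_of_real (\<xi> \<bullet> x)) * f x"]) measurable
  finally show ?thesis by (simp add: fourier_def)
qed

lemma schwartz_line_derivative: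
  assumes "f \<in> schwartz"
  shows "((\<lambda>s. f (x + s *\<^sub>R b)) has_derivative (\<lambda>h. h *\<^sub>R partial_deriv b f (x + s *\<^sub>R b))) (at s)"
proof -
  have d: "(f has_derivative frechet_derivative f (at (x + s *\<^sub>R b))) (at (x + s *\<^sub>R b))"
    using schwartz_differentiable[OF assms] frechet_derivative_works by blast
  have "((\<lambda>s. x + s *\<^sub>R b) has_derivative (\<lambda>h. h *\<^sub>R b)) (at s)"
    by (auto intro!: derivative_eq_intros)
  from has_derivative_compose[OF this d]
  have "((\<lambda>s. f (x + s *\<^sub>R b)) has_derivative (\<lambda>h. frechet_derivative f (at (x + s *\<^sub>R b)) (h *\<^sub>R b))) (at s)" .
  moreover have "frechet_derivative f (at (x + s *\<^sub>R b)) (h *\<^sub>R b) = h *\<^sub>R partial_deriv b f (x + s *\<^sub>R b)" for h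
    using d has_derivative_bounded_linear linear_cmul bounded_linear.linear
    unfolding partial_deriv_def by blast
  ultimately show ?thesis by simp
qed

text \<open>The integrable majorant for the limit in \<open>fourier_partial_deriv\<close>. The mean
  value theorem moves the derivative to a point at distance at most 1 from \<open>x\<close>; there 1
  + norm^2 is at least a third of its value at \<open>x\<close>, whence the factor
  \<open>3 powr ?s\<close>.\<close>

lemma schwartz_difference_quotient_bound:
  fixes f :: "'a::euclidean_space \<Rightarrow> complex"
  assumes f: "f \<in> schwartz" and b: "b \<in> Basis"
  obtains g where "integrable lborel g"
    and "\<And>x h. 0 < h \<Longrightarrow> h \<le> 1 \<Longrightarrow> norm (f (x + h *\<^sub>R b) - f x) \<le> h * g x"
proof -
  let ?s = "real DIM('a)"
  obtain C where C: "C \<ge> 0" "\<And>x. norm (partial_deriv b f x) \<le> C * (1 + (norm x)\<^sup>2) powr (- ?s)"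
    using rapid_decay[OF schwartz_rapid[OF schwartz_partial_deriv[OF f b]]] by blast
  define g where "g = (\<lambda>x::'a. C * 3 powr ?s * (1 + (norm x)\<^sup>2) powr (- ?s))"
  have "integrable lborel g"
    unfolding g_def by (intro integrable_mult_right integrable_decay) simp
  moreover have "norm (f (x + h *\<^sub>R b) - f x) \<le> h * g x" if h: "0 < h" "h \<le> 1" for x h
  proof -
    have "\<exists>s\<in>{0<..<h}. norm (f (x + h *\<^sub>R b) - f (x + 0 *\<^sub>R b)) \<le> norm ((h - 0) *\<^sub>R partial_deriv b f (x + s *\<^sub>R b))"
    proof (rule mvt_general[OF h(1)])
      show "continuous_on {0..h} (\<lambda>s. f (x + s *\<^sub>R b))"
        by (intro continuous_at_imp_continuous_on ballI has_derivative_continuous)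
           (rule schwartz_line_derivative[OF f])
    qed (rule schwartz_line_derivative[OF f])
    then obtain s where s: "0 < s" "s < h"
      and le: "norm (f (x + h *\<^sub>R b) - f x) \<le> h * norm (partial_deriv b f (x + s *\<^sub>R b))"
      using h by auto
    have "norm (partial_deriv b f (x + s *\<^sub>R b)) \<le> C * (1 + (norm (x + s *\<^sub>R b))\<^sup>2) powr (- ?s)"
      by (rule C)
    also have "\<dots> \<le> C * ((1 + (norm x)\<^sup>2) / 3) powr (- ?s)"
    proof (intro mult_left_mono powr_mono2')
      have "norm x = norm ((x + s *\<^sub>R b) - s *\<^sub>R b)" by simp
      also have "\<dots> \<le> norm (x + s *\<^sub>R b) + norm (s *\<^sub>R b)" by (rule norm_triangle_ineq4)
      also have "\<dots> \<le> norm (x + s *\<^sub>R b) + 1" using s h b by simp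
      finally have "(norm x)\<^sup>2 \<le> (norm (x + s *\<^sub>R b) + 1)\<^sup>2" by (intro power_mono) auto
      also have "\<dots> \<le> 2 * (norm (x + s *\<^sub>R b))\<^sup>2 + 2"
        using zero_le_power2[of "norm (x + s *\<^sub>R b) - 1"] by (simp add: power2_eq_square algebra_simps)
      also have "\<dots> \<le> 3 * (norm (x + s *\<^sub>R b))\<^sup>2 + 2" by simp
      finally show "(1 + (norm x)\<^sup>2) / 3 \<le> 1 + (norm (x + s *\<^sub>R b))\<^sup>2" by simp
    qed (use C in \<open>auto intro: add_pos_nonneg\<close>)
    also have "((1 + (norm x)\<^sup>2) / 3) powr (- ?s) = 3 powr ?s * (1 + (norm x)\<^sup>2) powr (- ?s)"
      by (simp add: powr_divide powr_minus field_simps)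
    finally have "norm (partial_deriv b f (x + s *\<^sub>R b)) \<le> g x" by (simp add: g_def)
    with le h show ?thesis by (meson less_imp_le mult_left_mono order_trans)
  qed
  ultimately show ?thesis using that by blast
qed

text \<open>Takes the place of integration by parts: a translation by \<open>h *\<^sub>R b\<close>
  multiplies the transform by a character, so difference quotients can be compared on both sides and
  \<open>h\<close> sent to 0.\<close>

lemma fourier_partial_deriv:
  fixes f :: "'a::euclidean_space \<Rightarrow> complex"
  assumes f: "f \<in> schwartz" and b: "b \<in> Basis"
  shows "fourier (partial_deriv b f) \<xi> = \<i> * complex_of_real (\<xi> \<bullet> b) * fourier f \<xi>"
proof -
  let ?c = "complex_of_real ((2 * pi) powr (- real DIM('a) / 2))"
  let ?e = "\<lambda>x y :: 'a. exp (- \<i> * complex_of_real (x \<bullet> y))"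
  define h where "h = (\<lambda>n. 1 / real (Suc n))"
  have h: "0 < h n" "h n \<le> 1" for n by (auto simp: h_def)
  have h0: "h \<longlonglongrightarrow> 0" unfolding h_def by (rule lim_inverse_n'[THEN LIMSEQ_Suc])
  have h0': "filterlim h (at 0) sequentially"
    using h0 h(1) by (auto simp: filterlim_at intro!: always_eventually dest: less_imp_neq[THEN not_sym])
  define q where "q = (\<lambda>n x. (f (h n *\<^sub>R b + x) - f x) / h n)"
  have mf [measurable]: "f \<in> borel_measurable borel" using f by (rule schwartz_measurable)
  have mp [measurable]: "partial_deriv b f \<in> borel_measurable borel"
    using schwartz_partial_deriv[OF f b] by (rule schwartz_measurable)
  obtain g where g: "integrable lborel g"
    and gle: "\<And>x h. 0 < h \<Longrightarrow> h \<le> 1 \<Longrightarrow> norm (f (x + h *\<^sub>R b) - f x) \<le> h * g x"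
    using schwartz_difference_quotient_bound[OF f b] by blast
  have fi: "integrable lborel f" using f by (rule schwartz_integrable)
  have lim1: "(\<lambda>n. fourier (q n) \<xi>) \<longlonglongrightarrow> fourier (partial_deriv b f) \<xi>"
    unfolding fourier_def
  proof (intro tendsto_mult tendsto_const integral_dominated_convergence)
    show "integrable lborel g" by (rule g)
    show "AE x in lborel. (\<lambda>n. ?e \<xi> x * q n x) \<longlonglongrightarrow> ?e \<xi> x * partial_deriv b f x"
    proof (intro AE_I2 tendsto_mult tendsto_const)
      fix x
      have "((\<lambda>s. norm (f (x + s *\<^sub>R b) - f x - s *\<^sub>R partial_deriv b f x) / norm s) \<longlongrightarrow> 0) (at 0)"
        using schwartz_line_derivative[OF f, of x b 0] by (simp add: has_derivative_at)
      from filterlim_compose[OF this h0']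
      have "(\<lambda>n. norm (f (x + h n *\<^sub>R b) - f x - h n *\<^sub>R partial_deriv b f x) / norm (h n)) \<longlonglongrightarrow> 0" .
      moreover have "norm (f (x + h n *\<^sub>R b) - f x - h n *\<^sub>R partial_deriv b f x) / norm (h n)
          = norm (q n x - partial_deriv b f x)" for n
      proof -
        have "q n x - partial_deriv b f x = (f (x + h n *\<^sub>R b) - f x - h n *\<^sub>R partial_deriv b f x) / h n"
          using h(1)[of n] by (simp add: q_def scaleR_conv_of_real field_simps add.commute)
        then show ?thesis by (simp add: norm_divide)
      qed
      ultimately show "(\<lambda>n. q n x) \<longlonglongrightarrow> partial_deriv b f x"
        by (simp add: tendsto_norm_zero_iff LIM_zero_iff)
    qed
    show "AE x in lborel. norm (?e \<xi> x * q n x) \<le> g x" for n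
      using gle[OF h[of n]] h(1)[of n]
      by (intro AE_I2) (simp add: q_def norm_mult norm_divide divide_le_eq mult.commute add.commute)
    show "(\<lambda>x. ?e \<xi> x * q n x) \<in> borel_measurable lborel" for n
      unfolding q_def by measurable
    show "(\<lambda>x. ?e \<xi> x * partial_deriv b f x) \<in> borel_measurable lborel" by measurable
  qed
  have eq: "fourier (q n) \<xi> = ((exp (\<i> * complex_of_real (\<xi> \<bullet> b) * h n) - 1) / h n) * fourier f \<xi>" for n
  proof -
    have "q n = (\<lambda>x. (1 / complex_of_real (h n)) * f (h n *\<^sub>R b + x) + (- 1 / h n) * f x)"
      by (simp add: q_def fun_eq_iff diff_divide_distrib)
    then have "fourier (q n) \<xi> = fourier (\<lambda>x. (1 / complex_of_real (h n)) * f (h n *\<^sub>R b + x) + (- 1 / h n) * f x) \<xi>"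
      by (rule arg_cong[where f = "\<lambda>q. fourier q \<xi>"])
    also have "\<dots> = (1 / complex_of_real (h n)) * fourier (\<lambda>x. f (h n *\<^sub>R b + x)) \<xi> + (- 1 / h n) * fourier f \<xi>"
      by (rule fourier_lincomb[OF lborel_integrable_shift[OF fi] fi])
    also have "fourier (\<lambda>x. f (h n *\<^sub>R b + x)) \<xi> = exp (\<i> * complex_of_real (\<xi> \<bullet> b) * h n) * fourier f \<xi>"
      by (simp add: fourier_shift[OF mf] mult.assoc mult.commute[of "h n"])
    finally show ?thesis by (simp add: diff_divide_distrib algebra_simps)
  qed
  have "((\<lambda>s. exp (\<i> * complex_of_real (\<xi> \<bullet> b) * s)) has_field_derivative \<i> * complex_of_real (\<xi> \<bullet> b)) (at 0)"
    by (auto intro!: derivative_eq_intros)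
  then have "((\<lambda>s. (exp (\<i> * complex_of_real (\<xi> \<bullet> b) * s) - 1) / s) \<longlongrightarrow> \<i> * complex_of_real (\<xi> \<bullet> b)) (at 0)"
    by (simp add: has_field_derivative_iff)
  moreover have "filterlim (\<lambda>n. complex_of_real (h n)) (at 0) sequentially"
    using h0 h(1) tendsto_of_real[OF h0]
    by (auto simp: filterlim_at intro!: always_eventually dest: less_imp_neq[THEN not_sym])
  ultimately have "(\<lambda>n. (exp (\<i> * complex_of_real (\<xi> \<bullet> b) * h n) - 1) / h n) \<longlonglongrightarrow> \<i> * complex_of_real (\<xi> \<bullet> b)"
    by (rule filterlim_compose)
  then have "(\<lambda>n. fourier (q n) \<xi>) \<longlonglongrightarrow> \<i> * complex_of_real (\<xi> \<bullet> b) * fourier f \<xi>"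
    unfolding eq by (intro tendsto_mult tendsto_const)
  with lim1 show ?thesis using LIMSEQ_unique by blast
qed

text \<open>One factor \<open>norm \<xi>\<close> is dominated by the sum of the coordinates, and
  each coordinate is traded for a partial derivative of \<open>f\<close>. That is why the induction
  leaves \<open>f\<close> arbitrary.\<close>

lemma rapid_fourier:
  fixes f :: "'a::euclidean_space \<Rightarrow> complex"
  assumes "f \<in> schwartz"
  shows "rapid (fourier f)"
  unfolding rapid_def
proof
  fix k
  show "\<exists>C. \<forall>\<xi>. norm \<xi> ^ k * norm (fourier f \<xi>) \<le> C"
    using assms
  proof (induction k arbitrary: f)
    case 0
    then show ?case using norm_fourier_le by auto
  next
    case (Suc k)
    have "\<forall>b\<in>Basis. \<exists>C. \<forall>\<xi>. norm \<xi> ^ k * norm (fourier (partial_deriv b f) \<xi>) \<le> C"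
      using Suc schwartz_partial_deriv by blast
    then obtain C where C: "\<And>b \<xi>. b \<in> Basis \<Longrightarrow> norm \<xi> ^ k * norm (fourier (partial_deriv b f) \<xi>) \<le> C b"
      by metis
    have "norm \<xi> ^ Suc k * norm (fourier f \<xi>) \<le> sum C Basis" for \<xi>
    proof -
      have "norm \<xi> ^ Suc k * norm (fourier f \<xi>) \<le> norm \<xi> ^ k * ((\<Sum>b\<in>Basis. \<bar>\<xi> \<bullet> b\<bar>) * norm (fourier f \<xi>))"
        unfolding power_Suc2 mult.assoc by (intro mult_left_mono mult_right_mono norm_le_l1) auto
      also have "\<dots> = (\<Sum>b\<in>Basis. norm \<xi> ^ k * norm (fourier (partial_deriv b f) \<xi>))"
        using Suc.prems by (simp add: fourier_partial_deriv norm_mult sum_distrib_left sum_distrib_right)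
      also have "\<dots> \<le> sum C Basis"
        by (intro sum_mono C)
      finally show ?thesis .
    qed
    then show ?case by blast
  qed
qed

lemma fourier_schwartz:
  fixes f :: "'a::euclidean_space \<Rightarrow> complex"
  assumes "f \<in> schwartz"
  shows "fourier f \<in> schwartz"
proof (rule schwartz_coinduct[where S = "fourier ` schwartz"])
  show "fourier f \<in> fourier ` schwartz" using assms by blast
next
  fix h :: "'a \<Rightarrow> complex" and b x :: 'a assume "h \<in> fourier ` schwartz"
  then obtain f where h: "h = fourier f" and f: "f \<in> schwartz" by blast
  show "h differentiable (at x)"
    using fourier_has_derivative[OF f] unfolding h differentiable_def by blast
  show "rapid h" unfolding h by (rule rapid_fourier[OF f])
  show "partial_deriv b h \<in> fourier ` schwartz"
    unfolding h partial_deriv_fourier[OF f] by (intro imageI schwartz_coord_mult schwartz_cmult f)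
qed

section \<open>Gaussian integrals\<close>

lemma integrable_gaussian_real:
  assumes "a > 0"
  shows "integrable lborel (\<lambda>x::real. exp (- a * x\<^sup>2 / 2))"
proof -
  have "integrable lborel (\<lambda>x. sqrt (2 * pi) * std_normal_density x)"
    by (intro integrable_mult_right integrable_normal_density) simp
  then have "integrable lborel (\<lambda>x::real. exp (- x\<^sup>2 / 2))"
    by (simp add: std_normal_density_def)
  from lborel_integrable_real_affine[OF this, of "sqrt a" 0] assms
  show ?thesis by (simp add: power_mult_distrib)
qed

text \<open>Rescaling by \<open>1 / sqrt a\<close> reduces this to the characteristic function of
  the standard normal distribution.\<close>

lemma gaussian_fourier_real:
  assumes a: "a > 0"
  shows "(LINT x|lborel. exp (- \<i> * complex_of_real (t * x)) * complex_of_real (exp (- a * x\<^sup>2 / 2)))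
    = complex_of_real (sqrt (2 * pi / a) * exp (- t\<^sup>2 / (2 * a)))"
proof -
  let ?r = "sqrt a"
  have r: "?r > 0" using a by simp
  have char: "(LINT x|lborel. std_normal_density x *\<^sub>R iexp (s * x)) = complex_of_real (exp (- s\<^sup>2 / 2))" for s
  proof -
    have "char std_normal_distribution s = (LINT x|lborel. std_normal_density x *\<^sub>R iexp (s * x))"
      unfolding char_def by (subst integral_density) auto
    then show ?thesis by (simp add: char_std_normal_distribution)
  qed
  have "(LINT x|lborel. exp (- \<i> * complex_of_real (t * x)) * complex_of_real (exp (- a * x\<^sup>2 / 2)))
    = \<bar>1 / ?r\<bar> *\<^sub>R (LINT x|lborel. exp (- \<i> * complex_of_real (t * (0 + (1 / ?r) * x))) *
        complex_of_real (exp (- a * (0 + (1 / ?r) * x)\<^sup>2 / 2)))"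
    using r by (intro lborel_integral_real_affine) simp
  also have "(LINT x|lborel. exp (- \<i> * complex_of_real (t * (0 + (1 / ?r) * x))) *
        complex_of_real (exp (- a * (0 + (1 / ?r) * x)\<^sup>2 / 2)))
     = (LINT x|lborel. complex_of_real (sqrt (2 * pi)) * (std_normal_density x *\<^sub>R iexp ((- t / ?r) * x)))"
    using a by (intro Bochner_Integration.integral_cong refl)
      (simp add: std_normal_density_def scaleR_conv_of_real power_divide power_mult_distrib)
  also have "\<dots> = complex_of_real (sqrt (2 * pi)) * complex_of_real (exp (- (- t / ?r)\<^sup>2 / 2))"
    by (simp only: integral_mult_right_zero char)
  also have "\<bar>1 / ?r\<bar> *\<^sub>R \<dots> = complex_of_real (sqrt (2 * pi / a) * exp (- t\<^sup>2 / (2 * a)))"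
    using a by (simp add: scaleR_conv_of_real power_divide real_sqrt_divide mult.commute)
  finally show ?thesis .
qed

lemma gaussian_prod_Basis:
  "exp (- a * (norm x)\<^sup>2 / 2) = (\<Prod>b\<in>Basis. exp (- a * (x \<bullet> b)\<^sup>2 / 2))" for x :: "'a::euclidean_space"
  unfolding power2_norm_eq_inner euclidean_inner[of x x]
  by (simp add: exp_sum[symmetric] power2_eq_square sum_divide_distrib sum_distrib_left sum_negf)

lemma integrable_gaussian:
  "a > 0 \<Longrightarrow> integrable lborel (\<lambda>x::'a::euclidean_space. exp (- a * (norm x)\<^sup>2 / 2))"
  unfolding gaussian_prod_Basis by (intro integrable_lborel_prod_Basis(1) integrable_gaussian_real)

lemma gaussian_fourier_integral:
  fixes \<xi> :: "'a::euclidean_space"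
  assumes a: "a > 0"
  shows "(LINT x|lborel. exp (- \<i> * complex_of_real (\<xi> \<bullet> x)) * complex_of_real (exp (- a * (norm x)\<^sup>2 / 2)))
    = complex_of_real ((2 * pi / a) powr (real DIM('a) / 2) * exp (- (norm \<xi>)\<^sup>2 / (2 * a)))"
proof -
  let ?f = "\<lambda>b t. exp (- \<i> * complex_of_real ((\<xi> \<bullet> b) * t)) * complex_of_real (exp (- a * t\<^sup>2 / 2))"
  have int: "integrable lborel (?f b)" for b
    by (rule Bochner_Integration.integrable_bound[OF integrable_gaussian_real[OF a]])
       (auto simp: norm_mult)
  have "exp (- \<i> * complex_of_real (\<xi> \<bullet> x)) * complex_of_real (exp (- a * (norm x)\<^sup>2 / 2))
      = (\<Prod>b\<in>Basis. ?f b (x \<bullet> b))" for x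
    unfolding gaussian_prod_Basis prod.distrib of_real_prod
    by (subst euclidean_inner[of \<xi> x]) (simp add: exp_sum[symmetric] sum_distrib_left sum_negf)
  then have "(LINT x|lborel. exp (- \<i> * complex_of_real (\<xi> \<bullet> x)) * complex_of_real (exp (- a * (norm x)\<^sup>2 / 2)))
      = (\<Prod>b\<in>Basis. LINT t|lborel. ?f b t)"
    using integrable_lborel_prod_Basis(2)[of ?f, OF int] by simp
  also have "\<dots> = complex_of_real ((\<Prod>b\<in>(Basis::'a set). sqrt (2 * pi / a)) * (\<Prod>b\<in>Basis. exp (- (1 / a) * (\<xi> \<bullet> b)\<^sup>2 / 2)))"
    unfolding of_real_mult[symmetric] prod.distrib[symmetric] of_real_prod
    by (intro prod.cong refl trans[OF gaussian_fourier_real[OF a]]) (simp add: mult.commute)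
  also have "(\<Prod>b\<in>(Basis::'a set). sqrt (2 * pi / a)) = (2 * pi / a) powr (real DIM('a) / 2)"
    using a by (simp add: powr_half_sqrt[symmetric] powr_powr flip: powr_realpow)
  finally show ?thesis
    unfolding gaussian_prod_Basis[symmetric] by simp
qed

subsection \<open>Inversion and Plancherel's inequality\<close>

lemma fourier_gaussian_scaled:
  fixes \<xi> :: "'a::euclidean_space"
  assumes "a > 0"
  shows "fourier (\<lambda>x. complex_of_real (exp (- a * (norm x)\<^sup>2 / 2))) \<xi>
    = complex_of_real (a powr (- real DIM('a) / 2) * exp (- (norm \<xi>)\<^sup>2 / (2 * a)))"
proof -
  have "(2 * pi) powr (- real DIM('a) / 2) * (2 * pi / a) powr (real DIM('a) / 2) = a powr (- real DIM('a) / 2)"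
    using assms by (simp add: powr_divide powr_minus field_simps)
  then show ?thesis
    unfolding fourier_def gaussian_fourier_integral[OF assms] of_real_mult[symmetric] mult.assoc[symmetric]
    by simp
qed

lemma integral_gaussian_normalized:
  "(LINT x::'a::euclidean_space|lborel. exp (- (norm x)\<^sup>2 / 2)) = (2 * pi) powr (real DIM('a) / 2)"
  (is "_ = ?r")
proof -
  have "complex_of_real (LINT x::'a|lborel. exp (- (norm x)\<^sup>2 / 2)) = complex_of_real ?r"
    using gaussian_fourier_integral[of 1 "0::'a"] by (simp flip: integral_complex_of_real)
  then show ?thesis by (simp only: of_real_eq_iff)
qed

lemma lborel_integral_scale:
  fixes f :: "'a::euclidean_space \<Rightarrow> 'b::{banach,second_countable_topology}"
  assumes [measurable]: "f \<in> borel_measurable borel" and c: "c > 0"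
  shows "(LINT x|lborel. f (c *\<^sub>R x)) = (1 / c ^ DIM('a)) *\<^sub>R (LINT x|lborel. f x)"
proof -
  have "(LINT x|lborel. f x) = (LINT x|density (distr lborel borel (\<lambda>x. 0 + c *\<^sub>R x)) (\<lambda>_. \<bar>c\<bar> ^ DIM('a)). f x)"
    using lborel_affine[of c "0::'a"] c by (metis less_irrefl)
  also have "\<dots> = c ^ DIM('a) *\<^sub>R (LINT x|lborel. f (c *\<^sub>R x))"
    using c by (subst integral_density) (auto simp: integral_distr)
  finally show ?thesis using c by simp
qed

text \<open>The identity \<open>\<integral> fourier f \<cdot> \<gamma> = \<integral> f \<cdot> fourier \<gamma>\<close> is used with Gaussians \<open>\<gamma>\<close> that flatten to \<open>1\<close>
  while their transforms concentrate at the origin.\<close>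

lemma fourier_inversion_zero:
  fixes f :: "'a::euclidean_space \<Rightarrow> complex"
  assumes f: "integrable lborel f" and bdd: "\<And>x. norm (f x) \<le> C" and cont: "continuous_on UNIV f"
    and F: "integrable lborel (fourier f)"
  shows "(LINT \<xi>|lborel. fourier f \<xi>) = complex_of_real ((2 * pi) powr (real DIM('a) / 2)) * f 0"
proof -
  let ?n = "real DIM('a)"
  define a where "a = (\<lambda>n. 1 / real (Suc n))"
  have a: "a n > 0" for n by (simp add: a_def)
  have a0: "a \<longlonglongrightarrow> 0" unfolding a_def by (rule lim_inverse_n'[THEN LIMSEQ_Suc])
  have mf [measurable]: "f \<in> borel_measurable borel"
    using borel_measurable_continuous_onI[OF cont] .
  have lim1: "(\<lambda>n. LINT \<xi>|lborel. fourier f \<xi> * complex_of_real (exp (- (a n)\<^sup>2 * (norm \<xi>)\<^sup>2 / 2)))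
     \<longlonglongrightarrow> (LINT \<xi>|lborel. fourier f \<xi>)"
  proof (rule integral_dominated_convergence[where w = "\<lambda>\<xi>. norm (fourier f \<xi>)"])
    show "AE \<xi> in lborel. (\<lambda>n. fourier f \<xi> * complex_of_real (exp (- (a n)\<^sup>2 * (norm \<xi>)\<^sup>2 / 2))) \<longlonglongrightarrow> fourier f \<xi>"
    proof (rule AE_I2)
      fix \<xi> :: 'a
      have "(\<lambda>n. fourier f \<xi> * complex_of_real (exp (- (a n)\<^sup>2 * (norm \<xi>)\<^sup>2 / 2)))
          \<longlonglongrightarrow> fourier f \<xi> * complex_of_real (exp (- 0\<^sup>2 * (norm \<xi>)\<^sup>2 / 2))"
        by (intro tendsto_intros a0) auto
      then show "(\<lambda>n. fourier f \<xi> * complex_of_real (exp (- (a n)\<^sup>2 * (norm \<xi>)\<^sup>2 / 2))) \<longlonglongrightarrow> fourier f \<xi>"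
        by simp
    qed
    show "AE \<xi> in lborel. norm (fourier f \<xi> * complex_of_real (exp (- (a n)\<^sup>2 * (norm \<xi>)\<^sup>2 / 2))) \<le> norm (fourier f \<xi>)" for n
      by (rule AE_I2) (simp add: norm_mult mult_left_le)
    show "integrable lborel (\<lambda>\<xi>. norm (fourier f \<xi>))" using F by simp
  qed measurable
  have eq: "(LINT \<xi>|lborel. fourier f \<xi> * complex_of_real (exp (- (a n)\<^sup>2 * (norm \<xi>)\<^sup>2 / 2)))
      = (LINT x|lborel. f (a n *\<^sub>R x) * complex_of_real (exp (- (norm x)\<^sup>2 / 2)))" for n
  proof -
    have a2: "(a n)\<^sup>2 > 0" using a[of n] by simp
    have "(LINT \<xi>|lborel. fourier f \<xi> * complex_of_real (exp (- (a n)\<^sup>2 * (norm \<xi>)\<^sup>2 / 2)))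
      = (LINT x|lborel. f x * fourier (\<lambda>\<xi>. complex_of_real (exp (- (a n)\<^sup>2 * (norm \<xi>)\<^sup>2 / 2))) x)"
      by (rule fourier_swap(2)[OF f integrable_of_real[OF integrable_gaussian[OF a2]]])
    also have "\<dots> = (LINT x|lborel. (1 / a n ^ DIM('a)) *\<^sub>R (f x * complex_of_real (exp (- (norm x)\<^sup>2 / (2 * (a n)\<^sup>2)))))"
    proof -
      have "((a n)\<^sup>2) powr (- ?n / 2) = 1 / a n ^ DIM('a)"
      proof -
        have "((a n)\<^sup>2) powr (- ?n / 2) = (a n powr 2) powr (- ?n / 2)"
          using a[of n] by simp
        also have "\<dots> = a n powr (- ?n)"
          by (simp only: powr_powr) simp
        also have "\<dots> = 1 / a n ^ DIM('a)"
          using a[of n] by (simp add: powr_minus powr_realpow divide_inverse)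
        finally show ?thesis .
      qed
      then show ?thesis
        unfolding fourier_gaussian_scaled[OF a2]
        by (intro Bochner_Integration.integral_cong refl) (simp add: scaleR_conv_of_real mult_ac)
    qed
    also have "\<dots> = (1 / a n ^ DIM('a)) *\<^sub>R (LINT x|lborel. f x * complex_of_real (exp (- (norm x)\<^sup>2 / (2 * (a n)\<^sup>2))))"
      by (rule integral_scaleR_right)
    also have "\<dots> = (LINT x|lborel. f (a n *\<^sub>R x) * complex_of_real (exp (- (norm (a n *\<^sub>R x))\<^sup>2 / (2 * (a n)\<^sup>2))))"
      by (subst lborel_integral_scale[symmetric, OF _ a[of n]]) auto
    also have "\<dots> = (LINT x|lborel. f (a n *\<^sub>R x) * complex_of_real (exp (- (norm x)\<^sup>2 / 2)))"
      using a[of n] by (simp add: power_mult_distrib)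
    finally show ?thesis .
  qed
  have "(\<lambda>n. LINT x|lborel. f (a n *\<^sub>R x) * complex_of_real (exp (- (norm x)\<^sup>2 / 2)))
     \<longlonglongrightarrow> (LINT x|lborel. f 0 * complex_of_real (exp (- (norm (x::'a))\<^sup>2 / 2)))"
  proof (rule integral_dominated_convergence[where w = "\<lambda>x. C * exp (- (norm x)\<^sup>2 / 2)"])
    show "integrable lborel (\<lambda>x::'a. C * exp (- (norm x)\<^sup>2 / 2))"
      using integrable_gaussian[of 1, where 'a='a] by simp
    show "AE x in lborel. (\<lambda>n. f (a n *\<^sub>R x) * complex_of_real (exp (- (norm x)\<^sup>2 / 2)))
        \<longlonglongrightarrow> f 0 * complex_of_real (exp (- (norm x)\<^sup>2 / 2))"
    proof (intro AE_I2 tendsto_mult tendsto_const)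
      fix x :: 'a
      have "(\<lambda>n. a n *\<^sub>R x) \<longlonglongrightarrow> 0 *\<^sub>R x" by (intro tendsto_intros a0)
      then show "(\<lambda>n. f (a n *\<^sub>R x)) \<longlonglongrightarrow> f 0"
        using continuous_on_tendsto_compose[OF cont, of "\<lambda>n. a n *\<^sub>R x" 0 sequentially] by simp
    qed
    show "AE x in lborel. norm (f (a n *\<^sub>R x) * complex_of_real (exp (- (norm x)\<^sup>2 / 2))) \<le> C * exp (- (norm x)\<^sup>2 / 2)" for n
      using bdd by (auto simp: norm_mult intro!: mult_right_mono)
  qed measurable
  then have "(\<lambda>n. LINT \<xi>|lborel. fourier f \<xi> * complex_of_real (exp (- (a n)\<^sup>2 * (norm \<xi>)\<^sup>2 / 2)))
     \<longlonglongrightarrow> (LINT x|lborel. f 0 * complex_of_real (exp (- (norm (x::'a))\<^sup>2 / 2)))"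
    unfolding eq .
  from LIMSEQ_unique[OF lim1 this]
  show ?thesis
    by (simp only: integral_mult_right_zero integral_complex_of_real integral_gaussian_normalized mult.commute)
qed

text \<open>Inversion at \<open>x\<close> is inversion at 0 for the translate of \<open>f\<close> by
  \<open>- x\<close>: the translation produces precisely the character that the outer transform
  carries.\<close>

theorem fourier_inversion:
  fixes f :: "'a::euclidean_space \<Rightarrow> complex"
  assumes f: "f \<in> schwartz"
  shows "fourier (fourier f) x = f (- x)"
proof -
  let ?g = "\<lambda>y. f (- x + y)"
  have m: "f \<in> borel_measurable borel" using f by (rule schwartz_measurable)
  have cont: "continuous_on UNIV f" using f by (intro smooth_continuous_on schwartz_smooth)
  obtain C where C: "\<And>y. norm (f y) \<le> C" using rapid_bounded[OF schwartz_rapid[OF f]] by blast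
  have g: "fourier ?g = (\<lambda>\<xi>. exp (- \<i> * complex_of_real (x \<bullet> \<xi>)) * fourier f \<xi>)"
    using fourier_shift[OF m, of "- x"] by (simp add: fun_eq_iff inner_commute)
  have "(LINT \<xi>|lborel. fourier ?g \<xi>) = complex_of_real ((2 * pi) powr (real DIM('a) / 2)) * ?g 0"
  proof (rule fourier_inversion_zero)
    show "integrable lborel ?g"
      using f by (intro lborel_integrable_shift schwartz_integrable)
    show "continuous_on UNIV ?g"
      by (intro continuous_on_compose2[OF cont] continuous_intros) auto
    show "integrable lborel (fourier ?g)"
      unfolding g using f by (intro integrable_fourier_kernel schwartz_integrable fourier_schwartz)
  qed (rule C)
  then have "fourier (fourier f) x = complex_of_real ((2 * pi) powr (- real DIM('a) / 2))
      * (complex_of_real ((2 * pi) powr (real DIM('a) / 2)) * f (- x))"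
    unfolding g by (simp add: fourier_def[of "fourier f"])
  then show ?thesis
    by (simp add: powr_minus)
qed

lemma cnj_measurable [measurable]: "f \<in> borel_measurable M \<Longrightarrow> (\<lambda>x. cnj (f x)) \<in> borel_measurable M"
  by (rule measurable_compose[of f M borel cnj])
     (auto intro: borel_measurable_continuous_onI continuous_intros)

text \<open>The Gaussian weight turns the left-hand side into a quadratic form with the kernel
  \<open>\<gamma>(\<xi> - \<eta>)\<close>, to which the Schur test applies.\<close>

lemma gaussian_plancherel:
  fixes g :: "'a::euclidean_space \<Rightarrow> complex"
  assumes g: "integrable lborel g" and g2: "integrable lborel (\<lambda>\<xi>. (norm (g \<xi>))\<^sup>2)" and a: "a > 0"
  shows "integrable lborel (\<lambda>x. (norm (fourier g x))\<^sup>2 * exp (- a * (norm x)\<^sup>2 / 2))"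
    and "(LINT x|lborel. (norm (fourier g x))\<^sup>2 * exp (- a * (norm x)\<^sup>2 / 2)) \<le> (LINT \<xi>|lborel. (norm (g \<xi>))\<^sup>2)"
proof -
  let ?n = "real DIM('a)"
  let ?G = "\<lambda>x::'a. exp (- a * (norm x)\<^sup>2 / 2)"
  let ?H = "\<lambda>\<xi>::'a. a powr (- ?n / 2) * exp (- (norm \<xi>)\<^sup>2 / (2 * a))"
  let ?c = "(2 * pi) powr (- ?n / 2)"
  let ?e = "\<lambda>x y :: 'a. exp (- \<i> * complex_of_real (x \<bullet> y))"
  have mg [measurable]: "g \<in> borel_measurable borel"
    using borel_measurable_integrable[OF g] by simp
  have G: "integrable lborel ?G" by (rule integrable_gaussian[OF a])
  obtain B where B: "\<And>x. norm (fourier g x) \<le> B" using norm_fourier_le by blast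
  show int: "integrable lborel (\<lambda>x. (norm (fourier g x))\<^sup>2 * ?G x)"
  proof (rule Bochner_Integration.integrable_bound)
    show "integrable lborel (\<lambda>x. B\<^sup>2 * ?G x)" using G by simp
    show "AE x in lborel. norm ((norm (fourier g x))\<^sup>2 * ?G x) \<le> norm (B\<^sup>2 * ?G x)"
      using B by (auto intro!: power_mono)
  qed measurable
  have cg: "integrable lborel (\<lambda>x. cnj (fourier g x) * complex_of_real (?G x))"
  proof (rule Bochner_Integration.integrable_bound)
    show "integrable lborel (\<lambda>x. B * ?G x)" using G by simp
    show "AE x in lborel. norm (cnj (fourier g x) * complex_of_real (?G x)) \<le> norm (B * ?G x)"
    proof (rule AE_I2)
      fix x
      have "norm (fourier g x) * ?G x \<le> B * ?G x"
        by (intro mult_right_mono B) simp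
      then show "norm (cnj (fourier g x) * complex_of_real (?G x)) \<le> norm (B * ?G x)"
        unfolding norm_mult complex_mod_cnj norm_of_real abs_exp_cancel
        by (simp only: real_norm_def abs_mult[symmetric] abs_exp_cancel) (rule mult_right_mono; auto intro: order_trans[OF B])
    qed
  qed measurable
  \<comment> \<open>A multiplication by the Gaussian becomes a convolution with its transform
    \<open>?H\<close>. This is derived directly: Fubini, then the known Gaussian integral at the
    frequency \<open>\<xi> - \<eta>\<close>.\<close>
  have F: "fourier (\<lambda>x. cnj (fourier g x) * complex_of_real (?G x)) \<xi>
      = ?c * (LINT \<eta>|lborel. cnj (g \<eta>) * complex_of_real (?H (\<xi> - \<eta>)))" for \<xi>
  proof -
    have eke: "cnj (?e x \<eta>) * ?e \<xi> x = ?e (\<xi> - \<eta>) x" for x \<eta>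
      unfolding exp_cnj exp_add[symmetric]
      by (rule arg_cong[where f = exp]) (simp add: inner_diff_left inner_commute algebra_simps)
    have "cnj (fourier g x) = complex_of_real ?c * (LINT \<eta>|lborel. cnj (?e x \<eta>) * cnj (g \<eta>))" for x
      unfolding fourier_def complex_cnj_mult complex_cnj_complex_of_real
      by (simp only: Bochner_Integration.integral_cnj[symmetric] complex_cnj_mult)
    then have "?e \<xi> x * (cnj (fourier g x) * complex_of_real (?G x)) = complex_of_real ?c *
       (LINT \<eta>|lborel. cnj (g \<eta>) * (cnj (?e x \<eta>) * ?e \<xi> x * complex_of_real (?G x)))" for x
      by (simp only: integral_mult_right_zero[symmetric] integral_mult_left_zero[symmetric] mult_ac)
    then have "fourier (\<lambda>x. cnj (fourier g x) * complex_of_real (?G x)) \<xi> = complex_of_real ?c *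
      (LINT x|lborel. complex_of_real ?c * (LINT \<eta>|lborel. cnj (g \<eta>) * (cnj (?e x \<eta>) * ?e \<xi> x * complex_of_real (?G x))))"
      by (simp only: fourier_def[of "\<lambda>x. cnj (fourier g x) * complex_of_real (?G x)"])
    also have "(LINT x|lborel. complex_of_real ?c * (LINT \<eta>|lborel. cnj (g \<eta>) * (cnj (?e x \<eta>) * ?e \<xi> x * complex_of_real (?G x))))
       = complex_of_real ?c * (LINT x|lborel. (LINT \<eta>|lborel. cnj (g \<eta>) * (cnj (?e x \<eta>) * ?e \<xi> x * complex_of_real (?G x))))"
      by (rule integral_mult_right_zero)
    also have "(LINT x|lborel. (LINT \<eta>|lborel. cnj (g \<eta>) * (cnj (?e x \<eta>) * ?e \<xi> x * complex_of_real (?G x))))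
       = (LINT \<eta>|lborel. (LINT x|lborel. cnj (g \<eta>) * (cnj (?e x \<eta>) * ?e \<xi> x * complex_of_real (?G x))))"
    proof (rule lborel_pair.Fubini_integral)
      show "integrable (lborel \<Otimes>\<^sub>M lborel) (\<lambda>(\<eta>, x). cnj (g \<eta>) * (cnj (?e x \<eta>) * ?e \<xi> x * complex_of_real (?G x)))"
      proof (rule Bochner_Integration.integrable_bound)
        show "integrable (lborel \<Otimes>\<^sub>M lborel) (\<lambda>(\<eta>, x). g \<eta> * complex_of_real (?G x))"
          by (rule integrable_prod_product[OF g integrable_of_real[OF G]])
        show "AE z in lborel \<Otimes>\<^sub>M lborel. norm (case z of (\<eta>, x) \<Rightarrow> cnj (g \<eta>) * (cnj (?e x \<eta>) * ?e \<xi> x * complex_of_real (?G x)))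
          \<le> norm (case z of (\<eta>, x) \<Rightarrow> g \<eta> * complex_of_real (?G x))"
          by (rule AE_I2) (simp only: case_prod_beta norm_mult complex_mod_cnj fourier_kernel_norm mult_1_left order_refl)
        show "(\<lambda>(\<eta>, x). cnj (g \<eta>) * (cnj (?e x \<eta>) * ?e \<xi> x * complex_of_real (?G x)))
          \<in> borel_measurable (lborel \<Otimes>\<^sub>M lborel)"
          by measurable
      qed
    qed
    also have "\<dots> = (LINT \<eta>|lborel. cnj (g \<eta>) * (LINT x|lborel. ?e (\<xi> - \<eta>) x * complex_of_real (?G x)))"
      by (simp only: eke integral_mult_right_zero)
    also have "complex_of_real ?c * \<dots> = (LINT \<eta>|lborel. cnj (g \<eta>) * complex_of_real (?H (\<xi> - \<eta>)))"
    proof -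
      have fg: "complex_of_real (?H \<zeta>) = complex_of_real ?c * (LINT x|lborel. ?e \<zeta> x * complex_of_real (?G x))" for \<zeta>
        using fourier_gaussian_scaled[OF a, of \<zeta>] by (simp only: fourier_def)
      show ?thesis
        unfolding fg
        by (subst integral_mult_right_zero[symmetric])
           (intro Bochner_Integration.integral_cong refl mult.left_commute)
    qed
    finally show ?thesis .
  qed
  have H: "integrable lborel ?H"
    using integrable_gaussian[of "1 / a", where 'a='a] a by (simp add: field_simps)
  \<comment> \<open>The mass of the kernel is the reciprocal of the normalizing constant
    \<open>?c\<close>; this is why the Schur test yields the constant 1.\<close>
  have intH: "(LINT \<xi>|lborel. ?H \<xi>) = 1 / ?c"
  proof -
    have "(LINT \<xi>|lborel. ?H \<xi>) = a powr (- ?n / 2) * (LINT \<xi>|lborel. exp (- (1 / a) * (norm (\<xi>::'a))\<^sup>2 / 2))"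
      by (simp add: mult.commute[of a 2])
    also have "complex_of_real (LINT \<xi>|lborel. exp (- (1 / a) * (norm (\<xi>::'a))\<^sup>2 / 2))
      = complex_of_real ((2 * pi / (1 / a)) powr (?n / 2))"
      using gaussian_fourier_integral[of "1 / a" "0::'a"] a by (simp flip: integral_complex_of_real)
    then have "(LINT \<xi>|lborel. exp (- (1 / a) * (norm (\<xi>::'a))\<^sup>2 / 2)) = (2 * pi * a) powr (?n / 2)"
      by (simp only: of_real_eq_iff) simp
    also have "a powr (- ?n / 2) * (2 * pi * a) powr (?n / 2) = 1 / ?c"
      using a by (simp add: powr_mult powr_minus field_simps)
    finally show ?thesis .
  qed
  have "complex_of_real (LINT x|lborel. (norm (fourier g x))\<^sup>2 * ?G x)
    = (LINT x|lborel. fourier g x * (cnj (fourier g x) * complex_of_real (?G x)))"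
    unfolding integral_complex_of_real[symmetric]
    by (intro Bochner_Integration.integral_cong refl) (simp add: complex_norm_square[symmetric] mult.assoc[symmetric])
  also have "\<dots> = (LINT \<xi>|lborel. g \<xi> * (?c * (LINT \<eta>|lborel. cnj (g \<eta>) * complex_of_real (?H (\<xi> - \<eta>)))))"
    using fourier_swap(2)[OF g cg] unfolding F .
  finally have eq: "complex_of_real (LINT x|lborel. (norm (fourier g x))\<^sup>2 * ?G x)
     = (LINT \<xi>|lborel. g \<xi> * (?c * (LINT \<eta>|lborel. cnj (g \<eta>) * complex_of_real (?H (\<xi> - \<eta>)))))" .
  define H where "H = ?H"
  have Hnn: "0 \<le> H \<xi>" and Hm: "H (- \<xi>) = H \<xi>" for \<xi> by (simp_all add: H_def)
  have [measurable]: "H \<in> borel_measurable borel" unfolding H_def by measurable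
  have eq': "complex_of_real (LINT x|lborel. (norm (fourier g x))\<^sup>2 * ?G x)
     = (LINT \<xi>|lborel. g \<xi> * (?c * (LINT \<eta>|lborel. cnj (g \<eta>) * complex_of_real (H (\<xi> - \<eta>)))))"
    using eq by (simp only: H_def)
  have sH: "(LINT \<eta>|lborel. H (\<eta> - \<xi>)) = 1 / ?c" for \<xi>
  proof -
    have "(LINT \<eta>|lborel. H (- \<xi> + \<eta>)) = (LINT \<eta>|lborel. H \<eta>)"
      by (rule lborel_integral_shift) measurable
    then show ?thesis by (simp only: uminus_add_conv_diff intH[folded H_def] intH H_def)
  qed
  have sH': "integrable lborel (\<lambda>\<eta>. H (\<eta> - \<xi>))" for \<xi>
    using lborel_integrable_shift[OF H[folded H_def], of "- \<xi>"] by (simp only: uminus_add_conv_diff)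
  have intp: "integrable (lborel \<Otimes>\<^sub>M lborel) (\<lambda>(\<xi>, \<eta>). (norm (g \<xi>))\<^sup>2 * H (\<eta> - \<xi>))"
  proof (rule lborel_pair.Fubini_integrable)
    show "integrable lborel (\<lambda>\<xi>. LINT \<eta>|lborel. norm (case (\<xi>, \<eta>) of (\<xi>, \<eta>) \<Rightarrow> (norm (g \<xi>))\<^sup>2 * H (\<eta> - \<xi>)))"
    proof -
      have "norm (case (\<xi>, \<eta>) of (\<xi>, \<eta>) \<Rightarrow> (norm (g \<xi>))\<^sup>2 * H (\<eta> - \<xi>)) = (norm (g \<xi>))\<^sup>2 * H (\<eta> - \<xi>)" for \<xi> \<eta>
        by (simp add: Hnn)
      then show ?thesis
        using g2 by (simp only: integral_mult_right_zero sH integrable_mult_left)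
    qed
    show "AE \<xi> in lborel. integrable lborel (\<lambda>\<eta>. case (\<xi>, \<eta>) of (\<xi>, \<eta>) \<Rightarrow> (norm (g \<xi>))\<^sup>2 * H (\<eta> - \<xi>))"
      by (intro AE_I2) (simp only: case_prod_conv integrable_mult_right sH')
  qed measurable
  have valp: "(LINT z|(lborel \<Otimes>\<^sub>M lborel). (case z of (\<xi>, \<eta>) \<Rightarrow> (norm (g \<xi>))\<^sup>2 * H (\<eta> - \<xi>)))
      = (LINT \<xi>|lborel. (norm (g \<xi>))\<^sup>2) * (1 / ?c)"
    unfolding lborel_pair.integral_fst'[OF intp, symmetric] case_prod_conv integral_mult_right_zero sH
    by (rule integral_mult_left_zero)
  have intq: "integrable (lborel \<Otimes>\<^sub>M lborel) (\<lambda>(\<xi>, \<eta>). (norm (g \<eta>))\<^sup>2 * H (\<xi> - \<eta>))"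
    using lborel_pair.integrable_product_swap[OF intp] by simp
  have valq: "(LINT z|(lborel \<Otimes>\<^sub>M lborel). (case z of (\<xi>, \<eta>) \<Rightarrow> (norm (g \<eta>))\<^sup>2 * H (\<xi> - \<eta>)))
      = (LINT \<xi>|lborel. (norm (g \<xi>))\<^sup>2) * (1 / ?c)"
    using lborel_pair.integral_product_swap[OF borel_measurable_integrable[OF intp]] valp by simp
  let ?K = "\<lambda>z. g (fst z) * (cnj (g (snd z)) * complex_of_real (H (fst z - snd z)))"
  let ?Q = "\<lambda>z. (1/2) * (case z of (\<xi>, \<eta>) \<Rightarrow> (norm (g \<xi>))\<^sup>2 * H (\<eta> - \<xi>))
    + (1/2) * (case z of (\<xi>, \<eta>) \<Rightarrow> (norm (g \<eta>))\<^sup>2 * H (\<xi> - \<eta>))"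
  have Q: "integrable (lborel \<Otimes>\<^sub>M lborel) ?Q"
    by (intro Bochner_Integration.integrable_add integrable_mult_right intp intq)
  \<comment> \<open>The Schur test in elementary form: the product of the two values is at most half
    the sum of their squares, and by \<open>valp\<close> and \<open>valq\<close> both halves
    integrate to the same value.\<close>
  have KQ: "norm (?K z) \<le> ?Q z" for z
  proof (cases z)
    case (Pair \<xi> \<eta>)
    have "norm (g \<xi>) * norm (g \<eta>) \<le> (1/2) * (norm (g \<xi>))\<^sup>2 + (1/2) * (norm (g \<eta>))\<^sup>2"
      using zero_le_power2[of "norm (g \<xi>) - norm (g \<eta>)"] by (simp add: power2_eq_square algebra_simps)
    then have "norm (g \<xi>) * norm (g \<eta>) * H (\<xi> - \<eta>) \<le> ((1/2) * (norm (g \<xi>))\<^sup>2 + (1/2) * (norm (g \<eta>))\<^sup>2) * H (\<xi> - \<eta>)"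
      by (intro mult_right_mono Hnn)
    then show ?thesis
      using Hm[of "\<xi> - \<eta>"] by (simp add: Pair norm_mult Hnn distrib_right mult.assoc)
  qed
  have K: "integrable (lborel \<Otimes>\<^sub>M lborel) ?K"
  proof (rule Bochner_Integration.integrable_bound[OF Q])
    show "AE z in lborel \<Otimes>\<^sub>M lborel. norm (?K z) \<le> norm (?Q z)"
      unfolding real_norm_def by (intro AE_I2 order_trans[OF KQ abs_ge_self])
  qed measurable
  have "(LINT \<xi>|lborel. g \<xi> * (?c * (LINT \<eta>|lborel. cnj (g \<eta>) * complex_of_real (H (\<xi> - \<eta>)))))
     = ?c * (LINT \<xi>|lborel. LINT \<eta>|lborel. ?K (\<xi>, \<eta>))"
    unfolding integral_mult_right_zero[symmetric]
    by (intro Bochner_Integration.integral_cong refl) (simp only: mult_ac fst_conv snd_conv)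
  also have "\<dots> = ?c * (LINT z|(lborel \<Otimes>\<^sub>M lborel). ?K z)"
    by (simp only: lborel_pair.integral_fst'[OF K])
  finally have "norm (complex_of_real (LINT x|lborel. (norm (fourier g x))\<^sup>2 * ?G x))
      = ?c * norm (LINT z|(lborel \<Otimes>\<^sub>M lborel). ?K z)"
    unfolding eq' by (simp add: norm_mult)
  also have "\<dots> \<le> ?c * (LINT z|(lborel \<Otimes>\<^sub>M lborel). ?Q z)"
    by (intro mult_left_mono Bochner_Integration.integral_norm_bound_integral K Q KQ) simp
  also have "(LINT z|(lborel \<Otimes>\<^sub>M lborel). ?Q z) = (LINT \<xi>|lborel. (norm (g \<xi>))\<^sup>2) * (1 / ?c)"
    by (subst Bochner_Integration.integral_add)
       (simp_all only: integral_mult_right_zero valp valq integrable_mult_right intp intq)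
  also have "?c * \<dots> = (LINT \<xi>|lborel. (norm (g \<xi>))\<^sup>2)" by simp
  finally show "(LINT x|lborel. (norm (fourier g x))\<^sup>2 * ?G x) \<le> (LINT \<xi>|lborel. (norm (g \<xi>))\<^sup>2)"
    by simp
qed

text \<open>Fatou's lemma removes the Gaussian weight: the weights tend to 1 and the bound of
  \<open>gaussian_plancherel\<close> does not depend on their width.\<close>

theorem plancherel_le:
  fixes g :: "'a::euclidean_space \<Rightarrow> complex"
  assumes g: "integrable lborel g" and g2: "integrable lborel (\<lambda>\<xi>. (norm (g \<xi>))\<^sup>2)"
  shows "integrable lborel (\<lambda>x. (norm (fourier g x))\<^sup>2)"
    and "(LINT x|lborel. (norm (fourier g x))\<^sup>2) \<le> (LINT \<xi>|lborel. (norm (g \<xi>))\<^sup>2)"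
proof -
  define a where "a = (\<lambda>n. 1 / real (Suc n))"
  have a: "a n > 0" for n by (simp add: a_def)
  have a0: "a \<longlonglongrightarrow> 0" unfolding a_def by (rule lim_inverse_n'[THEN LIMSEQ_Suc])
  have [measurable]: "g \<in> borel_measurable borel"
    using borel_measurable_integrable[OF g] by simp
  let ?B = "LINT \<xi>|lborel. (norm (g \<xi>))\<^sup>2"
  have B: "0 \<le> ?B" by simp
  let ?F = "\<lambda>n x. ennreal ((norm (fourier g x))\<^sup>2 * exp (- a n * (norm x)\<^sup>2 / 2))"
  have "(\<integral>\<^sup>+x. ennreal ((norm (fourier g x))\<^sup>2) \<partial>lborel) = (\<integral>\<^sup>+x. liminf (\<lambda>n. ?F n x) \<partial>lborel)"
  proof (intro nn_integral_cong)
    fix x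
    have "(\<lambda>n. (norm (fourier g x))\<^sup>2 * exp (- a n * (norm x)\<^sup>2 / 2)) \<longlonglongrightarrow> (norm (fourier g x))\<^sup>2 * exp (- 0 * (norm x)\<^sup>2 / 2)"
      by (intro tendsto_intros a0) auto
    then have "(\<lambda>n. ?F n x) \<longlonglongrightarrow> ennreal ((norm (fourier g x))\<^sup>2)"
      by (intro tendsto_ennrealI) simp
    then show "ennreal ((norm (fourier g x))\<^sup>2) = liminf (\<lambda>n. ?F n x)"
      by (intro lim_imp_Liminf[symmetric]) auto
  qed
  also have "\<dots> \<le> liminf (\<lambda>n. \<integral>\<^sup>+x. ?F n x \<partial>lborel)"
    by (rule nn_integral_liminf) measurable
  also have "\<dots> \<le> liminf (\<lambda>n::nat. ennreal ?B)"
  proof (rule Liminf_mono, rule always_eventually, rule allI)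
    fix n
    have "(\<integral>\<^sup>+x. ?F n x \<partial>lborel) = ennreal (LINT x|lborel. (norm (fourier g x))\<^sup>2 * exp (- a n * (norm x)\<^sup>2 / 2))"
      by (rule nn_integral_eq_integral[OF gaussian_plancherel(1)[OF g g2 a]]) simp
    also have "\<dots> \<le> ennreal ?B"
      by (rule ennreal_leI[OF gaussian_plancherel(2)[OF g g2 a]])
    finally show "(\<integral>\<^sup>+x. ?F n x \<partial>lborel) \<le> ennreal ?B" .
  qed
  also have "\<dots> = ennreal ?B" by (simp add: Liminf_const)
  finally have le: "(\<integral>\<^sup>+x. ennreal ((norm (fourier g x))\<^sup>2) \<partial>lborel) \<le> ennreal ?B" .
  show int: "integrable lborel (\<lambda>x. (norm (fourier g x))\<^sup>2)"
    using le by (intro integrableI_bounded) (auto intro: le_less_trans)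
  have "ennreal (LINT x|lborel. (norm (fourier g x))\<^sup>2) \<le> ennreal ?B"
    using le nn_integral_eq_integral[OF int] by simp
  then show "(LINT x|lborel. (norm (fourier g x))\<^sup>2) \<le> ?B"
    using B by (simp only: ennreal_le_iff)
qed

section \<open>Test functions\<close>

text \<open>A single term of the exponential series. It supplies every comparison of a power with an
  exponential below.\<close>

lemma power_le_exp:
  fixes y :: real
  assumes "0 \<le> y"
  shows "y ^ k \<le> fact k * exp y"
proof -
  have s: "(\<lambda>n. y ^ n /\<^sub>R fact n) sums exp y" by (rule exp_converges)
  have "sum (\<lambda>n. y ^ n /\<^sub>R fact n) {k} \<le> (\<Sum>n. y ^ n /\<^sub>R fact n)"
    using assms by (intro sum_le_suminf sums_summable[OF s]) auto
  then have "sum (\<lambda>n. y ^ n /\<^sub>R fact n) {k} \<le> exp y"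
    by (simp only: sums_unique[OF s, symmetric])
  then show ?thesis by (simp add: field_simps)
qed

text \<open>The case \<open>n = 0\<close> is the classical smooth function \<open>exp (- e / x)\<close> extended by zero; the powers
  make the family closed under differentiation.\<close>

definition cutoff :: "real \<Rightarrow> nat \<Rightarrow> real \<Rightarrow> real" where
  "cutoff e n x = (if x > 0 then exp (- e / x) / x ^ n else 0)"

lemma cutoff_nonneg: "0 \<le> cutoff e n x"
  by (simp add: cutoff_def)

text \<open>Flatness at the origin. The quadratic bound feeds
  \<open>has_derivative_quadratic\<close>, so every member of the family has derivative 0 at 0,
  whatever the power in its denominator.\<close>

lemma cutoff_le_square:
  assumes "e > 0"
  shows "cutoff e n x \<le> fact (n + 2) / e ^ (n + 2) * x\<^sup>2"
proof (cases "x > 0")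
  case True
  have "(e / x) ^ (n + 2) \<le> fact (n + 2) * exp (e / x)"
    using assms True by (intro power_le_exp) auto
  then have "exp (- e / x) / x ^ n \<le> fact (n + 2) / e ^ (n + 2) * x\<^sup>2"
    using assms True by (simp add: exp_minus field_simps power_add power2_eq_square)
  then show ?thesis using True by (simp add: cutoff_def)
qed (use assms in \<open>auto simp: cutoff_def\<close>)

lemma cutoff_has_derivative:
  assumes e: "e > 0"
  shows "(cutoff e n has_real_derivative (- real n * cutoff e (n + 1) x + e * cutoff e (n + 2) x)) (at x)"
proof -
  consider "x > 0" | "x < 0" | "x = 0" by linarith
  then show ?thesis
  proof cases
    case 1
    have "((\<lambda>x. exp (- e * inverse x) * inverse x ^ n) has_real_derivative
        (- real n * cutoff e (n + 1) x + e * cutoff e (n + 2) x)) (at x)"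
    proof -
      have "((\<lambda>x. inverse x ^ n) has_real_derivative (- real n * inverse x ^ (n + 1))) (at x)"
      proof (induction n)
        case (Suc n)
        have "(inverse has_real_derivative - (inverse x ^ Suc (Suc 0))) (at x)"
          using 1 by (intro DERIV_inverse) simp
        from DERIV_mult[OF this Suc.IH]
        have "((\<lambda>x. inverse x * inverse x ^ n) has_real_derivative
           (- (inverse x ^ Suc (Suc 0)) * inverse x ^ n + - real n * inverse x ^ (n + 1) * inverse x)) (at x)" .
        then show ?case by (simp add: algebra_simps)
      qed simp
      moreover have "((\<lambda>x. exp (- e * inverse x)) has_real_derivative (e * exp (- e * inverse x) * inverse x ^ 2)) (at x)"
        using 1 by (auto intro!: derivative_eq_intros simp: power2_eq_square)
      ultimately have "((\<lambda>x. exp (- e * inverse x) * inverse x ^ n) has_real_derivative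
        ((e * exp (- e * inverse x) * inverse x ^ 2) * inverse x ^ n
          + (- real n * inverse x ^ (n + 1)) * exp (- e * inverse x))) (at x)"
        by (rule DERIV_mult[rotated])
      then show ?thesis
        using 1 by (simp add: cutoff_def divide_inverse power_inverse algebra_simps power2_eq_square)
    qed
    then show ?thesis
      by (rule has_field_derivative_transform_within_open[of _ _ _ "{0<..}"]) (use 1 in \<open>auto simp: cutoff_def divide_inverse power_inverse\<close>)
  next
    case 2
    have "((\<lambda>x. 0) has_real_derivative (- real n * cutoff e (n + 1) x + e * cutoff e (n + 2) x)) (at x)"
      using 2 by (simp add: cutoff_def)
    then show ?thesis
      by (rule has_field_derivative_transform_within_open[of _ _ _ "{..<0}"]) (use 2 in \<open>auto simp: cutoff_def\<close>)
  next
    case 3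
    have "(cutoff e n has_derivative (\<lambda>h. 0)) (at 0)"
    proof (rule has_derivative_quadratic)
      fix v
      show "norm (cutoff e n (0 + v) - cutoff e n 0 - 0) \<le> fact (n + 2) / e ^ (n + 2) * (norm v)\<^sup>2"
        using cutoff_le_square[OF e, of n v] cutoff_nonneg[of e n v] by (simp add: cutoff_def[of _ _ 0])
    qed auto
    then have "(cutoff e n has_real_derivative 0) (at 0)"
      by (simp add: has_field_derivative_def lambda_zero)
    then show ?thesis using 3 by (simp add: cutoff_def[of _ _ 0])
  qed
qed

text \<open>The invariant for \<open>smooth_coinduct\<close>. Differentiating a cutoff along an
  affine function raises the index \<open>n\<close> and produces constants, and the product rule
  needs sums and products; these four rules close the set.\<close>

inductive_set cutoff_algebra :: "real \<Rightarrow> ('a::euclidean_space \<Rightarrow> complex) set" for e where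
  const: "(\<lambda>x. c) \<in> cutoff_algebra e"
| cutoff: "(\<lambda>x. complex_of_real (cutoff e n (x \<bullet> v + \<beta>))) \<in> cutoff_algebra e"
| add: "f \<in> cutoff_algebra e \<Longrightarrow> g \<in> cutoff_algebra e \<Longrightarrow> (\<lambda>x. f x + g x) \<in> cutoff_algebra e"
| mult: "f \<in> cutoff_algebra e \<Longrightarrow> g \<in> cutoff_algebra e \<Longrightarrow> (\<lambda>x. f x * g x) \<in> cutoff_algebra e"

lemma cutoff_affine_has_derivative:
  fixes x v :: "'a::euclidean_space"
  assumes "e > 0"
  shows "((\<lambda>x. complex_of_real (cutoff e n (x \<bullet> v + \<beta>))) has_derivative (\<lambda>h. complex_of_real
    ((h \<bullet> v) * (- real n * cutoff e (n + 1) (x \<bullet> v + \<beta>) + e * cutoff e (n + 2) (x \<bullet> v + \<beta>))))) (at x)"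
proof -
  have "((\<lambda>x. x \<bullet> v + \<beta>) has_derivative (\<lambda>h. h \<bullet> v)) (at x)"
    by (auto intro!: derivative_eq_intros)
  from has_derivative_compose[OF this cutoff_has_derivative[OF assms, unfolded has_field_derivative_def]]
  have "((\<lambda>x. cutoff e n (x \<bullet> v + \<beta>)) has_derivative
     (\<lambda>h. (h \<bullet> v) * (- real n * cutoff e (n + 1) (x \<bullet> v + \<beta>) + e * cutoff e (n + 2) (x \<bullet> v + \<beta>)))) (at x)"
    by (simp add: mult.commute)
  then show ?thesis
    by (rule has_derivative_of_real)
qed

lemma cutoff_algebra_deriv:
  fixes f :: "'a::euclidean_space \<Rightarrow> complex"
  assumes e: "e > 0" and f: "f \<in> cutoff_algebra e"
  shows "(\<forall>x. f differentiable (at x)) \<and> partial_deriv b f \<in> cutoff_algebra e"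
  using f
proof induction
  case (const c)
  have "partial_deriv b (\<lambda>x::'a. c) = (\<lambda>x. 0)"
    by (auto simp: fun_eq_iff intro!: partial_deriv_eq[THEN trans] has_derivative_const)
  then show ?case using cutoff_algebra.const[of 0 e] by simp
next
  case (cutoff n v \<beta>)
  have "partial_deriv b (\<lambda>x::'a. complex_of_real (cutoff e n (x \<bullet> v + \<beta>))) = (\<lambda>x.
     complex_of_real (- (b \<bullet> v) * real n) * complex_of_real (cutoff e (n + 1) (x \<bullet> v + \<beta>))
      + complex_of_real ((b \<bullet> v) * e) * complex_of_real (cutoff e (n + 2) (x \<bullet> v + \<beta>)))"
    unfolding partial_deriv_eq[OF cutoff_affine_has_derivative[OF e]] fun_eq_iff
    by (simp add: algebra_simps)
  then have "partial_deriv b (\<lambda>x::'a. complex_of_real (cutoff e n (x \<bullet> v + \<beta>))) \<in> cutoff_algebra e"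
    by (simp only:) (intro cutoff_algebra.intros)
  then show ?case
    using cutoff_affine_has_derivative[OF e] differentiable_def by blast
next
  case (add f g)
  have "partial_deriv b (\<lambda>x. f x + g x) = (\<lambda>x. partial_deriv b f x + partial_deriv b g x)"
    using partial_deriv_lincomb[of f g b 1 1] add by simp
  then show ?case
    using add by (auto intro!: cutoff_algebra.add)
next
  case (mult f g)
  have "partial_deriv b (\<lambda>x. f x * g x) = (\<lambda>x. f x * partial_deriv b g x + partial_deriv b f x * g x)"
    using partial_deriv_mult mult by blast
  then show ?case
    using mult by (auto intro!: cutoff_algebra.add cutoff_algebra.mult)
qed

lemma cutoff_algebra_smooth: "e > 0 \<Longrightarrow> f \<in> cutoff_algebra e \<Longrightarrow> smooth f"
  using cutoff_algebra_deriv by (intro smooth_coinduct[of f "cutoff_algebra e"]) blast+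

lemma cutoff_algebra_prod:
  "finite A \<Longrightarrow> (\<And>i. i \<in> A \<Longrightarrow> f i \<in> cutoff_algebra e) \<Longrightarrow> (\<lambda>x. \<Prod>i\<in>A. f i x) \<in> cutoff_algebra e"
  by (induction rule: finite_induct) (auto intro!: cutoff_algebra.const cutoff_algebra.mult)

text \<open>One pair of one-sided cutoffs per coordinate, so the function is positive exactly on
  \<open>box a c\<close>. The parameter \<open>e\<close> is kept because the bumps tend to the
  indicator of the box as \<open>e\<close> tends to 0.\<close>

definition bump :: "real \<Rightarrow> 'a::euclidean_space \<Rightarrow> 'a \<Rightarrow> 'a \<Rightarrow> real" where
  "bump e a c x = (\<Prod>b\<in>Basis. cutoff e 0 (x \<bullet> b - a \<bullet> b) * cutoff e 0 (c \<bullet> b - x \<bullet> b))"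

lemma bump_cutoff_algebra: "(\<lambda>x. complex_of_real (bump e a c x)) \<in> cutoff_algebra e"
proof -
  have "(\<lambda>x. \<Prod>b\<in>Basis. complex_of_real (cutoff e 0 (x \<bullet> b + (- (a \<bullet> b)))) *
      complex_of_real (cutoff e 0 (x \<bullet> (- b) + c \<bullet> b))) \<in> cutoff_algebra e"
    by (intro cutoff_algebra_prod cutoff_algebra.mult cutoff_algebra.cutoff finite_Basis)
  then show ?thesis by (simp add: bump_def)
qed

lemma bump_nonneg: "0 \<le> bump e a c x"
  unfolding bump_def by (intro prod_nonneg mult_nonneg_nonneg ballI cutoff_nonneg)

lemma bump_le_1: "e > 0 \<Longrightarrow> bump e a c x \<le> 1"
  unfolding bump_def
  by (intro prod_le_1 conjI mult_nonneg_nonneg mult_le_one cutoff_nonneg) (auto simp: cutoff_def)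

lemma bump_pos: "x \<in> box a c \<Longrightarrow> 0 < bump e a c x"
  unfolding bump_def by (intro prod_pos mult_pos_pos) (auto simp: mem_box cutoff_def)

lemma bump_eq_0: "x \<notin> box a c \<Longrightarrow> bump e a c x = 0"
  unfolding bump_def by (intro prod_zero) (auto simp: mem_box cutoff_def)

lemma bump_tendsto_indicator:
  "(\<lambda>n. bump (1 / real (Suc n)) a c x) \<longlonglongrightarrow> indicator (box a c) x"
proof (cases "x \<in> box a c")
  case True
  have lim: "(\<lambda>n. 1 / real (Suc n)) \<longlonglongrightarrow> 0" by (rule lim_inverse_n'[THEN LIMSEQ_Suc])
  have c: "(\<lambda>n. cutoff (1 / real (Suc n)) 0 y) \<longlonglongrightarrow> 1" if "y > 0" for y
  proof -
    have "(\<lambda>n. exp (- (1 / real (Suc n)) / y)) \<longlonglongrightarrow> exp (- 0 / y)"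
      by (intro tendsto_intros lim) (use that in auto)
    then show ?thesis using that by (simp add: cutoff_def)
  qed
  have "(\<lambda>n. bump (1 / real (Suc n)) a c x) \<longlonglongrightarrow> (\<Prod>b\<in>(Basis::'a set). 1 * 1)"
    unfolding bump_def by (intro tendsto_prod tendsto_mult c) (use True in \<open>auto simp: mem_box\<close>)
  then show ?thesis using True by simp
next
  case False
  then show ?thesis by (simp add: bump_eq_0)
qed

section \<open>Test functions and the fundamental lemma of the calculus of variations\<close>

lemma test_funI:
  assumes "smooth f" "compact K" "K \<subseteq> \<Omega>" "\<And>x. x \<notin> K \<Longrightarrow> f x = 0"
  shows "f \<in> test_fun \<Omega>"
proof -
  have "closure {x. f x \<noteq> 0} \<subseteq> K"
    using assms(2,4) by (intro closure_minimal compact_imp_closed) auto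
  then show ?thesis
    using assms compact_Int_closed[OF assms(2) closed_closure, of "{x. f x \<noteq> 0}"] unfolding test_fun_def
    by (auto simp: inf.absorb2)
qed

lemma bump_test_fun:
  assumes "e > 0" "cbox a c \<subseteq> \<Omega>"
  shows "(\<lambda>x. complex_of_real (bump e a c x)) \<in> test_fun \<Omega>"
  using assms box_subset_cbox[of a c]
  by (intro test_funI[where K = "cbox a c"] cutoff_algebra_smooth[OF assms(1)] bump_cutoff_algebra)
     (auto intro!: bump_eq_0)

lemma partial_deriv_local_zero:
  assumes "open U" "x \<in> U" "\<And>y. y \<in> U \<Longrightarrow> f y = 0"
  shows "partial_deriv b f x = 0"
proof -
  have "(f has_derivative (\<lambda>h. 0)) (at x)"
    using assms by (intro has_derivative_transform_within_open[OF has_derivative_const[of 0] assms(1,2)]) auto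
  then show ?thesis by (rule partial_deriv_eq)
qed

lemma partials_local_zero:
  assumes "open U" "\<And>y. y \<in> U \<Longrightarrow> f y = 0"
  shows "x \<in> U \<Longrightarrow> partials bs f x = 0"
  by (induction bs arbitrary: x) (auto simp: assms intro!: partial_deriv_local_zero[OF assms(1)])

lemma continuous_compact_support_bounded:
  fixes f :: "'a::euclidean_space \<Rightarrow> 'b::real_normed_vector"
  assumes "continuous_on UNIV f" "compact K" "\<And>x. x \<notin> K \<Longrightarrow> f x = 0"
  shows "bounded (range f)"
proof -
  have "range f \<subseteq> f ` K \<union> {0}" using assms(3) by auto
  moreover have "compact (f ` K \<union> {0})"
    using assms by (intro compact_Un compact_continuous_image) (auto intro: continuous_on_subset)
  ultimately show ?thesis using bounded_subset compact_imp_bounded by blast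
qed

lemma compact_support_schwartz:
  assumes "smooth f" "compact K" "\<And>x. x \<notin> K \<Longrightarrow> f x = 0"
  shows "f \<in> schwartz"
proof -
  have "bounded (range (\<lambda>x. norm x ^ k *\<^sub>R partials bs f x))" if "set bs \<subseteq> Basis" for k bs
  proof (rule continuous_compact_support_bounded[OF _ assms(2)])
    show "continuous_on UNIV (\<lambda>x. norm x ^ k *\<^sub>R partials bs f x)"
      using smooth_partials[OF assms(1) that] by (intro continuous_intros smooth_continuous_on)
    show "norm x ^ k *\<^sub>R partials bs f x = 0" if "x \<notin> K" for x
      using partials_local_zero[of "- K" f x bs] assms that by (simp add: compact_imp_closed open_Compl)
  qed
  then show ?thesis using assms(1) by (auto simp: schwartz_def)
qed

lemma test_fun_smooth: "f \<in> test_fun \<Omega> \<Longrightarrow> smooth f"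
  by (simp add: test_fun_def)

lemma test_fun_support:
  assumes "f \<in> test_fun \<Omega>"
  obtains K where "compact K" "K \<subseteq> \<Omega>" "\<And>x. x \<notin> K \<Longrightarrow> f x = 0"
proof
  show "compact (closure {x. f x \<noteq> 0})" "closure {x. f x \<noteq> 0} \<subseteq> \<Omega>"
    using assms by (auto simp: test_fun_def)
  show "f x = 0" if "x \<notin> closure {x. f x \<noteq> 0}" for x
    using that closure_subset[of "{x. f x \<noteq> 0}"] by auto
qed

lemma test_fun_schwartz: "f \<in> test_fun \<Omega> \<Longrightarrow> f \<in> schwartz"
  by (meson compact_support_schwartz test_fun_smooth test_fun_support)

lemma test_fun_outside: "f \<in> test_fun \<Omega> \<Longrightarrow> x \<notin> \<Omega> \<Longrightarrow> f x = 0"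
  by (meson subsetD test_fun_support)

lemma test_fun_lincomb:
  assumes "f \<in> test_fun \<Omega>" "g \<in> test_fun \<Omega>"
  shows "(\<lambda>x. c * f x + d * g x) \<in> test_fun \<Omega>"
proof -
  obtain K where K: "compact K" "K \<subseteq> \<Omega>" "\<And>x. x \<notin> K \<Longrightarrow> f x = 0"
    using test_fun_support[OF assms(1)] by blast
  obtain L where L: "compact L" "L \<subseteq> \<Omega>" "\<And>x. x \<notin> L \<Longrightarrow> g x = 0"
    using test_fun_support[OF assms(2)] by blast
  show ?thesis
  proof (rule test_funI[where K = "K \<union> L"])
    show "smooth (\<lambda>x. c * f x + d * g x)"
      using assms by (intro smooth_lincomb test_fun_smooth)
  qed (use K L in \<open>auto simp: compact_Un\<close>)
qed

lemma AE_box_cbox: "AE x in lborel. x \<in> cbox a b \<longrightarrow> x \<in> box a (b::'a::euclidean_space)"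
proof (rule AE_I')
  have "emeasure lborel (cbox a b - box a b) = emeasure lborel (cbox a b) - emeasure lborel (box a b)"
    using emeasure_lborel_box_finite[of a b] by (intro emeasure_Diff) (auto simp: box_subset_cbox)
  also have "\<dots> = 0"
    unfolding emeasure_lborel_box_eq emeasure_lborel_cbox_eq by simp
  finally show "cbox a b - box a b \<in> null_sets lborel"
    by (intro null_setsI) auto
qed auto

text \<open>The bumps of parameter \<open>1 / Suc n\<close> are admissible test functions bounded by
  the indicator of the closed box; dominated convergence passes to the indicator of the open
  one.\<close>

lemma integral_box_zero_if_test_integrals_zero:
  fixes g :: "'a::euclidean_space \<Rightarrow> complex"
  assumes g [measurable]: "g \<in> borel_measurable borel"
    and loc: "set_integrable lborel (cbox a c) g"
    and zero: "\<And>f. f \<in> test_fun (cbox a c) \<Longrightarrow> (LINT x|lborel. g x * f x) = 0"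
  shows "(LINT x|lborel. indicator (box a c) x *\<^sub>R g x) = 0"
proof -
  let ?b = "\<lambda>n x. complex_of_real (bump (1 / real (Suc n)) a c x)"
  have [measurable]: "?b n \<in> borel_measurable borel" for n
    by (rule smooth_measurable[OF cutoff_algebra_smooth[OF _ bump_cutoff_algebra]]) simp
  have "(\<lambda>n. LINT x|lborel. g x * ?b n x) \<longlonglongrightarrow> (LINT x|lborel. g x * complex_of_real (indicator (box a c) x))"
  proof (rule integral_dominated_convergence)
    show "integrable lborel (\<lambda>x. norm (indicator (cbox a c) x *\<^sub>R g x))"
      by (rule integrable_norm[OF loc[unfolded set_integrable_def]])
    show "AE x in lborel. (\<lambda>n. g x * ?b n x) \<longlonglongrightarrow> g x * complex_of_real (indicator (box a c) x)"
      by (intro AE_I2 tendsto_intros bump_tendsto_indicator)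
    show "AE x in lborel. norm (g x * ?b n x) \<le> norm (indicator (cbox a c) x *\<^sub>R g x)" for n
    proof (rule AE_I2)
      fix x
      show "norm (g x * ?b n x) \<le> norm (indicator (cbox a c) x *\<^sub>R g x)"
        using bump_le_1[of "1 / real (Suc n)" a c x] bump_nonneg[of "1 / real (Suc n)" a c x]
          bump_eq_0[of x a c "1 / real (Suc n)"] box_subset_cbox[of a c]
        by (cases "x \<in> box a c") (auto simp: norm_mult mult_left_le)
    qed
  qed measurable
  moreover have "(LINT x|lborel. g x * ?b n x) = 0" for n
    by (intro zero bump_test_fun) auto
  ultimately have "(LINT x|lborel. g x * complex_of_real (indicator (box a c) x)) = 0"
    by (simp add: LIMSEQ_const_iff)
  then show ?thesis by (simp add: scaleR_conv_of_real mult.commute)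
qed

lemma test_fun_mono: "f \<in> test_fun A \<Longrightarrow> A \<subseteq> B \<Longrightarrow> f \<in> test_fun B"
  by (auto simp: test_fun_def)

text \<open>Open boxes form an intersection-stable generator of the Borel sets, so vanishing
  integrals over boxes spread to all Borel subsets of a given box, and a function whose integral
  over every Borel set is zero vanishes almost everywhere. Countably many closed boxes exhaust the
  open set.\<close>

theorem AE_zero_if_test_integrals_zero:
  fixes g :: "'a::euclidean_space \<Rightarrow> complex"
  assumes \<Omega>: "open \<Omega>" and g [measurable]: "g \<in> borel_measurable borel"
    and loc: "\<And>a b. cbox a b \<subseteq> \<Omega> \<Longrightarrow> set_integrable lborel (cbox a b) g"
    and zero: "\<And>f. f \<in> test_fun \<Omega> \<Longrightarrow> (LINT x|lborel. g x * f x) = 0"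
  shows "AE x in lborel. x \<in> \<Omega> \<longrightarrow> g x = 0"
proof -
  have box0: "(LINT x|lborel. indicator (box a b) x *\<^sub>R g x) = 0" if "cbox a b \<subseteq> \<Omega>" for a b
    by (rule integral_box_zero_if_test_integrals_zero[OF g loc[OF that]])
       (rule zero, erule test_fun_mono, rule that)
  have AEc: "AE x in lborel. x \<in> cbox c d \<longrightarrow> g x = 0" if cd: "cbox c d \<subseteq> \<Omega>" for c d
  proof -
    let ?h = "\<lambda>x. indicator (box c d) x *\<^sub>R g x"
    have h: "integrable lborel ?h"
      using set_integrable_subset[OF loc[OF cd], of "box c d"] box_subset_cbox[of c d]
      by (simp add: set_integrable_def)
    have "AE x in lborel. ?h x = 0"
    proof (rule sigma_finite_measure.density_zero[OF lborel.sigma_finite_measure_axioms h])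
      fix A :: "'a set" assume "A \<in> sets lborel"
      then have A: "A \<in> sigma_sets UNIV (range (\<lambda>(a, b). box a b))"
        by (simp add: borel_eq_box)
      have stable: "Int_stable (range (\<lambda>(a, b). box a b :: 'a set))"
        by (auto simp: Int_stable_def box_Int_box)
      have "range (\<lambda>(a, b). box a b :: 'a set) \<subseteq> Pow UNIV" by simp
      from stable this A show "(LINT x:A|lborel. ?h x) = 0"
      proof (induction rule: sigma_sets_induct_disjoint)
        case (basic A)
        then obtain a b where A: "A = box a b" by auto
        \<comment> \<open>The corners of the intersection with \<open>box c d\<close>. Its closed
          version stays inside \<open>cbox c d\<close>, and hence inside \<open>\<Omega>\<close>,
          which is what \<open>box0\<close> asks for.\<close>
        define l u where "l = (\<Sum>i\<in>Basis. max (a\<bullet>i) (c\<bullet>i) *\<^sub>R i)" and "u = (\<Sum>i\<in>Basis. min (b\<bullet>i) (d\<bullet>i) *\<^sub>R i)"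
        have "cbox l u \<subseteq> cbox c d" by (auto simp: mem_box l_def u_def)
        then have "(LINT x|lborel. indicator (box l u) x *\<^sub>R g x) = 0"
          using cd by (intro box0) auto
        moreover have "indicator A x *\<^sub>R ?h x = indicator (box l u) x *\<^sub>R g x" for x
          unfolding A l_def u_def box_Int_box[symmetric] by (simp add: indicator_inter_arith)
        ultimately show ?case by (simp only: set_lebesgue_integral_def)
      next
        case empty
        then show ?case by (simp add: set_lebesgue_integral_def)
      next
        case (compl A)
        then have A: "A \<in> sets lborel" by (simp add: borel_eq_box)
        have "(LINT x:UNIV - A|lborel. ?h x) = (LINT x|lborel. ?h x) - (LINT x:A|lborel. ?h x)"
          unfolding set_lebesgue_integral_def
            Bochner_Integration.integral_diff[OF h integrable_mult_indicator[OF A h], symmetric]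
          by (intro Bochner_Integration.integral_cong) (auto simp: indicator_def)
        then show ?case using compl box0[OF cd] by simp
      next
        case (union A)
        have A: "A i \<in> sets lborel" for i using union(2) by (auto simp: borel_eq_box)
        have "(LINT x:(\<Union>i. A i)|lborel. ?h x) = (\<Sum>i. (LINT x:A i|lborel. ?h x))"
        proof (rule lebesgue_integral_countable_add)
          show "set_integrable lborel (\<Union>i. A i) ?h"
            unfolding set_integrable_def using A by (intro integrable_mult_indicator h) auto
        qed (use A union(1) in \<open>auto simp: disjoint_family_on_def\<close>)
        then show ?case using union(3) by simp
      qed
    qed
    with AE_box_cbox[of c d] show ?thesis by eventually_elim auto
  qed
  obtain D where D: "countable D" "D \<subseteq> Pow \<Omega>" "\<And>X. X \<in> D \<Longrightarrow> \<exists>a b. X = cbox a b" "\<Union>D = \<Omega>"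
    using open_countable_Union_open_cbox[OF \<Omega>] by blast
  have "AE x in lborel. \<forall>X\<in>D. x \<in> X \<longrightarrow> g x = 0"
    using D AEc by (subst AE_ball_countable) (auto, metis PowD subsetD)
  then show ?thesis
    by eventually_elim (use D(4) in auto)
qed

section \<open>Sobolev spaces\<close>

text \<open>The value 0 off \<open>schwartz\<close> is the convention of
  \<open>linear_functional_on\<close>; with it equality of functionals needs to be checked on
  Schwartz functions only.\<close>

definition fun_distr :: "('a::euclidean_space \<Rightarrow> complex) \<Rightarrow> 'a functional" where
  "fun_distr G = (\<lambda>h. if h \<in> schwartz then LINT x|lborel. G x * h x else 0)"

text \<open>The weight \<open>1 + norm x ^ k\<close> is shifted from \<open>G\<close> to the test
  function. The second bound is continuity in quantitative form, as needed for
  \<open>tempered_distributions\<close>.\<close>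

lemma rapid_mult_integrable:
  fixes G :: "'a::euclidean_space \<Rightarrow> complex"
  assumes [measurable]: "G \<in> borel_measurable borel"
    and int: "integrable lborel (\<lambda>x. norm (G x) / (1 + norm x ^ k))"
    and h [measurable]: "h \<in> borel_measurable borel" and C: "\<And>x. (1 + norm x ^ k) * norm (h x) \<le> C"
  shows "integrable lborel (\<lambda>x. G x * h x)"
    and "norm (LINT x|lborel. G x * h x) \<le> C * (LINT x|lborel. norm (G x) / (1 + norm x ^ k))"
proof -
  have le: "norm (G x * h x) \<le> C * (norm (G x) / (1 + norm x ^ k))" for x
  proof -
    have p: "1 + norm x ^ k > 0" by (simp add: add_pos_nonneg)
    have "norm (G x * h x) = norm (G x) / (1 + norm x ^ k) * ((1 + norm x ^ k) * norm (h x))"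
      using p by (simp add: norm_mult)
    also have "\<dots> \<le> norm (G x) / (1 + norm x ^ k) * C"
      using p by (intro mult_left_mono C) auto
    finally show ?thesis by (simp add: mult.commute)
  qed
  have intC: "integrable lborel (\<lambda>x. C * (norm (G x) / (1 + norm x ^ k)))"
    using int by (rule integrable_mult_right)
  show *: "integrable lborel (\<lambda>x. G x * h x)"
    by (rule Bochner_Integration.integrable_bound[OF intC])
       (measurable, intro AE_I2, unfold real_norm_def, rule order_trans[OF le abs_ge_self])
  have "norm (LINT x|lborel. G x * h x) \<le> (LINT x|lborel. C * (norm (G x) / (1 + norm x ^ k)))"
    using le by (intro Bochner_Integration.integral_norm_bound_integral intC *)
  then show "norm (LINT x|lborel. G x * h x) \<le> C * (LINT x|lborel. norm (G x) / (1 + norm x ^ k))"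
    by (simp only: integral_mult_right_zero)
qed

lemma schwartz_mult_integrable:
  fixes G :: "'a::euclidean_space \<Rightarrow> complex"
  assumes "G \<in> borel_measurable borel" "integrable lborel (\<lambda>x. norm (G x) / (1 + norm x ^ k))" "h \<in> schwartz"
  shows "integrable lborel (\<lambda>x. G x * h x)"
proof -
  obtain A B where A: "\<And>x. norm x ^ 0 * norm (h x) \<le> A" and B: "\<And>x. norm x ^ k * norm (h x) \<le> B"
    using schwartz_rapid[OF assms(3)] unfolding rapid_def by meson
  have "(1 + norm x ^ k) * norm (h x) \<le> A + B" for x
    using A[of x] B[of x] by (simp add: algebra_simps)
  then show ?thesis
    by (rule rapid_mult_integrable(1)[OF assms(1,2) schwartz_measurable[OF assms(3)]])
qed

lemma fun_distr_tempered:
  fixes G :: "'a::euclidean_space \<Rightarrow> complex"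
  assumes m: "G \<in> borel_measurable borel"
    and int: "integrable lborel (\<lambda>x. norm (G x) / (1 + norm x ^ k))"
  shows "fun_distr G \<in> tempered_distributions"
proof -
  have lin: "linear_functional_on schwartz (fun_distr G)"
    unfolding linear_functional_on_def
  proof (intro conjI ballI allI impI)
    fix f g :: "'a \<Rightarrow> complex" and a b assume f: "f \<in> schwartz" and g: "g \<in> schwartz"
    have "(LINT x|lborel. G x * (a * f x + b * g x)) = (LINT x|lborel. a * (G x * f x) + b * (G x * g x))"
      by (simp add: algebra_simps)
    also have "\<dots> = a * (LINT x|lborel. G x * f x) + b * (LINT x|lborel. G x * g x)"
      using schwartz_mult_integrable[OF m int f] schwartz_mult_integrable[OF m int g]
      by (subst Bochner_Integration.integral_add) auto
    finally show "fun_distr G (\<lambda>x. a * f x + b * g x) = a * fun_distr G f + b * fun_distr G g"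
      using f g by (simp add: fun_distr_def schwartz_lincomb)
  qed (simp add: fun_distr_def)
  moreover have "(\<lambda>n. fun_distr G (F n)) \<longlonglongrightarrow> fun_distr G f"
    if F: "\<And>n. F n \<in> schwartz" and f: "f \<in> schwartz" and conv: "schwartz_conv F f" for F f
  proof -
    define I where "I = (LINT x|lborel. norm (G x) / (1 + norm x ^ k))"
    have I: "I \<ge> 0" unfolding I_def by (intro Bochner_Integration.integral_nonneg) auto
    have ul: "uniform_limit UNIV (\<lambda>n x. norm x ^ j *\<^sub>R F n x) (\<lambda>x. norm x ^ j *\<^sub>R f x) sequentially" for j
    proof -
      have "uniform_limit UNIV (\<lambda>n x. norm x ^ j *\<^sub>R partials [] (F n) x) (\<lambda>x. norm x ^ j *\<^sub>R partials [] f x) sequentially"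
        using conv unfolding schwartz_conv_def by (metis empty_subsetI list.set(1))
      then show ?thesis by simp
    qed
    show ?thesis
    proof (rule tendstoI)
      fix e :: real assume e: "e > 0"
      \<comment> \<open>Convergence is used for the two powers 0 and \<open>k\<close>, which
        together cost \<open>2 * d\<close>; the 1 added to \<open>I\<close> avoids a division by
        zero and makes the final inequality strict.\<close>
      define d where "d = e / (2 * (I + 1))"
      have d: "d > 0" using e I by (simp add: d_def)
      have "\<forall>\<^sub>F n in sequentially. \<forall>x\<in>UNIV. dist (norm x ^ 0 *\<^sub>R F n x) (norm x ^ 0 *\<^sub>R f x) < d"
        using uniform_limitD[OF ul[of 0] d] .
      moreover have "\<forall>\<^sub>F n in sequentially. \<forall>x\<in>UNIV. dist (norm x ^ k *\<^sub>R F n x) (norm x ^ k *\<^sub>R f x) < d"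
        using uniform_limitD[OF ul[of k] d] .
      ultimately show "\<forall>\<^sub>F n in sequentially. dist (fun_distr G (F n)) (fun_distr G f) < e"
      proof eventually_elim
        case (elim n)
        have le: "(1 + norm x ^ k) * norm (F n x - f x) \<le> 2 * d" for x
        proof -
          have "norm (F n x - f x) < d" using elim(1) by (simp add: dist_norm)
          moreover have "norm x ^ k * norm (F n x - f x) < d"
            using elim(2)[rule_format, of x]
            by (simp add: dist_norm scaleR_diff_right[symmetric] del: scaleR_diff_right)
          ultimately show ?thesis by (simp add: algebra_simps)
        qed
        have h: "(\<lambda>x. F n x - f x) \<in> schwartz" using F f by (intro schwartz_diff)
        have "fun_distr G (F n) - fun_distr G f = (LINT x|lborel. G x * (F n x - f x))"
          using schwartz_mult_integrable[OF m int F[of n]] schwartz_mult_integrable[OF m int f] F f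
          by (simp add: fun_distr_def right_diff_distrib)
        also have "norm \<dots> \<le> 2 * d * I"
          unfolding I_def by (rule rapid_mult_integrable(2)[OF m int schwartz_measurable[OF h] le])
        also have "\<dots> < e"
          using e I by (simp add: d_def field_simps)
        finally show ?case by (simp add: dist_norm)
      qed
    qed
  qed
  ultimately show ?thesis
    by (auto simp: tempered_distributions_def)
qed

text \<open>The common compact support, which the limit inherits, bounds \<open>norm x ^ k\<close>
  by \<open>B ^ k\<close>; off the support both sides vanish. This makes the restriction of a
  tempered distribution continuous on test functions.\<close>

lemma test_conv_schwartz_conv:
  assumes "test_conv \<Omega> F f"
  shows "schwartz_conv F f"
proof -
  obtain C where C: "compact C" "\<And>n x. x \<notin> C \<Longrightarrow> F n x = 0"
    using assms unfolding test_conv_def by blast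
  have ul: "uniform_limit UNIV (\<lambda>n. partials bs (F n)) (partials bs f) sequentially" if "set bs \<subseteq> Basis" for bs
    using assms that unfolding test_conv_def by blast
  have f0: "f x = 0" if "x \<notin> C" for x
  proof -
    have "(\<lambda>n. F n x) \<longlonglongrightarrow> f x"
      using tendsto_uniform_limitI[OF ul[of "[]"], of x] by simp
    then show ?thesis using C(2)[OF that] by (simp add: LIMSEQ_const_iff)
  qed
  have opn: "open (- C)" using C(1) by (simp add: compact_imp_closed open_Compl)
  obtain B where B: "B > 0" "\<And>x. x \<in> C \<Longrightarrow> norm x \<le> B"
    using compact_imp_bounded[OF C(1)] unfolding bounded_pos by blast
  show ?thesis
    unfolding schwartz_conv_def
  proof (intro allI impI)
    fix k and bs :: "'a list" assume bs: "set bs \<subseteq> Basis"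
    show "uniform_limit UNIV (\<lambda>n x. norm x ^ k *\<^sub>R partials bs (F n) x) (\<lambda>x. norm x ^ k *\<^sub>R partials bs f x) sequentially"
    proof (rule uniform_limitI)
      fix e :: real assume e: "e > 0"
      have "e / B ^ k > 0" using e B by simp
      from uniform_limitD[OF ul[OF bs] this]
      show "\<forall>\<^sub>F n in sequentially. \<forall>x\<in>UNIV. dist (norm x ^ k *\<^sub>R partials bs (F n) x) (norm x ^ k *\<^sub>R partials bs f x) < e"
      proof eventually_elim
        case (elim n)
        show ?case
        proof
          fix x :: 'a
          show "dist (norm x ^ k *\<^sub>R partials bs (F n) x) (norm x ^ k *\<^sub>R partials bs f x) < e"
          proof (cases "x \<in> C")
            case True
            have "dist (norm x ^ k *\<^sub>R partials bs (F n) x) (norm x ^ k *\<^sub>R partials bs f x)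
              = norm x ^ k * dist (partials bs (F n) x) (partials bs f x)"
              by (simp add: dist_norm scaleR_diff_right[symmetric] del: scaleR_diff_right)
            also have "\<dots> \<le> B ^ k * dist (partials bs (F n) x) (partials bs f x)"
              using B(2)[OF True] by (intro mult_right_mono power_mono) auto
            also have "\<dots> < B ^ k * (e / B ^ k)"
              using elim B by (intro mult_strict_left_mono) auto
            finally show ?thesis using B by simp
          next
            case False
            have "partials bs (F n) x = 0" "partials bs f x = 0"
              using partials_local_zero[OF opn, of "F n" x bs] partials_local_zero[OF opn, of f x bs] C(2) f0 False
              by auto
            then show ?thesis using e by simp
          qed
        qed
      qed
    qed
  qed
qed

lemma restrict_tempered_distributions:
  assumes "U \<in> tempered_distributions"
  shows "restrict_distr \<Omega> U \<in> distributions \<Omega>"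
proof -
  have lin: "linear_functional_on schwartz U"
    and cont: "\<And>F f. (\<And>n. F n \<in> schwartz) \<Longrightarrow> f \<in> schwartz \<Longrightarrow> schwartz_conv F f \<Longrightarrow> (\<lambda>n. U (F n)) \<longlonglongrightarrow> U f"
    using assms by (auto simp: tempered_distributions_def)
  have "linear_functional_on (test_fun \<Omega>) (restrict_distr \<Omega> U)"
    using lin unfolding linear_functional_on_def restrict_distr_def
    by (auto simp: test_fun_lincomb test_fun_schwartz)
  moreover have "(\<lambda>n. restrict_distr \<Omega> U (F n)) \<longlonglongrightarrow> restrict_distr \<Omega> U f"
    if "\<And>n. F n \<in> test_fun \<Omega>" "f \<in> test_fun \<Omega>" "test_conv \<Omega> F f" for F f
    using cont[OF test_fun_schwartz[OF that(1)] test_fun_schwartz[OF that(2)] test_conv_schwartz_conv[OF that(3)]] that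
    by (simp add: restrict_distr_def)
  ultimately show ?thesis by (auto simp: distributions_def)
qed

section \<open>Uniqueness of densities, and norms of restrictions\<close>

text \<open>Removes the dependence of the Sobolev norm on the choice of a density. Both functions
  pair equally with all test functions, so the fundamental lemma applies once the difference is
  known to be locally integrable.\<close>

lemma weighted_density_unique:
  fixes g g' :: "'a::euclidean_space \<Rightarrow> complex"
  assumes "weighted_density s v g" "weighted_density s' v g'"
  shows "AE x in lborel. g x = g' x"
proof -
  have [measurable]: "g \<in> borel_measurable borel" "g' \<in> borel_measurable borel"
    using assms by (auto simp: weighted_density_def)
  have int: "integrable lborel (\<lambda>\<xi>. g \<xi> * f \<xi>)" "integrable lborel (\<lambda>\<xi>. g' \<xi> * f \<xi>)"
    and eq: "(LINT \<xi>|lborel. g \<xi> * f \<xi>) = (LINT \<xi>|lborel. g' \<xi> * f \<xi>)" if "f \<in> schwartz" for f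
    using assms that unfolding weighted_density_def by metis+
  have "AE x in lborel. x \<in> UNIV \<longrightarrow> g x - g' x = 0"
  proof (rule AE_zero_if_test_integrals_zero)
    fix f :: "'a \<Rightarrow> complex" assume "f \<in> test_fun UNIV"
    then have f: "f \<in> schwartz" by (rule test_fun_schwartz)
    show "(LINT x|lborel. (g x - g' x) * f x) = 0"
      using int[OF f] eq[OF f] by (simp add: left_diff_distrib)
  next
    fix a b :: 'a
    \<comment> \<open>Local integrability is read off from a single pairing: this bump belongs to a
      box larger by 1 on every side, so by compactness it is bounded below by some
      \<open>\<delta> > 0\<close> on \<open>cbox a b\<close>.\<close>
    let ?f = "\<lambda>x. complex_of_real (bump 1 (a - One) (b + One) x)"
    have f: "?f \<in> schwartz"
      by (rule test_fun_schwartz[OF bump_test_fun[of 1 _ _ UNIV]]) auto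
    have "continuous_on (cbox a b) (\<lambda>x. norm (?f x))"
      using f by (intro continuous_on_norm smooth_continuous_on schwartz_smooth)
    have pos: "0 < norm (?f x)" if "x \<in> cbox a b" for x
    proof -
      have "x \<in> box (a - One) (b + One)"
        using that by (force simp: mem_box inner_diff_left inner_add_left)
      then show ?thesis using bump_pos[of x "a - One" "b + One" 1] by simp
    qed
    obtain \<delta> where \<delta>: "\<delta> > 0" "\<And>x. x \<in> cbox a b \<Longrightarrow> \<delta> \<le> norm (?f x)"
    proof (cases "cbox a b = {}")
      case True
      then show ?thesis using that[of 1] by simp
    next
      case False
      obtain y where "y \<in> cbox a b" "\<And>x. x \<in> cbox a b \<Longrightarrow> norm (?f y) \<le> norm (?f x)"
        using continuous_attains_inf[OF compact_cbox False \<open>continuous_on (cbox a b) (\<lambda>x. norm (?f x))\<close>] by blast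
      then show ?thesis using that[of "norm (?f y)"] pos by blast
    qed
    have "integrable lborel (\<lambda>x. g x * ?f x - g' x * ?f x)"
      by (intro Bochner_Integration.integrable_diff int f)
    then have i: "integrable lborel (\<lambda>x. (1 / \<delta>) * norm ((g x - g' x) * ?f x))"
      by (intro integrable_mult_right integrable_norm) (simp add: left_diff_distrib)
    show "set_integrable lborel (cbox a b) (\<lambda>x. g x - g' x)"
      unfolding set_integrable_def
    proof (rule Bochner_Integration.integrable_bound[OF i])
      show "AE x in lborel. norm (indicator (cbox a b) x *\<^sub>R (g x - g' x)) \<le> norm ((1 / \<delta>) * norm ((g x - g' x) * ?f x))"
      proof (rule AE_I2)
        fix x
        show "norm (indicator (cbox a b) x *\<^sub>R (g x - g' x)) \<le> norm ((1 / \<delta>) * norm ((g x - g' x) * ?f x))"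
        proof (cases "x \<in> cbox a b")
          case True
          have "\<delta> * norm (g x - g' x) \<le> norm (?f x) * norm (g x - g' x)"
            by (intro mult_right_mono \<delta> True) auto
          then have "norm (g x - g' x) \<le> (1 / \<delta>) * norm ((g x - g' x) * ?f x)"
            using \<delta>(1) unfolding norm_mult[of "g x - g' x"] by (simp add: field_simps)
          then show ?thesis
            using True by (simp only: indicator_simps scaleR_one real_norm_def)
        qed simp
      qed
    qed measurable
  qed auto
  then show ?thesis by eventually_elim simp
qed

lemma nrm_sobolev_space:
  assumes "weighted_density s (fourier_distr U) g"
  shows "nrm (sobolev_space s) U = sqrt (LINT \<xi>|lborel. (1 + (norm \<xi>)\<^sup>2) powr s * (norm (g \<xi>))\<^sup>2)"
proof -
  let ?h = "SOME g. weighted_density s (fourier_distr U) g"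
  have h: "weighted_density s (fourier_distr U) ?h"
    by (rule someI[of "weighted_density s (fourier_distr U)", OF assms])
  have [measurable]: "g \<in> borel_measurable borel" "?h \<in> borel_measurable borel"
    using assms h by (auto simp: weighted_density_def)
  have "(LINT \<xi>|lborel. (1 + (norm \<xi>)\<^sup>2) powr s * (norm (?h \<xi>))\<^sup>2)
      = (LINT \<xi>|lborel. (1 + (norm \<xi>)\<^sup>2) powr s * (norm (g \<xi>))\<^sup>2)"
  proof (rule integral_cong_AE)
    show "AE \<xi> in lborel. (1 + (norm \<xi>)\<^sup>2) powr s * (norm (?h \<xi>))\<^sup>2 = (1 + (norm \<xi>)\<^sup>2) powr s * (norm (g \<xi>))\<^sup>2"
      using weighted_density_unique[OF h assms] by eventually_elim (simp only:)
  qed measurable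
  then show ?thesis by (simp add: sobolev_space_def)
qed

lemma sobolev_space_nrm_nonneg: "0 \<le> nrm (sobolev_space s) U"
  by (simp add: sobolev_space_def)

lemma sobolev_nrm:
  assumes "U \<in> carrier (sobolev_space s)" "restrict_distr \<Omega> U = u"
  shows "0 \<le> nrm (sobolev \<Omega> s) u" "nrm (sobolev \<Omega> s) u \<le> nrm (sobolev_space s) U"
proof -
  let ?A = "{nrm (sobolev_space s) U |U. U \<in> carrier (sobolev_space s) \<and> restrict_distr \<Omega> U = u}"
  have nrm: "nrm (sobolev \<Omega> s) u = Inf ?A" by (simp add: sobolev_def)
  have mem: "nrm (sobolev_space s) U \<in> ?A" using assms by blast
  show "0 \<le> nrm (sobolev \<Omega> s) u"
    unfolding nrm using mem by (intro cInf_greatest) (auto simp: sobolev_space_nrm_nonneg)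
  show "nrm (sobolev \<Omega> s) u \<le> nrm (sobolev_space s) U"
    unfolding nrm using mem sobolev_space_nrm_nonneg by (intro cInf_lower bdd_belowI[of _ 0]) auto
qed

text \<open>The source of all upper bounds for Sobolev norms on \<open>\<Omega>\<close>: the norm is
  an infimum over extensions, so one explicit extension with a known spectral density is
  enough.\<close>

lemma sobolev_restrict_fun_distr:
  assumes G: "G \<in> borel_measurable borel" "integrable lborel (\<lambda>x. norm (G x) / (1 + norm x ^ k))"
    and w: "weighted_density s (fourier_distr (fun_distr G)) g"
  shows "restrict_distr \<Omega> (fun_distr G) \<in> carrier (sobolev \<Omega> s)"
    and "0 \<le> nrm (sobolev \<Omega> s) (restrict_distr \<Omega> (fun_distr G))"
    and "(nrm (sobolev \<Omega> s) (restrict_distr \<Omega> (fun_distr G)))\<^sup>2 \<le> (LINT \<xi>|lborel. (1 + (norm \<xi>)\<^sup>2) powr s * (norm (g \<xi>))\<^sup>2)"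
proof -
  have t: "fun_distr G \<in> tempered_distributions"
    by (rule fun_distr_tempered[OF G])
  have U: "fun_distr G \<in> carrier (sobolev_space s)"
    using t w by (auto simp: sobolev_space_def)
  show "restrict_distr \<Omega> (fun_distr G) \<in> carrier (sobolev \<Omega> s)"
    using U restrict_tempered_distributions[OF t] by (auto simp: sobolev_def)
  show nn: "0 \<le> nrm (sobolev \<Omega> s) (restrict_distr \<Omega> (fun_distr G))"
    by (rule sobolev_nrm(1)[OF U refl])
  have "(nrm (sobolev \<Omega> s) (restrict_distr \<Omega> (fun_distr G)))\<^sup>2 \<le> (nrm (sobolev_space s) (fun_distr G))\<^sup>2"
    by (intro power_mono nn sobolev_nrm(2)[OF U refl])
  then show "(nrm (sobolev \<Omega> s) (restrict_distr \<Omega> (fun_distr G)))\<^sup>2 \<le> (LINT \<xi>|lborel. (1 + (norm \<xi>)\<^sup>2) powr s * (norm (g \<xi>))\<^sup>2)"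
    unfolding nrm_sobolev_space[OF w] by simp
qed

lemma weighted_density_fourier:
  fixes G :: "'a::euclidean_space \<Rightarrow> complex"
  assumes G: "integrable lborel G"
    and w: "integrable lborel (\<lambda>\<xi>. (1 + (norm \<xi>)\<^sup>2) powr s * (norm (fourier G \<xi>))\<^sup>2)"
  shows "weighted_density s (fourier_distr (fun_distr G)) (fourier G)"
proof -
  have [measurable]: "G \<in> borel_measurable borel"
    using borel_measurable_integrable[OF G] by simp
  have "integrable lborel (\<lambda>\<xi>. fourier G \<xi> * f \<xi>)"
       "fourier_distr (fun_distr G) f = (LINT \<xi>|lborel. fourier G \<xi> * f \<xi>)" if f: "f \<in> schwartz" for f
    using fourier_swap[OF G schwartz_integrable[OF f]] f
    by (simp_all add: fourier_distr_def fun_distr_def fourier_schwartz)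
  then show ?thesis using w by (simp add: weighted_density_def)
qed

lemma lborel_integral_reflect:
  fixes f :: "'a::euclidean_space \<Rightarrow> 'b::{banach,second_countable_topology}"
  assumes [measurable]: "f \<in> borel_measurable borel"
  shows "(LINT x|lborel. f (- x)) = (LINT x|lborel. f x)"
proof -
  have "(lborel :: 'a measure) = density (distr lborel borel (\<lambda>x. 0 + (- 1) *\<^sub>R x)) (\<lambda>_. ennreal (\<bar>- 1\<bar> ^ DIM('a)))"
    by (rule lborel_affine) simp
  also have "\<dots> = distr lborel borel (\<lambda>x::'a. - x)"
    by (simp add: density_1)
  finally have eq: "distr lborel borel (\<lambda>x::'a. - x) = lborel" by (rule sym)
  have "(LINT x|lborel. f x) = (LINT x|distr lborel borel (\<lambda>x::'a. - x). f x)"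
    by (simp only: eq)
  also have "\<dots> = (LINT x|lborel. f (- x))"
    by (rule integral_distr) measurable
  finally show ?thesis ..
qed

lemma fourier_reflect:
  fixes f :: "'a::euclidean_space \<Rightarrow> complex"
  assumes [measurable]: "f \<in> borel_measurable borel"
  shows "fourier (\<lambda>x. f (- x)) \<xi> = fourier f (- \<xi>)"
proof -
  have "(LINT x|lborel. exp (- \<i> * complex_of_real (\<xi> \<bullet> x)) * f (- x))
    = (LINT x|lborel. exp (- \<i> * complex_of_real (\<xi> \<bullet> - x)) * f (- (- x)))"
    by (rule lborel_integral_reflect[symmetric]) measurable
  then show ?thesis by (simp add: fourier_def)
qed

text \<open>Lets a value \<open>u f\<close> be rewritten as \<open>fourier_distr U\<close> at the
  inverse transform of \<open>f\<close>, where the spectral density of the extension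
  \<open>U\<close> is available.\<close>

lemma fourier_reflected_inversion:
  "f \<in> schwartz \<Longrightarrow> fourier (\<lambda>x. fourier f (- x)) x = f x"
  by (simp add: fourier_reflect schwartz_measurable[OF fourier_schwartz] fourier_inversion)

lemma fourier_reflected_swap:
  fixes g :: "'a::euclidean_space \<Rightarrow> complex"
  assumes g: "integrable lborel g" and f: "f \<in> schwartz"
  shows "(LINT x|lborel. fourier g (- x) * f x) = (LINT \<xi>|lborel. g \<xi> * fourier f (- \<xi>))"
proof -
  have [measurable]: "g \<in> borel_measurable borel" "f \<in> borel_measurable borel"
    using borel_measurable_integrable[OF g] schwartz_measurable[OF f] by auto
  have "(LINT x|lborel. fourier g (- x) * f x) = (LINT x|lborel. fourier g (- (- x)) * f (- x))"
    by (rule lborel_integral_reflect[symmetric]) measurable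
  also have "\<dots> = (LINT \<xi>|lborel. g \<xi> * fourier (\<lambda>x. f (- x)) \<xi>)"
    using fourier_swap(2)[OF g schwartz_integrable[OF schwartz_reflect[OF f]]] by simp
  finally show ?thesis by (simp add: fourier_reflect)
qed

lemma one_plus_square_power_le: "(1 + r\<^sup>2) ^ m \<le> 2 ^ m * (1 + r ^ (2 * m))" for r :: real
proof -
  have "(1 + r\<^sup>2) ^ m \<le> (2 * max 1 (r\<^sup>2)) ^ m"
    by (intro power_mono) auto
  also have "\<dots> = 2 ^ m * (max 1 (r\<^sup>2)) ^ m"
    by (rule power_mult_distrib)
  also have "(max 1 (r\<^sup>2)) ^ m \<le> 1 + r ^ (2 * m)"
    by (auto simp: max_def power_mult)
  finally show ?thesis by simp
qed

lemma bounded_over_power_integrable: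
  fixes G :: "'a::euclidean_space \<Rightarrow> complex"
  assumes [measurable]: "G \<in> borel_measurable borel" and B: "\<And>x. norm (G x) \<le> B"
  shows "integrable lborel (\<lambda>x. norm (G x) / (1 + norm x ^ (2 * DIM('a))))"
proof -
  let ?d = "DIM('a)"
  have i: "integrable lborel (\<lambda>x::'a. B * 2 ^ ?d * (1 + (norm x)\<^sup>2) powr (- real ?d))"
    by (intro integrable_mult_right integrable_decay) simp
  show ?thesis
  proof (rule Bochner_Integration.integrable_bound[OF i])
    show "AE x in lborel. norm (norm (G x) / (1 + norm x ^ (2 * ?d))) \<le> norm (B * 2 ^ ?d * (1 + (norm x)\<^sup>2) powr (- real ?d))"
    proof (rule AE_I2)
      fix x :: 'a
      have p: "1 + norm x ^ (2 * ?d) > 0" by (simp add: add_pos_nonneg)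
      have q: "1 + (norm x)\<^sup>2 > 0" by (simp add: add_pos_nonneg)
      have B0: "0 \<le> B" using order_trans[OF norm_ge_zero B] .
      have "norm (G x) / (1 + norm x ^ (2 * ?d)) \<le> B / (1 + norm x ^ (2 * ?d))"
        using p by (intro divide_right_mono B) auto
      also have "\<dots> \<le> B * 2 ^ ?d / (1 + (norm x)\<^sup>2) ^ ?d"
        using mult_left_mono[OF one_plus_square_power_le[of "norm x" ?d] B0] p q
        by (simp add: field_simps)
      also have "\<dots> = B * 2 ^ ?d * (1 + (norm x)\<^sup>2) powr (- real ?d)"
        using q by (simp add: powr_minus powr_realpow divide_inverse)
      finally show "norm (norm (G x) / (1 + norm x ^ (2 * ?d))) \<le> norm (B * 2 ^ ?d * (1 + (norm x)\<^sup>2) powr (- real ?d))"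
        using p by (simp add: B0)
    qed
  qed measurable
qed

text \<open>Builds an element from its spectral side. The inverse transform of an integrable
  \<open>g\<close> is bounded, hence tempered. The last conclusion records the values on test
  functions, so that a splitting of a density can be verified by adding integrals over
  frequencies.\<close>

lemma sobolev_inverse_fourier:
  fixes g :: "'a::euclidean_space \<Rightarrow> complex" and \<Omega> :: "'a set"
  assumes g: "integrable lborel g"
    and w: "integrable lborel (\<lambda>\<xi>. (1 + (norm \<xi>)\<^sup>2) powr s * (norm (g \<xi>))\<^sup>2)"
  defines "u \<equiv> restrict_distr \<Omega> (fun_distr (\<lambda>x. fourier g (- x)))"
  shows "u \<in> carrier (sobolev \<Omega> s)" "0 \<le> nrm (sobolev \<Omega> s) u"
    "(nrm (sobolev \<Omega> s) u)\<^sup>2 \<le> (LINT \<xi>|lborel. (1 + (norm \<xi>)\<^sup>2) powr s * (norm (g \<xi>))\<^sup>2)"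
    and "\<And>f. f \<in> test_fun \<Omega> \<Longrightarrow> u f = (LINT \<xi>|lborel. g \<xi> * fourier f (- \<xi>))"
proof -
  let ?G = "\<lambda>x. fourier g (- x)"
  have [measurable]: "g \<in> borel_measurable borel"
    using borel_measurable_integrable[OF g] by simp
  have m: "?G \<in> borel_measurable borel" by measurable
  have int: "integrable lborel (\<lambda>x. norm (?G x) / (1 + norm x ^ (2 * DIM('a))))"
    by (rule bounded_over_power_integrable[OF m norm_fourier_le])
  have "integrable lborel (\<lambda>\<xi>. g \<xi> * f \<xi>)"
       "fourier_distr (fun_distr ?G) f = (LINT \<xi>|lborel. g \<xi> * f \<xi>)" if f: "f \<in> schwartz" for f
  proof -
    obtain B where B: "\<And>x. norm (f x) \<le> B" using rapid_bounded[OF schwartz_rapid[OF f]] by blast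
    have [measurable]: "f \<in> borel_measurable borel" using f by (rule schwartz_measurable)
    show "integrable lborel (\<lambda>\<xi>. g \<xi> * f \<xi>)"
    proof (rule Bochner_Integration.integrable_bound)
      show "integrable lborel (\<lambda>x. B * norm (g x))" using g by simp
      show "AE x in lborel. norm (g x * f x) \<le> norm (B * norm (g x))"
      proof (rule AE_I2)
        fix x
        have "norm (g x * f x) \<le> norm (g x) * B" unfolding norm_mult by (intro mult_left_mono B) auto
        then show "norm (g x * f x) \<le> norm (B * norm (g x))"
          unfolding real_norm_def by (simp only: mult.commute[of B])
      qed
    qed measurable
    have "fourier_distr (fun_distr ?G) f = (LINT x|lborel. ?G x * fourier f x)"
      using f by (simp add: fourier_distr_def fun_distr_def fourier_schwartz)
    also have "\<dots> = (LINT \<xi>|lborel. g \<xi> * fourier (fourier f) (- \<xi>))"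
      by (rule fourier_reflected_swap[OF g fourier_schwartz[OF f]])
    finally show "fourier_distr (fun_distr ?G) f = (LINT \<xi>|lborel. g \<xi> * f \<xi>)"
      by (simp add: fourier_inversion[OF f])
  qed
  then have wd: "weighted_density s (fourier_distr (fun_distr ?G)) g"
    using w by (simp add: weighted_density_def)
  show "u \<in> carrier (sobolev \<Omega> s)" "0 \<le> nrm (sobolev \<Omega> s) u"
    "(nrm (sobolev \<Omega> s) u)\<^sup>2 \<le> (LINT \<xi>|lborel. (1 + (norm \<xi>)\<^sup>2) powr s * (norm (g \<xi>))\<^sup>2)"
    unfolding u_def by (rule sobolev_restrict_fun_distr[OF m int wd])+
  show "u f = (LINT \<xi>|lborel. g \<xi> * fourier f (- \<xi>))" if "f \<in> test_fun \<Omega>" for f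
    using that fourier_reflected_swap[OF g test_fun_schwartz[OF that]]
    by (simp add: u_def restrict_distr_def fun_distr_def test_fun_schwartz)
qed

section \<open>Square-integrable densities on sets of finite measure\<close>

lemma L2_set_integrable:
  fixes g :: "'a::euclidean_space \<Rightarrow> complex"
  assumes [measurable]: "g \<in> borel_measurable borel" "\<Omega> \<in> sets borel" and fin: "emeasure lborel \<Omega> < \<infinity>"
    and g2: "set_integrable lborel \<Omega> (\<lambda>x. (norm (g x))\<^sup>2)"
  shows "set_integrable lborel \<Omega> g"
  unfolding set_integrable_def
proof (rule Bochner_Integration.integrable_bound)
  show "integrable lborel (\<lambda>x. indicator \<Omega> x + indicator \<Omega> x *\<^sub>R (norm (g x))\<^sup>2)"
    using g2 fin by (intro Bochner_Integration.integrable_add) (auto simp: set_integrable_def integrable_indicator_iff)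
  show "AE x in lborel. norm (indicator \<Omega> x *\<^sub>R g x) \<le> norm (indicator \<Omega> x + indicator \<Omega> x *\<^sub>R (norm (g x))\<^sup>2)"
  proof (rule AE_I2)
    fix x
    have "2 * norm (g x) \<le> 1 + (norm (g x))\<^sup>2"
      using zero_le_power2[of "norm (g x) - 1"] by (simp add: power2_eq_square algebra_simps)
    then have "norm (g x) \<le> 1 + (norm (g x))\<^sup>2"
      using norm_ge_zero[of "g x"] by linarith
    then show "norm (indicator \<Omega> x *\<^sub>R g x) \<le> norm (indicator \<Omega> x + indicator \<Omega> x *\<^sub>R (norm (g x))\<^sup>2)"
      by (auto simp: indicator_def)
  qed
qed measurable

lemma integrable_mult_schwartz:
  fixes g :: "'a::euclidean_space \<Rightarrow> complex"
  assumes g: "integrable lborel g" and f: "f \<in> schwartz"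
  shows "integrable lborel (\<lambda>x. g x * f x)"
proof -
  obtain B where B: "\<And>x. norm (f x) \<le> B" using rapid_bounded[OF schwartz_rapid[OF f]] by blast
  have [measurable]: "f \<in> borel_measurable borel" "g \<in> borel_measurable borel"
    using schwartz_measurable[OF f] borel_measurable_integrable[OF g] by auto
  show ?thesis
  proof (rule Bochner_Integration.integrable_bound)
    show "integrable lborel (\<lambda>x. norm (g x) * B)" using g by simp
    show "AE x in lborel. norm (g x * f x) \<le> norm (norm (g x) * B)"
      unfolding norm_mult[of "g _"] real_norm_def
      by (intro AE_I2 order_trans[OF mult_left_mono[OF B norm_ge_zero] abs_ge_self])
  qed measurable
qed

lemma lborel_integrable_reflect:
  fixes f :: "'a::euclidean_space \<Rightarrow> 'b::{banach,second_countable_topology}"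
  assumes f: "integrable lborel f"
  shows "integrable lborel (\<lambda>x. f (- x))"
proof -
  have [measurable]: "f \<in> borel_measurable borel"
    using borel_measurable_integrable[OF f] by simp
  have "(lborel :: 'a measure) = density (distr lborel borel (\<lambda>x. 0 + (- 1) *\<^sub>R x)) (\<lambda>_. ennreal (\<bar>- 1\<bar> ^ DIM('a)))"
    by (rule lborel_affine) simp
  also have "\<dots> = distr lborel borel (\<lambda>x::'a. - x)"
    by (simp add: density_1)
  finally have "integrable (distr lborel borel (\<lambda>x::'a. - x)) f" using f by simp
  then show ?thesis by (subst (asm) integrable_distr_eq) auto
qed

lemma schwartz_square_integrable:
  assumes f: "f \<in> schwartz"
  shows "integrable lborel (\<lambda>x. (norm (f x))\<^sup>2)"
  using integrable_norm[OF integrable_mult_schwartz[OF schwartz_integrable[OF f] f]]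
  by (simp add: norm_mult power2_eq_square)

lemma product_le_sum_squares: "x * y \<le> x\<^sup>2 + y\<^sup>2" if "0 \<le> x" "0 \<le> y" for x y :: real
  using zero_le_power2[of "x - y"] mult_nonneg_nonneg[OF that]
  by (simp add: power2_eq_square algebra_simps)

text \<open>Test functions vanish off \<open>\<Omega>\<close>, so the integrals over
  \<open>\<Omega>\<close> become integrals over the whole space and the fundamental lemma applies;
  finite measure turns square integrability into the local integrability that it demands.\<close>

lemma L2_density_unique:
  fixes \<Omega> :: "'a::euclidean_space set"
  assumes \<Omega>: "open \<Omega>" and fin: "emeasure lborel \<Omega> < \<infinity>"
    and g: "L2_density \<Omega> u g" and g': "L2_density \<Omega> u g'"
  shows "AE x in lborel. x \<in> \<Omega> \<longrightarrow> g x = g' x"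
proof -
  have [measurable]: "g \<in> borel_measurable borel" "g' \<in> borel_measurable borel" "\<Omega> \<in> sets borel"
    using g g' \<Omega> by (auto simp: L2_density_def)
  have i: "set_integrable lborel \<Omega> g" "set_integrable lborel \<Omega> g'"
    using g g' fin by (auto intro!: L2_set_integrable simp: L2_density_def)
  have "AE x in lborel. x \<in> \<Omega> \<longrightarrow> g x - g' x = 0"
  proof (rule AE_zero_if_test_integrals_zero[OF \<Omega>])
    show "set_integrable lborel (cbox a b) (\<lambda>x. g x - g' x)" if "cbox a b \<subseteq> \<Omega>" for a b
      by (rule set_integrable_subset[OF set_integral_diff(1)[OF i]]) (use that in auto)
    fix f assume f: "f \<in> test_fun \<Omega>"
    have fi: "(indicator \<Omega> x *\<^sub>R h x) * f x = h x * f x" for h x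
      using test_fun_outside[OF f, of x] by (cases "x \<in> \<Omega>") auto
    have int: "integrable lborel (\<lambda>x. h x * f x)" if "set_integrable lborel \<Omega> h" for h
      using integrable_mult_schwartz[OF that[unfolded set_integrable_def] test_fun_schwartz[OF f]]
      by (simp only: fi)
    have "u f = (LINT x|lborel. h x * f x)" if "L2_density \<Omega> u h" for h
    proof -
      have "u f = (LINT x:\<Omega>|lborel. h x * f x)"
        using that f by (simp add: L2_density_def)
      also have "\<dots> = (LINT x|lborel. h x * f x)"
        unfolding set_lebesgue_integral_def using fi[of _ h]
        by (intro Bochner_Integration.integral_cong refl) (simp add: mult_scaleR_left)
      finally show ?thesis .
    qed
    from this[OF g] this[OF g'] show "(LINT x|lborel. (g x - g' x) * f x) = 0"
      using int[OF i(1)] int[OF i(2)] by (simp add: left_diff_distrib)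
  qed measurable
  then show ?thesis by eventually_elim simp
qed

lemma nrm_L2:
  fixes \<Omega> :: "'a::euclidean_space set"
  assumes \<Omega>: "open \<Omega>" and fin: "emeasure lborel \<Omega> < \<infinity>" and g: "L2_density \<Omega> u g"
  shows "nrm (L2 \<Omega>) u = sqrt (LINT x:\<Omega>|lborel. (norm (g x))\<^sup>2)"
proof -
  let ?h = "SOME g. L2_density \<Omega> u g"
  have h: "L2_density \<Omega> u ?h"
    by (rule someI[of "L2_density \<Omega> u", OF g])
  have [measurable]: "g \<in> borel_measurable borel" "?h \<in> borel_measurable borel" "\<Omega> \<in> sets borel"
    using g h \<Omega> by (auto simp: L2_density_def)
  have "(LINT x:\<Omega>|lborel. (norm (?h x))\<^sup>2) = (LINT x:\<Omega>|lborel. (norm (g x))\<^sup>2)"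
    unfolding set_lebesgue_integral_def
  proof (rule integral_cong_AE)
    show "AE x in lborel. indicator \<Omega> x *\<^sub>R (norm (?h x))\<^sup>2 = indicator \<Omega> x *\<^sub>R (norm (g x))\<^sup>2"
      using L2_density_unique[OF \<Omega> fin h g] by eventually_elim (auto simp: indicator_def)
  qed measurable
  then show ?thesis by (simp add: L2_def)
qed

section \<open>The inclusion for the exponent one half\<close>

text \<open>For the exponent 1/2 the weight \<open>(t powr (- 1 / 2))\<^sup>2 / t\<close> is
  \<open>1 / t\<^sup>2\<close>. It therefore suffices to exhibit one decomposition for every
  \<open>t\<close> and to integrate its squared cost; the infimum in the K-functional is never
  computed.\<close>

lemma interp_half_memI:
  fixes H\<^sub>0 H\<^sub>1 :: "'v::ab_group_add nspace"
  assumes dec: "\<And>t. t > 0 \<Longrightarrow> \<exists>\<phi>\<^sub>0\<in>carrier H\<^sub>0. \<exists>\<phi>\<^sub>1\<in>carrier H\<^sub>1. \<phi>\<^sub>0 + \<phi>\<^sub>1 = \<phi> \<and>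
      (nrm H\<^sub>0 \<phi>\<^sub>0)\<^sup>2 + t\<^sup>2 * (nrm H\<^sub>1 \<phi>\<^sub>1)\<^sup>2 \<le> \<Phi> t"
    and int: "set_integrable lborel {0<..} (\<lambda>t. \<Phi> t / t\<^sup>2)"
  shows "\<phi> \<in> carrier (interp H\<^sub>0 H\<^sub>1 (1 / 2))"
proof -
  define A where "A = (\<lambda>t::real. {sqrt ((nrm H\<^sub>0 \<phi>\<^sub>0)\<^sup>2 + t\<^sup>2 * (nrm H\<^sub>1 \<phi>\<^sub>1)\<^sup>2) |\<phi>\<^sub>0 \<phi>\<^sub>1.
     \<phi>\<^sub>0 \<in> carrier H\<^sub>0 \<and> \<phi>\<^sub>1 \<in> carrier H\<^sub>1 \<and> \<phi>\<^sub>0 + \<phi>\<^sub>1 = \<phi>})"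
  let ?K = "\<lambda>t. K_functional H\<^sub>0 H\<^sub>1 t \<phi>"
  have K: "?K t = Inf (A t)" for t by (simp add: K_functional_def A_def)
  obtain \<psi>\<^sub>0 \<psi>\<^sub>1 where \<psi>: "\<psi>\<^sub>0 \<in> carrier H\<^sub>0" "\<psi>\<^sub>1 \<in> carrier H\<^sub>1" "\<psi>\<^sub>0 + \<psi>\<^sub>1 = \<phi>"
    using dec[of 1] by auto
  have ne: "A t \<noteq> {}" for t using \<psi> unfolding A_def by blast
  have nn: "0 \<le> x" if "x \<in> A t" for x t using that by (auto simp: A_def)
  have bdd: "bdd_below (A t)" for t using nn by (rule bdd_belowI)
  have K0: "0 \<le> ?K t" for t
    unfolding K by (rule cInf_greatest[OF ne nn])
  have Kle: "(?K t)\<^sup>2 \<le> \<Phi> t" if t: "t > 0" for t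
  proof -
    obtain \<phi>\<^sub>0 \<phi>\<^sub>1 where p: "\<phi>\<^sub>0 \<in> carrier H\<^sub>0" "\<phi>\<^sub>1 \<in> carrier H\<^sub>1" "\<phi>\<^sub>0 + \<phi>\<^sub>1 = \<phi>"
      "(nrm H\<^sub>0 \<phi>\<^sub>0)\<^sup>2 + t\<^sup>2 * (nrm H\<^sub>1 \<phi>\<^sub>1)\<^sup>2 \<le> \<Phi> t"
      using dec[OF t] by blast
    have "sqrt ((nrm H\<^sub>0 \<phi>\<^sub>0)\<^sup>2 + t\<^sup>2 * (nrm H\<^sub>1 \<phi>\<^sub>1)\<^sup>2) \<in> A t"
      using p unfolding A_def by blast
    then have "?K t \<le> sqrt ((nrm H\<^sub>0 \<phi>\<^sub>0)\<^sup>2 + t\<^sup>2 * (nrm H\<^sub>1 \<phi>\<^sub>1)\<^sup>2)"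
      unfolding K by (rule cInf_lower[OF _ bdd])
    then have "(?K t)\<^sup>2 \<le> (sqrt ((nrm H\<^sub>0 \<phi>\<^sub>0)\<^sup>2 + t\<^sup>2 * (nrm H\<^sub>1 \<phi>\<^sub>1)\<^sup>2))\<^sup>2"
      by (rule power_mono[OF _ K0])
    also have "\<dots> = (nrm H\<^sub>0 \<phi>\<^sub>0)\<^sup>2 + t\<^sup>2 * (nrm H\<^sub>1 \<phi>\<^sub>1)\<^sup>2"
      by (rule real_sqrt_pow2) simp
    also note p(4)
    finally show ?thesis .
  qed
  \<comment> \<open>Measurability in \<open>t\<close> comes from monotonicity. Clamping at 0 is
    needed since \<open>t\<^sup>2\<close> decreases on the negative axis.\<close>
  have mono: "mono (\<lambda>t. ?K (max 0 t))"
  proof (rule monoI)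
    fix s t :: real assume st: "s \<le> t"
    show "?K (max 0 s) \<le> ?K (max 0 t)"
      unfolding K
    proof (rule cInf_mono[OF ne bdd])
      fix b assume "b \<in> A (max 0 t)"
      then obtain \<phi>\<^sub>0 \<phi>\<^sub>1 where p: "\<phi>\<^sub>0 \<in> carrier H\<^sub>0" "\<phi>\<^sub>1 \<in> carrier H\<^sub>1" "\<phi>\<^sub>0 + \<phi>\<^sub>1 = \<phi>"
        and b: "b = sqrt ((nrm H\<^sub>0 \<phi>\<^sub>0)\<^sup>2 + (max 0 t)\<^sup>2 * (nrm H\<^sub>1 \<phi>\<^sub>1)\<^sup>2)"
        unfolding A_def by blast
      have "sqrt ((nrm H\<^sub>0 \<phi>\<^sub>0)\<^sup>2 + (max 0 s)\<^sup>2 * (nrm H\<^sub>1 \<phi>\<^sub>1)\<^sup>2) \<le> b"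
        unfolding b using st by (intro real_sqrt_le_mono add_left_mono mult_right_mono power_mono) auto
      then show "\<exists>a\<in>A (max 0 s). a \<le> b" using p unfolding A_def by blast
    qed
  qed
  have [measurable]: "(\<lambda>t. ?K (max 0 t)) \<in> borel_measurable borel"
    by (rule borel_measurable_mono[OF mono])
  have eq: "indicator {0<..} t *\<^sub>R (\<bar>t powr (- (1 / 2)) * ?K t\<bar>\<^sup>2 / t) = indicator {0<..} t *\<^sub>R ((?K (max 0 t))\<^sup>2 / t\<^sup>2)" for t :: real
  proof (cases "t > 0")
    case True
    have "(t powr (- (1 / 2)))\<^sup>2 = t powr (- (1 / 2) + - (1 / 2))"
      unfolding power2_eq_square powr_add ..
    moreover have "- (1 / 2) + - (1 / 2) = (- 1 :: real)" by simp
    ultimately have "(t powr (- (1 / 2)))\<^sup>2 = 1 / t"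
      using True by (simp only: powr_neg_one)
    then have "\<bar>t powr (- (1 / 2)) * ?K t\<bar>\<^sup>2 / t = (1 / t) * (?K t)\<^sup>2 / t"
      by (simp only: power2_abs power_mult_distrib)
    then show ?thesis using True by (simp add: power2_eq_square[of t] max_def)
  qed simp
  have "set_integrable lborel {0<..} (\<lambda>t. \<bar>t powr (- (1 / 2)) * ?K t\<bar>\<^sup>2 / t)"
    unfolding set_integrable_def eq
  proof (rule Bochner_Integration.integrable_bound[OF int[unfolded set_integrable_def]])
    show "AE t in lborel. norm (indicator {0<..} t *\<^sub>R ((?K (max 0 t))\<^sup>2 / t\<^sup>2)) \<le> norm (indicator {0<..} t *\<^sub>R (\<Phi> t / t\<^sup>2))"
    proof (rule AE_I2)
      fix t :: real
      show "norm (indicator {0<..} t *\<^sub>R ((?K (max 0 t))\<^sup>2 / t\<^sup>2)) \<le> norm (indicator {0<..} t *\<^sub>R (\<Phi> t / t\<^sup>2))"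
      proof (cases "t > 0")
        case True
        then have "(?K t)\<^sup>2 / t\<^sup>2 \<le> \<bar>\<Phi> t\<bar> / t\<^sup>2"
          by (intro divide_right_mono order_trans[OF Kle abs_ge_self]) auto
        then show ?thesis using True by simp
      qed simp
    qed
  qed measurable
  then show ?thesis using \<psi> by (auto simp: interp_def)
qed

text \<open>A bounded set of frequencies has finite measure, so square integrability there implies
  integrability and the transform defined by the integral applies.\<close>

lemma low_frequency_integrable:
  fixes g :: "'a::euclidean_space \<Rightarrow> complex"
  assumes [measurable]: "g \<in> borel_measurable borel" "A \<in> sets borel" and A: "A \<subseteq> cball 0 r"
    and g2: "integrable lborel (\<lambda>\<xi>. (norm (g \<xi>))\<^sup>2)"
  shows "integrable lborel (\<lambda>\<xi>. indicator A \<xi> *\<^sub>R g \<xi>)"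
    "integrable lborel (\<lambda>\<xi>. (norm (indicator A \<xi> *\<^sub>R g \<xi>))\<^sup>2)"
proof -
  have "emeasure lborel A \<le> emeasure lborel (cball 0 r :: 'a set)"
    using A by (intro emeasure_mono) auto
  also have "\<dots> < \<infinity>" using emeasure_lborel_cball_finite[of "0::'a" r] by simp
  finally have fin: "emeasure lborel A < \<infinity>" .
  have g2': "set_integrable lborel A (\<lambda>\<xi>. (norm (g \<xi>))\<^sup>2)"
    unfolding set_integrable_def by (intro integrable_mult_indicator g2) simp
  show "integrable lborel (\<lambda>\<xi>. indicator A \<xi> *\<^sub>R g \<xi>)"
    using L2_set_integrable[OF assms(1,2) fin g2'] by (simp add: set_integrable_def)
  have "(norm (indicator A \<xi> *\<^sub>R g \<xi>))\<^sup>2 = indicator A \<xi> *\<^sub>R (norm (g \<xi>))\<^sup>2" for \<xi>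
    by (simp add: indicator_def)
  then show "integrable lborel (\<lambda>\<xi>. (norm (indicator A \<xi> *\<^sub>R g \<xi>))\<^sup>2)"
    using g2' by (simp only: set_integrable_def)
qed

text \<open>The inverse transforms of the truncations of \<open>g\<close> to \<open>cball 0 (2 ^ k)\<close> form a rapidly
  convergent Cauchy sequence in \<open>L\<^sup>2\<close>; their limit is the required density.\<close>

lemma H1_L2_density:
  fixes g :: "'a::euclidean_space \<Rightarrow> complex"
  assumes [measurable]: "g \<in> borel_measurable borel"
    and w: "integrable lborel (\<lambda>\<xi>. (1 + (norm \<xi>)\<^sup>2) * (norm (g \<xi>))\<^sup>2)"
    and \<Omega>: "open \<Omega>" and fin: "emeasure lborel \<Omega> < \<infinity>"
  obtains G where "G \<in> borel_measurable borel" "set_integrable lborel \<Omega> (\<lambda>x. (norm (G x))\<^sup>2)"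
    "(LINT x:\<Omega>|lborel. (norm (G x))\<^sup>2) \<le> (LINT \<xi>|lborel. (norm (g \<xi>))\<^sup>2)"
    "\<And>f. f \<in> test_fun \<Omega> \<Longrightarrow> (LINT x:\<Omega>|lborel. G x * f x) = (LINT \<xi>|lborel. g \<xi> * fourier f (- \<xi>))"
proof -
  have [measurable]: "\<Omega> \<in> sets borel" using \<Omega> by auto
  define M where "M = (LINT \<xi>|lborel. (1 + (norm \<xi>)\<^sup>2) * (norm (g \<xi>))\<^sup>2)"
  define m where "m = measure lborel \<Omega>"
  have g2: "integrable lborel (\<lambda>\<xi>. (norm (g \<xi>))\<^sup>2)"
    by (rule Bochner_Integration.integrable_bound[OF w]) (auto simp: algebra_simps)
  define c where "c = (\<lambda>k \<xi>. indicator (cball 0 (2 ^ k)) \<xi> *\<^sub>R g \<xi>)"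
  have [measurable]: "cball (0::'a) r \<in> sets borel" for r by simp
  have [measurable]: "c k \<in> borel_measurable borel" for k unfolding c_def by measurable
  have c: "integrable lborel (c k)" "integrable lborel (\<lambda>\<xi>. (norm (c k \<xi>))\<^sup>2)" for k
    unfolding c_def by (rule low_frequency_integrable[OF _ _ order_refl g2]; simp)+
  define d where "d = (\<lambda>k \<xi>. c (Suc k) \<xi> - c k \<xi>)"
  have [measurable]: "d k \<in> borel_measurable borel" for k unfolding d_def by measurable
  have d: "integrable lborel (d k)" for k unfolding d_def by (intro Bochner_Integration.integrable_diff c)
  \<comment> \<open>On the shell between the radii \<open>2 ^ k\<close> and \<open>2 ^ Suc k\<close>
    the weight is at least \<open>4 ^ k\<close>. Here the first-order weight turns mere convergence
    of the truncations into geometric convergence.\<close>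
  have dle: "(norm (d k \<xi>))\<^sup>2 \<le> (1 / 4 ^ k) * ((1 + (norm \<xi>)\<^sup>2) * (norm (g \<xi>))\<^sup>2)" for k \<xi>
  proof (cases "norm \<xi> \<le> 2 ^ k")
    case True
    moreover have "norm \<xi> \<le> 2 ^ Suc k" using True by (rule order_trans) simp
    ultimately show ?thesis by (simp add: d_def c_def)
  next
    case False
    then have "(2 ^ k)\<^sup>2 \<le> (norm \<xi>)\<^sup>2" by (intro power_mono) auto
    then have "4 ^ k \<le> 1 + (norm \<xi>)\<^sup>2" by (simp add: power2_eq_square flip: power_mult_distrib)
    then have "1 * (norm (g \<xi>))\<^sup>2 \<le> ((1 / 4 ^ k) * (1 + (norm \<xi>)\<^sup>2)) * (norm (g \<xi>))\<^sup>2"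
      by (intro mult_right_mono) (auto simp: field_simps)
    moreover have "(norm (d k \<xi>))\<^sup>2 \<le> 1 * (norm (g \<xi>))\<^sup>2"
      using False by (auto simp: d_def c_def indicator_def)
    ultimately show ?thesis by (simp only: mult.assoc)
  qed
  have d2: "integrable lborel (\<lambda>\<xi>. (norm (d k \<xi>))\<^sup>2)" "(LINT \<xi>|lborel. (norm (d k \<xi>))\<^sup>2) \<le> M / 4 ^ k" for k
  proof -
    have i: "integrable lborel (\<lambda>\<xi>. (1 / 4 ^ k) * ((1 + (norm \<xi>)\<^sup>2) * (norm (g \<xi>))\<^sup>2))"
      by (intro integrable_mult_right w)
    show *: "integrable lborel (\<lambda>\<xi>. (norm (d k \<xi>))\<^sup>2)"
      by (rule Bochner_Integration.integrable_bound[OF i])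
         (measurable, intro AE_I2, use dle in \<open>simp add: abs_of_nonneg add_nonneg_nonneg\<close>)
    have "(LINT \<xi>|lborel. (norm (d k \<xi>))\<^sup>2) \<le> (LINT \<xi>|lborel. (1 / 4 ^ k) * ((1 + (norm \<xi>)\<^sup>2) * (norm (g \<xi>))\<^sup>2))"
      by (intro integral_mono * i dle)
    then show "(LINT \<xi>|lborel. (norm (d k \<xi>))\<^sup>2) \<le> M / 4 ^ k"
      by (simp only: integral_mult_right_zero M_def) simp
  qed
  define G where "G = (\<lambda>k x. fourier (c k) (- x))"
  define D where "D = (\<lambda>k x. fourier (d k) (- x))"
  have [measurable]: "G k \<in> borel_measurable borel" "D k \<in> borel_measurable borel" for k
    unfolding G_def D_def by measurable
  have reflect_sq: "integrable lborel (\<lambda>x. (norm (fourier h (- x)))\<^sup>2)"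
      "(LINT x|lborel. (norm (fourier h (- x)))\<^sup>2) \<le> (LINT \<xi>|lborel. (norm (h \<xi>))\<^sup>2)"
    if h: "integrable lborel h" "integrable lborel (\<lambda>\<xi>. (norm (h \<xi>))\<^sup>2)" for h :: "'a \<Rightarrow> complex"
  proof -
    have [measurable]: "h \<in> borel_measurable borel" using borel_measurable_integrable[OF h(1)] by simp
    have r: "fourier h (- x) = fourier (\<lambda>y. h (- y)) x" for x
      by (simp add: fourier_reflect)
    have h': "integrable lborel (\<lambda>y. h (- y))" "integrable lborel (\<lambda>y. (norm (h (- y)))\<^sup>2)"
      using lborel_integrable_reflect[OF h(1)] lborel_integrable_reflect[OF h(2)] by auto
    have "(LINT y|lborel. (norm (h (- y)))\<^sup>2) = (LINT y|lborel. (norm (h y))\<^sup>2)"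
      by (rule lborel_integral_reflect) measurable
    then show "integrable lborel (\<lambda>x. (norm (fourier h (- x)))\<^sup>2)"
      "(LINT x|lborel. (norm (fourier h (- x)))\<^sup>2) \<le> (LINT \<xi>|lborel. (norm (h \<xi>))\<^sup>2)"
      using plancherel_le[OF h'] unfolding r by simp_all
  qed
  have GD: "D k x = G (Suc k) x - G k x" for k x
    using fourier_lincomb[OF c(1)[of "Suc k"] c(1)[of k], of 1 "-1" "- x"]
    by (simp add: D_def G_def d_def)
  define F where "F = (\<lambda>k x. indicator \<Omega> x *\<^sub>R D k x)"
  have [measurable]: "F k \<in> borel_measurable borel" for k unfolding F_def by measurable
  have bound_int: "integrable lborel (\<lambda>x. 2 ^ k * (norm (D k x))\<^sup>2 + (1 / 2 ^ k) * indicator \<Omega> x)" for k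
    using reflect_sq(1)[OF d d2(1), of k] fin
    by (intro Bochner_Integration.integrable_add integrable_mult_right) (auto simp: D_def integrable_indicator_iff)
  \<comment> \<open>Cauchy-Schwarz on a set of finite measure in additive form. With the factors
    \<open>2 ^ k\<close> and \<open>1 / 2 ^ k\<close> both terms have integrals of order
    \<open>2 ^ -k\<close>, since the square of \<open>D k\<close> integrates to at most
    \<open>M / 4 ^ k\<close>.\<close>
  have Fle: "norm (F k x) \<le> 2 ^ k * (norm (D k x))\<^sup>2 + (1 / 2 ^ k) * indicator \<Omega> x" for k x
  proof (cases "x \<in> \<Omega>")
    case True
    have "2 ^ k * norm (D k x) \<le> (2 ^ k * norm (D k x))\<^sup>2 + 1"
      using product_le_sum_squares[of "2 ^ k * norm (D k x)" 1] by simp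
    then have "norm (D k x) \<le> 2 ^ k * (norm (D k x))\<^sup>2 + 1 / 2 ^ k"
      by (simp add: field_simps power2_eq_square)
    then show ?thesis using True by (simp add: F_def)
  qed (simp add: F_def)
  have Fi: "integrable lborel (F k)" for k
    by (rule Bochner_Integration.integrable_bound[OF bound_int[of k]])
       (measurable, intro AE_I2, use Fle[of k] in \<open>auto intro: order_trans[OF _ abs_ge_self]\<close>)
  have Fn: "(LINT x|lborel. norm (F k x)) \<le> (M + m) * (1 / 2) ^ k" for k
  proof -
    have "(LINT x|lborel. norm (F k x)) \<le> (LINT x|lborel. 2 ^ k * (norm (D k x))\<^sup>2 + (1 / 2 ^ k) * indicator \<Omega> x)"
      by (intro integral_mono integrable_norm Fi bound_int Fle)
    also have "\<dots> = 2 ^ k * (LINT x|lborel. (norm (D k x))\<^sup>2) + (1 / 2 ^ k) * m"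
      using reflect_sq(1)[OF d d2(1), of k] fin
      by (subst Bochner_Integration.integral_add) (auto simp: D_def integrable_indicator_iff m_def)
    also have "\<dots> \<le> 2 ^ k * (M / 4 ^ k) + (1 / 2 ^ k) * m"
      unfolding D_def by (intro add_right_mono mult_left_mono order_trans[OF reflect_sq(2)[OF d d2(1)] d2(2)]) simp
    also have "\<dots> = (M + m) * (1 / 2) ^ k"
    proof -
      have "(4::real) ^ k = 2 ^ k * 2 ^ k" by (simp flip: power_mult_distrib)
      then show ?thesis by (simp add: field_simps)
    qed
    finally show ?thesis .
  qed
  have sumF: "summable (\<lambda>k. LINT x|lborel. norm (F k x))"
    by (rule summable_comparison_test'[where g = "\<lambda>k. (M + m) * (1 / 2) ^ k" and N = 0])
       (use Fn in \<open>auto intro!: summable_mult simp: abs_of_nonneg integral_nonneg_AE\<close>)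
  have AEsum: "AE x in lborel. summable (\<lambda>k. norm (F k x))"
  proof -
    have "(\<integral>\<^sup>+x. (\<Sum>k. ennreal (norm (F k x))) \<partial>lborel) = (\<Sum>k. \<integral>\<^sup>+x. ennreal (norm (F k x)) \<partial>lborel)"
      by (intro nn_integral_suminf) measurable
    also have "\<dots> = (\<Sum>k. ennreal (LINT x|lborel. norm (F k x)))"
      by (intro suminf_cong nn_integral_eq_integral integrable_norm Fi) auto
    also have "\<dots> = ennreal (\<Sum>k. LINT x|lborel. norm (F k x))"
      by (intro suminf_ennreal2 sumF integral_nonneg_AE) auto
    finally have "(\<integral>\<^sup>+x. (\<Sum>k. ennreal (norm (F k x))) \<partial>lborel) \<noteq> \<infinity>" by simp
    then have "AE x in lborel. (\<Sum>k. ennreal (norm (F k x))) \<noteq> \<infinity>"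
      by (intro nn_integral_PInf_AE) measurable
    then show ?thesis
      by eventually_elim (auto intro: summable_suminf_not_top)
  qed
  define L where "L = (\<lambda>x. indicator \<Omega> x *\<^sub>R (G 0 x + (\<Sum>k. F k x)))"
  have Lm [measurable]: "L \<in> borel_measurable borel" unfolding L_def by measurable
  have part: "(\<Sum>i<k. F i x) = indicator \<Omega> x *\<^sub>R (G k x - G 0 x)" for k x
    by (induction k) (simp_all add: F_def GD algebra_simps)
  have lim: "AE x in lborel. x \<in> \<Omega> \<longrightarrow> (\<lambda>k. G k x) \<longlonglongrightarrow> L x"
    using AEsum
  proof eventually_elim
    case (elim x)
    have "(\<lambda>k. \<Sum>i<k. F i x) \<longlonglongrightarrow> (\<Sum>k. F k x)"
      using summable_LIMSEQ[OF summable_norm_cancel[OF elim]] .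
    then have "(\<lambda>k. G 0 x + (\<Sum>i<k. F i x)) \<longlonglongrightarrow> G 0 x + (\<Sum>k. F k x)"
      by (intro tendsto_add tendsto_const)
    then show ?case by (auto simp: part L_def)
  qed
  have Gsq: "integrable lborel (\<lambda>x. (norm (G k x))\<^sup>2)" "(LINT x|lborel. (norm (G k x))\<^sup>2) \<le> (LINT \<xi>|lborel. (norm (g \<xi>))\<^sup>2)" for k
  proof -
    show "integrable lborel (\<lambda>x. (norm (G k x))\<^sup>2)" unfolding G_def by (rule reflect_sq(1)[OF c])
    have "(LINT \<xi>|lborel. (norm (c k \<xi>))\<^sup>2) \<le> (LINT \<xi>|lborel. (norm (g \<xi>))\<^sup>2)"
      by (intro integral_mono c g2) (simp add: c_def indicator_def)
    with reflect_sq(2)[OF c, of k] show "(LINT x|lborel. (norm (G k x))\<^sup>2) \<le> (LINT \<xi>|lborel. (norm (g \<xi>))\<^sup>2)"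
      unfolding G_def by linarith
  qed
  \<comment> \<open>Fatou's lemma along the pointwise limit, with the bound for the truncations that
    Plancherel's inequality gives uniformly in \<open>k\<close>.\<close>
  have nnL: "(\<integral>\<^sup>+x. ennreal (indicator \<Omega> x *\<^sub>R (norm (L x))\<^sup>2) \<partial>lborel) \<le> ennreal (LINT \<xi>|lborel. (norm (g \<xi>))\<^sup>2)"
  proof -
    have "(\<integral>\<^sup>+x. ennreal (indicator \<Omega> x *\<^sub>R (norm (L x))\<^sup>2) \<partial>lborel)
      = (\<integral>\<^sup>+x. liminf (\<lambda>k. ennreal (indicator \<Omega> x *\<^sub>R (norm (G k x))\<^sup>2)) \<partial>lborel)"
    proof (rule nn_integral_cong_AE)
      show "AE x in lborel. ennreal (indicator \<Omega> x *\<^sub>R (norm (L x))\<^sup>2) = liminf (\<lambda>k. ennreal (indicator \<Omega> x *\<^sub>R (norm (G k x))\<^sup>2))"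
        using lim
      proof eventually_elim
        case (elim x)
        have "(\<lambda>k. ennreal (indicator \<Omega> x *\<^sub>R (norm (G k x))\<^sup>2)) \<longlonglongrightarrow> ennreal (indicator \<Omega> x *\<^sub>R (norm (L x))\<^sup>2)"
        proof (cases "x \<in> \<Omega>")
          case True
          then have "(\<lambda>k. G k x) \<longlonglongrightarrow> L x" using elim by simp
          then show ?thesis by (intro tendsto_ennrealI tendsto_scaleR tendsto_const tendsto_power tendsto_norm)
        qed simp
        then show ?case by (intro lim_imp_Liminf[symmetric]) auto
      qed
    qed
    also have "\<dots> \<le> liminf (\<lambda>k. \<integral>\<^sup>+x. ennreal (indicator \<Omega> x *\<^sub>R (norm (G k x))\<^sup>2) \<partial>lborel)"
      by (rule nn_integral_liminf) measurable
    also have "\<dots> \<le> liminf (\<lambda>k::nat. ennreal (LINT \<xi>|lborel. (norm (g \<xi>))\<^sup>2))"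
    proof (rule Liminf_mono, rule always_eventually, rule allI)
      fix k
      have "(\<integral>\<^sup>+x. ennreal (indicator \<Omega> x *\<^sub>R (norm (G k x))\<^sup>2) \<partial>lborel) \<le> (\<integral>\<^sup>+x. ennreal ((norm (G k x))\<^sup>2) \<partial>lborel)"
        by (intro nn_integral_mono ennreal_leI) (simp add: indicator_def)
      also have "\<dots> = ennreal (LINT x|lborel. (norm (G k x))\<^sup>2)"
        by (intro nn_integral_eq_integral Gsq) simp
      also have "\<dots> \<le> ennreal (LINT \<xi>|lborel. (norm (g \<xi>))\<^sup>2)"
        by (intro ennreal_leI Gsq)
      finally show "(\<integral>\<^sup>+x. ennreal (indicator \<Omega> x *\<^sub>R (norm (G k x))\<^sup>2) \<partial>lborel) \<le> ennreal (LINT \<xi>|lborel. (norm (g \<xi>))\<^sup>2)" .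
    qed
    also have "\<dots> = ennreal (LINT \<xi>|lborel. (norm (g \<xi>))\<^sup>2)" by (simp add: Liminf_const)
    finally show ?thesis .
  qed
  have L2: "set_integrable lborel \<Omega> (\<lambda>x. (norm (L x))\<^sup>2)"
    unfolding set_integrable_def
    using nnL by (intro integrableI_bounded) (auto intro: le_less_trans)
  have Lle: "(LINT x:\<Omega>|lborel. (norm (L x))\<^sup>2) \<le> (LINT \<xi>|lborel. (norm (g \<xi>))\<^sup>2)"
  proof -
    have "ennreal (LINT x:\<Omega>|lborel. (norm (L x))\<^sup>2) \<le> ennreal (LINT \<xi>|lborel. (norm (g \<xi>))\<^sup>2)"
      using nnL nn_integral_eq_integral[OF L2[unfolded set_integrable_def]]
      by (simp add: set_lebesgue_integral_def)
    moreover have "0 \<le> (LINT \<xi>|lborel. (norm (g \<xi>))\<^sup>2)" by (intro integral_nonneg_AE) auto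
    ultimately show ?thesis by (simp only: ennreal_le_iff)
  qed
  \<comment> \<open>Both sides are limits along the truncations: on the left a telescoping series is
    integrated term by term, on the right dominated convergence acts on the frequencies.\<close>
  have test: "(LINT x:\<Omega>|lborel. L x * f x) = (LINT \<xi>|lborel. g \<xi> * fourier f (- \<xi>))" if f: "f \<in> test_fun \<Omega>" for f
  proof -
    have fs: "f \<in> schwartz" using f by (rule test_fun_schwartz)
    have [measurable]: "f \<in> borel_measurable borel" using fs by (rule schwartz_measurable)
    obtain B where B: "\<And>x. norm (f x) \<le> B" using rapid_bounded[OF schwartz_rapid[OF fs]] by blast
    have B0: "0 \<le> B" using order_trans[OF norm_ge_zero B] .
    have f0: "x \<notin> \<Omega> \<Longrightarrow> f x = 0" for x by (rule test_fun_outside[OF f])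
    let ?h = "\<lambda>\<xi>. fourier f (- \<xi>)"
    have hs: "?h \<in> schwartz" by (intro schwartz_reflect fourier_schwartz fs)
    have [measurable]: "?h \<in> borel_measurable borel" using hs by (rule schwartz_measurable)
    have Gi: "integrable lborel (\<lambda>x. G k x * f x)" for k
    proof (rule Bochner_Integration.integrable_bound)
      show "integrable lborel (\<lambda>x. (norm (G k x))\<^sup>2 + (norm (f x))\<^sup>2)"
        by (intro Bochner_Integration.integrable_add Gsq schwartz_square_integrable fs)
      show "AE x in lborel. norm (G k x * f x) \<le> norm ((norm (G k x))\<^sup>2 + (norm (f x))\<^sup>2)"
        by (intro AE_I2) (simp add: norm_mult product_le_sum_squares)
    qed measurable
    have Gval: "(LINT x|lborel. G k x * f x) = (LINT \<xi>|lborel. c k \<xi> * ?h \<xi>)" for k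
      unfolding G_def by (rule fourier_reflected_swap[OF c(1) fs])
    have lim1: "(\<lambda>k. LINT \<xi>|lborel. c k \<xi> * ?h \<xi>) \<longlonglongrightarrow> (LINT \<xi>|lborel. g \<xi> * ?h \<xi>)"
    proof (rule integral_dominated_convergence)
      show "integrable lborel (\<lambda>\<xi>. (norm (g \<xi>))\<^sup>2 + (norm (?h \<xi>))\<^sup>2)"
        by (intro Bochner_Integration.integrable_add g2 schwartz_square_integrable hs)
      show "AE \<xi> in lborel. norm (c k \<xi> * ?h \<xi>) \<le> (norm (g \<xi>))\<^sup>2 + (norm (?h \<xi>))\<^sup>2" for k
        by (intro AE_I2) (auto simp: norm_mult c_def indicator_def product_le_sum_squares)
      show "AE \<xi> in lborel. (\<lambda>k. c k \<xi> * ?h \<xi>) \<longlonglongrightarrow> g \<xi> * ?h \<xi>"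
      proof (intro AE_I2 tendsto_mult tendsto_const)
        fix \<xi> :: 'a
        obtain N where N: "norm \<xi> < 2 ^ N" using real_arch_pow[of 2 "norm \<xi>"] by auto
        have "c k \<xi> = g \<xi>" if "k \<ge> N" for k
        proof -
          have "(2::real) ^ N \<le> 2 ^ k" using that by simp
          with N have "norm \<xi> \<le> 2 ^ k" by linarith
          then show ?thesis by (simp add: c_def)
        qed
        then show "(\<lambda>k. c k \<xi>) \<longlonglongrightarrow> g \<xi>"
          by (intro tendsto_eventually) (auto simp: eventually_sequentially)
      qed
    qed measurable
    have Ffi: "integrable lborel (\<lambda>x. F k x * f x)" for k
      by (rule integrable_mult_schwartz[OF Fi fs])
    have AEf: "AE x in lborel. summable (\<lambda>k. norm (F k x * f x))"
      using AEsum by eventually_elim (simp add: norm_mult summable_mult2)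
    have sumf: "summable (\<lambda>k. LINT x|lborel. norm (F k x * f x))"
    proof (rule summable_comparison_test'[where N = 0])
      show "summable (\<lambda>k. (LINT x|lborel. norm (F k x)) * B)" by (intro summable_mult2 sumF)
      fix k
      have "(LINT x|lborel. norm (F k x * f x)) \<le> (LINT x|lborel. norm (F k x) * B)"
        using Fi[of k] by (intro integral_mono integrable_norm Ffi) (auto simp: norm_mult intro!: mult_left_mono B)
      then show "norm (LINT x|lborel. norm (F k x * f x)) \<le> (LINT x|lborel. norm (F k x)) * B"
        by (simp add: abs_of_nonneg integral_nonneg_AE)
    qed
    have "(\<lambda>k. LINT x|lborel. F k x * f x) sums (LINT x|lborel. (\<Sum>k. F k x * f x))"
      by (rule sums_integral[OF Ffi AEf sumf])
    then have "(\<lambda>k. \<Sum>i<k. LINT x|lborel. F i x * f x) \<longlonglongrightarrow> (LINT x|lborel. (\<Sum>k. F k x * f x))"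
      by (simp add: sums_def)
    moreover have "(\<Sum>i<k. LINT x|lborel. F i x * f x) = (LINT x|lborel. G k x * f x) - (LINT x|lborel. G 0 x * f x)" for k
    proof -
      have "(\<Sum>i<k. LINT x|lborel. F i x * f x) = (LINT x|lborel. (\<Sum>i<k. F i x * f x))"
        by (intro Bochner_Integration.integral_sum[symmetric] Ffi)
      also have "\<dots> = (LINT x|lborel. G k x * f x - G 0 x * f x)"
      proof (intro Bochner_Integration.integral_cong refl)
        fix x
        show "(\<Sum>i<k. F i x * f x) = G k x * f x - G 0 x * f x"
          unfolding sum_distrib_right[symmetric] part using f0[of x] by (cases "x \<in> \<Omega>") (auto simp: algebra_simps)
      qed
      also have "\<dots> = (LINT x|lborel. G k x * f x) - (LINT x|lborel. G 0 x * f x)"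
        by (intro Bochner_Integration.integral_diff Gi)
      finally show ?thesis .
    qed
    ultimately have "(\<lambda>k. (LINT x|lborel. G k x * f x) - (LINT x|lborel. G 0 x * f x)) \<longlonglongrightarrow> (LINT x|lborel. (\<Sum>k. F k x * f x))"
      by simp
    moreover have "(\<lambda>k. (LINT x|lborel. G k x * f x) - (LINT x|lborel. G 0 x * f x))
        \<longlonglongrightarrow> (LINT \<xi>|lborel. g \<xi> * ?h \<xi>) - (LINT x|lborel. G 0 x * f x)"
      unfolding Gval by (intro tendsto_diff tendsto_const lim1)
    ultimately have eq: "(LINT x|lborel. (\<Sum>k. F k x * f x)) = (LINT \<xi>|lborel. g \<xi> * ?h \<xi>) - (LINT x|lborel. G 0 x * f x)"
      using LIMSEQ_unique by blast
    have "(LINT x:\<Omega>|lborel. L x * f x) = (LINT x|lborel. G 0 x * f x + (\<Sum>k. F k x * f x))"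
      unfolding set_lebesgue_integral_def
    proof (rule integral_cong_AE)
      show "AE x in lborel. indicator \<Omega> x *\<^sub>R (L x * f x) = G 0 x * f x + (\<Sum>k. F k x * f x)"
        using AEsum
      proof eventually_elim
        case (elim x)
        have "(\<Sum>k. F k x * f x) = (\<Sum>k. F k x) * f x"
          by (rule suminf_mult2[symmetric, OF summable_norm_cancel[OF elim]])
        then show ?case using f0[of x] by (cases "x \<in> \<Omega>") (auto simp: L_def algebra_simps)
      qed
    qed measurable
    also have "\<dots> = (LINT x|lborel. G 0 x * f x) + (LINT x|lborel. (\<Sum>k. F k x * f x))"
      by (intro Bochner_Integration.integral_add Gi integrable_suminf Ffi AEf sumf)
    finally show ?thesis unfolding eq by simp
  qed
  show ?thesis by (rule that[OF Lm L2 Lle test])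
qed

text \<open>The ranges \<open>t < 1 / w\<close> and \<open>t \<ge> 1 / w\<close> contribute
  \<open>w\<close> each. The total is linear in \<open>w\<close>, so
  \<open>w = 1 + norm \<xi>^2\<close> reproduces exactly the weight of H^1.\<close>

lemma truncation_integral:
  fixes w :: real
  assumes w: "w > 0"
  shows "has_bochner_integral lborel (\<lambda>t. indicator {0<..} t * ((if t * w < 1 then (t * w)\<^sup>2 else 1) / t\<^sup>2)) (2 * w)"
proof -
  have "has_bochner_integral lborel (\<lambda>t::real. indicator {0<..<1/w} t * w\<^sup>2) (measure lborel {0<..<1/w} * w\<^sup>2)"
    using w by (intro has_bochner_integral_mult_left has_bochner_integral_real_indicator) auto
  then have 1: "has_bochner_integral lborel (\<lambda>t::real. indicator {0<..<1/w} t * w\<^sup>2) w"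
    using w by (simp add: power2_eq_square)
  have hi: "((\<lambda>t. t powr (-2)) has_integral - ((1/w) powr (-2 + 1)) / (-2 + 1)) {1/w..}"
    using w by (intro has_integral_powr_to_inf) auto
  have si: "set_integrable lborel {1/w..} (\<lambda>t. t powr (-2))"
    using hi by (intro set_integrable_lborel_nonneg) (auto simp: integrable_on_def)
  have "(LINT t:{1/w..}|lborel. t powr (-2)) = w"
    using set_borel_integral_eq_integral(2)[OF si] integral_unique[OF hi] w
    by (simp add: powr_neg_one)
  then have 2: "has_bochner_integral lborel (\<lambda>t. indicator {1/w..} t * t powr (-2)) w"
    using si by (simp add: has_bochner_integral_iff set_integrable_def set_lebesgue_integral_def)
  have "indicator {0<..} t * ((if t * w < 1 then (t * w)\<^sup>2 else 1) / t\<^sup>2)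
      = indicator {0<..<1/w} t * w\<^sup>2 + indicator {1/w..} t * t powr (-2)" for t :: real
  proof (cases "t > 0")
    case True
    have "t powr (-2) = 1 / t\<^sup>2"
      using True powr_realpow[OF True, of 2] by (simp add: powr_minus divide_inverse)
    moreover have "t * w < 1 \<longleftrightarrow> t < 1 / w" using w by (simp add: field_simps)
    ultimately show ?thesis using True by (auto simp: indicator_def power_mult_distrib)
  next
    case False
    then have "\<not> 1 / w \<le> t" using w by (smt (verit) divide_pos_pos)
    then show ?thesis using False by (simp add: indicator_def)
  qed
  then show ?thesis
    using has_bochner_integral_add[OF 1 2] by simp
qed

text \<open>For given \<open>t\<close> the extension is split at the frequencies where \<open>t (1 + norm \<xi>\<^sup>2) = 1\<close>.\<close>

theorem H1_subset_interp:
  fixes \<Omega> :: "'a::euclidean_space set"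
  assumes \<Omega>: "open \<Omega>" and fin: "emeasure lborel \<Omega> < \<infinity>"
  shows "carrier (sobolev \<Omega> 1) \<subseteq> carrier (interp (L2 \<Omega>) (sobolev \<Omega> 2) (1 / 2))"
proof
  fix u assume "u \<in> carrier (sobolev \<Omega> 1)"
  then obtain U where U: "U \<in> carrier (sobolev_space 1)" and u: "u = restrict_distr \<Omega> U"
    by (auto simp: sobolev_def)
  then obtain g where g: "weighted_density 1 (fourier_distr U) g"
    by (auto simp: sobolev_space_def)
  have gm [measurable]: "g \<in> borel_measurable borel"
    using g by (simp add: weighted_density_def)
  define w where "w = (\<lambda>\<xi>::'a. 1 + (norm \<xi>)\<^sup>2)"
  have w1: "1 \<le> w \<xi>" for \<xi> by (simp add: w_def)
  have w0: "0 < w \<xi>" for \<xi> using w1[of \<xi>] by linarith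
  have wm [measurable]: "w \<in> borel_measurable borel" unfolding w_def by measurable
  have wg: "integrable lborel (\<lambda>\<xi>. w \<xi> * (norm (g \<xi>))\<^sup>2)"
  proof -
    have "integrable lborel (\<lambda>\<xi>. (1 + (norm \<xi>)\<^sup>2) powr 1 * (norm (g \<xi>))\<^sup>2)"
      using g by (simp add: weighted_density_def)
    moreover have "(1 + (norm \<xi>)\<^sup>2) powr 1 = w \<xi>" for \<xi> using w0[of \<xi>] by (simp add: w_def)
    ultimately show ?thesis by simp
  qed
  have g2: "integrable lborel (\<lambda>\<xi>. (norm (g \<xi>))\<^sup>2)"
  proof (rule Bochner_Integration.integrable_bound[OF wg])
    show "AE \<xi> in lborel. norm ((norm (g \<xi>))\<^sup>2) \<le> norm (w \<xi> * (norm (g \<xi>))\<^sup>2)"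
    proof (rule AE_I2)
      fix \<xi>
      have "1 * (norm (g \<xi>))\<^sup>2 \<le> w \<xi> * (norm (g \<xi>))\<^sup>2" by (intro mult_right_mono w1) simp
      then show "norm ((norm (g \<xi>))\<^sup>2) \<le> norm (w \<xi> * (norm (g \<xi>))\<^sup>2)" by simp
    qed
  qed measurable
  \<comment> \<open>The cost at \<open>t\<close> of one unit of
    \<open>(norm (g \<xi>))\<^sup>2\<close>: it is 1 where the frequency goes to the L^2 part, and
    \<open>(t * w \<xi>)\<^sup>2\<close> where it goes to the H^2 part.\<close>
  define m where "m = (\<lambda>t \<xi>. if t * w \<xi> < 1 then (t * w \<xi>)\<^sup>2 else 1)"
  have mm [measurable]: "(\<lambda>(\<xi>, t). m t \<xi>) \<in> borel_measurable (lborel \<Otimes>\<^sub>M lborel)"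
    unfolding m_def by measurable
  have m0: "0 \<le> m t \<xi>" for t \<xi> by (simp add: m_def)
  define \<Phi> where "\<Phi> = (\<lambda>t. LINT \<xi>|lborel. (norm (g \<xi>))\<^sup>2 * m t \<xi>)"
  have uf: "u f = (LINT \<xi>|lborel. g \<xi> * fourier f (- \<xi>))"
    "integrable lborel (\<lambda>\<xi>. g \<xi> * fourier f (- \<xi>))" if f: "f \<in> test_fun \<Omega>" for f
  proof -
    have fs: "f \<in> schwartz" using f by (rule test_fun_schwartz)
    have hs: "(\<lambda>\<xi>. fourier f (- \<xi>)) \<in> schwartz" by (intro schwartz_reflect fourier_schwartz fs)
    have "fourier (\<lambda>\<xi>. fourier f (- \<xi>)) = f"
      using fourier_reflected_inversion[OF fs] by blast
    then have "u f = fourier_distr U (\<lambda>\<xi>. fourier f (- \<xi>))"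
      using f hs by (simp add: u restrict_distr_def fourier_distr_def)
    then show "u f = (LINT \<xi>|lborel. g \<xi> * fourier f (- \<xi>))"
      using g hs by (simp add: weighted_density_def)
    show "integrable lborel (\<lambda>\<xi>. g \<xi> * fourier f (- \<xi>))"
      using g hs by (simp add: weighted_density_def)
  qed
  show "u \<in> carrier (interp (L2 \<Omega>) (sobolev \<Omega> 2) (1 / 2))"
  proof (rule interp_half_memI[where \<Phi> = \<Phi>])
    fix t :: real assume t: "t > 0"
    define A where "A = {\<xi>::'a. t * w \<xi> < 1}"
    have Am [measurable]: "A \<in> sets borel" unfolding A_def by measurable
    have Ab: "A \<subseteq> cball 0 (sqrt (1 / t))"
    proof
      fix \<xi> assume "\<xi> \<in> A"
      then have "(norm \<xi>)\<^sup>2 \<le> 1 / t" using t by (simp add: A_def w_def field_simps)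
      then show "\<xi> \<in> cball 0 (sqrt (1 / t))" using real_le_rsqrt by auto
    qed
    define g1 where "g1 = (\<lambda>\<xi>. indicator A \<xi> *\<^sub>R g \<xi>)"
    define g0 where "g0 = (\<lambda>\<xi>. indicator (- A) \<xi> *\<^sub>R g \<xi>)"
    have [measurable]: "g0 \<in> borel_measurable borel" "g1 \<in> borel_measurable borel"
      unfolding g0_def g1_def by measurable
    have g1: "integrable lborel g1"
      unfolding g1_def by (rule low_frequency_integrable(1)[OF gm Am Ab g2])
    have p2: "(1 + (norm \<xi>)\<^sup>2) powr 2 = (w \<xi>)\<^sup>2" for \<xi>
      using w0[of \<xi>] by (simp add: w_def)
    have le1: "(w \<xi>)\<^sup>2 * (norm (g1 \<xi>))\<^sup>2 \<le> (1 / t) * (w \<xi> * (norm (g \<xi>))\<^sup>2)" for \<xi>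
    proof (cases "\<xi> \<in> A")
      case True
      then have "w \<xi> \<le> 1 / t" using t by (simp add: A_def field_simps)
      then have "w \<xi> * (w \<xi> * (norm (g \<xi>))\<^sup>2) \<le> (1 / t) * (w \<xi> * (norm (g \<xi>))\<^sup>2)"
        using w0[of \<xi>] by (intro mult_right_mono) auto
      then show ?thesis using True by (simp add: g1_def power2_eq_square mult.assoc)
    next
      case False
      then show ?thesis using t w0[of \<xi>] by (simp add: g1_def)
    qed
    have w1i: "integrable lborel (\<lambda>\<xi>. (w \<xi>)\<^sup>2 * (norm (g1 \<xi>))\<^sup>2)"
      by (rule Bochner_Integration.integrable_bound[OF integrable_mult_right[OF wg, of "1 / t"]])
         (measurable, intro AE_I2, unfold real_norm_def, rule order_trans[OF _ abs_ge_self],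
          simp only: abs_of_nonneg mult_nonneg_nonneg zero_le_power2, rule le1)
    define u1 where "u1 = restrict_distr \<Omega> (fun_distr (\<lambda>x. fourier g1 (- x)))"
    have u1: "u1 \<in> carrier (sobolev \<Omega> 2)"
      "(nrm (sobolev \<Omega> 2) u1)\<^sup>2 \<le> (LINT \<xi>|lborel. (w \<xi>)\<^sup>2 * (norm (g1 \<xi>))\<^sup>2)"
      and u1f: "\<And>f. f \<in> test_fun \<Omega> \<Longrightarrow> u1 f = (LINT \<xi>|lborel. g1 \<xi> * fourier f (- \<xi>))"
      using sobolev_inverse_fourier[OF g1, where s = 2 and \<Omega> = \<Omega>] w1i unfolding p2 u1_def by auto
    \<comment> \<open>The high frequencies \<open>g0\<close> need not be integrable, so their part
      cannot come from \<open>sobolev_inverse_fourier\<close>; the H^1 weight is retained in order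
      to apply \<open>H1_L2_density\<close>.\<close>
    have w0i: "integrable lborel (\<lambda>\<xi>. (1 + (norm \<xi>)\<^sup>2) * (norm (g0 \<xi>))\<^sup>2)"
    proof (rule Bochner_Integration.integrable_bound[OF wg])
      show "AE \<xi> in lborel. norm ((1 + (norm \<xi>)\<^sup>2) * (norm (g0 \<xi>))\<^sup>2) \<le> norm (w \<xi> * (norm (g \<xi>))\<^sup>2)"
        by (intro AE_I2) (auto simp: g0_def w_def indicator_def)
    qed measurable
    obtain G where G: "G \<in> borel_measurable borel" "set_integrable lborel \<Omega> (\<lambda>x. (norm (G x))\<^sup>2)"
      "(LINT x:\<Omega>|lborel. (norm (G x))\<^sup>2) \<le> (LINT \<xi>|lborel. (norm (g0 \<xi>))\<^sup>2)"
      and Gf: "\<And>f. f \<in> test_fun \<Omega> \<Longrightarrow> (LINT x:\<Omega>|lborel. G x * f x) = (LINT \<xi>|lborel. g0 \<xi> * fourier f (- \<xi>))"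
      using H1_L2_density[of g0, OF _ w0i \<Omega> fin] by auto
    define u0 where "u0 = (\<lambda>f. if f \<in> test_fun \<Omega> then LINT x:\<Omega>|lborel. G x * f x else 0)"
    have dens: "L2_density \<Omega> u0 G" using G by (simp add: L2_density_def u0_def)
    have u0: "u0 \<in> carrier (L2 \<Omega>)" using dens by (auto simp: L2_def)
    have "0 \<le> (LINT x:\<Omega>|lborel. (norm (G x))\<^sup>2)"
      unfolding set_lebesgue_integral_def by (intro integral_nonneg_AE) auto
    then have u0n: "(nrm (L2 \<Omega>) u0)\<^sup>2 \<le> (LINT \<xi>|lborel. (norm (g0 \<xi>))\<^sup>2)"
      unfolding nrm_L2[OF \<Omega> fin dens] using G(3) by simp
    have sum: "u0 + u1 = u"
    proof
      fix f
      show "(u0 + u1) f = u f"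
      proof (cases "f \<in> test_fun \<Omega>")
        case True
        have hm [measurable]: "(\<lambda>\<xi>. fourier f (- \<xi>)) \<in> borel_measurable borel"
          using schwartz_measurable[OF test_fun_schwartz[OF True]] by measurable
        have i: "integrable lborel (\<lambda>\<xi>. indicator B \<xi> *\<^sub>R g \<xi> * fourier f (- \<xi>))" if "B \<in> sets borel" for B
          using integrable_mult_indicator[OF _ uf(2)[OF True], of B] that by simp
        have "(u0 + u1) f = (LINT \<xi>|lborel. g0 \<xi> * fourier f (- \<xi>)) + (LINT \<xi>|lborel. g1 \<xi> * fourier f (- \<xi>))"
          using True by (simp add: u0_def Gf u1f)
        also have "\<dots> = (LINT \<xi>|lborel. g0 \<xi> * fourier f (- \<xi>) + g1 \<xi> * fourier f (- \<xi>))"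
          unfolding g0_def g1_def by (rule Bochner_Integration.integral_add[symmetric]; rule i; measurable)
        also have "\<dots> = (LINT \<xi>|lborel. g \<xi> * fourier f (- \<xi>))"
          by (intro Bochner_Integration.integral_cong refl) (simp add: g0_def g1_def indicator_def)
        finally show ?thesis by (simp add: uf(1)[OF True])
      next
        case False
        then show ?thesis by (simp add: u0_def u1_def u restrict_distr_def)
      qed
    qed
    have g0i: "integrable lborel (\<lambda>\<xi>. (norm (g0 \<xi>))\<^sup>2)"
      by (rule Bochner_Integration.integrable_bound[OF g2]) (measurable, auto simp: g0_def indicator_def)
    have \<Phi>: "(LINT \<xi>|lborel. (norm (g0 \<xi>))\<^sup>2) + t\<^sup>2 * (LINT \<xi>|lborel. (w \<xi>)\<^sup>2 * (norm (g1 \<xi>))\<^sup>2) = \<Phi> t"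
    proof -
      have "(LINT \<xi>|lborel. (norm (g0 \<xi>))\<^sup>2) + t\<^sup>2 * (LINT \<xi>|lborel. (w \<xi>)\<^sup>2 * (norm (g1 \<xi>))\<^sup>2)
        = (LINT \<xi>|lborel. (norm (g0 \<xi>))\<^sup>2 + t\<^sup>2 * ((w \<xi>)\<^sup>2 * (norm (g1 \<xi>))\<^sup>2))"
        using g0i w1i by (subst Bochner_Integration.integral_add) auto
      also have "\<dots> = \<Phi> t"
        unfolding \<Phi>_def
        by (intro Bochner_Integration.integral_cong refl)
           (simp add: g0_def g1_def m_def A_def indicator_def power_mult_distrib)
      finally show ?thesis .
    qed
    have "(nrm (L2 \<Omega>) u0)\<^sup>2 + t\<^sup>2 * (nrm (sobolev \<Omega> 2) u1)\<^sup>2 \<le> \<Phi> t"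
      unfolding \<Phi>[symmetric] by (intro add_mono u0n mult_left_mono u1) simp
    with u0 u1(1) sum show "\<exists>\<phi>\<^sub>0\<in>carrier (L2 \<Omega>). \<exists>\<phi>\<^sub>1\<in>carrier (sobolev \<Omega> 2). \<phi>\<^sub>0 + \<phi>\<^sub>1 = u \<and>
      (nrm (L2 \<Omega>) \<phi>\<^sub>0)\<^sup>2 + t\<^sup>2 * (nrm (sobolev \<Omega> 2) \<phi>\<^sub>1)\<^sup>2 \<le> \<Phi> t"
      by blast
  next
    let ?F = "\<lambda>\<xi> t. (norm (g \<xi>))\<^sup>2 * (indicator {0<..} t * (m t \<xi> / t\<^sup>2))"
    have tr: "has_bochner_integral lborel (\<lambda>t. indicator {0<..} t * (m t \<xi> / t\<^sup>2)) (2 * w \<xi>)" for \<xi>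
      unfolding m_def by (rule truncation_integral[OF w0])
    \<comment> \<open>Integrating over \<open>t\<close> first gives
      \<open>2 * w \<xi> * (norm (g \<xi>))\<^sup>2\<close>, which is integrable; exchanging the
      order yields integrability of \<open>\<Phi> t / t\<^sup>2\<close>.\<close>
    have "integrable (lborel \<Otimes>\<^sub>M lborel) (\<lambda>(\<xi>, t). ?F \<xi> t)"
    proof (rule lborel_pair.Fubini_integrable)
      have n: "norm (case (\<xi>, t) of (\<xi>, t) \<Rightarrow> ?F \<xi> t) = ?F \<xi> t" for \<xi> t
        using m0[of t \<xi>] by simp
      have "(LINT t|lborel. ?F \<xi> t) = 2 * (w \<xi> * (norm (g \<xi>))\<^sup>2)" for \<xi>
        unfolding integral_mult_right_zero has_bochner_integral_integral_eq[OF tr] by simp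
      then show "integrable lborel (\<lambda>\<xi>. LINT t|lborel. norm (case (\<xi>, t) of (\<xi>, t) \<Rightarrow> ?F \<xi> t))"
        unfolding n using wg by simp
      show "AE \<xi> in lborel. integrable lborel (\<lambda>t. case (\<xi>, t) of (\<xi>, t) \<Rightarrow> ?F \<xi> t)"
        unfolding case_prod_conv
        by (intro AE_I2 integrable_mult_right integrable.intros[OF tr])
    qed measurable
    from lborel_pair.integrable_fst'[OF lborel_pair.integrable_product_swap[OF this]]
    have "integrable lborel (\<lambda>t. LINT \<xi>|lborel. ?F \<xi> t)" by simp
    moreover have "(LINT \<xi>|lborel. ?F \<xi> t) = indicator {0<..} t *\<^sub>R (\<Phi> t / t\<^sup>2)" for t
    proof -
      have "(LINT \<xi>|lborel. ?F \<xi> t) = (LINT \<xi>|lborel. (indicator {0<..} t / t\<^sup>2) * ((norm (g \<xi>))\<^sup>2 * m t \<xi>))"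
        by (simp add: mult_ac)
      also have "\<dots> = indicator {0<..} t *\<^sub>R (\<Phi> t / t\<^sup>2)"
        unfolding integral_mult_right_zero \<Phi>_def by simp
      finally show ?thesis .
    qed
    ultimately show "set_integrable lborel {0<..} (\<lambda>t. \<Phi> t / t\<^sup>2)"
      by (simp only: set_integrable_def)
  qed
qed

section \<open>Hypographs\<close>

lemma holder_on_imp_continuous_on:
  assumes "holder_on \<beta> S f" "\<beta> > 0"
  shows "continuous_on S f"
proof -
  obtain C where C: "\<And>y z. y \<in> S \<Longrightarrow> z \<in> S \<Longrightarrow> \<bar>f y - f z\<bar> \<le> C * dist y z powr \<beta>"
    using assms(1) unfolding holder_on_def by blast
  show ?thesis
    unfolding continuous_on_def
  proof
    fix x assume x: "x \<in> S"
    have "((\<lambda>y. f y - f x) \<longlongrightarrow> 0) (at x within S)"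
    proof (rule Lim_null_comparison)
      show "\<forall>\<^sub>F y in at x within S. norm (f y - f x) \<le> C * dist y x powr \<beta>"
        using C x by (auto simp: eventually_at_filter intro!: always_eventually)
      have "((\<lambda>y. dist y x) \<longlongrightarrow> dist x x) (at x within S)"
        by (intro tendsto_intros)
      then have "((\<lambda>y. dist y x powr \<beta>) \<longlongrightarrow> 0) (at x within S)"
        using assms(2) by (intro tendsto_zero_powrI[where b = \<beta>]) auto
      then show "((\<lambda>y. C * dist y x powr \<beta>) \<longlongrightarrow> 0) (at x within S)"
        by (rule tendsto_mult_right_zero)
    qed
    then show "(f \<longlongrightarrow> f x) (at x within S)" by (rule LIM_zero_cancel)
  qed
qed

text \<open>The sign of the gap \<open>h\<close> between graph and point decides: where it is
  positive or negative, a whole neighbourhood lies inside or outside \<open>\<Omega>\<close>, and a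
  point on the graph is approached from inside by moving along \<open>- e\<close>, which leaves its
  projection unchanged. Hence a chart has to describe \<open>\<Omega>\<close> alone.\<close>

lemma frontier_hypograph:
  fixes e :: "'a::euclidean_space"
  assumes V: "open V" and e: "norm e = 1" and f: "continuous_on {z. z \<bullet> e = 0} f"
    and \<Omega>: "\<Omega> \<inter> V = {y \<in> V. y \<bullet> e < f (y - (y \<bullet> e) *\<^sub>R e)}"
  shows "frontier \<Omega> \<inter> V = {y \<in> V. y \<bullet> e = f (y - (y \<bullet> e) *\<^sub>R e)}"
proof -
  define h where "h = (\<lambda>y. f (y - (y \<bullet> e) *\<^sub>R e) - y \<bullet> e)"
  have ee: "e \<bullet> e = 1" using e by (simp add: norm_eq_1)
  have h: "continuous_on UNIV h"
    unfolding h_def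
    by (intro continuous_intros continuous_on_compose2[OF f]) (auto simp: inner_diff_left ee)
  have \<Omega>h: "y \<in> \<Omega> \<longleftrightarrow> 0 < h y" if "y \<in> V" for y
    using \<Omega> that by (auto simp: h_def)
  have pos: "open (V \<inter> {y. 0 < h y})" and neg: "open (V \<inter> {y. h y < 0})"
    using V h by (auto intro!: open_Int open_Collect_less continuous_intros)
  have fr: "h y = 0 \<longleftrightarrow> y \<in> frontier \<Omega>" if y: "y \<in> V" for y
  proof
    assume fr: "y \<in> frontier \<Omega>"
    have "\<not> 0 < h y"
    proof
      assume "0 < h y"
      then have "y \<in> interior \<Omega>"
        using pos y \<Omega>h by (intro interiorI[of "V \<inter> {y. 0 < h y}"]) auto
      with fr show False by (simp add: frontier_def)
    qed
    moreover have "\<not> h y < 0"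
    proof
      assume "h y < 0"
      have "\<Omega> \<inter> (V \<inter> {y. h y < 0}) = {}" using \<Omega>h by force
      then have "closure \<Omega> \<inter> (V \<inter> {y. h y < 0}) = {}"
        using open_Int_closure_eq_empty[OF neg, of \<Omega>] by auto
      with fr \<open>h y < 0\<close> y show False by (auto simp: frontier_def)
    qed
    ultimately show "h y = 0" by simp
  next
    assume hy: "h y = 0"
    then have "y \<notin> \<Omega>" using \<Omega>h[OF y] by simp
    moreover have "y \<in> closure \<Omega>"
      unfolding closure_approachable
    proof (intro allI impI)
      fix r :: real assume r: "r > 0"
      obtain d where d: "d > 0" "ball y d \<subseteq> V" using V y by (meson openE)
      define s where "s = min r d / 2"
      have s: "0 < s" "s < r" "s < d" using r d by (auto simp: s_def)
      let ?z = "y - s *\<^sub>R e"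
      have dz: "dist ?z y = s" using s e by (simp add: dist_norm)
      then have "?z \<in> V" using d s by (auto simp: dist_commute)
      moreover have "h ?z = s"
      proof -
        have 1: "?z - (?z \<bullet> e) *\<^sub>R e = y - (y \<bullet> e) *\<^sub>R e"
          by (simp add: inner_diff_left ee scaleR_diff_left)
        have 2: "?z \<bullet> e = y \<bullet> e - s" by (simp add: inner_diff_left ee)
        have "h ?z = f (y - (y \<bullet> e) *\<^sub>R e) - (y \<bullet> e - s)"
          unfolding h_def 1 unfolding 2 ..
        then show ?thesis using hy by (simp add: h_def)
      qed
      ultimately have "?z \<in> \<Omega>" using s \<Omega>h[of ?z] by simp
      then show "\<exists>z\<in>\<Omega>. dist z y < r" using s dz by (intro bexI[of _ ?z]) (simp_all only:)
    qed
    ultimately show "y \<in> frontier \<Omega>" using interior_subset by (auto simp: frontier_def)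
  qed
  have "y \<in> frontier \<Omega> \<longleftrightarrow> y \<bullet> e = f (y - (y \<bullet> e) *\<^sub>R e)" if "y \<in> V" for y
    using fr[OF that] unfolding h_def by (metis right_minus_eq)
  then show ?thesis by blast
qed

text \<open>The local condition of \<open>locally_hypograph\<close> without its clause on the
  frontier, which \<open>frontier_hypograph\<close> restores.\<close>

definition holder_chart :: "real \<Rightarrow> 'a::euclidean_space set \<Rightarrow> 'a \<Rightarrow> bool" where
  "holder_chart \<beta> \<Omega> x \<longleftrightarrow> (\<exists>V e f. open V \<and> x \<in> V \<and> norm e = 1 \<and> holder_on \<beta> {z. z \<bullet> e = 0} f \<and>
     \<Omega> \<inter> V = {y \<in> V. y \<bullet> e < f (y - (y \<bullet> e) *\<^sub>R e)})"

lemma C0_holder_open_setI: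
  assumes "open \<Omega>" "bounded \<Omega>" "0 < \<beta>" "\<beta> \<le> 1" "\<And>x. x \<in> frontier \<Omega> \<Longrightarrow> holder_chart \<beta> \<Omega> x"
  shows "C0_holder_open_set \<beta> \<Omega>"
proof -
  have "\<exists>V e f. open V \<and> x \<in> V \<and> norm e = 1 \<and> P {z. z \<bullet> e = 0} f \<and>
     frontier \<Omega> \<inter> V = {y \<in> V. y \<bullet> e = f (y - (y \<bullet> e) *\<^sub>R e)} \<and>
     \<Omega> \<inter> V = {y \<in> V. y \<bullet> e < f (y - (y \<bullet> e) *\<^sub>R e)}"
    if x: "x \<in> frontier \<Omega>" and P: "\<And>S f. holder_on \<beta> S f \<Longrightarrow> P S f" for x P
  proof -
    obtain V e f where V: "open V" "x \<in> V" and e: "norm e = 1" and f: "holder_on \<beta> {z. z \<bullet> e = 0} f"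
      and \<Omega>: "\<Omega> \<inter> V = {y \<in> V. y \<bullet> e < f (y - (y \<bullet> e) *\<^sub>R e)}"
      using assms(5)[OF x] unfolding holder_chart_def by blast
    show ?thesis
      by (intro exI[of _ V] exI[of _ e] exI[of _ f] conjI V e \<Omega> P f
          frontier_hypograph[OF V(1) e holder_on_imp_continuous_on[OF f assms(3)] \<Omega>])
  qed
  then have "locally_hypograph P \<Omega>" if "\<And>S f. holder_on \<beta> S f \<Longrightarrow> P S f" for P
    unfolding locally_hypograph_def using that by blast
  then have "locally_hypograph continuous_on \<Omega>" "locally_hypograph (holder_on \<beta>) \<Omega>"
    using holder_on_imp_continuous_on[OF _ assms(3)] by blast+
  moreover have "bounded (frontier \<Omega>)"
    by (rule bounded_subset[OF bounded_closure[OF assms(2)]]) (simp add: frontier_def)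
  ultimately show ?thesis
    using assms by (simp add: C0_holder_open_set_def C0_open_set_def)
qed

section \<open>Charts from Lipschitz inequalities\<close>

text \<open>An implicit function theorem without derivatives: along \<open>e\<close> the function
  \<open>G\<close> grows at rate at least \<open>c\<close>, so it has one zero on every line in this
  direction, and a displacement of the line moves the zero by at most \<open>L / c\<close> times as
  much.\<close>

lemma implicit_lipschitz:
  fixes G :: "'a::euclidean_space \<Rightarrow> real"
  assumes lip: "\<And>x y. \<bar>G x - G y\<bar> \<le> L * dist x y"
    and inc: "\<And>x t. t \<ge> 0 \<Longrightarrow> G x + c * t \<le> G (x + t *\<^sub>R e)" and c: "c > 0"
  obtains f where "\<And>z z'. \<bar>f z - f z'\<bar> \<le> L / c * dist z z'" "\<And>z s. G (z + s *\<^sub>R e) < 0 \<longleftrightarrow> s < f z"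
proof -
  have cont: "continuous_on UNIV G"
  proof (rule continuous_onI)
    fix x :: 'a and \<epsilon> :: real assume "\<epsilon> > 0"
    have "dist (G y) (G x) \<le> \<epsilon>" if "dist y x < \<epsilon> / (\<bar>L\<bar> + 1)" for y
    proof -
      have "dist (G y) (G x) \<le> L * dist y x" using lip[of y x] by (simp add: dist_real_def)
      also have "\<dots> \<le> (\<bar>L\<bar> + 1) * dist y x" by (intro mult_right_mono) auto
      also have "\<dots> \<le> \<epsilon>" using that by (simp add: field_simps)
      finally show ?thesis .
    qed
    then show "\<exists>d>0. \<forall>x'\<in>UNIV. dist x' x < d \<longrightarrow> dist (G x') (G x) \<le> \<epsilon>"
      using \<open>\<epsilon> > 0\<close> by (intro exI[of _ "\<epsilon> / (\<bar>L\<bar> + 1)"]) auto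
  qed
  have smono: "G (z + s *\<^sub>R e) + c * (t - s) \<le> G (z + t *\<^sub>R e)" if "s \<le> t" for z s t
    using inc[of "t - s" "z + s *\<^sub>R e"] that by (simp add: algebra_simps)
  have "\<exists>s. G (z + s *\<^sub>R e) = 0" for z
  proof -
    \<comment> \<open>At rate \<open>c\<close> a change of sign must occur within distance
      \<open>\<bar>G z\<bar> / c\<close> of \<open>z\<close>.\<close>
    let ?M = "\<bar>G z\<bar> / c"
    have M: "0 \<le> ?M" "c * ?M = \<bar>G z\<bar>" using c by auto
    have lo: "G (z + (- ?M) *\<^sub>R e) \<le> 0" using smono[of "- ?M" 0 z] M by simp
    have hi: "0 \<le> G (z + ?M *\<^sub>R e)" using smono[of 0 ?M z] M by simp
    have "continuous_on {- ?M..?M} (\<lambda>s. G (z + s *\<^sub>R e))"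
      by (intro continuous_on_compose2[OF cont] continuous_intros) auto
    then show ?thesis using IVT'[of "\<lambda>s. G (z + s *\<^sub>R e)" "- ?M" 0 ?M] lo hi M by auto
  qed
  then obtain f where f: "\<And>z. G (z + f z *\<^sub>R e) = 0" by metis
  show ?thesis
  proof
    fix z s
    show "G (z + s *\<^sub>R e) < 0 \<longleftrightarrow> s < f z"
    proof
      assume "s < f z"
      then show "G (z + s *\<^sub>R e) < 0" using smono[of s "f z" z] f[of z] c
        by (smt (verit) mult_pos_pos)
    next
      assume *: "G (z + s *\<^sub>R e) < 0"
      show "s < f z"
      proof (rule ccontr)
        assume "\<not> s < f z"
        then have "0 \<le> c * (s - f z)" using c by simp
        then show False using smono[of "f z" s z] f[of z] * \<open>\<not> s < f z\<close> by simp
      qed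
    qed
  next
    have one: "f z' - f z \<le> L / c * dist z z'" for z z'
    proof (cases "f z \<le> f z'")
      case True
      have "G (z' + f z *\<^sub>R e) + c * (f z' - f z) \<le> 0" using smono[OF True, of z'] f[of z'] by simp
      moreover have "\<bar>G (z' + f z *\<^sub>R e) - G (z + f z *\<^sub>R e)\<bar> \<le> L * dist z z'"
        using lip[of "z' + f z *\<^sub>R e" "z + f z *\<^sub>R e"] by (simp add: dist_commute)
      ultimately have "c * (f z' - f z) \<le> L * dist z z'" using f[of z] by linarith
      then show ?thesis using c by (simp add: field_simps)
    next
      case False
      have "0 \<le> L * dist z z'" using lip[of z z'] by linarith
      then have "0 \<le> L / c * dist z z'" using c by simp
      then show ?thesis using False by linarith
    qed
    fix z z'
    show "\<bar>f z - f z'\<bar> \<le> L / c * dist z z'"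
      using one[of z z'] one[of z' z] by (simp add: abs_le_iff dist_commute)
  qed
qed

text \<open>A bounded Lipschitz function is Hoelder for every exponent in (0, 1]: the Lipschitz
  bound serves distances up to 1, the boundedness the larger ones.\<close>

lemma lipschitz_holder_chart:
  fixes G :: "'a::euclidean_space \<Rightarrow> real"
  assumes lip: "\<And>x y. \<bar>G x - G y\<bar> \<le> L * dist x y"
    and inc: "\<And>x t. t \<ge> 0 \<Longrightarrow> G x + c * t \<le> G (x + t *\<^sub>R e)" and c: "c > 0"
    and e: "norm e = 1" and V: "open V" "x \<in> V" and \<Omega>: "\<And>y. y \<in> V \<Longrightarrow> y \<in> \<Omega> \<longleftrightarrow> G y < 0"
    and \<beta>: "0 < \<beta>" "\<beta> \<le> 1"
  shows "holder_chart \<beta> \<Omega> x"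
proof -
  obtain f where f: "\<And>z z'. \<bar>f z - f z'\<bar> \<le> L / c * dist z z'" "\<And>z s. G (z + s *\<^sub>R e) < 0 \<longleftrightarrow> s < f z"
    using implicit_lipschitz[OF lip inc c] by blast
  define M where "M = \<bar>x \<bullet> e\<bar> + 1"
  \<comment> \<open>Clamping to [-M, M] makes the function bounded. It does not change the chart,
    because \<open>W\<close> only keeps points with
    \<open>\<bar>y \<bullet> e\<bar> < M\<close>.\<close>
  define g where "g = (\<lambda>z. max (- M) (min M (f z)))"
  define W where "W = V \<inter> {y. \<bar>y \<bullet> e\<bar> < M}"
  have M: "M > 0" by (simp add: M_def)
  have "open W" unfolding W_def by (intro open_Int V open_Collect_less continuous_intros)
  moreover have "x \<in> W" using V by (simp add: W_def M_def)
  moreover have "\<Omega> \<inter> W = {y \<in> W. y \<bullet> e < g (y - (y \<bullet> e) *\<^sub>R e)}"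
  proof -
    have "y \<in> \<Omega> \<longleftrightarrow> y \<bullet> e < g (y - (y \<bullet> e) *\<^sub>R e)" if y: "y \<in> W" for y
    proof -
      have "y \<in> \<Omega> \<longleftrightarrow> G ((y - (y \<bullet> e) *\<^sub>R e) + (y \<bullet> e) *\<^sub>R e) < 0" using \<Omega> y by (simp add: W_def)
      also have "\<dots> \<longleftrightarrow> y \<bullet> e < f (y - (y \<bullet> e) *\<^sub>R e)" by (rule f(2))
      also have "\<dots> \<longleftrightarrow> y \<bullet> e < g (y - (y \<bullet> e) *\<^sub>R e)" using y by (auto simp: W_def g_def)
      finally show ?thesis .
    qed
    then show ?thesis by auto
  qed
  moreover have "holder_on \<beta> {z. z \<bullet> e = 0} g"
    unfolding holder_on_def
  proof (intro exI ballI)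
    fix y z :: 'a
    let ?d = "dist y z" and ?K = "\<bar>L / c\<bar> + 2 * M"
    have K: "\<bar>L / c\<bar> \<le> ?K" "2 * M \<le> ?K" using M by auto
    have b1: "\<bar>g y - g z\<bar> \<le> \<bar>L / c\<bar> * ?d"
    proof -
      have "\<bar>g y - g z\<bar> \<le> \<bar>f y - f z\<bar>" by (auto simp: g_def max_def min_def)
      also have "\<dots> \<le> L / c * ?d" by (rule f(1))
      also have "\<dots> \<le> \<bar>L / c\<bar> * ?d" by (intro mult_right_mono abs_ge_self) auto
      finally show ?thesis .
    qed
    have b2: "\<bar>g y - g z\<bar> \<le> 2 * M" using M by (auto simp: g_def)
    show "\<bar>g y - g z\<bar> \<le> ?K * ?d powr \<beta>"
    proof (cases "?d \<le> 1")
      case True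
      have "?d \<le> ?d powr \<beta>"
      proof (cases "?d = 0")
        case False
        then show ?thesis using powr_mono'[of \<beta> 1 ?d] True \<beta> by simp
      qed simp
      then have "\<bar>L / c\<bar> * ?d \<le> ?K * ?d powr \<beta>" using K M by (intro mult_mono) auto
      with b1 show ?thesis by linarith
    next
      case False
      then have "1 \<le> ?d powr \<beta>" using \<beta> by (intro ge_one_powr_ge_zero) auto
      then have "(2 * M) * 1 \<le> ?K * ?d powr \<beta>" using K M by (intro mult_mono) auto
      with b2 show ?thesis by linarith
    qed
  qed
  ultimately show ?thesis using e unfolding holder_chart_def by blast
qed

text \<open>For a ratio in [0, 1] the power with exponent \<beta> \<le> 1 is at least the ratio
  itself; apply this to the shares of \<open>x\<close> and \<open>y\<close> in their sum and
  add.\<close>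

lemma powr_add_le:
  fixes x y \<beta> :: real
  assumes "0 \<le> x" "0 \<le> y" "0 < \<beta>" "\<beta> \<le> 1"
  shows "(x + y) powr \<beta> \<le> x powr \<beta> + y powr \<beta>"
proof (cases "x + y = 0")
  case False
  then have s: "x + y > 0" using assms by linarith
  have "r / (x + y) * (x + y) powr \<beta> \<le> r powr \<beta>" if r: "0 \<le> r" "r \<le> x + y" for r
  proof -
    have "r / (x + y) \<le> (r / (x + y)) powr \<beta>"
      using powr_mono'[of \<beta> 1 "r / (x + y)"] assms r s by (simp add: powr_one_gt_zero_iff)
    then have "r / (x + y) * (x + y) powr \<beta> \<le> (r / (x + y)) powr \<beta> * (x + y) powr \<beta>"
      by (intro mult_right_mono) auto
    also have "\<dots> = r powr \<beta>" using r s by (simp add: powr_divide)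
    finally show ?thesis .
  qed
  from this[of x] this[of y] have "x / (x + y) * (x + y) powr \<beta> + y / (x + y) * (x + y) powr \<beta> \<le> x powr \<beta> + y powr \<beta>"
    using assms by simp
  moreover have "x / (x + y) * (x + y) powr \<beta> + y / (x + y) * (x + y) powr \<beta> = (x + y) powr \<beta>"
    unfolding distrib_right[symmetric] add_divide_distrib[symmetric] using s by simp
  ultimately show ?thesis by simp
qed (use assms in auto)

lemma powr_abs_diff_le:
  fixes a b \<beta> :: real
  assumes "0 < \<beta>" "\<beta> \<le> 1"
  shows "\<bar>\<bar>a\<bar> powr \<beta> - \<bar>b\<bar> powr \<beta>\<bar> \<le> \<bar>a - b\<bar> powr \<beta>"
proof -
  have *: "\<bar>a\<bar> powr \<beta> \<le> \<bar>b\<bar> powr \<beta> + \<bar>a - b\<bar> powr \<beta>" for a b :: real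
  proof -
    have "\<bar>a\<bar> powr \<beta> \<le> (\<bar>b\<bar> + \<bar>a - b\<bar>) powr \<beta>" using assms by (intro powr_mono2) auto
    also have "\<dots> \<le> \<bar>b\<bar> powr \<beta> + \<bar>a - b\<bar> powr \<beta>" using assms by (intro powr_add_le) auto
    finally show ?thesis .
  qed
  show ?thesis
    using *[of a b] *[of b a] unfolding abs_le_iff[of "\<bar>a\<bar> powr \<beta> - \<bar>b\<bar> powr \<beta>"] abs_minus_commute[of b a]
    by linarith
qed

section \<open>The cusp\<close>

definition cusp :: "real \<Rightarrow> (real ^ 2) set" where
  "cusp p = {x. 0 < x $ 1 \<and> x $ 1 < 1 \<and> \<bar>x $ 2\<bar> < x $ 1 powr p}"

text \<open>Solves the cusp inequality for the first coordinate. This form already contains its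
  positivity, and it shows the cusp as a region over the \<open>x $ 2\<close> axis bounded by a
  Hoelder function.\<close>

lemma less_powr_iff:
  fixes s r p :: real
  assumes "p > 0"
  shows "\<bar>s\<bar> powr (1 / p) < r \<longleftrightarrow> 0 < r \<and> \<bar>s\<bar> < r powr p"
proof
  assume *: "\<bar>s\<bar> powr (1 / p) < r"
  have r: "0 < r" using * powr_ge_zero[of "\<bar>s\<bar>" "1 / p"] by linarith
  have "\<bar>s\<bar> = (\<bar>s\<bar> powr (1 / p)) powr p" using assms by (simp add: powr_powr)
  also have "\<dots> < r powr p" using * assms by (intro powr_less_mono2) auto
  finally show "0 < r \<and> \<bar>s\<bar> < r powr p" using r by simp
next
  assume *: "0 < r \<and> \<bar>s\<bar> < r powr p"
  then have "\<bar>s\<bar> powr (1 / p) < (r powr p) powr (1 / p)" using assms by (intro powr_less_mono2) auto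
  then show "\<bar>s\<bar> powr (1 / p) < r" using * assms by (simp add: powr_powr)
qed

lemma cusp_eq: "p > 0 \<Longrightarrow> cusp p = {x. \<bar>x $ 2\<bar> powr (1 / p) < x $ 1 \<and> x $ 1 < 1}"
  by (auto simp: cusp_def less_powr_iff)

lemma continuous_on_powr_component:
  "p > 0 \<Longrightarrow> continuous_on S (\<lambda>x::real^2. \<bar>x $ 2\<bar> powr (1 / p))"
  by (intro continuous_on_powr' continuous_intros) auto

lemma open_cusp: "p > 0 \<Longrightarrow> open (cusp p)"
  unfolding cusp_eq
  by (intro open_Collect_conj open_Collect_less continuous_on_powr_component continuous_intros)

lemma norm_cusp_le: "p > 0 \<Longrightarrow> x \<in> cusp p \<Longrightarrow> norm x \<le> 2"
proof -
  assume p: "p > 0" and x: "x \<in> cusp p"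
  have "x $ 1 powr p \<le> 1 powr p" using x p by (intro powr_mono2) (auto simp: cusp_def)
  then have "\<bar>x $ 1\<bar> + \<bar>x $ 2\<bar> \<le> 2" using x by (simp add: cusp_def)
  then show ?thesis using norm_le_l1_cart[of x] by (simp add: sum_2)
qed

lemma bounded_cusp: "p > 0 \<Longrightarrow> bounded (cusp p)"
  using norm_cusp_le by (auto simp: bounded_iff)

text \<open>Every point is joined inside the cusp to the convex axis segment \<open>A\<close> by a
  vertical segment, so the cusp is a union of connected sets containing \<open>A\<close>.\<close>

lemma connected_cusp:
  assumes p: "p > 0"
  shows "connected (cusp p)"
proof -
  define A where "A = {x::real^2. 0 < x $ 1 \<and> x $ 1 < 1 \<and> x $ 2 = 0}"
  have A: "convex A"
  proof -
    have "A = {x. axis 1 1 \<bullet> x > 0} \<inter> {x. axis 1 1 \<bullet> x < 1} \<inter> {x. axis 2 1 \<bullet> x = 0}"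
      by (auto simp: A_def inner_axis')
    then show ?thesis
      by (simp only:) (intro convex_Int convex_halfspace_gt convex_halfspace_lt convex_hyperplane)
  qed
  have Asub: "A \<subseteq> cusp p" by (auto simp: A_def cusp_def)
  let ?y = "\<lambda>x::real^2. (\<chi> i. if i = 1 then x $ 1 else 0)"
  let ?S = "\<lambda>x. closed_segment x (?y x) \<union> A"
  have seg: "closed_segment x (?y x) \<subseteq> cusp p" if x: "x \<in> cusp p" for x
  proof
    fix z assume "z \<in> closed_segment x (?y x)"
    then obtain u where u: "0 \<le> u" "u \<le> 1" "z = (1 - u) *\<^sub>R x + u *\<^sub>R ?y x"
      by (auto simp: closed_segment_def)
    have "z $ 1 = x $ 1" "z $ 2 = (1 - u) * x $ 2" unfolding u(3) by (simp_all add: algebra_simps)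
    moreover have "\<bar>(1 - u) * x $ 2\<bar> \<le> \<bar>x $ 2\<bar>" using u by (simp add: abs_mult mult_left_le_one_le)
    ultimately show "z \<in> cusp p" using x by (auto simp: cusp_def)
  qed
  have yA: "?y x \<in> A" if "x \<in> cusp p" for x using that by (auto simp: A_def cusp_def)
  have "cusp p = \<Union> (?S ` cusp p) \<union> A"
    using seg Asub by auto
  also have "\<dots> = \<Union> (insert A (?S ` cusp p))" by auto
  also have "connected \<dots>"
  proof (rule connected_Union)
    have "connected (?S x)" if "x \<in> cusp p" for x
    proof (rule connected_Un)
      show "closed_segment x (?y x) \<inter> A \<noteq> {}" using yA[OF that] by blast
    qed (auto intro: convex_connected A)
    then show "connected s" if "s \<in> insert A (?S ` cusp p)" for s
      using that convex_connected[OF A] by blast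
    have "(\<chi> i. if i = 1 then 1 / 2 else 0) \<in> A" by (simp add: A_def)
    then show "\<Inter> (insert A (?S ` cusp p)) \<noteq> {}" by auto
  qed
  finally show ?thesis .
qed

text \<open>One chart covers the tip and the curved sides: seen from the direction
  \<open>- axis 1 1\<close>, the region with \<open>x $ 1 < 1\<close> is the hypograph of a power
  with exponent \<open>1 / p\<close>.\<close>

lemma holder_chart_cusp_tip:
  fixes x :: "real ^ 2"
  assumes p: "p > 1" and x: "x $ 1 < 1"
  shows "holder_chart (1 / p) (cusp p) x"
proof -
  define e :: "real ^ 2" where "e = - axis 1 1"
  define f where "f = (\<lambda>z::real^2. - (\<bar>z $ 2\<bar> powr (1 / p)))"
  have ye: "y \<bullet> e = - y $ 1" for y by (simp add: e_def inner_axis)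
  have e2: "e $ 2 = 0" by (simp add: e_def axis_def)
  have "open {y::real^2. y $ 1 < 1}" by (intro open_Collect_less continuous_intros)
  moreover have "norm e = 1" by (simp add: e_def norm_axis_1)
  moreover have "holder_on (1 / p) {z. z \<bullet> e = 0} f"
    unfolding holder_on_def
  proof (intro exI[of _ 1] ballI)
    fix y z :: "real ^ 2"
    have "\<bar>f y - f z\<bar> \<le> \<bar>y $ 2 - z $ 2\<bar> powr (1 / p)"
      using powr_abs_diff_le[of "1 / p" "y $ 2" "z $ 2"] p by (simp add: f_def abs_minus_commute)
    also have "\<dots> \<le> dist y z powr (1 / p)"
      using component_le_norm_cart[of "y - z" 2] p by (intro powr_mono2) (auto simp: dist_norm)
    finally show "\<bar>f y - f z\<bar> \<le> 1 * dist y z powr (1 / p)" by simp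
  qed
  moreover have "cusp p \<inter> {y. y $ 1 < 1} = {y \<in> {y. y $ 1 < 1}. y \<bullet> e < f (y - (y \<bullet> e) *\<^sub>R e)}"
    using p by (auto simp: cusp_eq f_def ye e2)
  ultimately show ?thesis using x unfolding holder_chart_def by blast
qed

text \<open>The vertical edge. The neighbourhood avoids the curved sides, so only
  \<open>x $ 1 < 1\<close> remains and the graph is constant.\<close>

lemma holder_chart_cusp_edge:
  fixes x :: "real ^ 2"
  assumes p: "p > 1" and x: "\<bar>x $ 2\<bar> powr (1 / p) < x $ 1"
  shows "holder_chart (1 / p) (cusp p) x"
proof -
  define e :: "real ^ 2" where "e = axis 1 1"
  let ?V = "{y::real^2. \<bar>y $ 2\<bar> powr (1 / p) < y $ 1}"
  have ye: "y \<bullet> e = y $ 1" for y by (simp add: e_def inner_axis)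
  have "open ?V" using p by (intro open_Collect_less continuous_on_powr_component continuous_intros) auto
  moreover have "norm e = 1" by (simp add: e_def norm_axis_1)
  moreover have "holder_on (1 / p) {z. z \<bullet> e = 0} (\<lambda>z. 1)"
    unfolding holder_on_def by (intro exI[of _ 0]) simp
  moreover have "cusp p \<inter> ?V = {y \<in> ?V. y \<bullet> e < 1}"
    using p by (auto simp: cusp_eq ye)
  ultimately show ?thesis using x unfolding holder_chart_def by blast
qed

text \<open>The derivative of the power is at most \<open>p\<close> on [0, 1]; the clamp extends the
  estimate to the whole line, as a globally Lipschitz \<open>G\<close> at the corners
  requires.\<close>

lemma powr_clamp_lipschitz:
  fixes p r s :: real
  assumes p: "p \<ge> 1" and rs: "r \<le> s"
  shows "max 0 (min 1 r) powr p \<le> max 0 (min 1 s) powr p"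
    "max 0 (min 1 s) powr p - max 0 (min 1 r) powr p \<le> p * (s - r)"
proof -
  let ?r = "max 0 (min 1 r)" and ?s = "max 0 (min 1 s)"
  have le: "?r \<le> ?s" "?s \<le> 1" "0 \<le> ?r" "?s - ?r \<le> s - r" using rs by auto
  show "?r powr p \<le> ?s powr p" using le p by (intro powr_mono2) auto
  show "?s powr p - ?r powr p \<le> p * (s - r)"
  proof (cases "?r < ?s")
    case True
    have "continuous_on {?r..?s} (\<lambda>x. x powr p)"
      using p by (intro continuous_on_powr' continuous_intros) auto
    moreover have "((\<lambda>x. x powr p) has_derivative (\<lambda>h. p * x powr (p - 1) * h)) (at x)" if "?r < x" "x < ?s" for x
    proof -
      have "x > 0" using that le by linarith
      from has_real_derivative_powr[OF this, of p] show ?thesis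
        unfolding has_field_derivative_def .
    qed
    ultimately obtain \<xi> where \<xi>: "?r < \<xi>" "\<xi> < ?s" "?s powr p - ?r powr p = p * \<xi> powr (p - 1) * (?s - ?r)"
      using mvt[OF True, of "\<lambda>x. x powr p" "\<lambda>x h. p * x powr (p - 1) * h"] by auto
    have "0 \<le> \<xi>" "\<xi> \<le> 1" using \<xi>(1,2) le(2,3) by linarith+
    then have "\<xi> powr (p - 1) \<le> 1" using p by (intro powr_le1) simp_all
    then have "p * \<xi> powr (p - 1) \<le> p * 1" using p by (intro mult_left_mono) linarith+
    moreover have "0 \<le> ?s - ?r" "0 \<le> p * 1" using le(1) p by linarith+
    ultimately have "p * \<xi> powr (p - 1) * (?s - ?r) \<le> p * 1 * (s - r)"
      using le(4) by (intro mult_mono[of "p * \<xi> powr (p - 1)" "p * 1" "?s - ?r" "s - r"])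
    then show ?thesis unfolding \<xi>(3) mult_1_right .
  next
    case False
    then have "?s = ?r" using le by linarith
    moreover have "0 \<le> p * (s - r)" using p rs by simp
    ultimately show ?thesis by (simp only: diff_self)
  qed
qed

lemma abs_max_diff_le:
  fixes a b a' b' D :: real
  shows "\<bar>a - a'\<bar> \<le> D \<Longrightarrow> \<bar>b - b'\<bar> \<le> D \<Longrightarrow> \<bar>max a b - max a' b'\<bar> \<le> D"
  by (auto simp: max_def)

text \<open>At the points (1, 1) and (1, -1) the edge meets a curved side. The region is where the
  maximum of two Lipschitz functions is negative, and one direction increases both.\<close>

lemma holder_chart_cusp_corner:
  fixes x :: "real ^ 2"
  assumes p: "p > 1" and x: "x $ 1 = 1" "\<bar>x $ 2\<bar> = 1"
  shows "holder_chart (1 / p) (cusp p) x"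
proof -
  define \<sigma> where "\<sigma> = x $ 2"
  have \<sigma>: "\<sigma> * \<sigma> = 1" "\<bar>\<sigma>\<bar> = 1" using x by (auto simp: \<sigma>_def abs_if split: if_splits)
  define \<phi> where "\<phi> = (\<lambda>r::real. max 0 (min 1 r) powr p)"
  define G where "G = (\<lambda>y::real^2. max (y $ 1 - 1) (\<sigma> * y $ 2 - \<phi> (y $ 1)))"
  \<comment> \<open>Moving by \<open>s\<close> along \<open>v\<close> raises the first function by
    \<open>s\<close>. It raises \<open>\<sigma> * y $ 2\<close> by \<open>s * (p + 1)\<close> while
    the power grows by at most \<open>p * s\<close>, so the second function also gains at least
    \<open>s\<close>.\<close>
  define v :: "real ^ 2" where "v = (\<chi> i. if i = 1 then 1 else \<sigma> * (p + 1))"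
  define e where "e = (1 / norm v) *\<^sub>R v"
  have "v $ 1 \<noteq> 0" by (simp add: v_def)
  then have v: "v \<noteq> 0" by auto
  then have nv: "norm v > 0" by simp
  show ?thesis
  proof (rule lipschitz_holder_chart[where G = G and V = "{y. 0 < y $ 1} \<inter> {y. 0 < \<sigma> * y $ 2}" and e = e and c = "1 / norm v" and L = "1 + p"])
    show "norm e = 1" using v by (simp add: e_def)
    show "1 / norm v > 0" using nv by simp
    show "open ({y::real^2. 0 < y $ 1} \<inter> {y. 0 < \<sigma> * y $ 2})"
      by (intro open_Int open_Collect_less continuous_intros)
    show "x \<in> {y. 0 < y $ 1} \<inter> {y. 0 < \<sigma> * y $ 2}" using x \<sigma> by (simp add: \<sigma>_def[symmetric])
    show "0 < 1 / p" "1 / p \<le> 1" using p by auto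
    show "y \<in> cusp p \<longleftrightarrow> G y < 0" if "y \<in> {y. 0 < y $ 1} \<inter> {y. 0 < \<sigma> * y $ 2}" for y
    proof -
      have "\<bar>y $ 2\<bar> = \<sigma> * y $ 2"
      proof -
        have "\<sigma> * y $ 2 = \<bar>\<sigma> * y $ 2\<bar>" using that by simp
        then show ?thesis by (simp add: abs_mult \<sigma>)
      qed
      then show ?thesis using that by (auto simp: cusp_def G_def \<phi>_def max_def min_def)
    qed
  next
    fix y z :: "real ^ 2"
    have 1: "\<bar>y $ 1 - z $ 1\<bar> \<le> dist y z" and 2: "\<bar>y $ 2 - z $ 2\<bar> \<le> dist y z"
      using component_le_norm_cart[of "y - z"] by (auto simp: dist_norm)
    have "\<bar>\<phi> (y $ 1) - \<phi> (z $ 1)\<bar> \<le> p * \<bar>y $ 1 - z $ 1\<bar>"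
      using powr_clamp_lipschitz[of p "y $ 1" "z $ 1"] powr_clamp_lipschitz[of p "z $ 1" "y $ 1"] p
      by (cases "y $ 1 \<le> z $ 1") (auto simp: \<phi>_def abs_if)
    also have "\<dots> \<le> p * dist y z" using 1 p by (intro mult_left_mono) auto
    finally have 3: "\<bar>\<phi> (y $ 1) - \<phi> (z $ 1)\<bar> \<le> p * dist y z" .
    have 4: "\<bar>\<sigma> * y $ 2 - \<sigma> * z $ 2\<bar> \<le> dist y z"
      unfolding right_diff_distrib[symmetric] abs_mult \<sigma>(2) using 2 by simp
    have "0 \<le> p * dist y z" using p by simp
    with 1 3 4 show "\<bar>G y - G z\<bar> \<le> (1 + p) * dist y z"
      unfolding G_def distrib_right mult_1 by (intro abs_max_diff_le) linarith+
  next
    fix y and t :: real assume t: "t \<ge> 0"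
    define s where "s = t / norm v"
    have s: "s \<ge> 0" using t nv by (simp add: s_def)
    have y1: "(y + t *\<^sub>R e) $ 1 = y $ 1 + s" by (simp add: e_def v_def s_def)
    have "(y + t *\<^sub>R e) $ 2 = y $ 2 + \<sigma> * (s * (p + 1))"
      by (simp add: e_def v_def s_def)
    then have "\<sigma> * (y + t *\<^sub>R e) $ 2 = \<sigma> * y $ 2 + (\<sigma> * \<sigma>) * (s * (p + 1))"
      by (simp only: distrib_left mult.assoc)
    then have y2: "\<sigma> * (y + t *\<^sub>R e) $ 2 = \<sigma> * y $ 2 + s * (p + 1)"
      unfolding \<sigma>(1) by simp
    have "\<phi> (y $ 1 + s) - \<phi> (y $ 1) \<le> p * s"
      using powr_clamp_lipschitz(2)[of p "y $ 1" "y $ 1 + s"] p s by (simp add: \<phi>_def)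
    then have "G y + s \<le> G (y + t *\<^sub>R e)"
      unfolding G_def y1 y2 max_add_distrib_left by (intro max.mono) (simp_all add: algebra_simps)
    then show "G y + 1 / norm v * t \<le> G (y + t *\<^sub>R e)" by (simp add: s_def)
  qed
qed

theorem C0_holder_domain_cusp:
  assumes p: "p > 1"
  shows "C0_holder_domain (1 / p) (cusp p)"
  unfolding C0_holder_domain_def
proof (intro conjI C0_holder_open_setI)
  show "open (cusp p)" "bounded (cusp p)" "connected (cusp p)" "0 < 1 / p" "1 / p \<le> 1"
    using p by (auto intro: open_cusp bounded_cusp connected_cusp)
  fix x assume "x \<in> frontier (cusp p)"
  then have "x \<in> closure (cusp p)" by (simp add: frontier_def)
  moreover have "closure (cusp p) \<subseteq> {x. \<bar>x $ 2\<bar> powr (1 / p) \<le> x $ 1 \<and> x $ 1 \<le> 1}"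
    using p by (intro closure_minimal closed_Collect_conj closed_Collect_le continuous_on_powr_component
        continuous_intros) (auto simp: cusp_eq)
  ultimately have x: "\<bar>x $ 2\<bar> powr (1 / p) \<le> x $ 1" "x $ 1 \<le> 1" by auto
  consider "x $ 1 < 1" | "\<bar>x $ 2\<bar> powr (1 / p) < x $ 1" | "x $ 1 = 1" "\<bar>x $ 2\<bar> powr (1 / p) = 1"
    using x by linarith
  then show "holder_chart (1 / p) (cusp p) x"
  proof cases
    case 3
    have "\<bar>x $ 2\<bar> = (\<bar>x $ 2\<bar> powr (1 / p)) powr p" using p by (simp add: powr_powr)
    then have "\<bar>x $ 2\<bar> = 1" using 3 by simp
    then show ?thesis using holder_chart_cusp_corner[OF p] 3 by blast
  next
    case 1
    then show ?thesis by (rule holder_chart_cusp_tip[OF p])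
  next
    case 2
    then show ?thesis by (rule holder_chart_cusp_edge[OF p])
  qed
qed

section \<open>A superposition of Gaussians concentrating at the tip\<close>

definition gaussian :: "nat \<Rightarrow> real ^ 2 \<Rightarrow> real" where
  "gaussian k x = exp (- (4 ^ k) * (norm x)\<^sup>2 / 2)"

lemma gaussian_pos: "0 < gaussian k x"
  by (simp add: gaussian_def)

lemma gaussian_measurable [measurable]: "gaussian k \<in> borel_measurable borel"
  unfolding gaussian_def by measurable

lemma integrable_gaussian_k: "integrable lborel (gaussian k)"
  using integrable_gaussian[of "4 ^ k", where 'a = "real ^ 2"] by (simp add: gaussian_def[abs_def])

lemma fourier_gaussian_k:
  "fourier (\<lambda>x. complex_of_real (gaussian k x)) \<xi> = complex_of_real ((1 / 4 ^ k) * exp (- (norm \<xi>)\<^sup>2 / (2 * 4 ^ k)))"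
proof -
  have "- real DIM(real ^ 2) / 2 = - 1" by simp
  then have "(4 ^ k) powr (- real DIM(real ^ 2) / 2) = 1 / (4 ^ k :: real)"
    by (simp only: powr_neg_one zero_less_power zero_less_numeral)
  moreover have "(0::real) < 4 ^ k" by simp
  ultimately show ?thesis
    using fourier_gaussian_scaled[of "4 ^ k" \<xi>] unfolding gaussian_def by (simp only:)
qed

text \<open>In the variable s = norm xi^2 / 4^k the integrand is at most (1 + s)^2 exp(-s). Since (1
  + s)^2 \<le> 8 exp(s/2), half of the decay pays for the weight; the remaining Gaussian has mass 2
  pi 4^k, whence 16 pi 4^k.\<close>

lemma gaussian_H2_integral:
  defines "h \<equiv> (\<lambda>k \<xi>::real^2. (1 + (norm \<xi>)\<^sup>2)\<^sup>2 * ((1 / 4 ^ k) * exp (- (norm \<xi>)\<^sup>2 / (2 * 4 ^ k)))\<^sup>2)"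
  shows "integrable lborel (h k)" "(LINT \<xi>|lborel. h k \<xi>) \<le> 16 * pi * 4 ^ k"
proof -
  let ?g = "\<lambda>\<xi>::real^2. 8 * exp (- (1 / 4 ^ k) * (norm \<xi>)\<^sup>2 / 2)"
  have le: "h k \<xi> \<le> ?g \<xi>" for \<xi> :: "real ^ 2"
  proof -
    define s where "s = (norm \<xi>)\<^sup>2 / 4 ^ k"
    have s: "s \<ge> 0" by (simp add: s_def)
    have n: "(norm \<xi>)\<^sup>2 = 4 ^ k * s" by (simp add: s_def)
    have "(1 + s)\<^sup>2 \<le> 8 * (1 + s / 2 + (s / 2)\<^sup>2 / 2)"
      using s by (simp add: power2_eq_square algebra_simps)
    also have "\<dots> \<le> 8 * exp (s / 2)"
      using s by (intro mult_left_mono exp_lower_Taylor_quadratic) auto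
    finally have q: "(1 + s)\<^sup>2 \<le> 8 * exp (s / 2)" .
    have "1 + (norm \<xi>)\<^sup>2 \<le> 4 ^ k * (1 + s)"
      by (simp add: n algebra_simps)
    then have "(1 + (norm \<xi>)\<^sup>2)\<^sup>2 \<le> (4 ^ k * (1 + s))\<^sup>2"
      by (intro power_mono) auto
    then have "h k \<xi> \<le> (4 ^ k * (1 + s))\<^sup>2 * ((1 / 4 ^ k) * exp (- s / 2))\<^sup>2"
      unfolding h_def by (intro mult_mono) (auto simp: s_def mult.commute[of 2])
    also have "\<dots> = (1 + s)\<^sup>2 * (exp (- s / 2))\<^sup>2"
      by (simp add: power_mult_distrib power_divide)
    also have "(exp (- s / 2))\<^sup>2 = exp (- s)"
      by (simp add: power2_eq_square flip: exp_add)
    also have "(1 + s)\<^sup>2 * exp (- s) \<le> 8 * exp (s / 2) * exp (- s)"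
      by (intro mult_right_mono q) simp
    also have "\<dots> = 8 * exp (- (1 / 4 ^ k) * (norm \<xi>)\<^sup>2 / 2)"
      by (simp add: s_def mult.assoc flip: exp_add)
    finally show ?thesis .
  qed
  have gi: "integrable lborel ?g"
    by (intro integrable_mult_right integrable_gaussian) simp
  have nn: "0 \<le> h k \<xi>" for \<xi> by (simp add: h_def)
  show i: "integrable lborel (h k)"
  proof (rule Bochner_Integration.integrable_bound[OF gi])
    show "AE \<xi> in lborel. norm (h k \<xi>) \<le> norm (?g \<xi>)"
      using le nn by (intro AE_I2) (simp add: abs_of_nonneg)
  qed (simp add: h_def)
  have "(LINT \<xi>|lborel. h k \<xi>) \<le> (LINT \<xi>|lborel. ?g \<xi>)"
    by (intro integral_mono i gi le)
  also have "\<dots> = 8 * (LINT \<xi>|lborel. exp (- (1 / 4 ^ k) * (norm (\<xi>::real^2))\<^sup>2 / 2))"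
    by (rule integral_mult_right_zero)
  also have "(LINT \<xi>|lborel. exp (- (1 / 4 ^ k) * (norm (\<xi>::real^2))\<^sup>2 / 2)) = 2 * pi * 4 ^ k"
  proof -
    have "complex_of_real (LINT \<xi>|lborel. exp (- (1 / 4 ^ k) * (norm (\<xi>::real^2))\<^sup>2 / 2))
      = complex_of_real ((2 * pi / (1 / 4 ^ k)) powr (real DIM(real^2) / 2))"
      using gaussian_fourier_integral[of "1 / 4 ^ k" "0::real^2"] by (simp flip: integral_complex_of_real)
    then have "(LINT \<xi>|lborel. exp (- (1 / 4 ^ k) * (norm (\<xi>::real^2))\<^sup>2 / 2)) = (2 * pi / (1 / 4 ^ k)) powr (real DIM(real^2) / 2)"
      by (simp only: of_real_eq_iff)
    then show ?thesis by simp
  qed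
  finally show "(LINT \<xi>|lborel. h k \<xi>) \<le> 16 * pi * 4 ^ k" by simp
qed

text \<open>The weights \<open>2 ^ k\<close> in the Cauchy-Schwarz inequality are harmless because all the geometric
  series below leave room for them.\<close>

lemma weighted_sum_square_le:
  fixes x w :: "nat \<Rightarrow> real"
  assumes "\<And>k. k \<in> I \<Longrightarrow> w k > 0"
  shows "(\<Sum>k\<in>I. x k)\<^sup>2 \<le> (\<Sum>k\<in>I. w k) * (\<Sum>k\<in>I. (x k)\<^sup>2 / w k)"
proof -
  have "(\<Sum>k\<in>I. sqrt (w k) * (x k / sqrt (w k)))\<^sup>2 \<le> (\<Sum>k\<in>I. (sqrt (w k))\<^sup>2) * (\<Sum>k\<in>I. (x k / sqrt (w k))\<^sup>2)"
    by (rule Cauchy_Schwarz_ineq_sum)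
  moreover have "(\<Sum>k\<in>I. sqrt (w k) * (x k / sqrt (w k))) = (\<Sum>k\<in>I. x k)"
    using assms by (intro sum.cong) (auto simp: less_imp_neq[THEN not_sym])
  moreover have "(\<Sum>k\<in>I. (sqrt (w k))\<^sup>2) = (\<Sum>k\<in>I. w k)"
    using assms by (intro sum.cong) (auto simp: less_imp_le)
  moreover have "(\<Sum>k\<in>I. (x k / sqrt (w k))\<^sup>2) = (\<Sum>k\<in>I. (x k)\<^sup>2 / w k)"
    using assms by (intro sum.cong) (auto simp: power_divide less_imp_le)
  ultimately show ?thesis by simp
qed

lemma geometric_sum_le:
  fixes q :: real
  assumes "q \<ge> 2"
  shows "(\<Sum>k<n. q ^ k) \<le> q ^ n - 1"
proof (induction n)
  case (Suc n)
  have "2 * q ^ n \<le> q * q ^ n" using assms by (intro mult_right_mono) auto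
  with Suc show ?case by simp
qed simp

definition partial_sum :: "real \<Rightarrow> nat \<Rightarrow> real ^ 2 \<Rightarrow> complex" where
  "partial_sum b n x = (\<Sum>k<n. complex_of_real (b ^ k * gaussian k x))"

lemma partial_sum_integrable: "integrable lborel (partial_sum b n)"
proof -
  have "integrable lborel (\<lambda>x. \<Sum>k<n. complex_of_real (b ^ k * gaussian k x))"
    by (intro Bochner_Integration.integrable_sum integrable_of_real integrable_mult_right integrable_gaussian_k)
  then show ?thesis by (simp add: partial_sum_def[abs_def])
qed

lemma fourier_partial_sum:
  "fourier (partial_sum b n) \<xi> = complex_of_real (\<Sum>k<n. b ^ k * ((1 / 4 ^ k) * exp (- (norm \<xi>)\<^sup>2 / (2 * 4 ^ k))))"
proof (induction n)
  case 0
  then show ?case by (simp add: partial_sum_def[abs_def] fourier_def)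
next
  case (Suc n)
  have "partial_sum b (Suc n) = (\<lambda>x. 1 * partial_sum b n x + complex_of_real (b ^ n) * complex_of_real (gaussian n x))"
    by (simp add: partial_sum_def fun_eq_iff)
  then have "fourier (partial_sum b (Suc n)) \<xi> =
      fourier (\<lambda>x. 1 * partial_sum b n x + complex_of_real (b ^ n) * complex_of_real (gaussian n x)) \<xi>"
    by (rule arg_cong[where f = "\<lambda>h. fourier h \<xi>"])
  also have "\<dots> = 1 * fourier (partial_sum b n) \<xi> + complex_of_real (b ^ n) * fourier (\<lambda>x. complex_of_real (gaussian n x)) \<xi>"
    by (rule fourier_lincomb[OF partial_sum_integrable integrable_of_real[OF integrable_gaussian_k]])
  finally show ?case unfolding Suc.IH fourier_gaussian_k by simp
qed

text \<open>The factor \<open>2 ^ n - 1\<close> is the sum of the Cauchy-Schwarz weights. It is not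
  rounded up to \<open>2 ^ n\<close> because it vanishes at \<open>n = 0\<close>: the empty sum must
  cost nothing, which matters for \<open>t \<ge> 1\<close>.\<close>

lemma partial_sum_H2:
  fixes \<Omega> :: "(real ^ 2) set" and n :: nat and b :: real
  assumes b: "b \<ge> 1"
  defines "u \<equiv> restrict_distr \<Omega> (fun_distr (partial_sum b n))"
  shows "u \<in> carrier (sobolev \<Omega> 2)" "0 \<le> nrm (sobolev \<Omega> 2) u"
    "(nrm (sobolev \<Omega> 2) u)\<^sup>2 \<le> 16 * pi * (2 ^ n - 1) * (2 * b\<^sup>2) ^ n"
proof -
  let ?w = "\<lambda>\<xi>::real^2. (1 + (norm \<xi>)\<^sup>2)\<^sup>2"
  let ?e = "\<lambda>k \<xi>::real^2. (1 / 4 ^ k) * exp (- (norm \<xi>)\<^sup>2 / (2 * 4 ^ k))"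
  let ?F = "\<lambda>\<xi>. (2 ^ n - 1) * (\<Sum>k<n. (b\<^sup>2 / 2) ^ k * (?w \<xi> * (?e k \<xi>)\<^sup>2))"
  have p2: "(1 + (norm \<xi>)\<^sup>2) powr 2 = ?w \<xi>" for \<xi> :: "real ^ 2"
    by (simp add: add_pos_nonneg)
  have le: "?w \<xi> * (norm (fourier (partial_sum b n) \<xi>))\<^sup>2 \<le> ?F \<xi>" for \<xi>
  proof -
    have "(norm (fourier (partial_sum b n) \<xi>))\<^sup>2 = (\<Sum>k<n. b ^ k * ?e k \<xi>)\<^sup>2"
      unfolding fourier_partial_sum norm_of_real by simp
    also have "\<dots> \<le> (\<Sum>k<n. 2 ^ k) * (\<Sum>k<n. (b ^ k * ?e k \<xi>)\<^sup>2 / 2 ^ k)"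
      by (rule weighted_sum_square_le) simp
    also have "\<dots> \<le> (2 ^ n - 1) * (\<Sum>k<n. (b ^ k * ?e k \<xi>)\<^sup>2 / 2 ^ k)"
      by (intro mult_right_mono geometric_sum_le sum_nonneg) auto
    also have "(\<Sum>k<n. (b ^ k * ?e k \<xi>)\<^sup>2 / 2 ^ k) = (\<Sum>k<n. (b\<^sup>2 / 2) ^ k * (?e k \<xi>)\<^sup>2)"
      by (simp only: power_mult_distrib power_divide power_commutes times_divide_eq_left flip: power_mult) (simp add: mult.commute)
    finally have "?w \<xi> * (norm (fourier (partial_sum b n) \<xi>))\<^sup>2
        \<le> ?w \<xi> * ((2 ^ n - 1) * (\<Sum>k<n. (b\<^sup>2 / 2) ^ k * (?e k \<xi>)\<^sup>2))"
      by (intro mult_left_mono) auto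
    also have "\<dots> = ?F \<xi>"
      by (simp only: sum_distrib_left mult_ac)
    finally show ?thesis .
  qed
  have Fi: "integrable lborel ?F"
    by (intro integrable_mult_right Bochner_Integration.integrable_sum gaussian_H2_integral(1))
  have [measurable]: "partial_sum b n \<in> borel_measurable borel"
    using borel_measurable_integrable[OF partial_sum_integrable] by simp
  have wi: "integrable lborel (\<lambda>\<xi>. ?w \<xi> * (norm (fourier (partial_sum b n) \<xi>))\<^sup>2)"
  proof (rule Bochner_Integration.integrable_bound[OF Fi])
    show "AE \<xi> in lborel. norm (?w \<xi> * (norm (fourier (partial_sum b n) \<xi>))\<^sup>2) \<le> norm (?F \<xi>)"
    proof (rule AE_I2)
      fix \<xi> :: "real ^ 2"
      have "norm (?w \<xi> * (norm (fourier (partial_sum b n) \<xi>))\<^sup>2) = ?w \<xi> * (norm (fourier (partial_sum b n) \<xi>))\<^sup>2"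
        by simp
      also have "\<dots> \<le> ?F \<xi>" by (rule le)
      also have "\<dots> \<le> norm (?F \<xi>)" unfolding real_norm_def by (rule abs_ge_self)
      finally show "norm (?w \<xi> * (norm (fourier (partial_sum b n) \<xi>))\<^sup>2) \<le> norm (?F \<xi>)" .
    qed
  qed measurable
  have wd: "weighted_density 2 (fourier_distr (fun_distr (partial_sum b n))) (fourier (partial_sum b n))"
    using wi by (intro weighted_density_fourier partial_sum_integrable) (simp only: p2)
  have k0: "integrable lborel (\<lambda>x. norm (partial_sum b n x) / (1 + norm x ^ 0))"
    using integrable_norm[OF partial_sum_integrable] by simp
  show "u \<in> carrier (sobolev \<Omega> 2)" "0 \<le> nrm (sobolev \<Omega> 2) u"
    unfolding u_def by (rule sobolev_restrict_fun_distr[OF _ k0 wd]; measurable)+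
  have "(nrm (sobolev \<Omega> 2) u)\<^sup>2 \<le> (LINT \<xi>|lborel. (1 + (norm \<xi>)\<^sup>2) powr 2 * (norm (fourier (partial_sum b n) \<xi>))\<^sup>2)"
    unfolding u_def by (rule sobolev_restrict_fun_distr(3)[OF _ k0 wd]) measurable
  also have "\<dots> = (LINT \<xi>|lborel. ?w \<xi> * (norm (fourier (partial_sum b n) \<xi>))\<^sup>2)"
    by (simp only: p2)
  also have "\<dots> \<le> (LINT \<xi>|lborel. ?F \<xi>)"
    by (intro integral_mono wi Fi le)
  also have "\<dots> = (2 ^ n - 1) * (\<Sum>k<n. (b\<^sup>2 / 2) ^ k * (LINT \<xi>|lborel. ?w \<xi> * (?e k \<xi>)\<^sup>2))"
    by (subst integral_mult_right_zero, subst Bochner_Integration.integral_sum)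
       (simp_all only: integral_mult_right_zero integrable_mult_right gaussian_H2_integral(1))
  also have "\<dots> \<le> (2 ^ n - 1) * (\<Sum>k<n. (b\<^sup>2 / 2) ^ k * (16 * pi * 4 ^ k))"
    by (intro mult_left_mono sum_mono gaussian_H2_integral(2)) auto
  also have "(\<Sum>k<n. (b\<^sup>2 / 2) ^ k * (16 * pi * 4 ^ k)) = 16 * pi * (\<Sum>k<n. (2 * b\<^sup>2) ^ k)"
  proof -
    have "(b\<^sup>2 / 2) ^ k * (16 * pi * 4 ^ k) = 16 * pi * ((b\<^sup>2 / 2) * 4) ^ k" for k
      by (simp only: power_mult_distrib mult_ac)
    moreover have "(b\<^sup>2 / 2) * 4 = 2 * b\<^sup>2" by simp
    ultimately show ?thesis by (simp only: sum_distrib_left)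
  qed
  also have "(2 ^ n - 1) * (16 * pi * (\<Sum>k<n. (2 * b\<^sup>2) ^ k)) \<le> (2 ^ n - 1) * (16 * pi * (2 * b\<^sup>2) ^ n)"
  proof -
    have "1 \<le> b\<^sup>2" using b by simp
    then have "(\<Sum>k<n. (2 * b\<^sup>2) ^ k) \<le> (2 * b\<^sup>2) ^ n - 1" by (intro geometric_sum_le) simp
    then show ?thesis by (intro mult_left_mono) auto
  qed
  finally show "(nrm (sobolev \<Omega> 2) u)\<^sup>2 \<le> 16 * pi * (2 ^ n - 1) * (2 * b\<^sup>2) ^ n"
    by (simp only: mult_ac)
qed

section \<open>The mass of the Gaussians on the cusp\<close>

text \<open>Choosing \<open>m\<close> with \<open>s * m \<ge> 2\<close> makes y^2 at most a constant
  times exp(\<bar>y\<bar>^s / 2) for \<bar>y\<bar> > 1, so the function is dominated by a multiple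
  of 1 / (1 + y^2).\<close>

lemma integrable_stretched_exp:
  fixes s :: real
  assumes s: "s > 0"
  shows "integrable lborel (\<lambda>y::real. exp (- (\<bar>y\<bar> powr s) / 2))"
proof -
  obtain m :: nat where m: "2 \<le> s * real m"
    using real_arch_simple[of "2 / s"] s by (auto simp: field_simps)
  let ?C = "2 ^ (m + 1) * fact m + 2 :: real"
  have i: "integrable lborel (\<lambda>y::real. ?C * (1 + y\<^sup>2) powr (- 1))"
    by (intro integrable_mult_right integrable_decay_real) simp
  show ?thesis
  proof (rule Bochner_Integration.integrable_bound[OF i])
    show "AE y in lborel. norm (exp (- (\<bar>y\<bar> powr s) / 2)) \<le> norm (?C * (1 + y\<^sup>2) powr (- 1))"
    proof (rule AE_I2)
      fix y :: real
      have p: "1 + y\<^sup>2 > 0" by (simp add: add_pos_nonneg)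
      have "(1 + y\<^sup>2) * exp (- (\<bar>y\<bar> powr s) / 2) \<le> ?C"
      proof (cases "\<bar>y\<bar> \<le> 1")
        case True
        have "y\<^sup>2 \<le> 1" using True by (simp add: abs_square_le_1)
        then have "(1 + y\<^sup>2) * exp (- (\<bar>y\<bar> powr s) / 2) \<le> 2 * 1" by (intro mult_mono) auto
        also have "\<dots> \<le> ?C" by simp
        finally show ?thesis .
      next
        case False
        let ?z = "\<bar>y\<bar> powr s / 2"
        have "y\<^sup>2 = \<bar>y\<bar> powr 2" using False powr_realpow[of "\<bar>y\<bar>" 2] by simp
        also have "\<dots> \<le> \<bar>y\<bar> powr (s * real m)" using False m by (intro powr_mono) auto
        also have "\<dots> = (\<bar>y\<bar> powr s) ^ m" using False by (simp add: powr_powr flip: powr_realpow)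
        also have "\<dots> = 2 ^ m * ?z ^ m" by (simp add: power_divide)
        also have "\<dots> \<le> 2 ^ m * (fact m * exp ?z)" by (intro mult_left_mono power_le_exp) auto
        finally have y2: "y\<^sup>2 \<le> 2 ^ m * fact m * exp ?z" by (simp add: mult.assoc)
        have "1 \<le> y\<^sup>2" using False power_mono[of 1 "\<bar>y\<bar>" 2] by simp
        then have "(1 + y\<^sup>2) * exp (- (\<bar>y\<bar> powr s) / 2) \<le> (2 * y\<^sup>2) * exp (- (\<bar>y\<bar> powr s) / 2)"
          by (intro mult_right_mono) auto
        also have "\<dots> \<le> (2 * (2 ^ m * fact m * exp ?z)) * exp (- (\<bar>y\<bar> powr s) / 2)"
          by (intro mult_right_mono mult_left_mono y2) auto
        also have "\<dots> = 2 ^ (m + 1) * fact m * (exp ?z * exp (- (\<bar>y\<bar> powr s) / 2))" by simp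
        also have "exp ?z * exp (- (\<bar>y\<bar> powr s) / 2) = 1" by (simp flip: exp_add)
        finally show ?thesis by simp
      qed
      then have "exp (- (\<bar>y\<bar> powr s) / 2) \<le> ?C * (1 + y\<^sup>2) powr (- 1)"
        using p by (simp add: powr_neg_one field_simps)
      then show "norm (exp (- (\<bar>y\<bar> powr s) / 2)) \<le> norm (?C * (1 + y\<^sup>2) powr (- 1))"
        unfolding real_norm_def by (simp only: abs_exp_cancel)
    qed
  qed measurable
qed

lemma Basis_real2: "(Basis :: (real ^ 2) set) = {axis 1 1, axis 2 1}"
  unfolding Basis_vec_def by (auto simp: UNIV_2)

lemma axis_1_neq_2: "(axis 1 1 :: real ^ 2) \<noteq> axis 2 1"
  by (simp add: axis_eq_axis)

lemma prod_Basis_real2: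
  fixes f :: "real ^ 2 \<Rightarrow> 'b::comm_monoid_mult"
  shows "(\<Prod>i\<in>Basis. f i) = f (axis 1 1) * f (axis 2 1)"
  unfolding Basis_real2 using axis_1_neq_2 by simp

text \<open>On the cusp \<open>\<bar>x $ 2\<bar> powr (1 / p) < x $ 1\<close>, so half of the exponent can be traded for decay
  in \<open>x $ 2\<close>, which gives a majorant that is a product.\<close>

lemma gaussian_cusp_integral:
  assumes p: "p > 0"
  obtains C where "C > 0" "\<And>k. set_integrable lborel (cusp p) (\<lambda>x. (gaussian k x)\<^sup>2)"
    "\<And>k. (LINT x:cusp p|lborel. (gaussian k x)\<^sup>2) \<le> C * (2 powr (- (p + 1))) ^ k"
proof -
  define J where "J = (LINT y|lborel. exp (- (\<bar>y::real\<bar> powr (2 / p)) / 2))"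
  have Ji: "integrable lborel (\<lambda>y::real. exp (- (\<bar>y\<bar> powr (2 / p)) / 2))"
    using p by (intro integrable_stretched_exp) simp
  have J0: "0 \<le> J" unfolding J_def by (intro integral_nonneg_AE) auto
  have I1: "integrable lborel (\<lambda>t::real. exp (- (4 ^ k) * t\<^sup>2 / 2))" for k
    by (intro integrable_gaussian_real) simp
  have V1: "(LINT t|lborel. exp (- (4 ^ k) * t\<^sup>2 / 2)) = sqrt (2 * pi) * (1 / 2) ^ k" for k
  proof -
    have "complex_of_real (LINT t|lborel. exp (- (4 ^ k) * t\<^sup>2 / 2)) = complex_of_real (sqrt (2 * pi / 4 ^ k))"
      using gaussian_fourier_real[of "4 ^ k" 0] by (simp flip: integral_complex_of_real)
    then have "(LINT t|lborel. exp (- (4 ^ k) * t\<^sup>2 / 2)) = sqrt (2 * pi / 4 ^ k)" by (simp only: of_real_eq_iff)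
    also have "sqrt (4 ^ k) = 2 ^ k"
      by (rule real_sqrt_unique) (simp_all add: power2_eq_square flip: power_mult_distrib)
    then have "sqrt (2 * pi / 4 ^ k) = sqrt (2 * pi) * (1 / 2) ^ k"
      by (simp add: real_sqrt_divide power_divide)
    finally show ?thesis .
  qed
  \<comment> \<open>The dilation factor of the second coordinate: \<open>4 ^ k\<close> inside the
    exponent equals \<open>c k powr (2 / p)\<close>. The second factor therefore has mass
    \<open>J / c k\<close>, the first one is of order \<open>2 ^ -k\<close>, and together they give
    the rate \<open>2 powr (- (p + 1))\<close>.\<close>
  define c where "c = (\<lambda>k::nat. (2 powr p) ^ k)"
  have c: "c k > 0" for k by (simp add: c_def)
  have scale: "4 ^ k * \<bar>t\<bar> powr (2 / p) = \<bar>0 + c k * t\<bar> powr (2 / p)" for k and t :: real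
  proof -
    have "c k powr (2 / p) = (2 powr p) powr (2 / p * real k)"
      by (simp add: c_def powr_powr mult.commute flip: powr_realpow)
    also have "\<dots> = 2 powr (2 * real k)" using p by (simp add: powr_powr)
    also have "\<dots> = (2 powr 2) powr real k" by (simp only: powr_powr)
    also have "\<dots> = 4 ^ k" by (simp add: powr_realpow)
    finally show ?thesis using c[of k] by (simp add: abs_mult powr_mult)
  qed
  have I2: "integrable lborel (\<lambda>t::real. exp (- (4 ^ k * \<bar>t\<bar> powr (2 / p)) / 2))" for k
    unfolding scale using lborel_integrable_real_affine[OF Ji, of "c k" 0] c[of k] by simp
  have V2: "(LINT t|lborel. exp (- (4 ^ k * \<bar>t::real\<bar> powr (2 / p)) / 2)) = J / c k" for k
  proof -
    have "J = \<bar>c k\<bar> *\<^sub>R (LINT t|lborel. exp (- (\<bar>0 + c k * t\<bar> powr (2 / p)) / 2))"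
      unfolding J_def using c[of k] by (intro lborel_integral_real_affine) simp
    then show ?thesis unfolding scale using c[of k] by (simp add: field_simps)
  qed
  define f where "f = (\<lambda>k (b::real^2) t::real. if b = axis 1 1 then exp (- (4 ^ k) * t\<^sup>2 / 2) else exp (- (4 ^ k * \<bar>t\<bar> powr (2 / p)) / 2))"
  have fi: "integrable lborel (f k b)" for k b
    using I1[of k] I2[of k] by (cases "b = axis 1 1") (simp_all add: f_def)
  let ?P = "\<lambda>k x. \<Prod>b\<in>Basis. f k b (x \<bullet> b)"
  have P: "?P k x = exp (- (4 ^ k) * (x $ 1)\<^sup>2 / 2) * exp (- (4 ^ k * \<bar>x $ 2\<bar> powr (2 / p)) / 2)" for k x
    unfolding prod_Basis_real2 f_def using axis_1_neq_2 by (simp add: inner_axis)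
  have Pi: "integrable lborel (?P k)" for k
    by (rule integrable_lborel_prod_Basis(1)[OF fi])
  have PV: "(LINT x|lborel. ?P k x) = sqrt (2 * pi) * (1 / 2) ^ k * (J / c k)" for k
    unfolding integrable_lborel_prod_Basis(2)[OF fi]
    unfolding prod_Basis_real2 using axis_1_neq_2 V1[of k] V2[of k] by (simp add: f_def)
  have [measurable]: "cusp p \<in> sets borel" using open_cusp[OF p] by simp
  have le: "indicator (cusp p) x *\<^sub>R (gaussian k x)\<^sup>2 \<le> ?P k x" for k x
  proof (cases "x \<in> cusp p")
    case True
    have "(\<bar>x $ 2\<bar> powr (1 / p))\<^sup>2 \<le> (x $ 1)\<^sup>2"
      using True p by (intro power_mono) (auto simp: cusp_eq)
    moreover have "(\<bar>x $ 2\<bar> powr (1 / p))\<^sup>2 = \<bar>x $ 2\<bar> powr (2 / p)"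
      by (simp add: power2_eq_square flip: powr_add)
    moreover have "(x $ 1)\<^sup>2 \<le> (norm x)\<^sup>2"
      using component_le_norm_cart[of x 1] by (metis abs_ge_zero power2_abs power_mono)
    ultimately have *: "(x $ 1)\<^sup>2 / 2 + \<bar>x $ 2\<bar> powr (2 / p) / 2 \<le> (norm x)\<^sup>2" by linarith
    have "(gaussian k x)\<^sup>2 = exp (- (4 ^ k * (norm x)\<^sup>2))"
      by (simp add: gaussian_def power2_eq_square flip: exp_add)
    also have "\<dots> \<le> exp (- (4 ^ k * ((x $ 1)\<^sup>2 / 2 + \<bar>x $ 2\<bar> powr (2 / p) / 2)))"
      using * by simp
    also have "\<dots> = ?P k x"
      unfolding P by (simp add: algebra_simps flip: exp_add)
    finally show ?thesis using True by simp
  next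
    case False
    then show ?thesis unfolding P by simp
  qed
  have si: "set_integrable lborel (cusp p) (\<lambda>x. (gaussian k x)\<^sup>2)" for k
    unfolding set_integrable_def
  proof (rule Bochner_Integration.integrable_bound[OF Pi[of k]])
    show "AE x in lborel. norm (indicator (cusp p) x *\<^sub>R (gaussian k x)\<^sup>2) \<le> norm (?P k x)"
    proof (rule AE_I2)
      fix x :: "real ^ 2"
      have "norm (indicator (cusp p) x *\<^sub>R (gaussian k x)\<^sup>2) = indicator (cusp p) x *\<^sub>R (gaussian k x)\<^sup>2" by simp
      also have "\<dots> \<le> ?P k x" by (rule le)
      also have "\<dots> \<le> norm (?P k x)" unfolding real_norm_def by (rule abs_ge_self)
      finally show "norm (indicator (cusp p) x *\<^sub>R (gaussian k x)\<^sup>2) \<le> norm (?P k x)" .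
    qed
  qed measurable
  show ?thesis
  proof
    show "sqrt (2 * pi) * J + 1 > 0" using J0 by (intro add_nonneg_pos) auto
    fix k
    show "set_integrable lborel (cusp p) (\<lambda>x. (gaussian k x)\<^sup>2)" by (rule si)
    have "(LINT x:cusp p|lborel. (gaussian k x)\<^sup>2) \<le> (LINT x|lborel. ?P k x)"
      unfolding set_lebesgue_integral_def by (intro integral_mono Pi le si[unfolded set_integrable_def])
    also have "\<dots> = sqrt (2 * pi) * J * (2 powr (- (p + 1))) ^ k"
    proof -
      have "- (p + 1) = - 1 - p" by linarith
      then have "2 powr (- (p + 1)) = (1 / 2) / (2 powr p)"
        by (simp only: powr_diff powr_neg_one zero_less_numeral)
      then have "(2 powr (- (p + 1))) ^ k = (1 / 2) ^ k / c k" by (simp only: power_divide c_def)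
      then show ?thesis unfolding PV by simp
    qed
    also have "\<dots> \<le> (sqrt (2 * pi) * J + 1) * (2 powr (- (p + 1))) ^ k"
      by (intro mult_right_mono) auto
    finally show "(LINT x:cusp p|lborel. (gaussian k x)\<^sup>2) \<le> (sqrt (2 * pi) * J + 1) * (2 powr (- (p + 1))) ^ k" .
  qed
qed

section \<open>The series and its tails\<close>

text \<open>A power bound of order \<open>m\<close> on the exponential gives decay like
  \<open>(1 / 4 ^ m) ^ k\<close>, which beats \<open>B ^ k\<close> as soon as
  \<open>4 ^ m > 2 * B\<close>.\<close>

lemma summable_superexponential:
  fixes B r :: real
  assumes B: "0 \<le> B" and r: "r > 0"
  shows "summable (\<lambda>k. B ^ k * exp (- (4 ^ k) * r))"
proof -
  obtain m :: nat where m: "2 * B < 4 ^ m" using real_arch_pow[of 4 "2 * B"] by auto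
  let ?g = "\<lambda>k. (fact m / r ^ m) * (B / 4 ^ m) ^ k"
  have q: "norm (B / 4 ^ m) < 1" using m B by (simp add: field_simps)
  show ?thesis
  proof (rule summable_comparison_test'[where N = 0])
    show "summable ?g" by (intro summable_mult summable_geometric q)
    fix k :: nat
    have y: "4 ^ k * r > 0" using r by simp
    have "(4 ^ k * r) ^ m \<le> fact m * exp (4 ^ k * r)" using y by (intro power_le_exp) simp
    then have "(4 ^ k * r) ^ m * exp (- (4 ^ k * r)) \<le> fact m * exp (4 ^ k * r) * exp (- (4 ^ k * r))"
      by (intro mult_right_mono) simp_all
    also have "\<dots> = fact m" by (simp add: mult.assoc flip: exp_add)
    finally have "exp (- (4 ^ k * r)) \<le> fact m / (4 ^ k * r) ^ m"
      using y by (simp only: pos_le_divide_eq zero_less_power mult.commute)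
    then have "B ^ k * exp (- (4 ^ k * r)) \<le> B ^ k * (fact m / (4 ^ k * r) ^ m)"
      using B by (intro mult_left_mono) auto
    also have "\<dots> = ?g k"
      by (simp add: power_mult_distrib power_divide mult.commute flip: power_mult)
    finally show "norm (B ^ k * exp (- (4 ^ k) * r)) \<le> ?g k"
      using B by simp
  qed
qed

lemma summable_gaussian:
  assumes "0 \<le> B" "x \<noteq> 0"
  shows "summable (\<lambda>k. B ^ k * gaussian k x)"
proof -
  have "gaussian k x = exp (- (4 ^ k) * ((norm x)\<^sup>2 / 2))" for k
    by (simp add: gaussian_def)
  then show ?thesis
    using summable_superexponential[of B "(norm x)\<^sup>2 / 2"] assms by simp
qed

lemma summable_gaussian_square:
  assumes "0 \<le> B" "x \<noteq> 0"
  shows "summable (\<lambda>k. B ^ k * (gaussian k x)\<^sup>2)"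
proof -
  have "(gaussian k x)\<^sup>2 = exp (- (4 ^ k) * (norm x)\<^sup>2)" for k
    by (simp add: gaussian_def power2_eq_square flip: exp_add)
  then show ?thesis
    using summable_superexponential[of B "(norm x)\<^sup>2"] assms by simp
qed

text \<open>\<open>tail b 0\<close> is the whole series. For \<open>b \<ge> 1\<close> it diverges at
  the origin, hence the assumption \<open>x \<noteq> 0\<close> in the lemmas that evaluate it, which
  holds on the cusp.\<close>

definition tail :: "real \<Rightarrow> nat \<Rightarrow> real ^ 2 \<Rightarrow> real" where
  "tail b n x = (\<Sum>j. b ^ (j + n) * gaussian (j + n) x)"

lemma tail_measurable [measurable]: "tail b n \<in> borel_measurable borel"
  unfolding tail_def by measurable

lemma tail_split:
  assumes "0 \<le> b" "x \<noteq> 0"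
  shows "tail b 0 x = (\<Sum>k<n. b ^ k * gaussian k x) + tail b n x"
  using suminf_split_initial_segment[OF summable_gaussian[OF assms], of n]
  by (simp add: tail_def)

text \<open>Cauchy-Schwarz with the weights \<open>(1 / 2) ^ k\<close>: their sum from
  \<open>n\<close> on yields the factor \<open>2 * (1 / 2) ^ n\<close>, and dividing by them turns
  \<open>(b ^ k)\<^sup>2\<close> into \<open>(2 * b\<^sup>2) ^ k\<close>. The estimate is made for
  finite sums and passes to the limit.\<close>

lemma tail_square_le:
  assumes b: "0 \<le> b" and x: "x \<noteq> 0"
  shows "(tail b n x)\<^sup>2 \<le> 2 * (1 / 2) ^ n * (\<Sum>j. (2 * b\<^sup>2) ^ (j + n) * (gaussian (j + n) x)\<^sup>2)"
proof -
  let ?f = "\<lambda>j. b ^ (j + n) * gaussian (j + n) x"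
  let ?h = "\<lambda>j. (2 * b\<^sup>2) ^ (j + n) * (gaussian (j + n) x)\<^sup>2"
  have f: "summable ?f"
    using summable_ignore_initial_segment[OF summable_gaussian[OF b x], of n] .
  have h: "summable ?h"
    using summable_ignore_initial_segment[OF summable_gaussian_square[of "2 * b\<^sup>2" x], of n] x by simp
  have geo: "(\<Sum>j<m. (1 / 2) ^ (j + n)) \<le> 2 * (1 / 2 :: real) ^ n" for m
  proof -
    have "(\<Sum>j<m. (1 / 2) ^ j) = 2 - 2 * (1 / 2 :: real) ^ m" by (induction m) auto
    then have "(\<Sum>j<m. (1 / 2) ^ j) \<le> (2 :: real)" by simp
    then have "(\<Sum>j<m. (1 / 2) ^ j) * (1 / 2) ^ n \<le> 2 * (1 / 2 :: real) ^ n" by (intro mult_right_mono) auto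
    then show ?thesis by (simp only: sum_distrib_right power_add)
  qed
  have "(\<Sum>j<m. ?f j)\<^sup>2 \<le> 2 * (1 / 2) ^ n * (\<Sum>j. ?h j)" for m
  proof -
    have "(\<Sum>j<m. ?f j)\<^sup>2 \<le> (\<Sum>j<m. (1 / 2) ^ (j + n)) * (\<Sum>j<m. (?f j)\<^sup>2 / (1 / 2) ^ (j + n))"
      by (rule weighted_sum_square_le) simp
    also have "(\<Sum>j<m. (?f j)\<^sup>2 / (1 / 2) ^ (j + n)) = (\<Sum>j<m. ?h j)"
    proof (rule sum.cong[OF refl])
      fix j
      have "(b ^ (j + n))\<^sup>2 / (1 / 2) ^ (j + n) = (2 * b\<^sup>2) ^ (j + n)"
        by (simp add: power_divide power_mult_distrib mult.commute flip: power_mult)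
      moreover have "(?f j)\<^sup>2 / (1 / 2) ^ (j + n) = (b ^ (j + n))\<^sup>2 / (1 / 2) ^ (j + n) * (gaussian (j + n) x)\<^sup>2"
        unfolding power_mult_distrib[of "b ^ (j + n)"] by (rule times_divide_eq_left[symmetric])
      ultimately show "(?f j)\<^sup>2 / (1 / 2) ^ (j + n) = ?h j" by (simp only:)
    qed
    also have "(\<Sum>j<m. (1 / 2) ^ (j + n)) * (\<Sum>j<m. ?h j) \<le> 2 * (1 / 2) ^ n * (\<Sum>j. ?h j)"
      by (intro mult_mono geo sum_le_suminf h sum_nonneg) auto
    finally show ?thesis .
  qed
  moreover have "(\<lambda>m. (\<Sum>j<m. ?f j)\<^sup>2) \<longlonglongrightarrow> (tail b n x)\<^sup>2"
    unfolding tail_def by (intro tendsto_power summable_LIMSEQ f)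
  ultimately show ?thesis by (intro LIMSEQ_le_const2) auto
qed

text \<open>The assumption on \<open>b\<close> makes the ratio \<open>q\<close> at most 1/2, so the
  geometric series is at most 2. With the factor 2 from \<open>tail_square_le\<close> this gives the
  constant 4, and \<open>(1 / 2) * q\<close> is the resulting rate.\<close>

lemma tail_L2:
  assumes p: "p > 0" and b: "0 \<le> b" "4 * b\<^sup>2 \<le> 2 powr (p + 1)"
    and C: "C > 0" "\<And>k. set_integrable lborel (cusp p) (\<lambda>x. (gaussian k x)\<^sup>2)"
    "\<And>k. (LINT x:cusp p|lborel. (gaussian k x)\<^sup>2) \<le> C * (2 powr (- (p + 1))) ^ k"
  shows "set_integrable lborel (cusp p) (\<lambda>x. (tail b n x)\<^sup>2)"
    "(LINT x:cusp p|lborel. (tail b n x)\<^sup>2) \<le> 4 * C * (b\<^sup>2 * 2 powr (- (p + 1))) ^ n"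
proof -
  define d where "d = 2 powr (- (p + 1))"
  define q where "q = 2 * b\<^sup>2 * d"
  have d: "d > 0" by (simp add: d_def)
  have "4 * b\<^sup>2 * d \<le> 2 powr (p + 1) * d" using b d by (intro mult_right_mono) auto
  also have "\<dots> = 1" by (simp add: d_def flip: powr_add)
  finally have q: "0 \<le> q" "q \<le> 1 / 2" using d by (auto simp: q_def)
  have [measurable]: "cusp p \<in> sets borel" using open_cusp[OF p] by simp
  let ?h = "\<lambda>j x. indicator (cusp p) x *\<^sub>R ((2 * b\<^sup>2) ^ (j + n) * (gaussian (j + n) x)\<^sup>2)"
  have h0: "0 \<le> ?h j x" for j x by simp
  have eq: "?h j x = (2 * b\<^sup>2) ^ (j + n) * (indicator (cusp p) x *\<^sub>R (gaussian (j + n) x)\<^sup>2)" for j x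
    by simp
  have hi: "integrable lborel (?h j)" for j
    unfolding eq by (intro integrable_mult_right C(2)[unfolded set_integrable_def])
  have hle: "(LINT x|lborel. ?h j x) \<le> C * q ^ (j + n)" for j
  proof -
    have "(LINT x|lborel. ?h j x) = (2 * b\<^sup>2) ^ (j + n) * (LINT x:cusp p|lborel. (gaussian (j + n) x)\<^sup>2)"
      unfolding eq set_lebesgue_integral_def by (rule integral_mult_right_zero)
    also have "\<dots> \<le> (2 * b\<^sup>2) ^ (j + n) * (C * d ^ (j + n))"
      unfolding d_def by (intro mult_left_mono C(3)) simp
    also have "\<dots> = C * q ^ (j + n)" unfolding q_def by (simp only: power_mult_distrib mult_ac)
    finally show ?thesis .
  qed
  have qs: "summable (\<lambda>j. C * q ^ (j + n))"
    using q by (intro summable_mult summable_ignore_initial_segment summable_geometric) auto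
  have hn: "norm (LINT x|lborel. ?h j x) = (LINT x|lborel. ?h j x)" for j
    by (simp only: real_norm_def) (intro abs_of_nonneg integral_nonneg_AE AE_I2 h0)
  have hs: "summable (\<lambda>j. LINT x|lborel. ?h j x)"
    by (rule summable_comparison_test'[OF qs, of 0]) (unfold hn, rule hle)
  have nz: "x \<noteq> 0" if "x \<in> cusp p" for x using that by (auto simp: cusp_def)
  have pt: "summable (\<lambda>j. ?h j x)" for x
  proof (cases "x \<in> cusp p")
    case True
    then show ?thesis
      using summable_ignore_initial_segment[OF summable_gaussian_square[of "2 * b\<^sup>2" x], of n] nz by simp
  qed simp
  have nh: "norm (?h j x) = ?h j x" for j x by simp
  have pt': "AE x in lborel. summable (\<lambda>j. norm (?h j x))" unfolding nh by (intro AE_I2 pt)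
  have hs': "summable (\<lambda>j. LINT x|lborel. norm (?h j x))" unfolding nh by (rule hs)
  have Si: "integrable lborel (\<lambda>x. \<Sum>j. ?h j x)" by (rule integrable_suminf[OF hi pt' hs'])
  have SV: "(LINT x|lborel. (\<Sum>j. ?h j x)) = (\<Sum>j. LINT x|lborel. ?h j x)" by (rule integral_suminf[OF hi pt' hs'])
  have S2i: "integrable lborel (\<lambda>x. 2 * (1 / 2) ^ n * (\<Sum>j. ?h j x))" by (intro integrable_mult_right Si)
  have le: "indicator (cusp p) x *\<^sub>R (tail b n x)\<^sup>2 \<le> 2 * (1 / 2) ^ n * (\<Sum>j. ?h j x)" for x
  proof (cases "x \<in> cusp p")
    case True
    then show ?thesis using tail_square_le[OF b(1) nz, of x n] by simp
  next
    case False
    then show ?thesis by simp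
  qed
  show ti: "set_integrable lborel (cusp p) (\<lambda>x. (tail b n x)\<^sup>2)"
    unfolding set_integrable_def
  proof (rule Bochner_Integration.integrable_bound[OF S2i])
    show "AE x in lborel. norm (indicator (cusp p) x *\<^sub>R (tail b n x)\<^sup>2) \<le> norm (2 * (1 / 2) ^ n * (\<Sum>j. ?h j x))"
    proof (rule AE_I2)
      fix x
      have "norm (indicator (cusp p) x *\<^sub>R (tail b n x)\<^sup>2) = indicator (cusp p) x *\<^sub>R (tail b n x)\<^sup>2" by simp
      also have "\<dots> \<le> 2 * (1 / 2) ^ n * (\<Sum>j. ?h j x)" by (rule le)
      also have "\<dots> \<le> norm (2 * (1 / 2) ^ n * (\<Sum>j. ?h j x))" unfolding real_norm_def by (rule abs_ge_self)
      finally show "norm (indicator (cusp p) x *\<^sub>R (tail b n x)\<^sup>2) \<le> norm (2 * (1 / 2) ^ n * (\<Sum>j. ?h j x))" .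
    qed
  qed measurable
  have "(LINT x:cusp p|lborel. (tail b n x)\<^sup>2) \<le> (LINT x|lborel. 2 * (1 / 2) ^ n * (\<Sum>j. ?h j x))"
    unfolding set_lebesgue_integral_def by (intro integral_mono S2i le ti[unfolded set_integrable_def])
  also have "\<dots> = 2 * (1 / 2) ^ n * (\<Sum>j. LINT x|lborel. ?h j x)"
    by (simp only: integral_mult_right_zero SV)
  also have "\<dots> \<le> 2 * (1 / 2) ^ n * (C * (2 * q ^ n))"
  proof (intro mult_left_mono)
    have "(\<Sum>j. LINT x|lborel. ?h j x) \<le> (\<Sum>j. C * q ^ (j + n))"
      by (intro suminf_le hle hs qs)
    also have "\<dots> = C * q ^ n * (\<Sum>j. q ^ j)"
      using q by (subst suminf_mult[symmetric]) (auto simp: power_add mult_ac intro!: summable_geometric)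
    also have "(\<Sum>j. q ^ j) = 1 / (1 - q)" using q by (intro suminf_geometric) auto
    also have "C * q ^ n * (1 / (1 - q)) \<le> C * q ^ n * 2"
      using q C(1) by (intro mult_left_mono) (auto simp: field_simps)
    finally show "(\<Sum>j. LINT x|lborel. ?h j x) \<le> C * (2 * q ^ n)" by simp
  qed simp
  also have "\<dots> = 4 * C * ((1 / 2) * q) ^ n" unfolding power_mult_distrib[of "1 / 2" q] by simp
  also have "(1 / 2) * q = b\<^sup>2 * d" by (simp add: q_def)
  finally show "(LINT x:cusp p|lborel. (tail b n x)\<^sup>2) \<le> 4 * C * (b\<^sup>2 * 2 powr (- (p + 1))) ^ n"
    by (simp only: d_def)
qed

section \<open>The two first endpoints, and membership in the interpolation spaces\<close>

definition set_distr :: "'a::euclidean_space set \<Rightarrow> ('a \<Rightarrow> complex) \<Rightarrow> 'a functional" where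
  "set_distr \<Omega> g = (\<lambda>f. if f \<in> test_fun \<Omega> then LINT x:\<Omega>|lborel. g x * f x else 0)"

lemma set_distr_L2:
  fixes \<Omega> :: "'a::euclidean_space set"
  assumes \<Omega>: "open \<Omega>" "emeasure lborel \<Omega> < \<infinity>"
    and g: "g \<in> borel_measurable borel" "set_integrable lborel \<Omega> (\<lambda>x. (norm (g x))\<^sup>2)"
  shows "set_distr \<Omega> g \<in> carrier (L2 \<Omega>)"
    "(nrm (L2 \<Omega>) (set_distr \<Omega> g))\<^sup>2 \<le> (LINT x:\<Omega>|lborel. (norm (g x))\<^sup>2)"
proof -
  have d: "L2_density \<Omega> (set_distr \<Omega> g) g"
    using g by (simp add: L2_density_def set_distr_def)
  then show "set_distr \<Omega> g \<in> carrier (L2 \<Omega>)" by (auto simp: L2_def)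
  have "0 \<le> (LINT x:\<Omega>|lborel. (norm (g x))\<^sup>2)"
    unfolding set_lebesgue_integral_def by (intro integral_nonneg_AE) auto
  then show "(nrm (L2 \<Omega>) (set_distr \<Omega> g))\<^sup>2 \<le> (LINT x:\<Omega>|lborel. (norm (g x))\<^sup>2)"
    unfolding nrm_L2[OF \<Omega> d] by simp
qed

text \<open>Extension by zero followed by Plancherel's inequality. It is the counterpart of
  \<open>set_distr_L2\<close> for \<open>sobolev \<Omega> 0\<close>, the endpoint that occurs in
  \<open>interpolation_scale\<close>.\<close>

lemma set_distr_H0:
  fixes \<Omega> :: "'a::euclidean_space set"
  assumes \<Omega>: "open \<Omega>" "emeasure lborel \<Omega> < \<infinity>"
    and g [measurable]: "g \<in> borel_measurable borel" and g2: "set_integrable lborel \<Omega> (\<lambda>x. (norm (g x))\<^sup>2)"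
  shows "set_distr \<Omega> g \<in> carrier (sobolev \<Omega> 0)"
    "(nrm (sobolev \<Omega> 0) (set_distr \<Omega> g))\<^sup>2 \<le> (LINT x:\<Omega>|lborel. (norm (g x))\<^sup>2)"
proof -
  have [measurable]: "\<Omega> \<in> sets borel" using \<Omega>(1) by simp
  define h where "h = (\<lambda>x. indicator \<Omega> x *\<^sub>R g x)"
  have hm [measurable]: "h \<in> borel_measurable borel" unfolding h_def by measurable
  have h1: "integrable lborel h"
    using L2_set_integrable[OF g _ \<Omega>(2) g2] unfolding h_def set_integrable_def by simp
  have sq: "(norm (h x))\<^sup>2 = indicator \<Omega> x *\<^sub>R (norm (g x))\<^sup>2" for x
    by (simp add: h_def indicator_def)
  have h2: "integrable lborel (\<lambda>x. (norm (h x))\<^sup>2)"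
    unfolding sq using g2 by (simp only: set_integrable_def)
  have p0: "(1 + (norm \<xi>)\<^sup>2) powr 0 = 1" for \<xi> :: 'a
  proof -
    have "1 + (norm \<xi>)\<^sup>2 > 0" by (simp add: add_pos_nonneg)
    then show ?thesis by simp
  qed
  have wd: "weighted_density 0 (fourier_distr (fun_distr h)) (fourier h)"
    using plancherel_le(1)[OF h1 h2] by (intro weighted_density_fourier h1) (simp only: p0 mult_1)
  have k0: "integrable lborel (\<lambda>x. norm (h x) / (1 + norm x ^ 0))"
    using integrable_norm[OF h1] by simp
  have eq: "restrict_distr \<Omega> (fun_distr h) = set_distr \<Omega> g"
  proof
    fix f
    show "restrict_distr \<Omega> (fun_distr h) f = set_distr \<Omega> g f"
      by (simp add: restrict_distr_def fun_distr_def set_distr_def h_def test_fun_schwartz set_lebesgue_integral_def)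
  qed
  show "set_distr \<Omega> g \<in> carrier (sobolev \<Omega> 0)"
    unfolding eq[symmetric] by (rule sobolev_restrict_fun_distr(1)[OF hm k0 wd])
  have "(nrm (sobolev \<Omega> 0) (set_distr \<Omega> g))\<^sup>2 \<le> (LINT \<xi>|lborel. (1 + (norm \<xi>)\<^sup>2) powr 0 * (norm (fourier h \<xi>))\<^sup>2)"
    unfolding eq[symmetric] by (rule sobolev_restrict_fun_distr(3)[OF hm k0 wd])
  also have "\<dots> \<le> (LINT x|lborel. (norm (h x))\<^sup>2)"
    unfolding p0 mult_1 by (rule plancherel_le(2)[OF h1 h2])
  also have "\<dots> = (LINT x:\<Omega>|lborel. (norm (g x))\<^sup>2)"
    unfolding sq set_lebesgue_integral_def ..
  finally show "(nrm (sobolev \<Omega> 0) (set_distr \<Omega> g))\<^sup>2 \<le> (LINT x:\<Omega>|lborel. (norm (g x))\<^sup>2)" .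
qed

lemma emeasure_cusp: "p > 0 \<Longrightarrow> emeasure lborel (cusp p) < \<infinity>"
  by (intro emeasure_bounded_finite bounded_cusp)

text \<open>The truncation index balances the two terms of the decomposition: \<open>2 powr (- n (p + 3) / 2)\<close>
  is comparable to \<open>t\<close>.\<close>

lemma truncation_balance:
  fixes p t C :: real
  assumes p: "p > 1" and t: "t > 0" and C: "C > 0"
  defines "b \<equiv> 2 powr ((p - 1) / 8)"
  obtains n where "4 * C * (b\<^sup>2 * 2 powr (- (p + 1))) ^ n + t\<^sup>2 * (16 * pi * (2 ^ n - 1) * (2 * b\<^sup>2) ^ n)
    \<le> (if t < 1 then (4 * C + 16 * pi) * 2 powr ((3 * p + 5) / 4) * t powr ((3 * p + 5) / (2 * (p + 3))) else 4 * C)"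
proof (cases "t < 1")
  case False
  \<comment> \<open>For \<open>t \<ge> 1\<close> nothing is put into the H^2 part: at
    \<open>n = 0\<close> the factor \<open>2 ^ n - 1\<close> cancels the term with
    \<open>t\<^sup>2\<close>.\<close>
  then show ?thesis using that[of 0] by simp
next
  case True
  \<comment> \<open>The common decay rate at balance: the tail gives -(p + 1) + (p - 1)/4 = -r, and
    the partial sum gives -(p + 3) + 2 + (p - 1)/4 = -r.\<close>
  define r where "r = (3 * p + 5) / 4"
  \<comment> \<open>The real index for which \<open>t\<close> equals
    \<open>2 powr (- (p + 3) / 2 * L)\<close>. Rounding it down to \<open>n\<close> costs at most
    the factor \<open>2 powr r\<close> below.\<close>
  define L where "L = (2 / (p + 3)) * log 2 (1 / t)"
  define n where "n = nat \<lfloor>L\<rfloor>"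
  have L: "L > 0" using True t p by (simp add: L_def)
  have n: "real n \<le> L" "L < real n + 1"
    using L by (simp_all add: n_def of_nat_nat)
  have b2: "b\<^sup>2 = 2 powr ((p - 1) / 4)"
    by (simp add: b_def power2_eq_square flip: powr_add)
  have "b\<^sup>2 * 2 powr (- (p + 1)) = 2 powr ((p - 1) / 4 + - (p + 1))" by (simp only: b2 powr_add)
  also have "(p - 1) / 4 + - (p + 1) = - r" by (simp add: r_def field_simps)
  finally have D: "(b\<^sup>2 * 2 powr (- (p + 1))) ^ n = 2 powr (- r * real n)"
    by (simp add: powr_powr flip: powr_realpow)
  have cancel: "(p + 3) / 2 * (2 / (p + 3)) = 1" using p by simp
  have "(p + 3) / 2 * L = log 2 (1 / t)"
    unfolding L_def mult.assoc[symmetric] cancel by (rule mult_1)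
  then have "2 powr (- (p + 3) / 2 * L) = 2 powr (- log 2 (1 / t))"
    by (simp only: mult_minus_left minus_divide_left[symmetric])
  also have "\<dots> = t" using t by (simp add: powr_minus)
  finally have tL: "t = 2 powr (- (p + 3) / 2 * L)" ..
  have t2: "t\<^sup>2 = 2 powr (- (p + 3) * L)"
  proof -
    have "- (p + 3) / 2 + - (p + 3) / 2 = - (p + 3)" by (simp only: minus_divide_left[symmetric]) simp
    then have "- (p + 3) / 2 * L + - (p + 3) / 2 * L = - (p + 3) * L"
      unfolding distrib_right[symmetric] by (simp only:)
    then show ?thesis unfolding tL power2_eq_square powr_add[symmetric] by (simp only:)
  qed
  have E: "(2 ^ n - 1) * (2 * b\<^sup>2) ^ n \<le> 2 powr ((2 + (p - 1) / 4) * real n)"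
  proof -
    have "(2 ^ n - 1) * (2 * b\<^sup>2) ^ n \<le> 2 ^ n * (2 * b\<^sup>2) ^ n" by (intro mult_right_mono) auto
    also have "\<dots> = (2 * (2 * b\<^sup>2)) ^ n" by (rule power_mult_distrib[symmetric])
    also have "2 * (2 * b\<^sup>2) = 2 powr (2 + (p - 1) / 4)" unfolding b2 by (simp add: powr_add)
    also have "(2 powr (2 + (p - 1) / 4)) ^ n = 2 powr ((2 + (p - 1) / 4) * real n)"
      by (simp add: powr_powr flip: powr_realpow)
    finally show ?thesis .
  qed
  have tE: "t\<^sup>2 * ((2 ^ n - 1) * (2 * b\<^sup>2) ^ n) \<le> 2 powr (- r * real n)"
  proof -
    have "t\<^sup>2 * ((2 ^ n - 1) * (2 * b\<^sup>2) ^ n) \<le> 2 powr (- (p + 3) * real n) * 2 powr ((2 + (p - 1) / 4) * real n)"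
    proof (unfold t2, rule mult_mono[OF _ E])
      have "- (p + 3) * L \<le> - (p + 3) * real n"
        using p by (intro mult_left_mono_neg n) simp
      then show "2 powr (- (p + 3) * L) \<le> 2 powr (- (p + 3) * real n)"
        by (rule powr_mono) simp
      have "1 \<le> (2 :: real) ^ n" by simp
      then show "0 \<le> (2 ^ n - 1) * (2 * b\<^sup>2) ^ n" by (intro mult_nonneg_nonneg) auto
    qed simp
    also have "\<dots> = 2 powr (- (p + 3) * real n + (2 + (p - 1) / 4) * real n)"
      by (simp only: powr_add)
    also have "- (p + 3) * real n + (2 + (p - 1) / 4) * real n = - r * real n"
      by (simp add: r_def field_simps)
    finally show ?thesis .
  qed
  have r0: "r > 0" using p by (simp add: r_def)
  have Dt: "2 powr (- r * real n) \<le> 2 powr r * t powr ((3 * p + 5) / (2 * (p + 3)))"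
  proof -
    have "r * L \<le> r * (real n + 1)" using n(2) r0 by (intro mult_left_mono) simp_all
    then have "- r * real n \<le> r + - r * L" by (simp add: distrib_left)
    then have "2 powr (- r * real n) \<le> 2 powr (r + - r * L)" by (intro powr_mono) auto
    also have "\<dots> = 2 powr r * 2 powr (- r * L)" by (rule powr_add)
    also have "- r * L = (- (p + 3) / 2 * L) * ((3 * p + 5) / (2 * (p + 3)))"
      using p by (simp add: r_def field_simps)
    also have "2 powr \<dots> = t powr ((3 * p + 5) / (2 * (p + 3)))"
      unfolding tL by (rule powr_powr[symmetric])
    finally show ?thesis .
  qed
  have "4 * C * (b\<^sup>2 * 2 powr (- (p + 1))) ^ n + t\<^sup>2 * (16 * pi * (2 ^ n - 1) * (2 * b\<^sup>2) ^ n)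
    = 4 * C * 2 powr (- r * real n) + 16 * pi * (t\<^sup>2 * ((2 ^ n - 1) * (2 * b\<^sup>2) ^ n))"
    unfolding D by (simp only: mult_ac)
  also have "\<dots> \<le> 4 * C * 2 powr (- r * real n) + 16 * pi * 2 powr (- r * real n)"
    by (intro add_left_mono mult_left_mono tE) simp
  also have "\<dots> = (4 * C + 16 * pi) * 2 powr (- r * real n)" by (rule distrib_right[symmetric])
  also have "\<dots> \<le> (4 * C + 16 * pi) * (2 powr r * t powr ((3 * p + 5) / (2 * (p + 3))))"
    using C by (intro mult_left_mono Dt) auto
  finally show ?thesis using that[of n] True by (simp add: r_def mult.assoc)
qed

text \<open>Near 0 the exponent \<open>\<kappa> - 2\<close> exceeds -1, and at infinity the constant
  leaves \<open>t powr (- 2)\<close>.\<close>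

lemma truncation_balance_integrable:
  fixes K c \<kappa> :: real
  assumes "\<kappa> > 1"
  shows "set_integrable lborel {0<..} (\<lambda>t. (if t < 1 then K * t powr \<kappa> else c) / t\<^sup>2)"
proof -
  have "((\<lambda>t. t powr (\<kappa> - 2)) has_integral (1 powr (\<kappa> - 2 + 1) / (\<kappa> - 2 + 1))) {0..1::real}"
    using assms by (intro has_integral_powr_from_0) auto
  then have 1: "set_integrable lborel {0..1::real} (\<lambda>t. t powr (\<kappa> - 2))"
    by (intro set_integrable_lborel_nonneg) (auto simp: integrable_on_def)
  have "((\<lambda>t. t powr (- 2)) has_integral - (1 powr (- 2 + 1)) / (- 2 + 1)) {1::real..}"
    by (intro has_integral_powr_to_inf) auto
  then have 2: "set_integrable lborel {1::real..} (\<lambda>t. t powr (- 2))"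
    by (intro set_integrable_lborel_nonneg) (auto simp: integrable_on_def)
  have i: "integrable lborel (\<lambda>t::real. \<bar>K\<bar> * (indicator {0..1} t *\<^sub>R t powr (\<kappa> - 2)) + \<bar>c\<bar> * (indicator {1..} t *\<^sub>R t powr (- 2)))"
    using 1 2 unfolding set_integrable_def by (intro Bochner_Integration.integrable_add integrable_mult_right)
  show ?thesis
    unfolding set_integrable_def
  proof (rule Bochner_Integration.integrable_bound[OF i])
    show "AE t in lborel. norm (indicator {0<..} t *\<^sub>R ((if t < 1 then K * t powr \<kappa> else c) / t\<^sup>2))
      \<le> norm (\<bar>K\<bar> * (indicator {0..1} t *\<^sub>R t powr (\<kappa> - 2)) + \<bar>c\<bar> * (indicator {1..} t *\<^sub>R t powr (- 2)))"
    proof (rule AE_I2)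
      fix t :: real
      have t2: "t powr (- 2) = 1 / t\<^sup>2" if "t > 0"
        using powr_realpow[OF that, of 2] by (simp add: powr_minus divide_inverse)
      have tk: "t powr (\<kappa> - 2) = t powr \<kappa> / t\<^sup>2" if "t > 0"
        using powr_realpow[OF that, of 2] by (simp add: powr_diff)
      consider "t \<le> 0" | "0 < t" "t < 1" | "1 \<le> t" by linarith
      then show "norm (indicator {0<..} t *\<^sub>R ((if t < 1 then K * t powr \<kappa> else c) / t\<^sup>2))
      \<le> norm (\<bar>K\<bar> * (indicator {0..1} t *\<^sub>R t powr (\<kappa> - 2)) + \<bar>c\<bar> * (indicator {1..} t *\<^sub>R t powr (- 2)))"
      proof cases
        case 1
        then show ?thesis by simp
      next
        case 2
        then show ?thesis by (simp add: tk abs_mult indicator_def)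
      next
        case 3
        then have "\<bar>c\<bar> * (1 / t\<^sup>2) \<le> \<bar>K\<bar> * (indicator {0..1} t *\<^sub>R t powr (\<kappa> - 2)) + \<bar>c\<bar> * (indicator {1..} t *\<^sub>R t powr (- 2))"
          by (simp add: t2)
        then show ?thesis
          unfolding real_norm_def using 3 by (intro order_trans[OF _ abs_ge_self]) simp
      qed
    qed
  qed measurable
qed

lemma tail_exponent:
  fixes p :: real
  assumes p: "p > 1"
  defines "b \<equiv> 2 powr ((p - 1) / 8)"
  shows "1 \<le> b" "4 * b\<^sup>2 \<le> 2 powr (p + 1)"
proof -
  show "1 \<le> b" using p by (simp add: b_def ge_one_powr_ge_zero)
  have "b\<^sup>2 = 2 powr ((p - 1) / 4)"
    by (simp add: b_def power2_eq_square flip: powr_add)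
  then have "4 * b\<^sup>2 = 2 powr (2 + (p - 1) / 4)" by (simp add: powr_add)
  also have "\<dots> \<le> 2 powr (p + 1)"
  proof (rule powr_mono)
    show "2 + (p - 1) / 4 \<le> p + 1" using p by (simp add: field_simps)
  qed simp
  finally show "4 * b\<^sup>2 \<le> 2 powr (p + 1)" .
qed

lemma series_set_integrable:
  fixes p :: real
  assumes p: "p > 1"
  shows "set_integrable lborel (cusp p) (\<lambda>x. complex_of_real (tail (2 powr ((p - 1) / 8)) n x))"
proof -
  have p0: "p > 0" using p by simp
  obtain C where C: "C > 0" "\<And>k. set_integrable lborel (cusp p) (\<lambda>x. (gaussian k x)\<^sup>2)"
    "\<And>k. (LINT x:cusp p|lborel. (gaussian k x)\<^sup>2) \<le> C * (2 powr (- (p + 1))) ^ k"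
    using gaussian_cusp_integral[OF p0] by blast
  have "set_integrable lborel (cusp p) (\<lambda>x. (norm (complex_of_real (tail (2 powr ((p - 1) / 8)) n x)))\<^sup>2)"
    using tail_L2(1)[OF p0 _ tail_exponent(2)[OF p] C, of n] by simp
  then show ?thesis
    using open_cusp[OF p0] emeasure_cusp[OF p0] by (intro L2_set_integrable) auto
qed

text \<open>The first space is left abstract, so that one argument serves both \<open>L2\<close> for
  the inclusion and \<open>sobolev (cusp p) 0\<close> for the scale. Only an upper bound on its norm
  enters.\<close>

lemma series_in_interp:
  fixes p :: real and H\<^sub>0 :: "(real ^ 2) functional nspace"
  assumes p: "p > 1"
    and H0: "\<And>g. g \<in> borel_measurable borel \<Longrightarrow> set_integrable lborel (cusp p) (\<lambda>x. (norm (g x))\<^sup>2) \<Longrightarrow>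
      set_distr (cusp p) g \<in> carrier H\<^sub>0 \<and> (nrm H\<^sub>0 (set_distr (cusp p) g))\<^sup>2 \<le> (LINT x:cusp p|lborel. (norm (g x))\<^sup>2)"
  defines "b \<equiv> 2 powr ((p - 1) / 8)"
  shows "set_distr (cusp p) (\<lambda>x. complex_of_real (tail b 0 x)) \<in> carrier (interp H\<^sub>0 (sobolev (cusp p) 2) (1 / 2))"
proof -
  have p0: "p > 0" using p by simp
  obtain C where C: "C > 0" "\<And>k. set_integrable lborel (cusp p) (\<lambda>x. (gaussian k x)\<^sup>2)"
    "\<And>k. (LINT x:cusp p|lborel. (gaussian k x)\<^sup>2) \<le> C * (2 powr (- (p + 1))) ^ k"
    using gaussian_cusp_integral[OF p0] by blast
  have b1: "1 \<le> b" and b4: "4 * b\<^sup>2 \<le> 2 powr (p + 1)"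
    using tail_exponent[OF p] by (simp_all only: b_def)
  then have b0: "0 \<le> b" by simp
  have T: "set_integrable lborel (cusp p) (\<lambda>x. (norm (complex_of_real (tail b n x)))\<^sup>2)"
    "(LINT x:cusp p|lborel. (norm (complex_of_real (tail b n x)))\<^sup>2) \<le> 4 * C * (b\<^sup>2 * 2 powr (- (p + 1))) ^ n" for n
    using tail_L2[OF p0 b0 b4 C, of n] by simp_all
  have open_fin: "open (cusp p)" "emeasure lborel (cusp p) < \<infinity>"
    using open_cusp[OF p0] emeasure_cusp[OF p0] by auto
  have [measurable]: "cusp p \<in> sets borel" using open_fin(1) by simp
  have tm: "(\<lambda>x. complex_of_real (tail b n x)) \<in> borel_measurable borel" for n by measurable
  have ti: "set_integrable lborel (cusp p) (\<lambda>x. complex_of_real (tail b n x))" for n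
    unfolding b_def by (rule series_set_integrable[OF p])
  \<comment> \<open>The partial sum lives on the whole plane and the tail on the cusp only; test
    functions do not see the difference, and on the cusp \<open>x \<noteq> 0\<close> permits
    splitting the series.\<close>
  have split: "set_distr (cusp p) (\<lambda>x. complex_of_real (tail b n x)) + restrict_distr (cusp p) (fun_distr (partial_sum b n))
      = set_distr (cusp p) (\<lambda>x. complex_of_real (tail b 0 x))" for n
  proof
    fix f
    show "(set_distr (cusp p) (\<lambda>x. complex_of_real (tail b n x)) + restrict_distr (cusp p) (fun_distr (partial_sum b n))) f
      = set_distr (cusp p) (\<lambda>x. complex_of_real (tail b 0 x)) f"
    proof (cases "f \<in> test_fun (cusp p)")
      case True
      have fs: "f \<in> schwartz" using True by (rule test_fun_schwartz)
      have i1: "integrable lborel (\<lambda>x. indicator (cusp p) x *\<^sub>R complex_of_real (tail b n x) * f x)"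
        by (rule integrable_mult_schwartz[OF ti[unfolded set_integrable_def] fs])
      have i2: "integrable lborel (\<lambda>x. partial_sum b n x * f x)"
        by (rule integrable_mult_schwartz[OF partial_sum_integrable fs])
      have "(LINT x:cusp p|lborel. complex_of_real (tail b 0 x) * f x)
        = (LINT x|lborel. indicator (cusp p) x *\<^sub>R complex_of_real (tail b n x) * f x + partial_sum b n x * f x)"
        unfolding set_lebesgue_integral_def
      proof (intro Bochner_Integration.integral_cong refl)
        fix x
        show "indicator (cusp p) x *\<^sub>R (complex_of_real (tail b 0 x) * f x)
          = indicator (cusp p) x *\<^sub>R complex_of_real (tail b n x) * f x + partial_sum b n x * f x"
        proof (cases "x \<in> cusp p")
          case in_cusp: True
          then have "x \<noteq> 0" by (auto simp: cusp_def)
          then show ?thesis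
            using in_cusp tail_split[OF b0, of x n] by (simp add: partial_sum_def algebra_simps)
        next
          case False
          then show ?thesis using test_fun_outside[OF True] by simp
        qed
      qed
      also have "\<dots> = (LINT x|lborel. indicator (cusp p) x *\<^sub>R complex_of_real (tail b n x) * f x) + (LINT x|lborel. partial_sum b n x * f x)"
        by (rule Bochner_Integration.integral_add[OF i1 i2])
      finally show ?thesis
        using True fs by (simp add: set_distr_def restrict_distr_def fun_distr_def set_lebesgue_integral_def)
    next
      case False
      then show ?thesis by (simp add: set_distr_def restrict_distr_def)
    qed
  qed
  let ?\<Phi> = "\<lambda>t. if t < 1 then ((4 * C + 16 * pi) * 2 powr ((3 * p + 5) / 4)) * t powr ((3 * p + 5) / (2 * (p + 3))) else 4 * C"
  show ?thesis
  proof (rule interp_half_memI[where \<Phi> = ?\<Phi>])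
    \<comment> \<open>The exponent (3 p + 5) / (2 (p + 3)) exceeds 1 exactly when p > 1.\<close>
    show "set_integrable lborel {0<..} (\<lambda>t. ?\<Phi> t / t\<^sup>2)"
      using p by (intro truncation_balance_integrable) (simp add: field_simps)
    fix t :: real assume t: "t > 0"
    obtain n where n: "4 * C * (b\<^sup>2 * 2 powr (- (p + 1))) ^ n + t\<^sup>2 * (16 * pi * (2 ^ n - 1) * (2 * b\<^sup>2) ^ n) \<le> ?\<Phi> t"
      using truncation_balance[OF p t C(1)] unfolding b_def by blast
    let ?u0 = "set_distr (cusp p) (\<lambda>x. complex_of_real (tail b n x))"
    let ?u1 = "restrict_distr (cusp p) (fun_distr (partial_sum b n))"
    have "(nrm H\<^sub>0 ?u0)\<^sup>2 + t\<^sup>2 * (nrm (sobolev (cusp p) 2) ?u1)\<^sup>2 \<le> ?\<Phi> t"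
    proof (rule order_trans[OF add_mono n])
      show "(nrm H\<^sub>0 ?u0)\<^sup>2 \<le> 4 * C * (b\<^sup>2 * 2 powr (- (p + 1))) ^ n"
        by (rule order_trans[OF conjunct2[OF H0[OF tm T(1)]] T(2)])
      show "t\<^sup>2 * (nrm (sobolev (cusp p) 2) ?u1)\<^sup>2 \<le> t\<^sup>2 * (16 * pi * (2 ^ n - 1) * (2 * b\<^sup>2) ^ n)"
        by (intro mult_left_mono partial_sum_H2(3)[OF b1]) simp
    qed
    then show "\<exists>\<phi>\<^sub>0\<in>carrier H\<^sub>0. \<exists>\<phi>\<^sub>1\<in>carrier (sobolev (cusp p) 2).
        \<phi>\<^sub>0 + \<phi>\<^sub>1 = set_distr (cusp p) (\<lambda>x. complex_of_real (tail b 0 x)) \<and>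
        (nrm H\<^sub>0 \<phi>\<^sub>0)\<^sup>2 + t\<^sup>2 * (nrm (sobolev (cusp p) 2) \<phi>\<^sub>1)\<^sup>2 \<le> ?\<Phi> t"
      by (intro bexI[of _ ?u0] bexI[of _ ?u1] conjI split)
         (auto simp only: H0[OF tm T(1)] partial_sum_H2(1)[OF b1])
  qed
qed

section \<open>The superposition does not belong to the first order Sobolev space\<close>

text \<open>The duality of H^1 and H^-1 in additive form. Here \<open>M\<close> is the weighted
  square integral of one spectral density; keeping \<open>s\<close> free instead of optimizing it
  avoids square roots and lets it be matched later to the size of the test function.\<close>

lemma sobolev1_test_bound:
  fixes \<Omega> :: "'a::euclidean_space set"
  assumes u: "u \<in> carrier (sobolev \<Omega> 1)"
  obtains M where "M \<ge> 0"
    "\<And>f s Q. f \<in> test_fun \<Omega> \<Longrightarrow> s > 0 \<Longrightarrow>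
      (LINT \<xi>|lborel. (norm (fourier f (- \<xi>)))\<^sup>2 / (1 + (norm \<xi>)\<^sup>2)) \<le> Q \<Longrightarrow> norm (u f) \<le> s * M + Q / s"
proof -
  obtain U where U: "U \<in> carrier (sobolev_space 1)" and uU: "u = restrict_distr \<Omega> U"
    using u by (auto simp: sobolev_def)
  then obtain g where g: "weighted_density 1 (fourier_distr U) g"
    by (auto simp: sobolev_space_def)
  have gm [measurable]: "g \<in> borel_measurable borel" using g by (simp add: weighted_density_def)
  define w where "w = (\<lambda>\<xi>::'a. 1 + (norm \<xi>)\<^sup>2)"
  have w1: "1 \<le> w \<xi>" for \<xi> by (simp add: w_def)
  have w0: "0 < w \<xi>" for \<xi> using w1[of \<xi>] by linarith
  have wm [measurable]: "w \<in> borel_measurable borel" unfolding w_def by measurable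
  have wp: "(1 + (norm \<xi>)\<^sup>2) powr 1 = w \<xi>" for \<xi> :: 'a using w0[of \<xi>] by (simp add: w_def)
  have wg: "integrable lborel (\<lambda>\<xi>. w \<xi> * (norm (g \<xi>))\<^sup>2)"
    using g unfolding weighted_density_def wp by blast
  define M where "M = (LINT \<xi>|lborel. w \<xi> * (norm (g \<xi>))\<^sup>2)"
  have M0: "M \<ge> 0" unfolding M_def using w0 by (intro integral_nonneg_AE AE_I2 mult_nonneg_nonneg) (auto intro: less_imp_le)
  have "norm (u f) \<le> s * M + Q / s"
    if f: "f \<in> test_fun \<Omega>" and s: "s > 0" and Q: "(LINT \<xi>|lborel. (norm (fourier f (- \<xi>)))\<^sup>2 / w \<xi>) \<le> Q" for f s Q
  proof -
    let ?h = "\<lambda>\<xi>. fourier f (- \<xi>)"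
    have fs: "f \<in> schwartz" using f by (rule test_fun_schwartz)
    have hs: "?h \<in> schwartz" by (intro schwartz_reflect fourier_schwartz fs)
    have [measurable]: "?h \<in> borel_measurable borel" using hs by (rule schwartz_measurable)
    have "fourier ?h = f" using fourier_reflected_inversion[OF fs] by blast
    then have "u f = fourier_distr U ?h"
      using f hs by (simp add: uU restrict_distr_def fourier_distr_def)
    also have "\<dots> = (LINT \<xi>|lborel. g \<xi> * ?h \<xi>)"
      using g hs by (simp add: weighted_density_def)
    finally have uf: "u f = (LINT \<xi>|lborel. g \<xi> * ?h \<xi>)" .
    have gi: "integrable lborel (\<lambda>\<xi>. g \<xi> * ?h \<xi>)"
      using g hs by (simp add: weighted_density_def)
    have hw: "integrable lborel (\<lambda>\<xi>. (norm (?h \<xi>))\<^sup>2 / w \<xi>)"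
    proof (rule Bochner_Integration.integrable_bound[OF schwartz_square_integrable[OF hs]])
      show "AE \<xi> in lborel. norm ((norm (?h \<xi>))\<^sup>2 / w \<xi>) \<le> norm ((norm (?h \<xi>))\<^sup>2)"
      proof (rule AE_I2)
        fix \<xi>
        have "(norm (?h \<xi>))\<^sup>2 / w \<xi> \<le> (norm (?h \<xi>))\<^sup>2 / 1"
          by (intro divide_left_mono w1) (use w0[of \<xi>] in auto)
        then show "norm ((norm (?h \<xi>))\<^sup>2 / w \<xi>) \<le> norm ((norm (?h \<xi>))\<^sup>2)"
          using w0[of \<xi>] by simp
      qed
    qed measurable
    let ?b = "\<lambda>\<xi>. s * (w \<xi> * (norm (g \<xi>))\<^sup>2) + (1 / s) * ((norm (?h \<xi>))\<^sup>2 / w \<xi>)"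
    have bi: "integrable lborel ?b"
      by (intro Bochner_Integration.integrable_add integrable_mult_right wg hw)
    have le: "norm (g \<xi> * ?h \<xi>) \<le> ?b \<xi>" for \<xi>
    proof -
      \<comment> \<open>Distributing \<open>r\<close> and \<open>1 / r\<close> over the two factors
        produces the weights \<open>s * w\<close> and \<open>1 / (s * w)\<close> after
        squaring.\<close>
      define r where "r = sqrt (s * w \<xi>)"
      have r: "r > 0" "r\<^sup>2 = s * w \<xi>" using s w0[of \<xi>] by (auto simp: r_def)
      have "(r * norm (g \<xi>)) * (norm (?h \<xi>) / r) \<le> (r * norm (g \<xi>))\<^sup>2 + (norm (?h \<xi>) / r)\<^sup>2"
        using r by (intro product_le_sum_squares) auto
      then show ?thesis using r s by (simp add: norm_mult power_mult_distrib power_divide)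
    qed
    have "norm (u f) \<le> (LINT \<xi>|lborel. ?b \<xi>)"
      unfolding uf by (intro Bochner_Integration.integral_norm_bound_integral gi bi le)
    also have "\<dots> = s * M + (1 / s) * (LINT \<xi>|lborel. (norm (?h \<xi>))\<^sup>2 / w \<xi>)"
      unfolding M_def using integrable_mult_right[OF wg, of s] integrable_mult_right[OF hw, of "1 / s"]
      by (simp only: Bochner_Integration.integral_add integral_mult_right_zero)
    also have "\<dots> \<le> s * M + (1 / s) * Q"
      using s by (intro add_left_mono mult_left_mono Q) auto
    finally show ?thesis by simp
  qed
  then show ?thesis using that M0 unfolding w_def by blast
qed

lemma cutoff_0_le_1: "cutoff 1 0 x \<le> 1"
  by (simp add: cutoff_def)

text \<open>\<open>cutoff 1 2\<close> is the derivative of \<open>cutoff 1 0\<close>, so this is the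
  slope bound used in \<open>slope_le_cutoff\<close>.\<close>

lemma cutoff_2_le: "cutoff 1 2 x \<le> 2"
proof (cases "x > 0")
  case True
  have "(1 / x) ^ 2 \<le> fact 2 * exp (1 / x)" using True by (intro power_le_exp) auto
  then have "(1 / x) ^ 2 * exp (- 1 / x) \<le> 2 * exp (1 / x) * exp (- 1 / x)"
    by (intro mult_right_mono) (auto simp: numeral_2_eq_2)
  also have "\<dots> = 2" by (simp add: mult.assoc flip: exp_add)
  finally show ?thesis using True by (simp add: cutoff_def power_divide)
qed (simp add: cutoff_def)

text \<open>The first conjuncts make the bound on the derivative of a product of such functions additive.\<close>

definition slope_le :: "'a::euclidean_space \<Rightarrow> real \<Rightarrow> ('a \<Rightarrow> complex) \<Rightarrow> bool" where
  "slope_le b K f \<longleftrightarrow> (\<forall>x. f differentiable (at x) \<and> norm (f x) \<le> 1 \<and> norm (partial_deriv b f x) \<le> K)"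

lemma slope_le_mult:
  assumes "slope_le b K f" "slope_le b L g"
  shows "slope_le b (K + L) (\<lambda>x. f x * g x)"
  unfolding slope_le_def
proof (intro allI conjI)
  fix x
  have f: "f differentiable (at x)" "norm (f x) \<le> 1" "norm (partial_deriv b f x) \<le> K"
    and g: "g differentiable (at x)" "norm (g x) \<le> 1" "norm (partial_deriv b g x) \<le> L"
    using assms by (auto simp: slope_le_def)
  show "(\<lambda>x. f x * g x) differentiable (at x)" by (intro differentiable_mult f g)
  show "norm (f x * g x) \<le> 1" unfolding norm_mult by (intro mult_le_one f g norm_ge_zero)
  have "norm (partial_deriv b (\<lambda>x. f x * g x) x) \<le> norm (f x * partial_deriv b g x) + norm (partial_deriv b f x * g x)"
    unfolding partial_deriv_mult[OF f(1) g(1)] by (rule norm_triangle_ineq)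
  also have "\<dots> \<le> 1 * L + K * 1"
    unfolding norm_mult using f g order_trans[OF norm_ge_zero f(3)] by (intro add_mono mult_mono) auto
  finally show "norm (partial_deriv b (\<lambda>x. f x * g x) x) \<le> K + L" by simp
qed

lemma slope_le_cutoff: "slope_le b (2 * \<bar>b \<bullet> v\<bar>) (\<lambda>x. complex_of_real (cutoff 1 0 (x \<bullet> v + \<beta>)))"
  unfolding slope_le_def
proof (intro allI conjI)
  fix x :: 'a
  have d: "((\<lambda>x. complex_of_real (cutoff 1 0 (x \<bullet> v + \<beta>))) has_derivative
      (\<lambda>h. complex_of_real ((h \<bullet> v) * (- real 0 * cutoff 1 (0 + 1) (x \<bullet> v + \<beta>) + 1 * cutoff 1 (0 + 2) (x \<bullet> v + \<beta>))))) (at x)"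
    by (rule cutoff_affine_has_derivative) simp
  show "(\<lambda>x. complex_of_real (cutoff 1 0 (x \<bullet> v + \<beta>))) differentiable (at x)"
    using d unfolding differentiable_def by blast
  show "norm (complex_of_real (cutoff 1 0 (x \<bullet> v + \<beta>))) \<le> 1"
    using cutoff_0_le_1[of "x \<bullet> v + \<beta>"] cutoff_nonneg[of 1 0 "x \<bullet> v + \<beta>"] by simp
  have "norm (partial_deriv b (\<lambda>x. complex_of_real (cutoff 1 0 (x \<bullet> v + \<beta>))) x) = \<bar>b \<bullet> v\<bar> * cutoff 1 2 (x \<bullet> v + \<beta>)"
    unfolding partial_deriv_eq[OF d] using cutoff_nonneg[of 1 2 "x \<bullet> v + \<beta>"] by (simp add: norm_mult abs_mult numeral_2_eq_2)
  also have "\<dots> \<le> \<bar>b \<bullet> v\<bar> * 2" by (intro mult_left_mono cutoff_2_le) simp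
  finally show "norm (partial_deriv b (\<lambda>x. complex_of_real (cutoff 1 0 (x \<bullet> v + \<beta>))) x) \<le> 2 * \<bar>b \<bullet> v\<bar>" by simp
qed

lemma norm_fourier_le_box:
  fixes f :: "real ^ 2 \<Rightarrow> complex"
  assumes f [measurable]: "f \<in> borel_measurable borel" and K: "\<And>x. norm (f x) \<le> K * indicator (cbox l r) x"
  shows "norm (fourier f \<xi>) \<le> K * measure lborel (cbox l r)"
proof -
  have i: "integrable lborel (\<lambda>x. K * indicator (cbox l r) x :: real)"
    by (intro integrable_mult_right) (simp add: integrable_indicator_iff emeasure_lborel_cbox_finite[unfolded infinity_ennreal_def])
  have fi: "integrable lborel (\<lambda>x. norm (f x))"
  proof (rule Bochner_Integration.integrable_bound[OF i])
    show "AE x in lborel. norm (norm (f x)) \<le> norm (K * indicator (cbox l r) x)"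
      using K by (intro AE_I2) (simp only: real_norm_def abs_norm_cancel order_trans[OF K abs_ge_self])
  qed measurable
  have c: "(2 * pi) powr (- real DIM(real^2) / 2) \<le> 1"
  proof -
    have "- real DIM(real^2) / 2 = - 1" by simp
    then have "(2 * pi) powr (- real DIM(real^2) / 2) = 1 / (2 * pi)"
      using pi_gt_zero by (simp only: powr_neg_one mult_pos_pos zero_less_numeral)
    then show ?thesis using pi_gt3 by simp
  qed
  have I: "(LINT x|lborel. norm (f x)) \<le> K * measure lborel (cbox l r)"
  proof -
    have "(LINT x|lborel. norm (f x)) \<le> (LINT x|lborel. K * indicator (cbox l r) x)"
      by (intro integral_mono fi i K)
    also have "\<dots> = K * measure lborel (cbox l r)" by simp
    finally show ?thesis .
  qed
  have "norm (fourier f \<xi>) \<le> (2 * pi) powr (- real DIM(real^2) / 2) * (LINT x|lborel. norm (f x))"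
    by (rule norm_fourier_le)
  also have "\<dots> \<le> 1 * (LINT x|lborel. norm (f x))"
    by (intro mult_right_mono c integral_nonneg_AE) auto
  also note mult_1
  also note I
  finally show ?thesis .
qed

section \<open>Test functions inside the cusp\<close>

text \<open>\<open>T\<close> and \<open>S\<close> below are the reciprocals of the width and the
  height of the support. The bound \<open>k \<ge> 2\<close> gives \<open>T \<ge> 4\<close>, which
  keeps the support away from the edge \<open>x $ 1 = 1\<close>.\<close>

locale cusp_test =
  fixes p :: real and k :: nat
  assumes p: "p > 1" and k: "k \<ge> 2"
begin

definition T :: real where "T = 2 ^ k"

definition S :: real where "S = 2 powr (p * real k)"

text \<open>A dilated product of four one-sided cutoffs, positive on the interior of the box of
  sides \<open>1 / T\<close> and \<open>1 / S\<close>. Inner products with scaled axes are used so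
  that it visibly belongs to \<open>cutoff_algebra\<close>; \<open>test_cart\<close> has the
  coordinates.\<close>

definition test :: "real ^ 2 \<Rightarrow> real" where
  "test x = (cutoff 1 0 (x \<bullet> (T *\<^sub>R axis 1 1) + (- 1)) * cutoff 1 0 (x \<bullet> (- T *\<^sub>R axis 1 1) + 2)) *
    (cutoff 1 0 (x \<bullet> (S *\<^sub>R axis 2 1) + 1 / 2) * cutoff 1 0 (x \<bullet> (- S *\<^sub>R axis 2 1) + 1 / 2))"

abbreviation ctest :: "real ^ 2 \<Rightarrow> complex" where
  "ctest x \<equiv> complex_of_real (test x)"

definition lo :: "real ^ 2" where "lo = (\<chi> i. if i = 1 then 1 / T else - 1 / (2 * S))"

definition hi :: "real ^ 2" where "hi = (\<chi> i. if i = 1 then 2 / T else 1 / (2 * S))"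

lemma T: "T \<ge> 4"
proof -
  have "(2::real) ^ 2 \<le> 2 ^ k" using k by (intro power_increasing) auto
  then show ?thesis by (simp add: T_def)
qed

lemma TS: "T \<le> S"
proof -
  have "T = 2 powr real k" by (simp add: T_def powr_realpow)
  also have "\<dots> \<le> S" unfolding S_def using p by (intro powr_mono) (auto simp: mult_le_cancel_right1)
  finally show ?thesis .
qed

lemma S: "S \<ge> 4" using T TS by linarith

lemma S_T: "1 / S = (1 / T) powr p"
proof -
  have "T powr p = S" by (simp add: T_def S_def powr_powr mult.commute flip: powr_realpow)
  then show ?thesis using T by (simp add: powr_divide)
qed

lemma test_cart: "test x = (cutoff 1 0 (T * x $ 1 - 1) * cutoff 1 0 (2 - T * x $ 1)) *
    (cutoff 1 0 (S * x $ 2 + 1 / 2) * cutoff 1 0 (1 / 2 - S * x $ 2))"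
  by (simp add: test_def inner_axis)

lemma mem_support: "x \<in> cbox lo hi \<longleftrightarrow> 1 \<le> T * x $ 1 \<and> T * x $ 1 \<le> 2 \<and> - 1 / 2 \<le> S * x $ 2 \<and> S * x $ 2 \<le> 1 / 2"
  using T S by (auto simp: mem_box_cart lo_def hi_def forall_2 field_simps)

lemma test_nonneg: "0 \<le> test x"
  unfolding test_def by (intro mult_nonneg_nonneg cutoff_nonneg)

lemma test_zero: "x \<notin> cbox lo hi \<Longrightarrow> test x = 0"
  unfolding mem_support test_cart by (auto simp: cutoff_def)

text \<open>At the left end \<open>x $ 1 = 1 / T\<close> the cusp has half-opening
  \<open>1 / S\<close> by \<open>S_T\<close>, twice the half-height of the box, and it widens to the
  right.\<close>

lemma support_subset: "cbox lo hi \<subseteq> cusp p"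
proof
  fix x assume "x \<in> cbox lo hi"
  then have x: "1 \<le> T * x $ 1" "T * x $ 1 \<le> 2" "- 1 / 2 \<le> S * x $ 2" "S * x $ 2 \<le> 1 / 2"
    by (auto simp: mem_support)
  have x1: "1 / T \<le> x $ 1" using x T by (simp add: field_simps)
  have "4 * x $ 1 \<le> T * x $ 1" using T x1 order_trans[OF _ x1, of 0] by (intro mult_right_mono) auto
  then have x1': "x $ 1 < 1" using x by linarith
  have "S * \<bar>x $ 2\<bar> \<le> 1 / 2"
    using x S by (auto simp: abs_if)
  then have "\<bar>x $ 2\<bar> < 1 / S" using S by (simp add: field_simps)
  also have "\<dots> = (1 / T) powr p" by (rule S_T)
  also have "\<dots> \<le> x $ 1 powr p" using x1 T p by (intro powr_mono2) auto
  finally show "x \<in> cusp p" using x1 x1' T order_less_le_trans[OF _ x1, of 0] by (simp add: cusp_def)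
qed

lemma ctest_smooth: "smooth ctest"
proof -
  have "ctest \<in> cutoff_algebra 1"
    unfolding test_def of_real_mult
    by (intro cutoff_algebra.mult cutoff_algebra.cutoff)
  then show ?thesis by (intro cutoff_algebra_smooth[of 1]) auto
qed

lemma ctest_test_fun: "ctest \<in> test_fun (cusp p)"
  using support_subset test_zero by (intro test_funI[where K = "cbox lo hi"] ctest_smooth) auto

text \<open>Two factors have slope at most \<open>2 * T\<close> and two at most
  \<open>2 * S\<close>; as \<open>T \<le> S\<close>, the total is at most
  \<open>8 * S\<close>.\<close>

lemma slope_ctest:
  assumes b: "b \<in> Basis"
  shows "slope_le b (8 * S) ctest"
proof -
  have s: "slope_le b (2 * \<bar>b \<bullet> v\<bar>) (\<lambda>x. complex_of_real (cutoff 1 0 (x \<bullet> v + \<beta>)))" for v \<beta>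
    by (rule slope_le_cutoff)
  have "slope_le b ((2 * \<bar>b \<bullet> (T *\<^sub>R axis 1 1)\<bar> + 2 * \<bar>b \<bullet> (- T *\<^sub>R axis 1 1)\<bar>) +
     (2 * \<bar>b \<bullet> (S *\<^sub>R axis 2 1)\<bar> + 2 * \<bar>b \<bullet> (- S *\<^sub>R axis 2 1)\<bar>)) ctest"
    unfolding test_def of_real_mult by (intro slope_le_mult s)
  moreover have "(2 * \<bar>b \<bullet> (T *\<^sub>R axis 1 1)\<bar> + 2 * \<bar>b \<bullet> (- T *\<^sub>R axis 1 1)\<bar>) +
     (2 * \<bar>b \<bullet> (S *\<^sub>R axis 2 1)\<bar> + 2 * \<bar>b \<bullet> (- S *\<^sub>R axis 2 1)\<bar>) \<le> 8 * S"
  proof -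
    have b1: "\<bar>b \<bullet> axis 1 1\<bar> \<le> 1" and b2: "\<bar>b \<bullet> axis 2 1\<bar> \<le> 1"
      using component_le_norm_cart[of b] b by (auto simp: inner_axis norm_Basis[OF b])
    have "T * \<bar>b \<bullet> axis 1 1\<bar> \<le> S * 1" by (rule mult_mono[OF TS b1]) (use S in auto)
    moreover have "S * \<bar>b \<bullet> axis 2 1\<bar> \<le> S * 1" by (rule mult_left_mono[OF b2]) (use S in simp)
    ultimately have "4 * (T * \<bar>b \<bullet> axis 1 1\<bar>) + 4 * (S * \<bar>b \<bullet> axis 2 1\<bar>) \<le> 8 * S" by linarith
    then show ?thesis using T S by (simp add: abs_mult)
  qed
  ultimately show ?thesis unfolding slope_le_def by (meson order_trans)
qed

definition area :: real where "area = 1 / (T * S)"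

lemma area_pos: "area > 0" using T S by (simp add: area_def)

lemma measure_box_cart:
  fixes l r :: "real ^ 2"
  assumes "l $ 1 \<le> r $ 1" "l $ 2 \<le> r $ 2"
  shows "measure lborel (cbox l r) = (r $ 1 - l $ 1) * (r $ 2 - l $ 2)"
proof -
  have "emeasure lborel (cbox l r) = (\<Prod>b\<in>Basis. (r - l) \<bullet> b)"
    using assms by (intro emeasure_lborel_cbox) (auto simp: Basis_real2 inner_axis)
  also have "(\<Prod>b\<in>Basis. (r - l) \<bullet> b) = (r $ 1 - l $ 1) * (r $ 2 - l $ 2)"
    unfolding prod_Basis_real2 by (simp add: inner_axis)
  finally show ?thesis using assms by (simp add: measure_def)
qed

lemma measure_support: "measure lborel (cbox lo hi) = area"
proof -
  have "measure lborel (cbox lo hi) = (hi $ 1 - lo $ 1) * (hi $ 2 - lo $ 2)"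
    using T S by (intro measure_box_cart) (auto simp: lo_def hi_def divide_right_mono)
  also have "\<dots> = area" using T S by (simp add: lo_def hi_def area_def field_simps)
  finally show ?thesis .
qed

text \<open>Both bounds come from the L^1 norm on a support of size \<open>area\<close>. The
  constant is 129 = 1 + 2 * 64: one for the function itself, absorbed by
  \<open>1 \<le> S\<^sup>2\<close>, and \<open>(8 * S)\<^sup>2\<close> for each of the two partial
  derivatives.\<close>

lemma fourier_ctest_bound: "(norm (fourier ctest \<xi>))\<^sup>2 \<le> area\<^sup>2" "(1 + (norm \<xi>)\<^sup>2) * (norm (fourier ctest \<xi>))\<^sup>2 \<le> 129 * S\<^sup>2 * area\<^sup>2"
proof -
  have sch: "ctest \<in> schwartz" by (rule test_fun_schwartz[OF ctest_test_fun])
  have le1: "norm (ctest x) \<le> 1 * indicator (cbox lo hi) x" for x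
    using slope_ctest[of "axis 1 1"] test_zero[of x] by (cases "x \<in> cbox lo hi") (auto simp: slope_le_def Basis_real2)
  have "norm (fourier ctest \<xi>) \<le> 1 * area"
    using norm_fourier_le_box[OF schwartz_measurable[OF sch] le1] unfolding measure_support .
  then show 1: "(norm (fourier ctest \<xi>))\<^sup>2 \<le> area\<^sup>2" by (intro power_mono) auto
  have d: "(\<xi> \<bullet> b)\<^sup>2 * (norm (fourier ctest \<xi>))\<^sup>2 \<le> 64 * S\<^sup>2 * area\<^sup>2" if b: "b \<in> Basis" for b
  proof -
    have le: "norm (partial_deriv b ctest x) \<le> (8 * S) * indicator (cbox lo hi) x" for x
    proof (cases "x \<in> cbox lo hi")
      case True
      then show ?thesis using slope_ctest[OF b] by (simp add: slope_le_def)
    next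
      case False
      have "partial_deriv b ctest x = 0"
        by (rule partial_deriv_local_zero[of "- cbox lo hi"]) (use False test_zero in auto)
      then show ?thesis using False by simp
    qed
    have "norm (fourier (partial_deriv b ctest) \<xi>) \<le> (8 * S) * area"
      using norm_fourier_le_box[OF schwartz_measurable[OF schwartz_partial_deriv[OF sch b]] le] unfolding measure_support .
    then have "(norm (fourier (partial_deriv b ctest) \<xi>))\<^sup>2 \<le> ((8 * S) * area)\<^sup>2" by (intro power_mono) auto
    moreover have "norm (fourier (partial_deriv b ctest) \<xi>) = \<bar>\<xi> \<bullet> b\<bar> * norm (fourier ctest \<xi>)"
      unfolding fourier_partial_deriv[OF sch b] by (simp add: norm_mult)
    ultimately show ?thesis by (simp add: power_mult_distrib)
  qed
  have n: "(norm \<xi>)\<^sup>2 = (\<xi> \<bullet> axis 1 1)\<^sup>2 + (\<xi> \<bullet> axis 2 1)\<^sup>2"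
  proof -
    have "\<xi> \<bullet> axis 1 1 = \<xi> $ 1" "\<xi> \<bullet> axis 2 1 = \<xi> $ 2" by (simp_all add: inner_axis)
    then show ?thesis
      unfolding power2_norm_eq_inner by (simp only:) (simp add: inner_vec_def sum_2 power2_eq_square)
  qed
  have "1 \<le> S\<^sup>2" using S by simp
  then have "1 * area\<^sup>2 \<le> S\<^sup>2 * area\<^sup>2" by (intro mult_right_mono) auto
  with 1 d[of "axis 1 1"] d[of "axis 2 1"]
  show "(1 + (norm \<xi>)\<^sup>2) * (norm (fourier ctest \<xi>))\<^sup>2 \<le> 129 * S\<^sup>2 * area\<^sup>2"
    unfolding n distrib_right by (simp add: Basis_real2)
qed

text \<open>Interpolates between the two bounds of the preceding lemma by \<open>X \<le> X powr \<epsilon>\<close> for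
  \<open>0 \<le> X \<le> 1\<close>; \<open>\<epsilon> > 0\<close> makes the integral over the plane finite.\<close>

lemma fourier_ctest_dual_norm:
  assumes e: "0 < \<epsilon>" "\<epsilon> \<le> 1"
  shows "(LINT \<xi>|lborel. (norm (fourier ctest (- \<xi>)))\<^sup>2 / (1 + (norm \<xi>)\<^sup>2))
    \<le> 129 * area\<^sup>2 * (S powr \<epsilon>)\<^sup>2 * (LINT \<xi>|lborel. (1 + (norm (\<xi>::real^2))\<^sup>2) powr (- (1 + \<epsilon>)))"
proof -
  let ?h = "\<lambda>\<xi>. fourier ctest (- \<xi>)"
  have sch: "ctest \<in> schwartz" by (rule test_fun_schwartz[OF ctest_test_fun])
  have hs: "?h \<in> schwartz" by (intro schwartz_reflect fourier_schwartz sch)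
  have [measurable]: "?h \<in> borel_measurable borel" using hs by (rule schwartz_measurable)
  have le: "(norm (?h \<xi>))\<^sup>2 / (1 + (norm \<xi>)\<^sup>2) \<le> 129 * area\<^sup>2 * (S powr \<epsilon>)\<^sup>2 * (1 + (norm \<xi>)\<^sup>2) powr (- (1 + \<epsilon>))" for \<xi>
  proof -
    define w where "w = 1 + (norm \<xi>)\<^sup>2"
    define X where "X = (norm (?h \<xi>))\<^sup>2 / area\<^sup>2"
    have w: "w > 0" by (simp add: w_def add_pos_nonneg)
    have X: "0 \<le> X" "X \<le> 1" "X \<le> 129 * S\<^sup>2 / w"
      using fourier_ctest_bound[of "- \<xi>"] area_pos w by (auto simp: X_def w_def field_simps)
    have "X \<le> X powr \<epsilon>"
      using powr_mono'[of \<epsilon> 1 X] X e by (cases "X = 0") auto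
    also have "\<dots> \<le> (129 * S\<^sup>2 / w) powr \<epsilon>" using X e by (intro powr_mono2) auto
    also have "\<dots> = 129 powr \<epsilon> * (S powr \<epsilon>)\<^sup>2 * w powr (- \<epsilon>)"
    proof -
      have "(129 * S\<^sup>2 / w) powr \<epsilon> = (129 * S\<^sup>2) powr \<epsilon> / w powr \<epsilon>" by (rule powr_divide)
      moreover have "(129 * S\<^sup>2) powr \<epsilon> = 129 powr \<epsilon> * (S powr \<epsilon> * S powr \<epsilon>)"
        by (simp only: powr_mult power2_eq_square)
      moreover have "w powr (- \<epsilon>) = 1 / w powr \<epsilon>" by (rule powr_minus_divide)
      ultimately show ?thesis by (simp only: power2_eq_square times_divide_eq_right mult_1_right mult.assoc)
    qed
    also have "\<dots> \<le> 129 * (S powr \<epsilon>)\<^sup>2 * w powr (- \<epsilon>)"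
    proof -
      have "129 powr \<epsilon> \<le> (129::real) powr 1" using e(2) by (rule powr_mono) simp
      then have "129 powr \<epsilon> \<le> (129::real)" by simp
      then show ?thesis by (intro mult_right_mono zero_le_power2 powr_ge_zero)
    qed
    finally have *: "X \<le> 129 * (S powr \<epsilon>)\<^sup>2 * w powr (- \<epsilon>)" .
    have "- (1 + \<epsilon>) = - \<epsilon> - 1" by simp
    then have "w powr (- (1 + \<epsilon>)) = w powr (- \<epsilon>) / w powr 1" by (simp only: powr_diff)
    then have **: "w powr (- (1 + \<epsilon>)) = w powr (- \<epsilon>) / w" using w by (simp only: powr_one)
    have "area\<^sup>2 * X / w \<le> area\<^sup>2 * (129 * (S powr \<epsilon>)\<^sup>2 * w powr (- \<epsilon>)) / w"
      using w by (intro divide_right_mono mult_left_mono * zero_le_power2) simp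
    also have "\<dots> = 129 * area\<^sup>2 * (S powr \<epsilon>)\<^sup>2 * w powr (- (1 + \<epsilon>))"
      unfolding ** by (simp only: mult_ac times_divide_eq_right times_divide_eq_left)
    also have "area\<^sup>2 * X = (norm (?h \<xi>))\<^sup>2" using area_pos by (simp add: X_def)
    finally show ?thesis unfolding w_def .
  qed
  have bi: "integrable lborel (\<lambda>\<xi>::real^2. 129 * area\<^sup>2 * (S powr \<epsilon>)\<^sup>2 * (1 + (norm \<xi>)\<^sup>2) powr (- (1 + \<epsilon>)))"
    using e by (intro integrable_mult_right integrable_decay) simp
  have "(LINT \<xi>|lborel. (norm (?h \<xi>))\<^sup>2 / (1 + (norm \<xi>)\<^sup>2))
    \<le> (LINT \<xi>|lborel. 129 * area\<^sup>2 * (S powr \<epsilon>)\<^sup>2 * (1 + (norm (\<xi>::real^2))\<^sup>2) powr (- (1 + \<epsilon>)))"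
  proof (intro integral_mono bi le)
    show "integrable lborel (\<lambda>\<xi>. (norm (?h \<xi>))\<^sup>2 / (1 + (norm \<xi>)\<^sup>2))"
    proof (rule Bochner_Integration.integrable_bound[OF bi])
      show "AE \<xi> in lborel. norm ((norm (?h \<xi>))\<^sup>2 / (1 + (norm \<xi>)\<^sup>2)) \<le> norm (129 * area\<^sup>2 * (S powr \<epsilon>)\<^sup>2 * (1 + (norm \<xi>)\<^sup>2) powr (- (1 + \<epsilon>)))"
        unfolding real_norm_def by (intro AE_I2 order_trans[OF _ abs_ge_self]) (simp only: abs_of_nonneg divide_nonneg_nonneg zero_le_power2 add_nonneg_nonneg zero_le_one le)
    qed measurable
  qed
  then show ?thesis by (simp only: integral_mult_right_zero)
qed

text \<open>The middle half of the support in each direction. There all four cutoffs have arguments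
  at least 1/4, hence values at least \<open>exp (- 4)\<close>, which is the origin of
  \<open>exp (- 16)\<close>.\<close>

definition inner_lo :: "real ^ 2" where "inner_lo = (\<chi> i. if i = 1 then 5 / (4 * T) else - 1 / (4 * S))"

definition inner_hi :: "real ^ 2" where "inner_hi = (\<chi> i. if i = 1 then 7 / (4 * T) else 1 / (4 * S))"

lemma measure_inner: "measure lborel (cbox inner_lo inner_hi) = area / 4"
proof -
  have "measure lborel (cbox inner_lo inner_hi) = (inner_hi $ 1 - inner_lo $ 1) * (inner_hi $ 2 - inner_lo $ 2)"
    using T S by (intro measure_box_cart) (auto simp: inner_lo_def inner_hi_def divide_right_mono)
  also have "\<dots> = area / 4" using T S by (simp add: inner_lo_def inner_hi_def area_def field_simps)
  finally show ?thesis .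
qed

lemma cutoff_mono: "0 < x \<Longrightarrow> x \<le> y \<Longrightarrow> cutoff 1 0 x \<le> cutoff 1 0 y"
  by (simp add: cutoff_def frac_le)

lemma test_lower: "exp (- 16) * indicator (cbox inner_lo inner_hi) x \<le> test x"
proof (cases "x \<in> cbox inner_lo inner_hi")
  case True
  then have x: "5 / 4 \<le> T * x $ 1" "T * x $ 1 \<le> 7 / 4" "- 1 / 4 \<le> S * x $ 2" "S * x $ 2 \<le> 1 / 4"
    using T S by (auto simp: mem_box_cart inner_lo_def inner_hi_def forall_2 field_simps)
  have c: "exp (- 4) \<le> cutoff 1 0 y" if "1 / 4 \<le> y" for y
    using cutoff_mono[of "1 / 4" y] that by (simp add: cutoff_def)
  have "exp (- 16) = (exp (- 4) * exp (- 4)) * (exp (- 4) * exp (- 4 :: real))"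
    by (simp flip: exp_add)
  also have "\<dots> \<le> test x"
    unfolding test_cart using x by (intro mult_mono c mult_nonneg_nonneg cutoff_nonneg) auto
  finally show ?thesis using True by simp
next
  case False
  then show ?thesis using test_nonneg[of x] by simp
qed

text \<open>The two coordinates contribute 4 and 1. Consequently \<open>gaussian k\<close> is at
  least \<open>exp (- 5 / 2)\<close> on the support, and the cruder \<open>exp (- 3)\<close> is used
  below.\<close>

lemma norm_support:
  assumes "x \<in> cbox lo hi"
  shows "4 ^ k * (norm x)\<^sup>2 \<le> 5"
proof -
  have x: "1 \<le> T * x $ 1" "T * x $ 1 \<le> 2" "- 1 / 2 \<le> S * x $ 2" "S * x $ 2 \<le> 1 / 2"
    using assms by (auto simp: mem_support)
  have "4 ^ k = T\<^sup>2" by (simp add: T_def power2_eq_square flip: power_mult_distrib)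
  then have "4 ^ k * (norm x)\<^sup>2 = (T * x $ 1)\<^sup>2 + (T * x $ 2)\<^sup>2"
    unfolding power2_norm_eq_inner by (simp add: inner_vec_def sum_2 power2_eq_square algebra_simps)
  also have "(T * x $ 1)\<^sup>2 \<le> 2\<^sup>2" using x by (intro power_mono) auto
  also have "(T * x $ 2)\<^sup>2 \<le> 1\<^sup>2"
  proof -
    have "\<bar>T * x $ 2\<bar> \<le> S * \<bar>x $ 2\<bar>" using T TS by (simp add: abs_mult mult_right_mono)
    also have "\<dots> \<le> 1" using x S by (auto simp: abs_if)
    finally show ?thesis by (simp add: abs_square_le_1)
  qed
  finally show ?thesis by simp
qed

text \<open>All terms of the series are nonnegative, so the \<open>k\<close>-th one alone bounds it
  from below. The exponent 19 adds 3 for the Gaussian and 16 for the test function, and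
  \<open>area / 4\<close> is the measure of the inner box.\<close>

lemma tail_test_lower:
  assumes b: "b \<ge> 0" and i: "set_integrable lborel (cusp p) (\<lambda>x. complex_of_real (tail b 0 x))"
  shows "b ^ k * exp (- 19) * area / 4 \<le> norm (set_distr (cusp p) (\<lambda>x. complex_of_real (tail b 0 x)) ctest)"
proof -
  have sch: "ctest \<in> schwartz" by (rule test_fun_schwartz[OF ctest_test_fun])
  let ?F = "\<lambda>x. indicator (cusp p) x * (tail b 0 x * test x)"
  have Fi: "integrable lborel ?F"
  proof -
    have "integrable lborel (\<lambda>x. indicator (cusp p) x *\<^sub>R complex_of_real (tail b 0 x) * ctest x)"
      by (rule integrable_mult_schwartz[OF i[unfolded set_integrable_def] sch])
    moreover have "indicator (cusp p) x *\<^sub>R complex_of_real (tail b 0 x) * ctest x = complex_of_real (?F x)" for x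
      by (simp add: scaleR_conv_of_real)
    ultimately have "integrable lborel (\<lambda>x. complex_of_real (?F x))" by (simp only:)
    from integrable_Re[OF this] show ?thesis by simp
  qed
  have "set_distr (cusp p) (\<lambda>x. complex_of_real (tail b 0 x)) ctest
      = (LINT x|lborel. indicator (cusp p) x *\<^sub>R (complex_of_real (tail b 0 x) * ctest x))"
    using ctest_test_fun by (simp add: set_distr_def set_lebesgue_integral_def)
  also have "\<dots> = (LINT x|lborel. complex_of_real (?F x))"
    by (intro Bochner_Integration.integral_cong refl) (simp add: scaleR_conv_of_real)
  also have "\<dots> = complex_of_real (LINT x|lborel. ?F x)" by (rule integral_complex_of_real)
  finally have eq: "set_distr (cusp p) (\<lambda>x. complex_of_real (tail b 0 x)) ctest = complex_of_real (LINT x|lborel. ?F x)" .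
  have tail: "b ^ k * gaussian k x \<le> tail b 0 x" if "x \<noteq> 0" for x
  proof -
    have "(\<Sum>j\<in>{k}. b ^ (j + 0) * gaussian (j + 0) x) \<le> tail b 0 x"
      unfolding tail_def using summable_gaussian[OF b that] b gaussian_pos
      by (intro sum_le_suminf) (auto intro!: mult_nonneg_nonneg less_imp_le[OF gaussian_pos])
    then show ?thesis by simp
  qed
  have le: "b ^ k * exp (- 3) * exp (- 16) * indicator (cbox inner_lo inner_hi) x \<le> ?F x" for x
  proof (cases "x \<in> cbox lo hi")
    case True
    then have xc: "x \<in> cusp p" using support_subset by blast
    then have x0: "x \<noteq> 0" by (auto simp: cusp_def)
    have "exp (- 3) \<le> gaussian k x"
      using norm_support[OF True] by (simp add: gaussian_def)
    then have "b ^ k * exp (- 3) \<le> b ^ k * gaussian k x" using b by (intro mult_left_mono) auto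
    also have "\<dots> \<le> tail b 0 x" by (rule tail[OF x0])
    finally have t: "b ^ k * exp (- 3) \<le> tail b 0 x" .
    have "b ^ k * exp (- 3) * (exp (- 16) * indicator (cbox inner_lo inner_hi) x) \<le> tail b 0 x * test x"
      using b t by (intro mult_mono test_lower order_trans[OF _ t]) auto
    then show ?thesis using xc by (simp add: mult.assoc)
  next
    case False
    then have "test x = 0" by (rule test_zero)
    moreover have "indicator (cbox inner_lo inner_hi) x = (0::real)"
    proof (rule ccontr)
      assume "indicator (cbox inner_lo inner_hi) x \<noteq> (0::real)"
      then have "exp (- 16) \<le> test x" using test_lower[of x] by (simp add: indicator_def split: if_splits)
      with \<open>test x = 0\<close> show False by (simp add: not_le)
    qed
    ultimately show ?thesis by simp
  qed
  have li: "integrable lborel (\<lambda>x. b ^ k * exp (- 3) * exp (- 16) * indicator (cbox inner_lo inner_hi) x :: real)"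
    by (intro integrable_mult_right) (simp add: integrable_indicator_iff emeasure_lborel_cbox_finite[unfolded infinity_ennreal_def])
  have "b ^ k * exp (- 3) * exp (- 16) * (area / 4) = (LINT x|lborel. b ^ k * exp (- 3) * exp (- 16) * indicator (cbox inner_lo inner_hi) x)"
    by (simp add: measure_inner)
  also have "\<dots> \<le> (LINT x|lborel. ?F x)" by (intro integral_mono li Fi le)
  also have "\<dots> \<le> norm (set_distr (cusp p) (\<lambda>x. complex_of_real (tail b 0 x)) ctest)"
    unfolding eq norm_of_real by (rule abs_ge_self)
  also have "b ^ k * exp (- 3) * exp (- 16) * (area / 4) = b ^ k * exp (- 19) * area / 4"
    by (simp add: mult.assoc flip: exp_add)
  finally show ?thesis .
qed

end

text \<open>With \<open>c = sqrt b\<close>, and relative to \<open>area\<close>, the pairing is at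
  least a constant times \<open>c ^ (2 * k)\<close>, while membership in H^1 would bound it by a
  constant times \<open>c ^ k\<close>.\<close>

lemma series_not_in_sobolev1:
  fixes p :: real
  assumes p: "p > 1"
  defines "b \<equiv> 2 powr ((p - 1) / 8)"
  assumes i: "set_integrable lborel (cusp p) (\<lambda>x. complex_of_real (tail b 0 x))"
  shows "set_distr (cusp p) (\<lambda>x. complex_of_real (tail b 0 x)) \<notin> carrier (sobolev (cusp p) 1)" (is "?u \<notin> _")
proof
  assume "?u \<in> carrier (sobolev (cusp p) 1)"
  then obtain M where M: "M \<ge> 0" "\<And>f s Q. f \<in> test_fun (cusp p) \<Longrightarrow> s > 0 \<Longrightarrow>
      (LINT \<xi>|lborel. (norm (fourier f (- \<xi>)))\<^sup>2 / (1 + (norm \<xi>)\<^sup>2)) \<le> Q \<Longrightarrow> norm (?u f) \<le> s * M + Q / s"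
    using sobolev1_test_bound by blast
  \<comment> \<open>Chosen so that \<open>S powr \<epsilon> = 2 powr (p * k * \<epsilon>)\<close>
    equals \<open>c ^ k\<close>: the loss in the dual norm is then only the square root of the
    growth \<open>b ^ k\<close>.\<close>
  define \<epsilon> where "\<epsilon> = (p - 1) / (16 * p)"
  have e: "0 < \<epsilon>" "\<epsilon> \<le> 1" using p by (auto simp: \<epsilon>_def field_simps)
  define Z where "Z = (LINT \<xi>|lborel. (1 + (norm (\<xi>::real^2))\<^sup>2) powr (- (1 + \<epsilon>)))"
  define c where "c = 2 powr ((p - 1) / 16)"
  have c: "c > 1" using p by (simp add: c_def)
  have bc: "b = c\<^sup>2" by (simp add: b_def c_def power2_eq_square flip: powr_add)
  have b0: "b \<ge> 0" by (simp add: b_def)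
  have bound: "c ^ k * (exp (- 19) / 4) \<le> M + 129 * Z" if k: "k \<ge> 2" for k
  proof -
    interpret cusp_test p k using p k by unfold_locales
    have S: "S powr \<epsilon> = c ^ k"
    proof -
      have "p * real k * \<epsilon> = (p - 1) / 16 * real k" using p by (simp add: \<epsilon>_def)
      then have "S powr \<epsilon> = 2 powr ((p - 1) / 16 * real k)" by (simp only: S_def powr_powr)
      also have "\<dots> = c powr real k" by (simp only: c_def powr_powr)
      also have "\<dots> = c ^ k" using c by (simp add: powr_realpow)
      finally show ?thesis .
    qed
    \<comment> \<open>Balances the two terms: \<open>Q\<close> is a multiple of
      \<open>(area * c ^ k)\<^sup>2\<close>, so \<open>s * M\<close> and \<open>Q / s\<close> are
      both multiples of \<open>s\<close>.\<close>
    define s where "s = area * c ^ k"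
    have s: "s > 0" using area_pos c by (simp add: s_def)
    have "b ^ k * exp (- 19) * area / 4 \<le> s * M + 129 * area\<^sup>2 * (S powr \<epsilon>)\<^sup>2 * Z / s"
      unfolding Z_def by (intro order_trans[OF tail_test_lower[OF b0 i] M(2)[OF ctest_test_fun s fourier_ctest_dual_norm[OF e]]])
    also have "\<dots> = s * M + s * (129 * Z)"
      using s unfolding S by (simp add: s_def power2_eq_square field_simps)
    also have "\<dots> = s * (M + 129 * Z)" by (rule distrib_left[symmetric])
    finally have "s * (c ^ k * (exp (- 19) / 4)) \<le> s * (M + 129 * Z)"
      by (simp add: s_def bc power2_eq_square power_mult_distrib mult_ac)
    then show ?thesis using s by (simp only: mult_le_cancel_left_pos)
  qed
  obtain n where n: "(M + 129 * Z) / (exp (- 19) / 4) < c ^ n" using real_arch_pow[OF c] by blast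
  have "c ^ n \<le> c ^ (n + 2)" using c by (intro power_increasing) auto
  with n have "(M + 129 * Z) / (exp (- 19) / 4) < c ^ (n + 2)" by linarith
  then have "M + 129 * Z < c ^ (n + 2) * (exp (- 19) / 4)" by (simp add: divide_less_eq)
  with bound[of "n + 2"] show False by simp
qed

theorem lemma4p8:
  fixes p :: real and \<Omega> :: "(real ^ 2) set"
  assumes "p > 1"
    and "\<Omega> = {x. 0 < x $ 1 \<and> x $ 1 < 1 \<and> \<bar>x $ 2\<bar> < x $ 1 powr p}"
  shows "1 / p < 1 \<and> C0_holder_domain (1 / p) \<Omega> \<and>
    carrier (sobolev \<Omega> 1) \<subset> carrier (interp (L2 \<Omega>) (sobolev \<Omega> 2) (1 / 2)) \<and>
    \<not> interpolation_scale {0..2} (sobolev \<Omega>)"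
proof -
  have p: "p > 1" by fact
  then have p0: "p > 0" by simp
  have \<Omega>: "\<Omega> = cusp p" using assms(2) by (simp add: cusp_def)
  have open_fin: "open (cusp p)" "emeasure lborel (cusp p) < \<infinity>"
    using open_cusp[OF p0] emeasure_cusp[OF p0] by auto
  define u where "u = set_distr (cusp p) (\<lambda>x. complex_of_real (tail (2 powr ((p - 1) / 8)) 0 x))"
  have u0: "u \<in> carrier (interp (L2 (cusp p)) (sobolev (cusp p) 2) (1 / 2))"
    unfolding u_def by (rule series_in_interp[OF p]) (intro conjI set_distr_L2 open_fin)
  \<comment> \<open>The same element over the other first endpoint:
    \<open>interpolation_scale\<close> sees \<open>sobolev (cusp p) 0\<close>, whereas the strict
    inclusion sees \<open>L2 (cusp p)\<close>.\<close>
  have u1: "u \<in> carrier (interp (sobolev (cusp p) 0) (sobolev (cusp p) 2) (1 / 2))"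
    unfolding u_def by (rule series_in_interp[OF p]) (intro conjI set_distr_H0 open_fin)
  have nu: "u \<notin> carrier (sobolev (cusp p) 1)"
    unfolding u_def by (rule series_not_in_sobolev1[OF p series_set_integrable[OF p]])
  have "\<not> interpolation_scale {0..2} (sobolev (cusp p))"
  proof
    assume A: "interpolation_scale {0..2} (sobolev (cusp p))"
    have z: "(0::real) \<in> {0..2}" "(2::real) \<in> {0..2}" "0 < (1 / 2 :: real) \<and> 1 / 2 < (1 :: real)" by auto
    have "carrier (interp (sobolev (cusp p) 0) (sobolev (cusp p) 2) (1 / 2))
      = carrier (sobolev (cusp p) ((1 - 1 / 2) * 0 + 1 / 2 * 2))"
      using spec[of _ "1 / 2", OF bspec[OF bspec[OF A[unfolded interpolation_scale_def] z(1)] z(2)]] z(3) by (rule mp)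
    moreover have "(1 - 1 / 2) * 0 + 1 / 2 * 2 = (1::real)" by simp
    ultimately have "carrier (interp (sobolev (cusp p) 0) (sobolev (cusp p) 2) (1 / 2)) = carrier (sobolev (cusp p) 1)"
      by (simp only:)
    with u1 nu show False by (simp only:)
  qed
  moreover have "carrier (sobolev (cusp p) 1) \<subset> carrier (interp (L2 (cusp p)) (sobolev (cusp p) 2) (1 / 2))"
    using H1_subset_interp[OF open_fin] u0 nu by blast
  moreover have "1 / p < 1" using p by simp
  ultimately show ?thesis
    using C0_holder_domain_cusp[OF p] by (simp add: \<Omega>)
qed

end
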